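(* Let $A$ be an edge-degenerate differential operator of order $\mu\in\mathbb N$ on $\Omega=\mathbb R^q\times\mathbb R_+$ with $y$-independent coefficients, satisfying the standing assumptions listed in the context, let $\tilde A=L\circ A_{tr}\circ L^{-1}$ be the associated conjugated truncated operator, and for $\sigma\in\Sigma$ let $\tilde{\mathfrak g}_\sigma(\eta)=\sum_{\ell=0}^{\mu_\sigma}\tilde{\mathfrak g}_\sigma^{(\ell)}(\eta)$ and the asymptotic type $S_\sigma$ be as in the context. Then, for every $\sigma\in\Sigma$, $$\mathrm{range}\,\tilde{\mathfrak g}_\sigma(D):=\mathrm{range}\Big(\tilde{\mathfrak g}_\sigma(D):L^2(\mathbb R^q,\mathcal K^{0,\mu}(\mathbb R_+))\longrightarrow H^\mu(\mathbb R^q,\mathcal E_{S_\sigma})\Big)$$ is a closed subspace of $H^\mu(\mathbb R^q,\mathcal E_{S_\sigma})$ which is mapped by $\tilde A$ into $L^2(\Omega)$.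
   Context: **Spaces on $\mathbb R_+=(0,\infty)$.** A cut-off function is a smooth compactly supported function on $[0,\infty)$ that is identically $1$ near $t=0$. Fix a cut-off function $\omega$. For an integer $s\ge0$ and $\gamma\in\mathbb R$, $\mathcal K^{s,\gamma}(\mathbb R_+)$ is the Hilbert space of all distributions $u$ on $\mathbb R_+$ with $(1-\omega)u\in H^s(\mathbb R_+)$ and $t^{-\gamma}(t\partial_t)^j(\omega u)\in L^2(\mathbb R_+,dt)$ for all $j\le s$; $\mathcal K^{0,0}(\mathbb R_+)=L^2(\mathbb R_+)$. For a finite set $S\subset\mathbb C\times\mathbb N_0$ containing at most one pair $(p,n)$ for each $p$, $\mathcal E_S$ is the finite-dimensional space of functions $\omega(t)\sum_{(p,n)\in S}\sum_{j=0}^{n}a_{p,j}t^{-p}\log^jt$, $a_{p,j}\in\mathbb C$. **Group action and spaces.** $(\kappa_\lambda u)(t)=\lambda^{1/2}u(\lambda t)$, $\lambda>0$. Let $\eta\mapsto[\eta]$ be a positive smooth function on $\mathbb R^q$ with $[\eta]=|\eta|$ outside the unit ball, $\kappa(\eta):=\kappa_{[\eta]}$, and $L=\mathscr F^{-1}\kappa^{-1}(\eta)\mathscr F$ with $\mathscr F$ the Fourier transform in $y\in\mathbb R^q$. $H^s(\mathbb R^q,H)$ is the usual $H$-valued Sobolev space, $L^2(\mathbb R^q,H)=H^0(\mathbb R^q,H)$, $L^2(\Omega)=L^2(\mathbb R^q,L^2(\mathbb R_+))$. $\mathcal W^{s,\gamma}(\Omega)$ is the completion of $\mathscr S(\mathbb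 R^q,\mathcal K^{s,\gamma}(\mathbb R_+))$ with respect to $\big(\int[\eta]^{2s}\|\kappa^{-1}(\eta)\mathscr Fu(\eta)\|^2_{\mathcal K^{s,\gamma}}d\eta\big)^{1/2}$. For an operator-valued function $a(\eta)$, $a(D)=\mathscr F^{-1}a(\eta)\mathscr F$. **The operator $A$.** $A$ is a differential operator of order $\mu$ on $\Omega$ with smooth $y$-independent coefficients which near $t=0$ has the form $A=t^{-\mu}\sum_{j+|\alpha|\le\mu}a_{j\alpha}(t)(tD_y)^\alpha(-t\partial_t)^j$ with $a_{j\alpha}$ smooth up to $t=0$. Standing assumptions: $(1-\omega)(t)A$ maps $\mathcal W^{\mu,0}(\Omega)$ into $L^2(\Omega)$; $f_0(z):=\sum_{j=0}^\mu a_{j0}(0)z^j$ is meromorphically invertible and $f_0^{-1}$ has no pole on the line $\mathrm{Re}\,z=1/2-\mu$. **Derived objects.** Let $a_{j\alpha}(t)\sim\sum_k a^{(k)}_{j\alpha}t^k$ be the Taylor expansion at $0$, and $$A_{tr}=t^{-\mu}\sum_{\ell=0}^\mu t^\ell\sum_{k+|\alpha|=\ell}\sum_{j=0}^{\mu-|\alpha|}a^{(k)}_{j\alpha}D_y^\alpha(-t\partial_t)^j .$$ Then $\tilde A=L\circ A_{tr}\circ L^{-1}$ is the pseudodifferential operator $\tilde{\mathfrak a}(D)$ with operator-valued symbol $$\tilde{\mathfrak a}(\eta)=t^{-\mu}\sum_{\ell=0}^\mu t^\ell\tilde f_\ell(-t\partial_t,\eta),\qquad \tilde f_\ell(z,\eta)=[\eta]^{\mu-\ell}\sum_{k+|\alpha|=\ell}\sum_{j=0}^{\mu-|\alpha|}a^{(k)}_{j\alpha}\eta^\alpha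 z^j .$$ In particular $\tilde f_0(z,\eta)=[\eta]^\mu f_0(z)$. With $(T^\rho h)(z)=h(z+\rho)$ acting in $z$, define recursively $\tilde g_0=1$, $\tilde g_\ell=-(T^{-\ell}\tilde f_0^{-1})\sum_{j=0}^{\ell-1}(T^{-j}\tilde f_{\ell-j})\tilde g_j$; these are meromorphic in $z$. $\Sigma$ is the set of poles $\sigma$ of $f_0^{-1}$ with $1/2-\mu<\mathrm{Re}\,\sigma<1/2$. For $\sigma\in\Sigma$: $n_\sigma+1$ is the order of the pole $\sigma$ of $f_0^{-1}$; $\mu_\sigma=[\mathrm{Re}\,\sigma+\mu-1/2]$ (integer part); $N_\sigma^{(\ell)}\ge0$ is an integer such that for all $\eta$ the Laurent expansion of $\tilde g_\ell(\cdot,\eta)$ at $\sigma$ contains no powers $(z-\sigma)^k$ with $k<-N_\sigma^{(\ell)}$, $N_\sigma^{(0)}=0$; and $$S_\sigma=\{(\sigma-\ell,m_\sigma)\mid0\le\ell\le\mu_\sigma\},\qquad m_\sigma=\max_{0\le\ell\le\mu_\sigma}(N_\sigma^{(\ell)}+n_\sigma).$$ $\hat u(z)=\int_0^\infty t^{z-1}u(t)\,dt$ is the Mellin transform, $\Pi_\sigma h$ is the principal part of the Laurent series of $h$ at $\sigma$, $\omega_0$ is another fixed cut-off function. For $u\in\mathcal K^{0,\mu}(\mathbb R_+)$ and $\ell=0,\dots,\mu_\sigma$, $$[\tilde{\mathfrak g}^{(\ell)}_\sigma(\eta)u](t)=\omega(t)t^\ell\int_{|z-\sigma|=\varepsilon}t^{-z}\tilde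 g_\ell(z,\eta)\,\Pi_\sigma\big(\tilde f_0(\cdot,\eta)^{-1}\widehat{\omega_0u}\big)(z)\,\frac{dz}{2\pi i},$$ the contour being counter-clockwise with $\varepsilon>0$ so small that no pole of the integrand other than $\sigma$ lies in the closed disc. (With trivial group actions these are classical symbols of order $-\mu$ in $\eta$ with values in $\mathscr L(\mathcal K^{0,\mu}(\mathbb R_+),\mathcal E_{S_\sigma})$.) *)

theory Defs
  imports "HOL-Complex_Analysis.Complex_Analysis"
begin

text \<open>
  Conventions.  A function or distribution class on \<open>(0,\<infinity>)\<close> is represented by a function
  \<open>real \<Rightarrow> complex\<close>, one on \<open>\<Omega> = R^q \<times> (0,\<infinity>)\<close> by a curried function
  \<open>real^'q \<Rightarrow> real \<Rightarrow> complex\<close>; values at \<open>t \<le> 0\<close> are irrelevant.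
  A Hilbert space \<open>H\<close> of functions on \<open>(0,\<infinity>)\<close> is represented by its squared norm
  \<open>N :: (real \<Rightarrow> complex) \<Rightarrow> ennreal\<close>, with \<open>N f = \<infinity>\<close> iff \<open>f\<close> is not in \<open>H\<close>.
  Multi-indices are functions \<open>'q \<Rightarrow> nat\<close>.
\<close>

section \<open>Calculus\<close>

definition halfline :: "real measure" where
  "halfline = restrict_space lborel {0<..}"

definition Omega :: "((real^'q) \<times> real) measure" where
  "Omega = lborel \<Otimes>\<^sub>M halfline"

text \<open>Derivative on the half-line, one-sided at \<open>t = 0\<close>.\<close>

definition hd_deriv :: "(real \<Rightarrow> complex) \<Rightarrow> real \<Rightarrow> complex" where
  "hd_deriv f t = vector_derivative f (at t within {0..})"

definition smooth_upto0_on :: "real set \<Rightarrow> (real \<Rightarrow> complex) \<Rightarrow> bool" where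
  "smooth_upto0_on S f \<longleftrightarrow> (\<forall>k. \<forall>t\<in>S. (hd_deriv ^^ k) f differentiable (at t within {0..}))"

text \<open>The operator \<open>-t \<partial>\<^sub>t\<close>, and \<open>p(-t \<partial>\<^sub>t)\<close> for a polynomial \<open>p\<close>.\<close>

definition mtd :: "(real \<Rightarrow> complex) \<Rightarrow> real \<Rightarrow> complex" where
  "mtd f t = - of_real t * hd_deriv f t"

definition poly_mtd :: "complex poly \<Rightarrow> (real \<Rightarrow> complex) \<Rightarrow> real \<Rightarrow> complex" where
  "poly_mtd p f t = (\<Sum>j\<le>degree p. coeff p j * (mtd ^^ j) f t)"

definition cutoff :: "(real \<Rightarrow> complex) \<Rightarrow> bool" where
  "cutoff \<omega> \<longleftrightarrow> smooth_upto0_on {0..} \<omega> \<and> (\<exists>R. \<forall>t>R. \<omega> t = 0) \<and>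
     (\<exists>\<epsilon>>0. \<forall>t. 0 \<le> t \<and> t < \<epsilon> \<longrightarrow> \<omega> t = 1)"

definition mi_pow :: "real^'q \<Rightarrow> ('q \<Rightarrow> nat) \<Rightarrow> complex" where
  "mi_pow \<eta> \<alpha> = (\<Prod>i\<in>UNIV. of_real (\<eta> $ i) ^ \<alpha> i)"

abbreviation mi_len :: "('q::finite \<Rightarrow> nat) \<Rightarrow> nat" where
  "mi_len \<alpha> \<equiv> sum \<alpha> UNIV"

definition mi_suc :: "'q \<Rightarrow> ('q \<Rightarrow> nat) \<Rightarrow> ('q \<Rightarrow> nat)" where
  "mi_suc i \<alpha> = \<alpha>(i := Suc (\<alpha> i))"

text \<open>Smoothness on \<open>R^q\<close>: \<open>F \<alpha>\<close> is the partial derivative of order \<open>\<alpha>\<close>.\<close>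

definition smooth_Rq :: "(real^'q \<Rightarrow> real) \<Rightarrow> bool" where
  "smooth_Rq f \<longleftrightarrow> (\<exists>F. F (\<lambda>_. 0) = f \<and> (\<forall>\<alpha>. continuous_on UNIV (F \<alpha>)) \<and>
     (\<forall>\<alpha> i y. ((\<lambda>h. F \<alpha> (y + h *\<^sub>R axis i 1)) has_vector_derivative F (mi_suc i \<alpha>) y) (at 0)))"

text \<open>The function \<open>\<eta> \<mapsto> [\<eta>]\<close>.\<close>

definition bracket :: "(real^'q \<Rightarrow> real) \<Rightarrow> bool" where
  "bracket br \<longleftrightarrow> smooth_Rq br \<and> (\<forall>\<eta>. br \<eta> > 0) \<and> (\<forall>\<eta>. norm \<eta> > 1 \<longrightarrow> br \<eta> = norm \<eta>)"

definition kap :: "real \<Rightarrow> (real \<Rightarrow> complex) \<Rightarrow> real \<Rightarrow> complex" where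
  "kap r u t = of_real (sqrt r) * u (r * t)"


section \<open>Function spaces on the half-line\<close>

definition loc_integrable_half :: "(real \<Rightarrow> complex) \<Rightarrow> bool" where
  "loc_integrable_half u \<longleftrightarrow> u \<in> borel_measurable halfline \<and>
     (\<forall>a b. 0 < a \<longrightarrow> set_integrable lborel {a..b} u)"

definition test_half :: "(real \<Rightarrow> complex) \<Rightarrow> bool" where
  "test_half \<phi> \<longleftrightarrow> smooth_upto0_on {0..} \<phi> \<and> (\<exists>a b. 0 < a \<and> (\<forall>t. t \<notin> {a..b} \<longrightarrow> \<phi> t = 0))"

definition is_weak_deriv :: "(real \<Rightarrow> complex) \<Rightarrow> (real \<Rightarrow> complex) \<Rightarrow> bool" where
  "is_weak_deriv u v \<longleftrightarrow> loc_integrable_half u \<and> loc_integrable_half v \<and>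
     (\<forall>\<phi>. test_half \<phi> \<longrightarrow>
        (LINT t|halfline. u t * hd_deriv \<phi> t) = - (LINT t|halfline. v t * \<phi> t))"

definition weak_deriv :: "(real \<Rightarrow> complex) \<Rightarrow> real \<Rightarrow> complex" where
  "weak_deriv u = (SOME v. is_weak_deriv u v)"

definition weak_td :: "(real \<Rightarrow> complex) \<Rightarrow> real \<Rightarrow> complex" where
  "weak_td u t = of_real t * weak_deriv u t"

definition L2_sq :: "(real \<Rightarrow> complex) \<Rightarrow> ennreal" where
  "L2_sq u = (if u \<in> borel_measurable halfline
              then \<integral>\<^sup>+t. ennreal ((cmod (u t))\<^sup>2) \<partial>halfline else \<infinity>)"

definition Sobolev_sq :: "nat \<Rightarrow> (real \<Rightarrow> complex) \<Rightarrow> ennreal" where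
  "Sobolev_sq s u =
     (if \<forall>k<s. \<exists>v. is_weak_deriv ((weak_deriv ^^ k) u) v
      then \<Sum>k\<le>s. L2_sq ((weak_deriv ^^ k) u) else \<infinity>)"

definition Fuchs_sq :: "nat \<Rightarrow> real \<Rightarrow> (real \<Rightarrow> complex) \<Rightarrow> ennreal" where
  "Fuchs_sq s \<gamma> u =
     (if \<forall>k<s. \<exists>v. is_weak_deriv ((weak_td ^^ k) u) v
      then \<Sum>k\<le>s. L2_sq (\<lambda>t. of_real (t powr (- \<gamma>)) * (weak_td ^^ k) u t) else \<infinity>)"

text \<open>\<open>\<K>\<^sup>s\<^sup>,\<^sup>\<gamma>\<close>; as \<open>s \<ge> 0\<close>, all elements are regular distributions.\<close>

definition K_sq :: "(real \<Rightarrow> complex) \<Rightarrow> nat \<Rightarrow> real \<Rightarrow> (real \<Rightarrow> complex) \<Rightarrow> ennreal" where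
  "K_sq \<omega> s \<gamma> u = Sobolev_sq s (\<lambda>t. (1 - \<omega> t) * u t) + Fuchs_sq s \<gamma> (\<lambda>t. \<omega> t * u t)"

text \<open>The space \<open>\<E>\<^sub>S\<close>, normed by the Euclidean norm of the coefficients (which are unique).\<close>

definition E_fun :: "(real \<Rightarrow> complex) \<Rightarrow> (complex \<times> nat) set \<Rightarrow> (complex \<Rightarrow> nat \<Rightarrow> complex)
    \<Rightarrow> real \<Rightarrow> complex" where
  "E_fun \<omega> S c t =
     \<omega> t * (\<Sum>(p,n)\<in>S. \<Sum>j\<le>n. c p j * of_real t powr (- p) * of_real (ln t ^ j))"

definition E_sq :: "(real \<Rightarrow> complex) \<Rightarrow> (complex \<times> nat) set \<Rightarrow> (real \<Rightarrow> complex) \<Rightarrow> ennreal" where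
  "E_sq \<omega> S f = (INF c \<in> {c. \<forall>t>0. f t = E_fun \<omega> S c t}.
                    \<Sum>(p,n)\<in>S. \<Sum>j\<le>n. ennreal ((cmod (c p j))\<^sup>2))"


section \<open>Hilbert space valued functions on \<open>R^q\<close> and the Fourier transform in \<open>y\<close>\<close>

text \<open>\<open>L\<^sup>2(R\<^sup>q, H)\<close>.\<close>

definition L2H :: "((real \<Rightarrow> complex) \<Rightarrow> ennreal) \<Rightarrow> (real^'q \<Rightarrow> real \<Rightarrow> complex) set" where
  "L2H N = {u. (\<lambda>(y,t). u y t) \<in> borel_measurable Omega \<and> (\<forall>y. N (u y) < \<infinity>) \<and>
               (\<integral>\<^sup>+y. N (u y) \<partial>lborel) < \<infinity>}"

definition ft_on :: "(real^'q) set \<Rightarrow> (real^'q \<Rightarrow> real \<Rightarrow> complex) \<Rightarrow> real^'q \<Rightarrow> real \<Rightarrow> complex" where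
  "ft_on B u \<eta> t = (LINT y:B|lborel. cis (- (y \<bullet> \<eta>)) * u y t)"

text \<open>
  \<open>v\<close> is the Fourier transform of \<open>u \<in> L\<^sup>2(R\<^sup>q, H)\<close>: the \<open>L\<^sup>2(R\<^sup>q, H)\<close>-limit, as \<open>R \<rightarrow> \<infinity>\<close>,
  of the integrals over \<open>|y| \<le> R\<close>.
\<close>

definition is_ft :: "((real \<Rightarrow> complex) \<Rightarrow> ennreal) \<Rightarrow> (real^'q \<Rightarrow> real \<Rightarrow> complex)
    \<Rightarrow> (real^'q \<Rightarrow> real \<Rightarrow> complex) \<Rightarrow> bool" where
  "is_ft N u v \<longleftrightarrow> u \<in> L2H N \<and> v \<in> L2H N \<and>
     ((\<lambda>R. \<integral>\<^sup>+\<eta>. N (\<lambda>t. v \<eta> t - ft_on (cball 0 R) u \<eta> t) \<partial>lborel) \<longlongrightarrow> 0) at_top"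

text \<open>\<open>w = a(D) u\<close> with \<open>a(D) = F\<^sup>-\<^sup>1 a(\<eta>) F\<close>, for \<open>u\<close> with values in \<open>H\<^sub>1\<close> and \<open>w\<close> with values
  in \<open>H\<^sub>2\<close>; both \<open>u\<close> and \<open>w\<close> matter only up to null sets.\<close>

definition is_op :: "((real \<Rightarrow> complex) \<Rightarrow> ennreal) \<Rightarrow> ((real \<Rightarrow> complex) \<Rightarrow> ennreal)
    \<Rightarrow> (real^'q \<Rightarrow> (real \<Rightarrow> complex) \<Rightarrow> real \<Rightarrow> complex)
    \<Rightarrow> (real^'q \<Rightarrow> real \<Rightarrow> complex) \<Rightarrow> (real^'q \<Rightarrow> real \<Rightarrow> complex) \<Rightarrow> bool" where
  "is_op N1 N2 a u w \<longleftrightarrow> (\<exists>v. is_ft N1 u v \<and> is_ft N2 w (\<lambda>\<eta>. a \<eta> (v \<eta>)))"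

text \<open>\<open>H\<^sup>s(R\<^sup>q, H)\<close> with its squared norm; the transform \<open>v\<close> is unique almost everywhere.\<close>

definition Hs_sq :: "((real \<Rightarrow> complex) \<Rightarrow> ennreal) \<Rightarrow> nat \<Rightarrow> (real^'q \<Rightarrow> real \<Rightarrow> complex) \<Rightarrow> ennreal" where
  "Hs_sq N s u = (INF v \<in> {v. is_ft N u v}. \<integral>\<^sup>+\<eta>. ennreal ((1 + (norm \<eta>)\<^sup>2) ^ s) * N (v \<eta>) \<partial>lborel)"

definition Hs :: "((real \<Rightarrow> complex) \<Rightarrow> ennreal) \<Rightarrow> nat \<Rightarrow> (real^'q \<Rightarrow> real \<Rightarrow> complex) set" where
  "Hs N s = {u \<in> L2H N. Hs_sq N s u < \<infinity>}"

text \<open>A closed linear subspace \<open>R\<close> of a space \<open>H\<close> of functions with squared norm \<open>Q\<close>.\<close>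

definition closed_subspace :: "((real^'q \<Rightarrow> real \<Rightarrow> complex) \<Rightarrow> ennreal)
    \<Rightarrow> (real^'q \<Rightarrow> real \<Rightarrow> complex) set \<Rightarrow> (real^'q \<Rightarrow> real \<Rightarrow> complex) set \<Rightarrow> bool" where
  "closed_subspace Q H R \<longleftrightarrow> R \<subseteq> H \<and> (\<lambda>_ _. 0) \<in> R \<and>
     (\<forall>u\<in>R. \<forall>w\<in>R. (\<lambda>y t. u y t + w y t) \<in> R) \<and>
     (\<forall>c. \<forall>u\<in>R. (\<lambda>y t. c * u y t) \<in> R) \<and>
     (\<forall>w u. (\<forall>n::nat. w n \<in> R) \<and> u \<in> H \<and> (\<lambda>n. Q (\<lambda>y t. w n y t - u y t)) \<longlonglongrightarrow> 0 \<longrightarrow> u \<in> R)"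


section \<open>The spaces \<open>\<W>\<^sup>s\<^sup>,\<^sup>\<gamma>(\<Omega>)\<close>\<close>

text \<open>\<open>\<S>(R\<^sup>q, H)\<close>; \<open>U \<alpha>\<close> is the partial derivative of order \<open>\<alpha>\<close> with respect to the norm of \<open>H\<close>.\<close>

definition schwartz :: "((real \<Rightarrow> complex) \<Rightarrow> ennreal) \<Rightarrow> (real^'q \<Rightarrow> real \<Rightarrow> complex) \<Rightarrow> bool" where
  "schwartz N u \<longleftrightarrow> (\<exists>U. U (\<lambda>_. 0) = u \<and>
     (\<forall>\<alpha>. (\<lambda>(y,t). U \<alpha> y t) \<in> borel_measurable Omega) \<and>
     (\<forall>\<alpha> i y. ((\<lambda>h. N (\<lambda>t. (U \<alpha> (y + h *\<^sub>R axis i 1) t - U \<alpha> y t) / of_real h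
                            - U (mi_suc i \<alpha>) y t)) \<longlongrightarrow> 0) (at 0)) \<and>
     (\<forall>\<alpha> k. \<exists>C. \<forall>y. ennreal ((1 + norm y) ^ k) * N (U \<alpha> y) \<le> ennreal C))"

definition W_sq :: "(real^'q \<Rightarrow> real) \<Rightarrow> (real \<Rightarrow> complex) \<Rightarrow> nat \<Rightarrow> real
    \<Rightarrow> (real^'q \<Rightarrow> real \<Rightarrow> complex) \<Rightarrow> ennreal" where
  "W_sq br \<omega> s \<gamma> u =
     (\<integral>\<^sup>+\<eta>. ennreal (br \<eta> ^ (2 * s)) * K_sq \<omega> s \<gamma> (kap (1 / br \<eta>) (ft_on UNIV u \<eta>)) \<partial>lborel)"

text \<open>
  The completion is realised inside \<open>L\<^sup>2(R\<^sup>q, L\<^sup>2\<^sub>l\<^sub>o\<^sub>c(0,\<infinity>))\<close>, into which it embeds continuously and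
  injectively for \<open>s \<ge> 0\<close>: limits of Cauchy sequences of Schwartz functions.
\<close>

definition Wspace :: "(real^'q \<Rightarrow> real) \<Rightarrow> (real \<Rightarrow> complex) \<Rightarrow> nat \<Rightarrow> real
    \<Rightarrow> (real^'q \<Rightarrow> real \<Rightarrow> complex) set" where
  "Wspace br \<omega> s \<gamma> = {u. (\<lambda>(y,t). u y t) \<in> borel_measurable Omega \<and>
     (\<exists>w :: nat \<Rightarrow> real^'q \<Rightarrow> real \<Rightarrow> complex.
        (\<forall>n. schwartz (K_sq \<omega> s \<gamma>) (w n)) \<and>
        (\<forall>e>0. \<exists>M. \<forall>m\<ge>M. \<forall>n\<ge>M. W_sq br \<omega> s \<gamma> (\<lambda>y t. w m y t - w n y t) < e) \<and>
        (\<forall>a b. 0 < a \<and> a < b \<longrightarrow>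
           (\<lambda>n. \<integral>\<^sup>+(y,t). ennreal ((cmod (w n y t - u y t))\<^sup>2) * indicator {a..b} t \<partial>Omega)
             \<longlonglongrightarrow> 0))}"


section \<open>The differential operator\<close>

text \<open>\<open>\<Phi> \<alpha> j = \<partial>\<^sub>y\<^sup>\<alpha> \<partial>\<^sub>t\<^sup>j \<phi>\<close> for a test function \<open>\<phi> = \<Phi> 0 0\<close> on \<open>\<Omega>\<close>.\<close>

definition test_Omega :: "(('q \<Rightarrow> nat) \<Rightarrow> nat \<Rightarrow> real^'q \<Rightarrow> real \<Rightarrow> complex) \<Rightarrow> bool" where
  "test_Omega \<Phi> \<longleftrightarrow>
     (\<forall>\<alpha> j. continuous_on UNIV (\<lambda>(y,t). \<Phi> \<alpha> j y t)) \<and>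
     (\<forall>\<alpha> j i y t. ((\<lambda>h. \<Phi> \<alpha> j (y + h *\<^sub>R axis i 1) t)
                      has_vector_derivative \<Phi> (mi_suc i \<alpha>) j y t) (at 0)) \<and>
     (\<forall>\<alpha> j y t. (\<Phi> \<alpha> j y has_vector_derivative \<Phi> \<alpha> (Suc j) y t) (at t)) \<and>
     (\<exists>K. compact K \<and> K \<subseteq> UNIV \<times> {0<..} \<and> (\<forall>y t. (y,t) \<notin> K \<longrightarrow> \<Phi> (\<lambda>_. 0) 0 y t = 0))"

definition loc_integrable_Omega :: "(real^'q \<Rightarrow> real \<Rightarrow> complex) \<Rightarrow> bool" where
  "loc_integrable_Omega u \<longleftrightarrow> (\<lambda>(y,t). u y t) \<in> borel_measurable Omega \<and>
     (\<forall>K. compact K \<and> K \<subseteq> UNIV \<times> {0<..} \<longrightarrow> set_integrable Omega K (\<lambda>(y,t). u y t))"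

definition is_weak_deriv_Omega :: "('q \<Rightarrow> nat) \<Rightarrow> nat \<Rightarrow> (real^'q \<Rightarrow> real \<Rightarrow> complex)
    \<Rightarrow> (real^'q \<Rightarrow> real \<Rightarrow> complex) \<Rightarrow> bool" where
  "is_weak_deriv_Omega \<alpha> j u v \<longleftrightarrow> loc_integrable_Omega u \<and> loc_integrable_Omega v \<and>
     (\<forall>\<Phi>. test_Omega \<Phi> \<longrightarrow>
        (LINT (y,t)|Omega. u y t * \<Phi> \<alpha> j y t) =
        (-1) ^ (mi_len \<alpha> + j) * (LINT (y,t)|Omega. v y t * \<Phi> (\<lambda>_. 0) 0 y t))"

text \<open>
  \<open>A = \<Sum> b\<^sub>j\<^sub>\<alpha>(t) D\<^sub>y\<^sup>\<alpha> \<partial>\<^sub>t\<^sup>j\<close> over \<open>j + |\<alpha>| \<le> \<mu>\<close>, with \<open>D\<^sub>y = -\<i> \<partial>\<^sub>y\<close>, evaluated on a family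
  \<open>U \<alpha> j = \<partial>\<^sub>y\<^sup>\<alpha> \<partial>\<^sub>t\<^sup>j u\<close> of (weak or classical) derivatives.
\<close>

definition diffop :: "nat \<Rightarrow> (nat \<Rightarrow> ('q \<Rightarrow> nat) \<Rightarrow> real \<Rightarrow> complex)
    \<Rightarrow> (('q \<Rightarrow> nat) \<Rightarrow> nat \<Rightarrow> real^'q \<Rightarrow> real \<Rightarrow> complex) \<Rightarrow> real^'q \<Rightarrow> real \<Rightarrow> complex" where
  "diffop \<mu> b U y t =
     (\<Sum>(j,\<alpha>) | j + mi_len \<alpha> \<le> \<mu>. b j \<alpha> t * (- \<i>) ^ mi_len \<alpha> * U \<alpha> j y t)"

text \<open>\<open>b\<close> are the coefficients of \<open>A\<close> on \<open>\<Omega>\<close>, \<open>a\<close> those of its edge-degenerate form near \<open>t = 0\<close>.\<close>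

definition edge_degenerate :: "nat \<Rightarrow> (nat \<Rightarrow> ('q::finite \<Rightarrow> nat) \<Rightarrow> real \<Rightarrow> complex)
    \<Rightarrow> (nat \<Rightarrow> ('q \<Rightarrow> nat) \<Rightarrow> real \<Rightarrow> complex) \<Rightarrow> bool" where
  "edge_degenerate \<mu> b a \<longleftrightarrow>
     (\<forall>j \<alpha>. j + mi_len \<alpha> \<le> \<mu> \<longrightarrow> smooth_upto0_on {0<..} (b j \<alpha>)) \<and>
     (\<exists>\<epsilon>>0.
        (\<forall>j \<alpha>. j + mi_len \<alpha> \<le> \<mu> \<longrightarrow> smooth_upto0_on {0..<\<epsilon>} (a j \<alpha>)) \<and>
        (\<forall>\<Phi> (y :: real^'q) t. test_Omega \<Phi> \<and> 0 < t \<and> t < \<epsilon> \<longrightarrow>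
           diffop \<mu> b \<Phi> y t =
           (\<Sum>(j,\<alpha>) | j + mi_len \<alpha> \<le> \<mu>.
              a j \<alpha> t * of_real t ^ mi_len \<alpha> * (- \<i>) ^ mi_len \<alpha> * (mtd ^^ j) (\<Phi> \<alpha> 0 y) t)
             / of_real t ^ \<mu>))"

text \<open>\<open>h = A u\<close> in the sense of weak derivatives on \<open>\<Omega>\<close>.\<close>

definition is_A :: "nat \<Rightarrow> (nat \<Rightarrow> ('q \<Rightarrow> nat) \<Rightarrow> real \<Rightarrow> complex)
    \<Rightarrow> (real^'q \<Rightarrow> real \<Rightarrow> complex) \<Rightarrow> (real^'q \<Rightarrow> real \<Rightarrow> complex) \<Rightarrow> bool" where
  "is_A \<mu> b u h \<longleftrightarrow> (\<exists>U. (\<forall>\<alpha> j. j + mi_len \<alpha> \<le> \<mu> \<longrightarrow> is_weak_deriv_Omega \<alpha> j u (U \<alpha> j)) \<and>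
     (AE (y,t) in Omega. h y t = diffop \<mu> b U y t))"


section \<open>Objects derived from \<open>A\<close>\<close>

definition taylor :: "(real \<Rightarrow> complex) \<Rightarrow> nat \<Rightarrow> complex" where
  "taylor f k = (hd_deriv ^^ k) f 0 / fact k"

definition conormal :: "nat \<Rightarrow> (nat \<Rightarrow> ('q \<Rightarrow> nat) \<Rightarrow> real \<Rightarrow> complex) \<Rightarrow> complex poly" where
  "conormal \<mu> a = (\<Sum>j\<le>\<mu>. monom (a j (\<lambda>_. 0) 0) j)"

abbreviation f0_inv :: "nat \<Rightarrow> (nat \<Rightarrow> ('q \<Rightarrow> nat) \<Rightarrow> real \<Rightarrow> complex) \<Rightarrow> complex \<Rightarrow> complex" where
  "f0_inv \<mu> a \<equiv> (\<lambda>z. inverse (poly (conormal \<mu> a) z))"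

text \<open>\<open>A\<^sub>t\<^sub>r\<close> has \<open>y\<close>-independent coefficients, so \<open>A\<^sub>t\<^sub>r = F\<^sup>-\<^sup>1 a\<^sub>t\<^sub>r(\<eta>) F\<close> with \<open>D\<^sub>y\<^sup>\<alpha>\<close> replaced by \<open>\<eta>\<^sup>\<alpha>\<close>;
  then \<open>L A\<^sub>t\<^sub>r L\<^sup>-\<^sup>1\<close> has the symbol \<open>\<kappa>(\<eta>)\<^sup>-\<^sup>1 a\<^sub>t\<^sub>r(\<eta>) \<kappa>(\<eta>)\<close>.\<close>

definition atr_symbol :: "nat \<Rightarrow> (nat \<Rightarrow> ('q \<Rightarrow> nat) \<Rightarrow> real \<Rightarrow> complex)
    \<Rightarrow> real^'q \<Rightarrow> (real \<Rightarrow> complex) \<Rightarrow> real \<Rightarrow> complex" where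
  "atr_symbol \<mu> a \<eta> u t =
     (\<Sum>l\<le>\<mu>. of_real t ^ l * (\<Sum>(k,\<alpha>) | k + mi_len \<alpha> = l. \<Sum>j\<le>\<mu> - mi_len \<alpha>.
        taylor (a j \<alpha>) k * mi_pow \<eta> \<alpha> * (mtd ^^ j) u t)) / of_real t ^ \<mu>"

definition atilde :: "(real^'q \<Rightarrow> real) \<Rightarrow> nat \<Rightarrow> (nat \<Rightarrow> ('q \<Rightarrow> nat) \<Rightarrow> real \<Rightarrow> complex)
    \<Rightarrow> real^'q \<Rightarrow> (real \<Rightarrow> complex) \<Rightarrow> real \<Rightarrow> complex" where
  "atilde br \<mu> a \<eta> u = kap (1 / br \<eta>) (atr_symbol \<mu> a \<eta> (kap (br \<eta>) u))"

definition ftilde :: "(real^'q \<Rightarrow> real) \<Rightarrow> nat \<Rightarrow> (nat \<Rightarrow> ('q \<Rightarrow> nat) \<Rightarrow> real \<Rightarrow> complex)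
    \<Rightarrow> nat \<Rightarrow> real^'q \<Rightarrow> complex poly" where
  "ftilde br \<mu> a l \<eta> =
     smult (of_real (br \<eta> powi (int \<mu> - int l)))
       (\<Sum>(k,\<alpha>) | k + mi_len \<alpha> = l. \<Sum>j\<le>\<mu> - mi_len \<alpha>.
          monom (taylor (a j \<alpha>) k * mi_pow \<eta> \<alpha>) j)"

text \<open>Explicit form of the conjugated symbol:
  \<open>t\<^sup>-\<^sup>\<mu> \<Sum>\<^sub>l t\<^sup>l f\<^sub>l(-t \<partial>\<^sub>t, \<eta>)\<close> on smooth functions, with \<open>f\<^sub>l = ftilde \<dots> l\<close>.\<close>

lemma at_within_pos: "(t::real) > 0 \<Longrightarrow> at t within {0..} = at t"
  by (rule at_within_interior) (simp add: interior_real_atLeast)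

lemma hd_deriv_pos_eqI:
  assumes "(f has_vector_derivative d) (at t)" "t > 0" "\<And>s. s > 0 \<Longrightarrow> g s = f s"
  shows "hd_deriv g t = d" "(g has_vector_derivative d) (at t)"
proof -
  show d: "(g has_vector_derivative d) (at t)"
    by (rule has_vector_derivative_transform_within_open[of f d t "{0<..}"])
       (use assms in auto)
  then show "hd_deriv g t = d"
    using assms(2) by (simp add: hd_deriv_def at_within_pos vector_derivative_at)
qed

lemma smooth_upto0_on_D:
  assumes "smooth_upto0_on {0<..} u" "t > 0"
  shows "((hd_deriv ^^ k) u has_vector_derivative (hd_deriv ^^ Suc k) u t) (at t)"
proof -
  have "(hd_deriv ^^ k) u differentiable (at t)"
    using assms unfolding smooth_upto0_on_def by (metis at_within_pos greaterThan_iff)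
  then show ?thesis
    using assms(2) by (simp add: hd_deriv_def at_within_pos vector_derivative_works)
qed

lemma smooth_upto0_on_mtd:
  assumes u: "smooth_upto0_on {0<..} u"
  shows "smooth_upto0_on {0<..} (mtd u)"
proof -
  let ?D = "\<lambda>k t. - (of_real t * (hd_deriv ^^ Suc k) u t + of_nat k * (hd_deriv ^^ k) u t)"
  have der: "(?D k has_vector_derivative ?D (Suc k) t) (at t)" if t: "t > 0" for k t
  proof -
    have 1: "((\<lambda>t. complex_of_real t) has_vector_derivative 1) (at t)"
      by (auto intro!: derivative_eq_intros has_vector_derivative_of_real)
    show ?thesis
      by (rule has_vector_derivative_eq_rhs,
          rule has_vector_derivative_minus, rule has_vector_derivative_add,
          rule has_vector_derivative_mult[OF 1 smooth_upto0_on_D[OF u t]],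
          rule has_vector_derivative_mult_right[OF smooth_upto0_on_D[OF u t]])
         (simp add: algebra_simps)
  qed
  have eq: "(hd_deriv ^^ k) (mtd u) t = ?D k t" if "t > 0" for k t
    using that
  proof (induction k arbitrary: t)
    case 0 then show ?case by (simp add: mtd_def)
  next
    case (Suc k)
    show ?case
      using hd_deriv_pos_eqI(1)[OF der[OF Suc.prems, of k] Suc.prems, of "(hd_deriv ^^ k) (mtd u)"]
        Suc.IH by simp
  qed
  show ?thesis
    unfolding smooth_upto0_on_def
  proof (intro allI ballI)
    fix k and t :: real assume "t \<in> {0<..}"
    then have t: "t > 0" by simp
    from hd_deriv_pos_eqI(2)[OF der[OF t, of k] t, of "(hd_deriv ^^ k) (mtd u)"] eq
    show "(hd_deriv ^^ k) (mtd u) differentiable (at t within {0..})"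
      using t by (auto simp: at_within_pos intro: differentiableI_vector)
  qed
qed

lemma mtd_kap:
  assumes u: "smooth_upto0_on {0<..} u" and r: "r > 0" and t: "t > 0"
  shows "(mtd ^^ j) (kap r u) t = kap r ((mtd ^^ j) u) t"
  using t
proof (induction j arbitrary: t)
  case 0 then show ?case by simp
next
  case (Suc j)
  let ?v = "(mtd ^^ j) u"
  have v: "smooth_upto0_on {0<..} ?v"
    by (induction j) (simp_all add: u smooth_upto0_on_mtd)
  have rt: "r * t > 0" using r Suc.prems by simp
  have "(?v has_vector_derivative hd_deriv ?v (r * t)) (at (r * t))"
    using smooth_upto0_on_D[OF v rt, of 0] by simp
  then have "(?v \<circ> (\<lambda>t. r * t) has_vector_derivative r *\<^sub>R hd_deriv ?v (r * t)) (at t)"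
    by (intro vector_diff_chain_at) (auto intro!: derivative_eq_intros)
  then have "(kap r ?v has_vector_derivative of_real (sqrt r) * (r *\<^sub>R hd_deriv ?v (r * t))) (at t)"
    unfolding kap_def o_def by (rule has_vector_derivative_mult_right)
  from hd_deriv_pos_eqI(1)[OF this Suc.prems, of "(mtd ^^ j) (kap r u)"] Suc.IH
  have "hd_deriv ((mtd ^^ j) (kap r u)) t = of_real (sqrt r) * (r *\<^sub>R hd_deriv ?v (r * t))"
    by blast
  then show ?case by (simp add: mtd_def[of "(mtd ^^ j) _"] kap_def[of r "\<lambda>s. - (of_real s * _ s)"] scaleR_conv_of_real)
qed

lemma poly_mtd_eq:
  assumes "degree p \<le> n"
  shows "poly_mtd p u t = (\<Sum>j\<le>n. coeff p j * (mtd ^^ j) u t)"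
  unfolding poly_mtd_def using assms
  by (intro sum.mono_neutral_left) (auto simp: coeff_eq_0)

lemma poly_mtd_sum: "finite A \<Longrightarrow> poly_mtd (\<Sum>i\<in>A. P i) u t = (\<Sum>i\<in>A. poly_mtd (P i) u t)"
proof (induction A rule: finite_induct)
  case empty then show ?case by (simp add: poly_mtd_def)
next
  case (insert x A)
  define n where "n = max (degree (P x)) (degree (sum P A))"
  have "degree (P x + sum P A) \<le> n" unfolding n_def by (rule degree_add_le_max)
  then have "poly_mtd (P x + sum P A) u t = poly_mtd (P x) u t + poly_mtd (sum P A) u t"
    by (simp add: poly_mtd_eq[of _ n] n_def algebra_simps sum.distrib)
  then show ?case using insert by simp
qed

lemma poly_mtd_smult: "poly_mtd (smult c p) u t = c * poly_mtd p u t"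
  by (simp add: poly_mtd_eq[of _ "degree p"] sum_distrib_left mult.assoc)

lemma poly_mtd_monom: "poly_mtd (monom c j) u t = c * (mtd ^^ j) u t"
  by (subst poly_mtd_eq[of _ j])
     (simp_all add: degree_monom_le if_distrib[of "\<lambda>x. x * _"] sum.delta' cong: if_cong)

lemma finite_kalpha: "finite {(k, \<alpha> :: 'q::finite \<Rightarrow> nat). k + mi_len \<alpha> = l}"
proof (rule finite_subset)
  have "\<alpha> i \<le> mi_len \<alpha>" for \<alpha> :: "'q \<Rightarrow> nat" and i
    by (rule member_le_sum) auto
  then show "{(k, \<alpha> :: 'q \<Rightarrow> nat). k + mi_len \<alpha> = l} \<subseteq> {..l} \<times> (UNIV \<rightarrow>\<^sub>E {..l})"
    by (force simp: PiE_def extensional_def intro: trans_le_add2)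
  show "finite ({..l} \<times> ((UNIV :: 'q set) \<rightarrow>\<^sub>E {..l}))"
    by (intro finite_cartesian_product finite_PiE) auto
qed

lemma atilde_eq:
  fixes br :: "real^'q \<Rightarrow> real"
  assumes u: "smooth_upto0_on {0<..} u" and r: "br \<eta> > 0" and t: "t > 0"
  shows "atilde br \<mu> a \<eta> u t =
           (\<Sum>l\<le>\<mu>. of_real t ^ l * poly_mtd (ftilde br \<mu> a l \<eta>) u t) / of_real t ^ \<mu>"
proof -
  define r where "r = br \<eta>"
  have r: "r > 0" using r by (simp add: r_def)
  define X where "X l = (\<Sum>(k,\<alpha>) | k + mi_len \<alpha> = l. \<Sum>j\<le>\<mu> - mi_len \<alpha>.
        taylor (a j \<alpha>) k * mi_pow \<eta> \<alpha> * (mtd ^^ j) u t)" for l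
  have sq: "complex_of_real (sqrt (1 / r)) * of_real (sqrt r) = 1"
    using r by (simp flip: of_real_mult real_sqrt_mult)
  have X: "(\<Sum>(k,\<alpha>) | k + mi_len \<alpha> = l. \<Sum>j\<le>\<mu> - mi_len \<alpha>.
        taylor (a j \<alpha>) k * mi_pow \<eta> \<alpha> * (mtd ^^ j) (kap r u) (1 / r * t)) = of_real (sqrt r) * X l"
    for l
    using r t unfolding X_def
    by (auto simp: mtd_kap[OF u] kap_def sum_distrib_left mult_ac intro!: sum.cong)
  have P: "poly_mtd (ftilde br \<mu> a l \<eta>) u t = of_real (r powi (int \<mu> - int l)) * X l" for l
    unfolding ftilde_def X_def r_def poly_mtd_smult poly_mtd_sum[OF finite_kalpha]
    by (simp add: case_prod_unfold poly_mtd_sum poly_mtd_monom)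
  have pw: "complex_of_real (1 / r * t) ^ l / of_real (1 / r * t) ^ \<mu> =
      of_real t ^ l / of_real t ^ \<mu> * of_real (r powi (int \<mu> - int l))" for l
    using r t by (simp add: power_int_diff power_divide field_simps)
  have "atilde br \<mu> a \<eta> u t = of_real (sqrt (1 / r)) *
     ((\<Sum>l\<le>\<mu>. of_real (1 / r * t) ^ l * (of_real (sqrt r) * X l)) / of_real (1 / r * t) ^ \<mu>)"
    unfolding atilde_def r_def[symmetric] kap_def[of "1 / r"] atr_symbol_def X by (rule refl)
  also have "\<dots> = (of_real (sqrt (1 / r)) * of_real (sqrt r)) *
     (\<Sum>l\<le>\<mu>. (of_real (1 / r * t) ^ l / of_real (1 / r * t) ^ \<mu>) * X l)"
    by (simp add: sum_divide_distrib sum_distrib_left mult_ac)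
  also have "\<dots> = (\<Sum>l\<le>\<mu>. of_real t ^ l * poly_mtd (ftilde br \<mu> a l \<eta>) u t) / of_real t ^ \<mu>"
    unfolding sq pw P by (simp add: sum_divide_distrib mult_ac)
  finally show ?thesis .
qed

fun gtilde :: "(real^'q \<Rightarrow> real) \<Rightarrow> nat \<Rightarrow> (nat \<Rightarrow> ('q \<Rightarrow> nat) \<Rightarrow> real \<Rightarrow> complex)
    \<Rightarrow> nat \<Rightarrow> real^'q \<Rightarrow> complex \<Rightarrow> complex" where
  "gtilde br \<mu> a l \<eta> z =
     (if l = 0 then 1
      else - inverse (poly (ftilde br \<mu> a 0 \<eta>) (z - of_nat l)) *
           (\<Sum>j<l. poly (ftilde br \<mu> a (l - j) \<eta>) (z - of_nat j) * gtilde br \<mu> a j \<eta> z))"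

declare gtilde.simps [simp del]

definition Sigma_poles :: "nat \<Rightarrow> (nat \<Rightarrow> ('q \<Rightarrow> nat) \<Rightarrow> real \<Rightarrow> complex) \<Rightarrow> complex set" where
  "Sigma_poles \<mu> a = {\<sigma>. is_pole (f0_inv \<mu> a) \<sigma> \<and> 1/2 - real \<mu> < Re \<sigma> \<and> Re \<sigma> < 1/2}"

definition n_sig :: "nat \<Rightarrow> (nat \<Rightarrow> ('q \<Rightarrow> nat) \<Rightarrow> real \<Rightarrow> complex) \<Rightarrow> complex \<Rightarrow> nat" where
  "n_sig \<mu> a \<sigma> = nat (- zorder (f0_inv \<mu> a) \<sigma>) - 1"

definition mu_sig :: "nat \<Rightarrow> complex \<Rightarrow> nat" where
  "mu_sig \<mu> \<sigma> = nat \<lfloor>Re \<sigma> + real \<mu> - 1/2\<rfloor>"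

text \<open>\<open>N\<close> is an admissible choice of the numbers \<open>N\<^sub>\<sigma>\<^sup>(\<^sup>l\<^sup>)\<close>.\<close>

definition admissible_N :: "(real^'q \<Rightarrow> real) \<Rightarrow> nat \<Rightarrow> (nat \<Rightarrow> ('q \<Rightarrow> nat) \<Rightarrow> real \<Rightarrow> complex)
    \<Rightarrow> (complex \<Rightarrow> nat \<Rightarrow> nat) \<Rightarrow> bool" where
  "admissible_N br \<mu> a N \<longleftrightarrow> (\<forall>\<sigma>\<in>Sigma_poles \<mu> a. N \<sigma> 0 = 0 \<and>
     (\<forall>l\<le>mu_sig \<mu> \<sigma>. \<forall>\<eta>. \<forall>k < - int (N \<sigma> l).
        fls_nth (laurent_expansion (gtilde br \<mu> a l \<eta>) \<sigma>) k = 0))"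

definition m_sig :: "nat \<Rightarrow> (nat \<Rightarrow> ('q \<Rightarrow> nat) \<Rightarrow> real \<Rightarrow> complex)
    \<Rightarrow> (complex \<Rightarrow> nat \<Rightarrow> nat) \<Rightarrow> complex \<Rightarrow> nat" where
  "m_sig \<mu> a N \<sigma> = Max ((\<lambda>l. N \<sigma> l + n_sig \<mu> a \<sigma>) ` {..mu_sig \<mu> \<sigma>})"

definition S_sig :: "nat \<Rightarrow> (nat \<Rightarrow> ('q \<Rightarrow> nat) \<Rightarrow> real \<Rightarrow> complex)
    \<Rightarrow> (complex \<Rightarrow> nat \<Rightarrow> nat) \<Rightarrow> complex \<Rightarrow> (complex \<times> nat) set" where
  "S_sig \<mu> a N \<sigma> = (\<lambda>l. (\<sigma> - of_nat l, m_sig \<mu> a N \<sigma>)) ` {..mu_sig \<mu> \<sigma>}"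

definition mellin :: "(real \<Rightarrow> complex) \<Rightarrow> complex \<Rightarrow> complex" where
  "mellin u z = (LINT t|halfline. of_real t powr (z - 1) * u t)"

definition principal_part :: "complex \<Rightarrow> (complex \<Rightarrow> complex) \<Rightarrow> complex \<Rightarrow> complex" where
  "principal_part \<sigma> h z = poly (fls_prpart (laurent_expansion h \<sigma>)) (inverse (z - \<sigma>))"

text \<open>\<open>residue F \<sigma>\<close> is by definition \<open>1/(2\<pi>\<i>)\<close> times the integral of \<open>F\<close> over all sufficiently small
  counter-clockwise circles about \<open>\<sigma>\<close>.\<close>

definition g_part :: "(real^'q \<Rightarrow> real) \<Rightarrow> (real \<Rightarrow> complex) \<Rightarrow> (real \<Rightarrow> complex) \<Rightarrow> nat
    \<Rightarrow> (nat \<Rightarrow> ('q \<Rightarrow> nat) \<Rightarrow> real \<Rightarrow> complex) \<Rightarrow> complex \<Rightarrow> nat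
    \<Rightarrow> real^'q \<Rightarrow> (real \<Rightarrow> complex) \<Rightarrow> real \<Rightarrow> complex" where
  "g_part br \<omega> \<omega>0 \<mu> a \<sigma> l \<eta> u t =
     \<omega> t * of_real t ^ l *
     residue (\<lambda>z. of_real t powr (- z) * gtilde br \<mu> a l \<eta> z *
       principal_part \<sigma> (\<lambda>z. inverse (poly (ftilde br \<mu> a 0 \<eta>) z) * mellin (\<lambda>t. \<omega>0 t * u t) z) z) \<sigma>"

definition g_sig :: "(real^'q \<Rightarrow> real) \<Rightarrow> (real \<Rightarrow> complex) \<Rightarrow> (real \<Rightarrow> complex) \<Rightarrow> nat
    \<Rightarrow> (nat \<Rightarrow> ('q \<Rightarrow> nat) \<Rightarrow> real \<Rightarrow> complex) \<Rightarrow> complex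
    \<Rightarrow> real^'q \<Rightarrow> (real \<Rightarrow> complex) \<Rightarrow> real \<Rightarrow> complex" where
  "g_sig br \<omega> \<omega>0 \<mu> a \<sigma> \<eta> u t = (\<Sum>l\<le>mu_sig \<mu> \<sigma>. g_part br \<omega> \<omega>0 \<mu> a \<sigma> l \<eta> u t)"

definition range_g :: "(real^'q \<Rightarrow> real) \<Rightarrow> (real \<Rightarrow> complex) \<Rightarrow> (real \<Rightarrow> complex) \<Rightarrow> nat
    \<Rightarrow> (nat \<Rightarrow> ('q \<Rightarrow> nat) \<Rightarrow> real \<Rightarrow> complex) \<Rightarrow> (complex \<Rightarrow> nat \<Rightarrow> nat) \<Rightarrow> complex
    \<Rightarrow> (real^'q \<Rightarrow> real \<Rightarrow> complex) set" where
  "range_g br \<omega> \<omega>0 \<mu> a N \<sigma> =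
     {w. \<exists>u \<in> L2H (K_sq \<omega> 0 (real \<mu>)).
           is_op (K_sq \<omega> 0 (real \<mu>)) (E_sq \<omega> (S_sig \<mu> a N \<sigma>)) (g_sig br \<omega> \<omega>0 \<mu> a \<sigma>) u w}"

end

theory Submission
  imports Defs "HOL-Probability.Probability"
begin

text \<open>
  On the Fourier side, \<open>g\<^sub>\<sigma>(\<eta>) v(\<eta>)\<close> is a finite combination of the functions \<open>\<omega> t\<^bsup>l-\<sigma>\<^esup> log\<^sup>j t\<close>. Up to the
  factor \<open>[\<eta>]\<^bsup>-\<mu>\<^esup>\<close> its coefficients with \<open>l = 0\<close> are those of the principal part at \<open>\<sigma>\<close> of
  \<open>f\<^sub>0\<^sup>-\<^sup>1\<close> times the Mellin transform of \<open>\<omega>\<^sub>0 v(\<eta>)\<close>, and the remaining ones arise from them by a matrix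
  that is bounded in \<open>\<eta>\<close>, because all the \<open>f\<^sub>l\<close> are of order \<open>[\<eta>]\<^bsup>\<mu>\<^esup>\<close> and the recursion for \<open>g\<^sub>l\<close> divides by
  \<open>[\<eta>]\<^bsup>\<mu>\<^esup> f\<^sub>0(z - l)\<close>. Every principal part
  with the pole order of \<open>f\<^sub>0\<^sup>-\<^sup>1\<close> occurs, as the moment functionals of the Mellin transform are linearly
  independent. So the range is cut out of \<open>H\<^sup>\<mu>(R\<^sup>q, \<E>\<^sub>S)\<close> by linear relations with bounded coefficients,
  and it is closed by the Plancherel theorem.

  Near \<open>t = 0\<close> the operator \<open>p(-t \<partial>\<^sub>t)\<close> acts on \<open>t\<^bsup>l-\<sigma>\<^esup> log\<^sup>j t\<close> through multiplication of Laurent series by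
  \<open>p(z - l)\<close>. The recursion for \<open>g\<^sub>l\<close> then cancels all terms of order \<open>t\<^bsup>M-\<mu>-\<sigma>\<^esup>\<close> with \<open>M \<le> \<mu>\<^sub>\<sigma>\<close>, and the
  remaining ones are square integrable at \<open>0\<close> with norm bounded by that of \<open>v(\<eta>)\<close>.
\<close>

section \<open>Square integrable functions\<close>

text \<open>\<open>gtilde\<close> with l = 0 is 1, so the coefficients with l = 0 return the
  principal part itself; this left inverse turns the range into the solution set of linear
  relations. Conversely, with n = \<open>n_sig \<mu> a \<sigma>\<close>, a principal part F of order
  n + 1 is hit as soon as the Mellin transform of \<omega>0 v agrees to order n at \<sigma> with f0
  F (up to a factor [\<eta>]^\<mu>), and f0 F has no negative powers because f0 vanishes at \<sigma>
  to order n + 1. Three strict inequalities carry the estimates. Re \<sigma> > 1/2 - \<mu> leaves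
  room for a factor exp (\<delta> |ln t|) in the Mellin integral at \<sigma>, which gives
  analyticity and bounds all moments. Re \<sigma> + \<mu> - 1/2 <
  \<open>mu_sig \<mu> \<sigma>\<close> + 1 makes the first uncancelled power of t square integrable
  at 0, with room for logarithms. Re \<sigma> < 1/2 gives \<open>mu_sig \<mu> \<sigma>\<close> <
  \<mu>, so all terms needed for the cancellation occur in the truncated operator. Function-valued
  transforms are reduced to scalar ones in two ways: for weighted L2 spaces t becomes a parameter,
  for the finite-dimensional spaces the coefficients are transformed.\<close>

definition nsq :: "'a measure \<Rightarrow> ('a \<Rightarrow> complex) \<Rightarrow> ennreal" where
  "nsq M f = (\<integral>\<^sup>+x. ennreal ((cmod (f x))\<^sup>2) \<partial>M)"

lemma nsq_cong: "(\<And>x. x \<in> space M \<Longrightarrow> cmod (f x) = cmod (g x)) \<Longrightarrow> nsq M f = nsq M g"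
  unfolding nsq_def by (intro nn_integral_cong) simp

lemma nsq_cong_AE: "AE x in M. cmod (f x) = cmod (g x) \<Longrightarrow> nsq M f = nsq M g"
  unfolding nsq_def by (intro nn_integral_cong_AE) auto

lemma nsq_mono: "(\<And>x. x \<in> space M \<Longrightarrow> cmod (f x) \<le> cmod (g x)) \<Longrightarrow> nsq M f \<le> nsq M g"
  unfolding nsq_def by (intro nn_integral_mono) (simp add: power_mono)

lemma nsq_cmult:
  assumes "f \<in> borel_measurable M"
  shows "nsq M (\<lambda>x. c * f x) = ennreal ((cmod c)\<^sup>2) * nsq M f"
  unfolding nsq_def using assms
  by (subst nn_integral_cmult[symmetric]) (auto simp: norm_mult power_mult_distrib ennreal_mult)

lemma cmod_add_sq_le: "(cmod (a + b))\<^sup>2 \<le> 2 * (cmod a)\<^sup>2 + 2 * (cmod b)\<^sup>2"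
proof -
  have "(cmod (a + b))\<^sup>2 \<le> (cmod a + cmod b)\<^sup>2" by (simp add: norm_triangle_ineq power_mono)
  also have "\<dots> \<le> 2 * (cmod a)\<^sup>2 + 2 * (cmod b)\<^sup>2"
    using zero_le_power2[of "cmod a - cmod b"] by (simp add: power2_eq_square algebra_simps)
  finally show ?thesis .
qed

text \<open>The factor 2 replaces the triangle inequality and avoids square roots in
  \<open>ennreal\<close>; it is good enough wherever only finiteness or convergence to 0 is at
  stake.\<close>

lemma nsq_add_le:
  assumes [measurable]: "f \<in> borel_measurable M" "g \<in> borel_measurable M"
  shows "nsq M (\<lambda>x. f x + g x) \<le> 2 * nsq M f + 2 * nsq M g"
proof -
  have "nsq M (\<lambda>x. f x + g x) \<le> (\<integral>\<^sup>+x. ennreal (2 * (cmod (f x))\<^sup>2 + 2 * (cmod (g x))\<^sup>2) \<partial>M)"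
    unfolding nsq_def by (intro nn_integral_mono ennreal_leI cmod_add_sq_le)
  also have "\<dots> = (\<integral>\<^sup>+x. 2 * ennreal ((cmod (f x))\<^sup>2) + 2 * ennreal ((cmod (g x))\<^sup>2) \<partial>M)"
    by (simp add: ennreal_mult)
  also have "\<dots> = 2 * nsq M f + 2 * nsq M g"
    unfolding nsq_def by (simp add: nn_integral_add nn_integral_cmult)
  finally show ?thesis .
qed

lemma nsq_diff_le:
  assumes [measurable]: "f \<in> borel_measurable M" "g \<in> borel_measurable M"
  shows "nsq M (\<lambda>x. f x - g x) \<le> 2 * nsq M f + 2 * nsq M g"
  using nsq_add_le[of f M "\<lambda>x. - g x"] by (simp add: nsq_def)

lemma nsq_triangle:
  assumes [measurable]: "f \<in> borel_measurable M" "g \<in> borel_measurable M" "h \<in> borel_measurable M"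
  shows "nsq M (\<lambda>x. f x - g x) \<le> 2 * nsq M (\<lambda>x. f x - h x) + 2 * nsq M (\<lambda>x. h x - g x)"
  using nsq_add_le[of "\<lambda>x. f x - h x" M "\<lambda>x. h x - g x"] by simp

lemma nsq_add_finite:
  assumes "f \<in> borel_measurable M" "g \<in> borel_measurable M" "nsq M f < \<infinity>" "nsq M g < \<infinity>"
  shows "nsq M (\<lambda>x. f x + g x) < \<infinity>" "nsq M (\<lambda>x. f x - g x) < \<infinity>"
  using nsq_add_le[OF assms(1,2)] nsq_diff_le[OF assms(1,2)] assms(3,4)
  by (auto simp: ennreal_mult_less_top top.not_eq_extremum intro: order.strict_trans1)

text \<open>Cauchy-Schwarz for the bilinear pairing; conjugates are inserted where a scalar product
  is meant.\<close>

lemma nsq_integrable_mult: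
  assumes [measurable]: "f \<in> borel_measurable M" "g \<in> borel_measurable M"
    and "nsq M f < \<infinity>" "nsq M g < \<infinity>"
  shows "integrable M (\<lambda>x. f x * g x)"
    and "ennreal ((cmod (LINT x|M. f x * g x))\<^sup>2) \<le> nsq M f * nsq M g"
proof -
  have cs: "(\<integral>\<^sup>+x. ennreal (cmod (f x)) * ennreal (cmod (g x)) \<partial>M)\<^sup>2 \<le> nsq M f * nsq M g"
    using Cauchy_Schwarz_nn_integral[of "\<lambda>x. ennreal (cmod (f x))" M "\<lambda>x. ennreal (cmod (g x))"]
    by (simp add: nsq_def ennreal_power)
  also have "\<dots> < \<infinity>" using assms by (simp add: ennreal_mult_less_top)
  finally have "(\<integral>\<^sup>+x. ennreal (cmod (f x)) * ennreal (cmod (g x)) \<partial>M) < \<infinity>"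
    by (auto simp: power2_eq_square ennreal_mult_less_top top.not_eq_extremum)
  then show int: "integrable M (\<lambda>x. f x * g x)"
    by (intro integrableI_bounded) (auto simp: norm_mult ennreal_mult)
  have "ennreal (cmod (LINT x|M. f x * g x)) \<le> (\<integral>\<^sup>+x. ennreal (cmod (f x)) * ennreal (cmod (g x)) \<partial>M)"
    using integral_norm_bound_ennreal[OF int] by (simp add: norm_mult ennreal_mult)
  then have "(ennreal (cmod (LINT x|M. f x * g x)))\<^sup>2 \<le> (\<integral>\<^sup>+x. ennreal (cmod (f x)) * ennreal (cmod (g x)) \<partial>M)\<^sup>2"
    by (rule power_mono) simp
  with cs show "ennreal ((cmod (LINT x|M. f x * g x))\<^sup>2) \<le> nsq M f * nsq M g"
    by (simp add: ennreal_power)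
qed

lemma tendsto_0_squeeze_ennreal:
  fixes g :: "'a \<Rightarrow> ennreal"
  assumes "(g \<longlongrightarrow> 0) F" "\<And>n. f n \<le> g n"
  shows "(f \<longlongrightarrow> 0) F"
  using assms by (intro tendsto_sandwich[OF _ _ tendsto_const, of 0 f F g]) (auto intro: always_eventually)

lemma ennreal_sq_tendsto_0:
  assumes "((\<lambda>n. ennreal ((cmod (g n))\<^sup>2)) \<longlongrightarrow> 0) F"
  shows "(g \<longlongrightarrow> 0) F"
proof -
  have "((\<lambda>n. (cmod (g n))\<^sup>2) \<longlongrightarrow> 0) F"
    using assms by (subst (asm) ennreal_0[symmetric], subst (asm) tendsto_ennreal_iff) auto
  from tendsto_real_sqrt[OF this] show ?thesis by (simp add: tendsto_norm_zero_iff)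
qed

lemma nsq_inner_tendsto:
  assumes [measurable]: "\<And>n. f n \<in> borel_measurable M" "f' \<in> borel_measurable M" "g \<in> borel_measurable M"
    and fin: "\<And>n. nsq M (f n) < \<infinity>" "nsq M f' < \<infinity>" "nsq M g < \<infinity>"
    and lim: "((\<lambda>n. nsq M (\<lambda>x. f n x - f' x)) \<longlongrightarrow> 0) F"
  shows "((\<lambda>n. LINT x|M. f n x * g x) \<longlongrightarrow> (LINT x|M. f' x * g x)) F"
proof -
  have eq: "(LINT x|M. f n x * g x) - (LINT x|M. f' x * g x) = (LINT x|M. (f n x - f' x) * g x)" for n
    using nsq_integrable_mult(1)[OF assms(1,3) fin(1,3), of n] nsq_integrable_mult(1)[OF assms(2,3) fin(2,3)]
    by (simp add: left_diff_distrib)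
  have "((\<lambda>n. nsq M (\<lambda>x. f n x - f' x) * nsq M g) \<longlongrightarrow> 0) F"
    using tendsto_mult_ennreal[OF lim tendsto_const[of "nsq M g"]] fin(3) by auto
  then have "((\<lambda>n. ennreal ((cmod (LINT x|M. (f n x - f' x) * g x))\<^sup>2)) \<longlongrightarrow> 0) F"
    by (rule tendsto_0_squeeze_ennreal) (intro nsq_integrable_mult nsq_add_finite fin; measurable)
  from ennreal_sq_tendsto_0[OF this] show ?thesis
    unfolding eq[symmetric] by (rule LIM_zero_cancel)
qed

lemma nsq_eq_inner:
  assumes [measurable]: "f \<in> borel_measurable M" and "nsq M f < \<infinity>"
  shows "complex_of_real (enn2real (nsq M f)) = (LINT x|M. f x * cnj (f x))"
proof -
  have "enn2real (nsq M f) = (LINT x|M. (cmod (f x))\<^sup>2)"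
    unfolding nsq_def by (subst integral_eq_nn_integral) auto
  then show ?thesis
    by (simp only: complex_norm_square[symmetric] flip: integral_complex_of_real)
qed

lemma nsq_cnj [simp]: "nsq M (\<lambda>x. cnj (f x)) = nsq M f"
  by (simp add: nsq_def)

text \<open>Continuity of the norm needs a sharp constant, so the factor 2 of
  \<open>nsq_add_le\<close> will not do: the cross term is kept as \<open>I\<close> and is
  controlled by Cauchy-Schwarz.\<close>

lemma nsq_tendsto:
  assumes [measurable]: "\<And>n. f n \<in> borel_measurable M" "f' \<in> borel_measurable M"
    and fin: "nsq M f' < \<infinity>"
    and lim: "((\<lambda>n. nsq M (\<lambda>x. f n x - f' x)) \<longlongrightarrow> 0) F"
  shows "((\<lambda>n. nsq M (f n)) \<longlongrightarrow> nsq M f') F"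
proof -
  define d where "d n x = f n x - f' x" for n x
  have [measurable]: "d n \<in> borel_measurable M" for n unfolding d_def by measurable
  define e where "e n = nsq M (d n)" for n
  define I where "I n = (\<integral>\<^sup>+x. ennreal (cmod (d n x)) * ennreal (cmod (f' x)) \<partial>M)" for n
  have e0: "(e \<longlongrightarrow> 0) F" using lim by (simp add: e_def[abs_def] d_def[abs_def])
  have cs: "(I n)\<^sup>2 \<le> e n * nsq M f'" for n
    using Cauchy_Schwarz_nn_integral[of "\<lambda>x. ennreal (cmod (d n x))" M "\<lambda>x. ennreal (cmod (f' x))"]
    by (simp add: nsq_def ennreal_power I_def e_def)
  have "((\<lambda>n. e n * nsq M f') \<longlongrightarrow> 0) F"
    using tendsto_mult_ennreal[OF e0 tendsto_const[of "nsq M f'"]] fin by auto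
  then have I2: "((\<lambda>n. (I n)\<^sup>2) \<longlongrightarrow> 0) F"
    by (rule tendsto_0_squeeze_ennreal[OF _ cs])
  have I0: "(I \<longlongrightarrow> 0) F"
  proof (rule order_tendstoI)
    fix a :: ennreal assume a: "0 < a"
    then have "0 < a\<^sup>2" by (simp add: power2_eq_square ennreal_zero_less_mult_iff)
    from order_tendstoD(2)[OF I2 this] show "\<forall>\<^sub>F x in F. I x < a"
      by eventually_elim (metis power_mono not_less zero_le)
  qed simp
  have up: "nsq M (f n) \<le> nsq M f' + (e n + 2 * I n)" for n
  proof -
    have "(cmod (f n x))\<^sup>2 \<le> (cmod (f' x))\<^sup>2 + ((cmod (d n x))\<^sup>2 + 2 * (cmod (d n x) * cmod (f' x)))" for x
    proof -
      have "(cmod (f n x))\<^sup>2 \<le> (cmod (f' x) + cmod (d n x))\<^sup>2"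
        using norm_triangle_ineq[of "f' x" "d n x"] by (intro power_mono) (auto simp: d_def)
      then show ?thesis by (simp add: power2_eq_square algebra_simps)
    qed
    then have "nsq M (f n) \<le> (\<integral>\<^sup>+x. ennreal ((cmod (f' x))\<^sup>2 + ((cmod (d n x))\<^sup>2 + 2 * (cmod (d n x) * cmod (f' x)))) \<partial>M)"
      unfolding nsq_def by (intro nn_integral_mono ennreal_leI)
    also have "\<dots> = nsq M f' + (e n + 2 * I n)"
      unfolding nsq_def e_def I_def
      by (simp add: nn_integral_add nn_integral_cmult ennreal_mult)
    finally show ?thesis .
  qed
  have lo: "nsq M f' \<le> nsq M (f n) + (e n + 2 * I n)" for n
  proof -
    have "(cmod (f' x))\<^sup>2 \<le> (cmod (f n x))\<^sup>2 + ((cmod (d n x))\<^sup>2 + 2 * (cmod (d n x) * cmod (f' x)))" for x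
    proof -
      have 1: "cmod (f' x) - cmod (f n x) \<le> cmod (d n x)" "cmod (f n x) \<le> cmod (f' x) + cmod (d n x)"
        using norm_triangle_ineq2[of "f' x" "f n x"] norm_triangle_ineq[of "f' x" "d n x"]
        by (auto simp: d_def norm_minus_commute)
      have "(cmod (f' x) - cmod (f n x)) * (cmod (f' x) + cmod (f n x)) \<le> cmod (d n x) * (cmod (f' x) + cmod (f n x))"
        using 1 by (intro mult_right_mono) auto
      also have "\<dots> \<le> cmod (d n x) * (2 * cmod (f' x) + cmod (d n x))"
        using 1 by (intro mult_left_mono) auto
      finally show ?thesis
        by (simp add: power2_eq_square algebra_simps)
    qed
    then have "nsq M f' \<le> (\<integral>\<^sup>+x. ennreal ((cmod (f n x))\<^sup>2 + ((cmod (d n x))\<^sup>2 + 2 * (cmod (d n x) * cmod (f' x)))) \<partial>M)"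
      unfolding nsq_def by (intro nn_integral_mono ennreal_leI)
    also have "\<dots> = nsq M (f n) + (e n + 2 * I n)"
      unfolding nsq_def e_def I_def
      by (simp add: nn_integral_add nn_integral_cmult ennreal_mult)
    finally show ?thesis .
  qed
  have z: "((\<lambda>n. e n + 2 * I n) \<longlongrightarrow> 0) F"
    using tendsto_add[OF e0 tendsto_mult_ennreal[OF tendsto_const[of 2] I0]] by simp
  show ?thesis
  proof (rule tendsto_sandwich)
    show "\<forall>\<^sub>F n in F. nsq M f' - (e n + 2 * I n) \<le> nsq M (f n)"
      using lo fin by (intro always_eventually allI) (auto simp: ennreal_minus_le_iff add.commute)
    show "\<forall>\<^sub>F n in F. nsq M (f n) \<le> nsq M f' + (e n + 2 * I n)"
      using up by (intro always_eventually allI)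
    show "((\<lambda>n. nsq M f' + (e n + 2 * I n)) \<longlongrightarrow> nsq M f') F"
      using tendsto_add[OF tendsto_const z, of "nsq M f'"] by simp
    show "((\<lambda>n. nsq M f' - (e n + 2 * I n)) \<longlongrightarrow> nsq M f') F"
      using tendsto_diff_ennreal[OF tendsto_const z, of "nsq M f'"] fin by simp
  qed
qed

lemma nsq_Fatou:
  assumes [measurable]: "\<And>n. f n \<in> borel_measurable M"
    and lim: "AE x in M. (\<lambda>n. f n x) \<longlonglongrightarrow> g x"
    and le: "\<And>n. nsq M (f n) \<le> B"
  shows "nsq M g \<le> B"
proof -
  have "nsq M g = (\<integral>\<^sup>+x. liminf (\<lambda>n. ennreal ((cmod (f n x))\<^sup>2)) \<partial>M)"
    unfolding nsq_def
  proof (intro nn_integral_cong_AE)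
    show "AE x in M. ennreal ((cmod (g x))\<^sup>2) = liminf (\<lambda>n. ennreal ((cmod (f n x))\<^sup>2))"
      using lim
    proof eventually_elim
      fix x assume "(\<lambda>n. f n x) \<longlonglongrightarrow> g x"
      then have "(\<lambda>n. ennreal ((cmod (f n x))\<^sup>2)) \<longlonglongrightarrow> ennreal ((cmod (g x))\<^sup>2)"
        by (intro tendsto_intros tendsto_ennrealI)
      from lim_imp_Liminf[OF _ this] show "ennreal ((cmod (g x))\<^sup>2) = liminf (\<lambda>n. ennreal ((cmod (f n x))\<^sup>2))"
        by simp
    qed
  qed
  also have "\<dots> \<le> liminf (\<lambda>n. nsq M (f n))"
    unfolding nsq_def by (intro nn_integral_liminf) auto
  also have "\<dots> \<le> B"
    using le by (intro order_trans[OF Liminf_le_Limsup Limsup_bounded]) auto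
  finally show ?thesis .
qed

text \<open>Riesz-Fischer: a rapidly converging subsequence converges almost everywhere, and Fatou's
  lemma passes the Cauchy estimate of the whole sequence to its limit.\<close>

lemma nsq_complete:
  assumes [measurable]: "\<And>n. f n \<in> borel_measurable M"
    and cau: "\<And>e. e > 0 \<Longrightarrow> \<exists>K. \<forall>m\<ge>K. \<forall>n\<ge>K. nsq M (\<lambda>x. f m x - f n x) \<le> ennreal e"
  obtains g where "g \<in> borel_measurable M" "(\<lambda>n. nsq M (\<lambda>x. f n x - g x)) \<longlonglongrightarrow> 0"
proof -
  have "\<forall>k. \<exists>K. \<forall>m\<ge>K. \<forall>n\<ge>K. nsq M (\<lambda>x. f m x - f n x) \<le> ennreal ((1/8)^k)"
    using cau by simp
  then obtain K where K: "\<And>k m n. m \<ge> K k \<Longrightarrow> n \<ge> K k \<Longrightarrow> nsq M (\<lambda>x. f m x - f n x) \<le> ennreal ((1/8)^k)"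
    by metis
  define r where "r k = Max (K ` {..k}) + k" for k
  have rK: "r k \<ge> K j" if "j \<le> k" for j k
    unfolding r_def using that by (intro trans_le_add1 Max_ge) auto
  have rk: "r k \<ge> k" for k by (simp add: r_def)
  define h where "h k = f (r k)" for k
  have [measurable]: "h k \<in> borel_measurable M" for k by (simp add: h_def)
  have h: "nsq M (\<lambda>x. h (Suc k) x - h k x) \<le> ennreal ((1/8)^k)" for k
    unfolding h_def by (intro K rK) auto
  \<comment> \<open>The weight 4^k turns finiteness of \<open>S x\<close> into steps of size at most
    a constant times (1/2)^k, and against the bound (1/8)^k it still leaves a convergent series of
    integrals.\<close>
  define S where "S x = (\<Sum>k. ennreal (4^k) * ennreal ((cmod (h (Suc k) x - h k x))\<^sup>2))" for x
  have "(\<integral>\<^sup>+x. S x \<partial>M) = (\<Sum>k. ennreal (4^k) * nsq M (\<lambda>x. h (Suc k) x - h k x))"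
    unfolding S_def nsq_def by (subst nn_integral_suminf) (auto simp: nn_integral_cmult)
  also have "\<dots> \<le> (\<Sum>k. ennreal ((1/2)^k))"
  proof (intro suminf_le summableI)
    fix k :: nat
    have "ennreal (4^k) * nsq M (\<lambda>x. h (Suc k) x - h k x) \<le> ennreal (4^k) * ennreal ((1/8)^k)"
      by (intro mult_left_mono h) simp
    also have "\<dots> = ennreal ((1/2)^k)"
      by (subst ennreal_mult[symmetric]) (simp_all add: power_mult_distrib[symmetric])
    finally show "ennreal (4^k) * nsq M (\<lambda>x. h (Suc k) x - h k x) \<le> ennreal ((1/2)^k)" .
  qed
  also have "\<dots> < \<infinity>" by (subst suminf_ennreal2) (auto simp: summable_geometric)
  finally have "AE x in M. S x \<noteq> \<infinity>"
    by (intro nn_integral_PInf_AE) (auto simp: S_def)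
  then have AEc: "AE x in M. convergent (\<lambda>k. h k x)"
  proof eventually_elim
    fix x assume Sx: "S x \<noteq> \<infinity>"
    have le: "ennreal (4^k) * ennreal ((cmod (h (Suc k) x - h k x))\<^sup>2) \<le> ennreal (enn2real (S x))" for k
      using Sx sum_le_suminf[OF summableI, of "{k}" "\<lambda>k. ennreal (4^k) * ennreal ((cmod (h (Suc k) x - h k x))\<^sup>2)"]
      by (simp add: S_def top.not_eq_extremum)
    have nle: "norm (h (Suc k) x - h k x) \<le> sqrt (enn2real (S x)) * (1/2)^k" for k
    proof -
      have "4^k * (cmod (h (Suc k) x - h k x))\<^sup>2 \<le> enn2real (S x)"
        using le[of k] by (subst (asm) ennreal_mult[symmetric]) auto
      then have "(cmod (h (Suc k) x - h k x))\<^sup>2 \<le> enn2real (S x) * (1/4)^k"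
        by (simp add: field_simps)
      moreover have "(1/4::real)^k = ((1/2)^k)\<^sup>2"
        by (simp add: power2_eq_square flip: power_mult_distrib)
      ultimately have "(cmod (h (Suc k) x - h k x))\<^sup>2 \<le> (sqrt (enn2real (S x)) * (1/2)^k)\<^sup>2"
        by (simp add: power_mult_distrib)
      then show ?thesis
        by (rule power2_le_imp_le) simp
    qed
    have "summable (\<lambda>k. h (Suc k) x - h k x)"
      by (rule summable_comparison_test'[OF summable_mult[OF summable_geometric] nle]) simp
    then have "convergent (\<lambda>n. \<Sum>k<n. h (Suc k) x - h k x)"
      by (simp add: summable_iff_convergent)
    then have "convergent (\<lambda>n. (h n x - h 0 x) + h 0 x)"
      unfolding sum_lessThan_telescope[of "\<lambda>k. h k x"] by (rule convergent_add[OF _ convergent_const])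
    then show "convergent (\<lambda>k. h k x)" by simp
  qed
  define g where "g x = lim (\<lambda>k. h k x)" for x
  have gm [measurable]: "g \<in> borel_measurable M" unfolding g_def by measurable
  have glim: "AE x in M. (\<lambda>k. h k x) \<longlonglongrightarrow> g x"
    using AEc by eventually_elim (simp add: g_def convergent_LIMSEQ_iff)
  have bd: "nsq M (\<lambda>x. f m x - g x) \<le> ennreal ((1/8)^k)" if "m \<ge> K k" for m k
  proof (rule nsq_Fatou[of "\<lambda>j x. f m x - h (j + k) x"])
    show "AE x in M. (\<lambda>n. f m x - h (n + k) x) \<longlonglongrightarrow> f m x - g x"
      using glim by eventually_elim (intro tendsto_intros LIMSEQ_ignore_initial_segment)
    show "nsq M (\<lambda>x. f m x - h (n + k) x) \<le> ennreal ((1/8)^k)" for n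
      unfolding h_def by (intro K that rK) auto
  qed auto
  have "(\<lambda>n. nsq M (\<lambda>x. f n x - g x)) \<longlonglongrightarrow> 0"
  proof (rule order_tendstoI)
    fix a :: ennreal assume a: "0 < a"
    have "(\<lambda>k. ennreal ((1/8)^k)) \<longlonglongrightarrow> ennreal 0"
      by (intro tendsto_ennrealI LIMSEQ_power_zero) simp
    from order_tendstoD(2)[OF this, of a] a obtain k where k: "ennreal ((1/8)^k) < a"
      by (auto simp: eventually_sequentially)
    show "\<forall>\<^sub>F n in sequentially. nsq M (\<lambda>x. f n x - g x) < a"
      using eventually_ge_at_top[of "K k"] by eventually_elim (use bd k in \<open>auto intro: order.strict_trans1\<close>)
  qed simp
  with gm show thesis by (rule that)
qed

section \<open>The Plancherel theorem\<close>

lemma borel_measurable_cis [measurable]: "cis \<in> borel_measurable borel"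
  by (intro borel_measurable_continuous_onI continuous_intros)

lemma borel_measurable_cnj [measurable]: "cnj \<in> borel_measurable borel"
  by (intro borel_measurable_continuous_onI continuous_intros)

text \<open>This is the characteristic function of the standard normal law, freed of the normalising
  factor 1 / sqrt (2 pi) of its density.\<close>

lemma std_normal_ft:
  fixes t :: real
  shows "integrable lborel (\<lambda>x. cis (t * x) * of_real (exp (- x\<^sup>2 / 2)))"
    and "(LINT x|lborel. cis (t * x) * of_real (exp (- x\<^sup>2 / 2))) = of_real (sqrt (2 * pi) * exp (- t\<^sup>2 / 2))"
proof -
  have dens: "std_normal_density x *\<^sub>R z = of_real (1 / sqrt (2 * pi)) * (z * of_real (exp (- x\<^sup>2 / 2)))" for x and z :: complex
    by (simp add: std_normal_density_def scaleR_conv_of_real mult_ac)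
  interpret real_distribution std_normal_distribution by (rule real_dist_normal_dist)
  have ip: "integrable std_normal_distribution (\<lambda>x. cis (t * x))"
    by (intro integrable_const_bound[of _ 1]) auto
  then have "integrable lborel (\<lambda>x. std_normal_density x *\<^sub>R cis (t * x))"
    by (subst (asm) integrable_density) auto
  then show "integrable lborel (\<lambda>x. cis (t * x) * of_real (exp (- x\<^sup>2 / 2)))"
    using integrable_mult_right[of "of_real (sqrt (2 * pi))" lborel "\<lambda>x. std_normal_density x *\<^sub>R cis (t * x)"]
    unfolding dens by (simp flip: of_real_mult mult.assoc)
  have "of_real (exp (- t\<^sup>2 / 2)) = (LINT x|std_normal_distribution. cis (t * x))"
    using fun_cong[OF char_std_normal_distribution, of t] by (simp add: char_def cis_conv_exp)
  also have "\<dots> = (LINT x|lborel. std_normal_density x *\<^sub>R cis (t * x))"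
    by (subst integral_density) auto
  also have "\<dots> = of_real (1 / sqrt (2 * pi)) * (LINT x|lborel. cis (t * x) * of_real (exp (- x\<^sup>2 / 2)))"
    unfolding dens by simp
  finally show "(LINT x|lborel. cis (t * x) * of_real (exp (- x\<^sup>2 / 2))) = of_real (sqrt (2 * pi) * exp (- t\<^sup>2 / 2))"
    by (simp add: field_simps)
qed

lemma cis_sum: "finite A \<Longrightarrow> cis (sum f A) = (\<Prod>i\<in>A. cis (f i))"
  by (induction A rule: finite_induct) (auto simp: cis_mult[symmetric])

text \<open>The integrand is a product over the coordinates, so Lebesgue measure is written as a
  product of one-dimensional ones and \<open>std_normal_ft\<close> is applied to every
  factor.\<close>

lemma gaussian_ft:
  fixes x :: "'a::euclidean_space"
  shows "integrable lborel (\<lambda>s. cis (x \<bullet> s) * of_real (exp (- (norm s)\<^sup>2 / 2)))" (is ?int)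
    and "(LINT s|lborel. cis (x \<bullet> s) * of_real (exp (- (norm s)\<^sup>2 / 2))) =
           of_real (sqrt (2 * pi) ^ DIM('a) * exp (- (norm x)\<^sup>2 / 2))" (is ?eq)
proof -
  interpret product_sigma_finite "\<lambda>_. lborel :: real measure" ..
  let ?s = "\<lambda>f. (\<Sum>b\<in>Basis. f b *\<^sub>R b) :: 'a"
  have nrm: "(norm y)\<^sup>2 = (\<Sum>b\<in>Basis. (y \<bullet> b)\<^sup>2)" for y :: 'a
    using euclidean_inner[of y y] by (simp add: dot_square_norm power2_eq_square)
  have eq: "cis (x \<bullet> ?s f) * of_real (exp (- (norm (?s f))\<^sup>2 / 2)) =
      (\<Prod>b\<in>Basis. cis ((x \<bullet> b) * f b) * of_real (exp (- (f b)\<^sup>2 / 2)))" for f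
    unfolding nrm
    by (simp add: inner_sum_right prod.distrib cis_sum exp_sum sum_negf[symmetric] sum_divide_distrib mult.commute)
  let ?P = "Pi\<^sub>M Basis (\<lambda>_. lborel :: real measure)"
  have m: "?s \<in> measurable (Pi\<^sub>M Basis (\<lambda>_. lborel :: real measure)) borel"
    by measurable
  have int: "integrable (Pi\<^sub>M Basis (\<lambda>_. lborel :: real measure))
      (\<lambda>f. \<Prod>b\<in>Basis. cis ((x \<bullet> b) * f b) * of_real (exp (- (f b)\<^sup>2 / 2)))"
    by (rule product_integrable_prod) (use std_normal_ft(1) in auto)
  show ?int
    by (subst lborel_eq, subst integrable_distr_eq[OF m]) (use int in \<open>simp_all only: eq, auto\<close>)
  have "(LINT s|lborel. cis (x \<bullet> s) * of_real (exp (- (norm s)\<^sup>2 / 2))) =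
      (LINT f|?P. (\<Prod>b\<in>Basis. cis ((x \<bullet> b) * f b) * of_real (exp (- (f b)\<^sup>2 / 2))))"
    by (subst lborel_eq, subst integral_distr[OF m]) (simp_all only: eq, auto)
  also have "\<dots> = (\<Prod>b\<in>Basis. of_real (sqrt (2 * pi) * exp (- (x \<bullet> b)\<^sup>2 / 2)))"
    by (subst product_integral_prod) (use std_normal_ft in auto)
  also have "\<dots> = of_real (sqrt (2 * pi) ^ DIM('a) * exp (- (norm x)\<^sup>2 / 2))"
    by (simp add: nrm prod.distrib exp_sum sum_negf[symmetric] sum_divide_distrib)
  finally show ?eq .
qed

lemma integrable_scaleR_iff:
  fixes f :: "'a \<Rightarrow> 'b::{banach, second_countable_topology}"
  assumes "k \<noteq> 0"
  shows "integrable M (\<lambda>x. k *\<^sub>R f x) \<longleftrightarrow> integrable M f"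
proof
  assume "integrable M (\<lambda>x. k *\<^sub>R f x)"
  then have "integrable M (\<lambda>x. inverse k *\<^sub>R (k *\<^sub>R f x))" by (rule integrable_scaleR_right)
  then show "integrable M f" using assms by simp
qed (rule integrable_scaleR_right)

lemma lborel_integral_affine:
  fixes f :: "'a::euclidean_space \<Rightarrow> 'b::{banach, second_countable_topology}"
  assumes [measurable]: "f \<in> borel_measurable borel" and c: "c \<noteq> 0"
  shows "(LINT y|lborel. f y) = \<bar>c\<bar> ^ DIM('a) *\<^sub>R (LINT x|lborel. f (t + c *\<^sub>R x))"
    and "integrable lborel f \<longleftrightarrow> integrable lborel (\<lambda>x. f (t + c *\<^sub>R x))"
proof -
  have "(LINT y|lborel. f y) = (LINT y|density (distr lborel borel (\<lambda>x. t + c *\<^sub>R x)) (\<lambda>_. \<bar>c\<bar>^DIM('a)). f y)"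
    using lborel_affine[OF c, of t] by simp
  also have "\<dots> = \<bar>c\<bar> ^ DIM('a) *\<^sub>R (LINT x|lborel. f (t + c *\<^sub>R x))"
    by (subst integral_density) (auto simp: integral_distr)
  finally show "(LINT y|lborel. f y) = \<bar>c\<bar> ^ DIM('a) *\<^sub>R (LINT x|lborel. f (t + c *\<^sub>R x))" .
  have "integrable lborel f \<longleftrightarrow> integrable (density (distr lborel borel (\<lambda>x. t + c *\<^sub>R x)) (\<lambda>_. \<bar>c\<bar>^DIM('a))) f"
    using lborel_affine[OF c, of t] by simp
  also have "\<dots> \<longleftrightarrow> integrable lborel (\<lambda>x. f (t + c *\<^sub>R x))"
    using c by (subst integrable_density) (use c in \<open>auto simp: integrable_distr_eq integrable_scaleR_iff\<close>)
  finally show "integrable lborel f \<longleftrightarrow> integrable lborel (\<lambda>x. f (t + c *\<^sub>R x))" .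
qed

text \<open>The substitution \<eta> = r s. As r grows the weight flattens and its transform
  concentrates at x = 0.\<close>

lemma gaussian_ft_scaled:
  fixes x :: "'a::euclidean_space"
  assumes r: "r > 0"
  shows "integrable lborel (\<lambda>\<eta>. cis (x \<bullet> \<eta>) * of_real (exp (- (norm \<eta>)\<^sup>2 / (2 * r\<^sup>2))))" (is ?int)
    and "(LINT \<eta>|lborel. cis (x \<bullet> \<eta>) * of_real (exp (- (norm \<eta>)\<^sup>2 / (2 * r\<^sup>2)))) =
           of_real ((r * sqrt (2 * pi)) ^ DIM('a) * exp (- r\<^sup>2 * (norm x)\<^sup>2 / 2))" (is ?eq)
proof -
  let ?f = "\<lambda>\<eta>. cis (x \<bullet> \<eta>) * of_real (exp (- (norm \<eta>)\<^sup>2 / (2 * r\<^sup>2)))"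
  have [measurable]: "?f \<in> borel_measurable borel" by measurable
  have eq: "?f (0 + r *\<^sub>R s) = cis ((r *\<^sub>R x) \<bullet> s) * of_real (exp (- (norm s)\<^sup>2 / 2))" for s
    using r by (simp add: power_mult_distrib field_simps)
  show ?int
    using gaussian_ft(1)[of "r *\<^sub>R x"] r
    by (subst lborel_integral_affine(2)[where c = r and t = 0]) (simp_all only: eq, auto)
  show ?eq
    using gaussian_ft(2)[of "r *\<^sub>R x"] r
    by (subst lborel_integral_affine(1)[where c = r and t = 0])
       (simp_all only: eq, auto simp: power_mult_distrib scaleR_conv_of_real)
qed

text \<open>The form in which the integrability hypothesis of Fubini's theorem is checked below:
  characters have modulus 1, so the kernels are dominated by tensor products of integrable
  functions.\<close>

lemma (in pair_sigma_finite) integrable_product_bound: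
  fixes w g :: "_ \<Rightarrow> complex" and k :: "_ \<Rightarrow> complex"
  assumes w: "integrable M1 w" and g: "integrable M2 g"
    and [measurable]: "k \<in> borel_measurable (M1 \<Otimes>\<^sub>M M2)"
    and le: "\<And>a b. norm (k (a, b)) \<le> norm (w a) * norm (g b)"
  shows "integrable (M1 \<Otimes>\<^sub>M M2) k"
proof (rule integrableI_bounded)
  note [measurable] = borel_measurable_integrable[OF w] borel_measurable_integrable[OF g]
  have "(\<integral>\<^sup>+p. ennreal (norm (k p)) \<partial>(M1 \<Otimes>\<^sub>M M2)) = (\<integral>\<^sup>+a. \<integral>\<^sup>+b. ennreal (norm (k (a, b))) \<partial>M2 \<partial>M1)"
    by (subst M2.nn_integral_fst[symmetric]) auto
  also have "\<dots> \<le> (\<integral>\<^sup>+a. \<integral>\<^sup>+b. ennreal (norm (w a)) * ennreal (norm (g b)) \<partial>M2 \<partial>M1)"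
    using le by (intro nn_integral_mono) (simp add: ennreal_mult[symmetric])
  also have "\<dots> = (\<integral>\<^sup>+a. ennreal (norm (w a)) \<partial>M1) * (\<integral>\<^sup>+b. ennreal (norm (g b)) \<partial>M2)"
    by (simp add: nn_integral_cmult nn_integral_multc)
  also have "\<dots> < \<infinity>"
    using w g by (auto simp: integrable_iff_bounded ennreal_mult_less_top)
  finally show "(\<integral>\<^sup>+p. ennreal (norm (k p)) \<partial>(M1 \<Otimes>\<^sub>M M2)) < \<infinity>" .
qed simp

text \<open>No power of 2 pi is put in front, as in \<open>ft_on\<close>; the Plancherel constant is
  therefore (2 pi)^DIM.\<close>

definition ftr :: "('a::euclidean_space \<Rightarrow> complex) \<Rightarrow> 'a \<Rightarrow> complex" where
  "ftr f \<eta> = (LINT x|lborel. cis (- (x \<bullet> \<eta>)) * f x)"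

lemma borel_measurable_ftr [measurable]:
  assumes [measurable]: "f \<in> borel_measurable borel"
  shows "ftr f \<in> borel_measurable borel"
  unfolding ftr_def by measurable

lemma integrable_cis_mult:
  fixes f :: "'a::euclidean_space \<Rightarrow> complex"
  assumes "integrable lborel f"
  shows "integrable lborel (\<lambda>x. cis (x \<bullet> \<eta>) * f x)" "integrable lborel (\<lambda>x. cis (- (x \<bullet> \<eta>)) * f x)"
  using borel_measurable_integrable[OF assms]
  by (auto intro!: Bochner_Integration.integrable_bound[OF assms] simp: norm_mult)

lemma ftr_bound:
  assumes "integrable lborel f"
  shows "cmod (ftr f \<eta>) \<le> (LINT x|lborel. cmod (f x))"
  unfolding ftr_def using integral_norm_bound[of lborel "\<lambda>x. cis (- (x \<bullet> \<eta>)) * f x"]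
  by (simp add: norm_mult)

text \<open>Inserting the Gaussian weight makes Fubini applicable to the square of the Fourier integral.\<close>

lemma ftr_gaussian_regularisation:
  fixes g :: "'a::euclidean_space \<Rightarrow> complex"
  assumes g: "integrable lborel g" and [measurable]: "g \<in> borel_measurable borel" and r: "r > 0"
  shows "(LINT \<eta>|lborel. of_real (exp (- (norm \<eta>)\<^sup>2 / (2 * r\<^sup>2))) * (ftr g \<eta> * cnj (ftr g \<eta>))) =
    of_real (sqrt (2 * pi) ^ DIM('a)) *
      (LINT x|lborel. g x * (LINT s|lborel. cnj (g (x + s /\<^sub>R r)) * of_real (exp (- (norm s)\<^sup>2 / 2))))"
proof -
  define w where "w \<eta> = complex_of_real (exp (- (norm \<eta>)\<^sup>2 / (2 * r\<^sup>2)))" for \<eta> :: 'a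
  have [measurable]: "w \<in> borel_measurable borel" unfolding w_def by measurable
  have w: "integrable lborel w" using gaussian_ft_scaled(1)[OF r, of 0] by (simp add: w_def[abs_def])
  define B where "B \<eta> = cnj (ftr g \<eta>)" for \<eta>
  have [measurable]: "B \<in> borel_measurable borel" unfolding B_def by measurable
  have B: "B \<eta> = (LINT y|lborel. cis (y \<bullet> \<eta>) * cnj (g y))" for \<eta>
    unfolding B_def ftr_def by (subst Bochner_Integration.integral_cnj[symmetric]) (simp add: cis_cnj)
  have gc: "integrable lborel (\<lambda>y. cnj (g y))" using g by simp
  define m where "m = (LINT x|lborel. cmod (g x))"
  have m0: "m \<ge> 0" unfolding m_def by simp
  have Bb: "cmod (B \<eta>) \<le> m" for \<eta> using ftr_bound[OF g] by (simp add: B_def m_def)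
  have wB: "integrable lborel (\<lambda>\<eta>. w \<eta> * of_real m)" using w by simp
  have inner: "(LINT \<eta>|lborel. w \<eta> * cis (- (x \<bullet> \<eta>)) * B \<eta>) =
      of_real (sqrt (2 * pi) ^ DIM('a)) * (LINT s|lborel. cnj (g (x + s /\<^sub>R r)) * of_real (exp (- (norm s)\<^sup>2 / 2)))" for x
  proof -
    have "(LINT \<eta>|lborel. w \<eta> * cis (- (x \<bullet> \<eta>)) * B \<eta>) =
        (LINT \<eta>|lborel. LINT y|lborel. w \<eta> * cis (- (x \<bullet> \<eta>)) * (cis (y \<bullet> \<eta>) * cnj (g y)))"
      unfolding B using integrable_cis_mult(1)[OF gc] by simp
    also have "\<dots> = (LINT y|lborel. LINT \<eta>|lborel. w \<eta> * cis (- (x \<bullet> \<eta>)) * (cis (y \<bullet> \<eta>) * cnj (g y)))"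
      by (rule lborel_pair.Fubini_integral[symmetric], subst case_prod_unfold,
          rule lborel_pair.integrable_product_bound[OF w gc]) (auto simp: norm_mult)
    also have "\<dots> = (LINT y|lborel. cnj (g y) * of_real ((r * sqrt (2 * pi)) ^ DIM('a) * exp (- r\<^sup>2 * (norm (y - x))\<^sup>2 / 2)))"
    proof (rule Bochner_Integration.integral_cong[OF refl])
      fix y
      have e: "w \<eta> * cis (- (x \<bullet> \<eta>)) * (cis (y \<bullet> \<eta>) * cnj (g y)) = cnj (g y) * (cis ((y - x) \<bullet> \<eta>) * w \<eta>)" for \<eta>
      proof -
        have "cis ((y - x) \<bullet> \<eta>) = cis (- (x \<bullet> \<eta>)) * cis (y \<bullet> \<eta>)"
          by (simp add: cis_mult inner_diff_left)
        then show ?thesis by simp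
      qed
      show "(LINT \<eta>|lborel. w \<eta> * cis (- (x \<bullet> \<eta>)) * (cis (y \<bullet> \<eta>) * cnj (g y))) =
          cnj (g y) * of_real ((r * sqrt (2 * pi)) ^ DIM('a) * exp (- r\<^sup>2 * (norm (y - x))\<^sup>2 / 2))"
        unfolding e using gaussian_ft_scaled[OF r, of "y - x"] by (simp add: w_def)
    qed
    \<comment> \<open>Substituting y = x + s / r moves the scale r from the Gaussian into the
      argument of g; the powers of r cancel and a fixed Gaussian remains, so that the limit of large
      r can be taken.\<close>
    also have "\<dots> = \<bar>inverse r\<bar> ^ DIM('a) *\<^sub>R (LINT s|lborel. cnj (g (x + inverse r *\<^sub>R s)) *
        of_real ((r * sqrt (2 * pi)) ^ DIM('a) * exp (- r\<^sup>2 * (norm (x + inverse r *\<^sub>R s - x))\<^sup>2 / 2)))"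
      using r by (intro lborel_integral_affine) auto
    also have "\<dots> = \<bar>inverse r\<bar> ^ DIM('a) *\<^sub>R (LINT s|lborel. of_real ((r * sqrt (2 * pi)) ^ DIM('a)) *
        (cnj (g (x + s /\<^sub>R r)) * of_real (exp (- (norm s)\<^sup>2 / 2))))"
      using r by (intro arg_cong2[where f = scaleR] Bochner_Integration.integral_cong)
         (auto simp: power_mult_distrib field_simps)
    also have "\<dots> = of_real (\<bar>inverse r\<bar> ^ DIM('a) * (r * sqrt (2 * pi)) ^ DIM('a)) *
        (LINT s|lborel. cnj (g (x + s /\<^sub>R r)) * of_real (exp (- (norm s)\<^sup>2 / 2)))"
      by (simp add: scaleR_conv_of_real)
    also have "\<bar>inverse r\<bar> ^ DIM('a) * (r * sqrt (2 * pi)) ^ DIM('a) = sqrt (2 * pi) ^ DIM('a)"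
      using r by (simp add: power_mult_distrib[symmetric] mult.assoc[symmetric])
    finally show ?thesis .
  qed
  have "(LINT \<eta>|lborel. w \<eta> * (ftr g \<eta> * cnj (ftr g \<eta>))) =
      (LINT \<eta>|lborel. LINT x|lborel. g x * (w \<eta> * cis (- (x \<bullet> \<eta>)) * B \<eta>))"
  proof (rule Bochner_Integration.integral_cong[OF refl])
    fix \<eta>
    have "w \<eta> * (ftr g \<eta> * cnj (ftr g \<eta>)) = (w \<eta> * B \<eta>) * (LINT x|lborel. cis (- (x \<bullet> \<eta>)) * g x)"
      by (simp add: B_def ftr_def)
    also have "\<dots> = (LINT x|lborel. (w \<eta> * B \<eta>) * (cis (- (x \<bullet> \<eta>)) * g x))"
      using integrable_cis_mult(2)[OF g] by simp
    also have "\<dots> = (LINT x|lborel. g x * (w \<eta> * cis (- (x \<bullet> \<eta>)) * B \<eta>))"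
      by (simp add: mult_ac)
    finally show "w \<eta> * (ftr g \<eta> * cnj (ftr g \<eta>)) = (LINT x|lborel. g x * (w \<eta> * cis (- (x \<bullet> \<eta>)) * B \<eta>))" .
  qed
  also have "\<dots> = (LINT x|lborel. LINT \<eta>|lborel. g x * (w \<eta> * cis (- (x \<bullet> \<eta>)) * B \<eta>))"
    using Bb by (intro lborel_pair.Fubini_integral[symmetric], subst case_prod_unfold,
        intro lborel_pair.integrable_product_bound[OF wB g])
       (auto simp: norm_mult m0 mult_ac intro!: mult_right_mono)
  also have "\<dots> = (LINT x|lborel. of_real (sqrt (2 * pi) ^ DIM('a)) *
      (g x * (LINT s|lborel. cnj (g (x + s /\<^sub>R r)) * of_real (exp (- (norm s)\<^sup>2 / 2)))))"
    by (simp only: integral_mult_right_zero inner mult.left_commute)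
  finally show ?thesis by (simp add: w_def)
qed

text \<open>In \<open>ftr_gaussian_regularisation\<close> let r tend to infinity: the averages of g
  over x + s / r converge to g x by continuity, with a majorant because g is bounded and integrable,
  and the Gaussian weight on the other side increases to 1.\<close>

lemma plancherel_continuous:
  fixes g :: "'a::euclidean_space \<Rightarrow> complex"
  assumes cont: "continuous_on UNIV g" and supp: "\<And>x. norm x > R \<Longrightarrow> g x = 0"
  shows "nsq lborel (ftr g) = ennreal ((2 * pi) ^ DIM('a)) * nsq lborel g"
proof -
  have [measurable]: "g \<in> borel_measurable borel" using cont by (rule borel_measurable_continuous_onI)
  have "bounded (g ` cball 0 R)"
    by (intro compact_imp_bounded compact_continuous_image continuous_on_subset[OF cont]) auto
  then obtain M0 where M0: "\<And>x. x \<in> cball 0 R \<Longrightarrow> cmod (g x) \<le> M0" unfolding bounded_iff by blast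
  define M where "M = max 0 M0"
  have M: "cmod (g x) \<le> M" "M \<ge> 0" for x
  proof -
    show "M \<ge> 0" by (simp add: M_def)
    show "cmod (g x) \<le> M"
    proof (cases "norm x > R")
      case True then show ?thesis using supp[of x] by (simp add: M_def)
    next
      case False then show ?thesis using M0[of x] by (simp add: M_def)
    qed
  qed
  have gM: "g = (\<lambda>x. indicator (cball 0 R) x *\<^sub>R g x)"
    using supp by (auto simp: fun_eq_iff indicator_def dist_norm)
  have g: "integrable lborel g"
    by (subst gM, rule integrableI_bounded_set_indicator[of _ _ _ M])
       (use emeasure_bounded_finite[of "cball 0 R :: 'a set"] in \<open>auto intro: M(1)\<close>)
  have g2: "integrable lborel (\<lambda>x. g x * cnj (g x))"
    by (rule Bochner_Integration.integrable_bound[OF integrable_mult_right[OF g, of "of_real M"]])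
       (use M in \<open>auto simp: norm_mult intro!: mult_right_mono\<close>)
  have nsqg: "nsq lborel g = ennreal (LINT x|lborel. (cmod (g x))\<^sup>2)"
    and g2': "integrable lborel (\<lambda>x. (cmod (g x))\<^sup>2)"
  proof -
    show i: "integrable lborel (\<lambda>x. (cmod (g x))\<^sup>2)"
      using integrable_norm[OF g2] by (simp only: norm_mult complex_mod_cnj power2_eq_square)
    show "nsq lborel g = ennreal (LINT x|lborel. (cmod (g x))\<^sup>2)"
      unfolding nsq_def by (rule nn_integral_eq_integral[OF i]) auto
  qed
  \<comment> \<open>One factor c stems from the regularisation identity and another from the total
    mass of the Gaussian e; together they give (2 pi)^DIM.\<close>
  define c where "c = sqrt (2 * pi) ^ DIM('a)"
  have c0: "c > 0" by (simp add: c_def)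
  have "c * c = (sqrt (2 * pi) * sqrt (2 * pi)) ^ DIM('a)"
    by (simp only: c_def power_mult_distrib)
  also have "sqrt (2 * pi) * sqrt (2 * pi) = 2 * pi" by (rule real_sqrt_mult_self[THEN trans]) simp
  finally have c2: "c * c = (2 * pi) ^ DIM('a)" .
  define e where "e s = complex_of_real (exp (- (norm s)\<^sup>2 / 2))" for s :: 'a
  have [measurable]: "e \<in> borel_measurable borel" unfolding e_def by measurable
  have eint: "integrable lborel e" and eval: "(LINT s|lborel. e s) = of_real c"
    using gaussian_ft[of "0::'a"] by (simp_all add: e_def[abs_def] c_def)
  define K where "K n x = (LINT s|lborel. cnj (g (x + s /\<^sub>R real (Suc n))) * e s)" for n x
  have [measurable]: "K n \<in> borel_measurable borel" for n unfolding K_def by measurable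
  define w where "w n \<eta> = exp (- (norm \<eta>)\<^sup>2 / (2 * (real (Suc n))\<^sup>2))" for n and \<eta> :: 'a
  have [measurable]: "w n \<in> borel_measurable borel" for n unfolding w_def by measurable
  have Klim: "(\<lambda>n. K n x) \<longlonglongrightarrow> of_real c * cnj (g x)" for x
  proof -
    have "(\<lambda>n. K n x) \<longlonglongrightarrow> (LINT s|lborel. cnj (g x) * e s)"
      unfolding K_def
    proof (rule integral_dominated_convergence[where w = "\<lambda>s. M * cmod (e s)"])
      show "AE s in lborel. (\<lambda>n. cnj (g (x + s /\<^sub>R real (Suc n))) * e s) \<longlonglongrightarrow> cnj (g x) * e s"
      proof (intro AE_I2 tendsto_intros)
        fix s :: 'a
        have "(\<lambda>n. x + s /\<^sub>R real (Suc n)) \<longlonglongrightarrow> x + 0 *\<^sub>R s"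
          by (intro tendsto_intros LIMSEQ_inverse_real_of_nat)
        then have "(\<lambda>n. g (x + s /\<^sub>R real (Suc n))) \<longlonglongrightarrow> g (x + 0 *\<^sub>R s)"
          by (intro continuous_on_tendsto_compose[OF cont]) auto
        then show "(\<lambda>n. g (x + s /\<^sub>R real (Suc n))) \<longlonglongrightarrow> g x" by simp
      qed
    qed (use eint in \<open>auto simp: norm_mult M intro!: mult_right_mono\<close>)
    then show ?thesis using eint by (simp add: eval mult.commute)
  qed
  have Kb: "cmod (K n x) \<le> M * c" for n x
  proof -
    have "cmod (K n x) \<le> (LINT s|lborel. M * exp (- (norm (s::'a))\<^sup>2 / 2))"
      unfolding K_def
    proof (rule Bochner_Integration.integral_norm_bound_integral)
      show "integrable lborel (\<lambda>s::'a. M * exp (- (norm s)\<^sup>2 / 2))"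
        using integrable_norm[OF eint] by (simp add: e_def)
      show "integrable lborel (\<lambda>s. cnj (g (x + s /\<^sub>R real (Suc n))) * e s)"
        by (rule Bochner_Integration.integrable_bound[OF integrable_mult_right[OF eint, of "of_real M"]])
           (auto simp: norm_mult M intro!: mult_right_mono)
    qed (auto simp: norm_mult e_def M)
    also have "\<dots> = M * (LINT s|lborel. exp (- (norm (s::'a))\<^sup>2 / 2))" by simp
    also have "(LINT s|lborel. exp (- (norm (s::'a))\<^sup>2 / 2)) = c"
      using eval unfolding e_def by (simp only: integral_complex_of_real of_real_eq_iff)
    finally show ?thesis .
  qed
  have rhs: "(\<lambda>n. of_real c * (LINT x|lborel. g x * K n x)) \<longlonglongrightarrow> of_real ((2 * pi) ^ DIM('a) * (LINT x|lborel. (cmod (g x))\<^sup>2))"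
  proof -
    have "(\<lambda>n. LINT x|lborel. g x * K n x) \<longlonglongrightarrow> (LINT x|lborel. g x * (of_real c * cnj (g x)))"
    proof (rule integral_dominated_convergence[where w = "\<lambda>x. cmod (g x) * (M * c)"])
      show "AE x in lborel. (\<lambda>n. g x * K n x) \<longlonglongrightarrow> g x * (of_real c * cnj (g x))"
        by (intro AE_I2 tendsto_intros Klim)
    qed (use g Kb in \<open>auto simp: norm_mult intro!: mult_left_mono\<close>)
    also have "(LINT x|lborel. g x * (of_real c * cnj (g x))) = (LINT x|lborel. of_real c * of_real ((cmod (g x))\<^sup>2))"
      by (simp only: complex_norm_square mult_ac)
    also have "\<dots> = of_real (c * (LINT x|lborel. (cmod (g x))\<^sup>2))"
      by (simp only: integral_mult_right_zero integral_complex_of_real of_real_mult)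
    finally have "(\<lambda>n. of_real c * (LINT x|lborel. g x * K n x)) \<longlonglongrightarrow> of_real c * of_real (c * (LINT x|lborel. (cmod (g x))\<^sup>2))"
      by (intro tendsto_intros)
    then show ?thesis unfolding c2[symmetric] by (simp add: mult_ac)
  qed
  have lhs: "(\<integral>\<^sup>+\<eta>. ennreal (w n \<eta> * (cmod (ftr g \<eta>))\<^sup>2) \<partial>lborel) = ennreal (Re (of_real c * (LINT x|lborel. g x * K n x)))" for n
  proof -
    define m where "m = (LINT x|lborel. cmod (g x))"
    have "integrable lborel (\<lambda>\<eta>. complex_of_real (w n \<eta>))"
      using gaussian_ft_scaled(1)[of "real (Suc n)" "0::'a"] by (simp add: w_def)
    then have "integrable lborel (w n)" by (simp only: complex_of_real_integrable_eq)
    then have im: "integrable lborel (\<lambda>\<eta>. w n \<eta> * m\<^sup>2)" by simp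
    have i: "integrable lborel (\<lambda>\<eta>. w n \<eta> * (cmod (ftr g \<eta>))\<^sup>2)"
      using ftr_bound[OF g]
      by (intro Bochner_Integration.integrable_bound[OF im])
         (auto simp: abs_mult w_def m_def intro!: AE_I2 mult_left_mono power_mono)
    have "complex_of_real (LINT \<eta>|lborel. w n \<eta> * (cmod (ftr g \<eta>))\<^sup>2) =
        (LINT \<eta>|lborel. of_real (w n \<eta>) * (ftr g \<eta> * cnj (ftr g \<eta>)))"
      by (simp only: complex_norm_square[symmetric] integral_complex_of_real[symmetric] of_real_mult)
    also have "\<dots> = of_real c * (LINT x|lborel. g x * K n x)"
      using ftr_gaussian_regularisation[OF g, of "real (Suc n)"] by (simp add: w_def c_def K_def e_def)
    finally have "(LINT \<eta>|lborel. w n \<eta> * (cmod (ftr g \<eta>))\<^sup>2) = Re (of_real c * (LINT x|lborel. g x * K n x))"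
      by (metis Re_complex_of_real)
    then show ?thesis
      by (subst nn_integral_eq_integral[OF i]) (auto simp: w_def)
  qed
  \<comment> \<open>Monotone convergence, because square integrability of \<open>ftr g\<close> is
    part of what is being proved.\<close>
  have "(\<lambda>n. \<integral>\<^sup>+\<eta>. ennreal (w n \<eta> * (cmod (ftr g \<eta>))\<^sup>2) \<partial>lborel) \<longlonglongrightarrow> (\<integral>\<^sup>+\<eta>. ennreal ((cmod (ftr g \<eta>))\<^sup>2) \<partial>lborel)"
  proof (rule nn_integral_LIMSEQ)
    show "incseq (\<lambda>n \<eta>. ennreal (w n \<eta> * (cmod (ftr g \<eta>))\<^sup>2))"
      unfolding incseq_def le_fun_def w_def
      by (intro allI impI ennreal_leI mult_right_mono)
         (auto intro!: divide_left_mono power_mono mult_pos_pos)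
    fix \<eta> :: 'a
    have "(\<lambda>n. - (norm \<eta>)\<^sup>2 / 2 * (inverse (real (Suc n)))\<^sup>2) \<longlonglongrightarrow> - (norm \<eta>)\<^sup>2 / 2 * 0\<^sup>2"
      by (intro tendsto_intros LIMSEQ_inverse_real_of_nat)
    then have "(\<lambda>n. w n \<eta>) \<longlonglongrightarrow> exp (- (norm \<eta>)\<^sup>2 / 2 * 0\<^sup>2)"
      unfolding w_def by (intro tendsto_exp) (simp add: field_simps)
    then have "(\<lambda>n. w n \<eta> * (cmod (ftr g \<eta>))\<^sup>2) \<longlonglongrightarrow> 1 * (cmod (ftr g \<eta>))\<^sup>2"
      by (intro tendsto_intros) simp
    then show "(\<lambda>n. ennreal (w n \<eta> * (cmod (ftr g \<eta>))\<^sup>2)) \<longlonglongrightarrow> ennreal ((cmod (ftr g \<eta>))\<^sup>2)"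
      by (intro tendsto_ennrealI) simp
  qed auto
  moreover have "(\<lambda>n. ennreal (Re (of_real c * (LINT x|lborel. g x * K n x)))) \<longlonglongrightarrow>
      ennreal ((2 * pi) ^ DIM('a) * (LINT x|lborel. (cmod (g x))\<^sup>2))"
    using tendsto_Re[OF rhs] by (intro tendsto_ennrealI) simp
  ultimately have "nsq lborel (ftr g) = ennreal ((2 * pi) ^ DIM('a) * (LINT x|lborel. (cmod (g x))\<^sup>2))"
    unfolding lhs nsq_def by (rule LIMSEQ_unique)
  then show ?thesis by (simp add: nsqg ennreal_mult)
qed

lemma sets_borel_cball [measurable]: "cball a r \<in> sets (borel :: 'a::metric_space measure)"
  by simp

lemma nsq_dominated:
  assumes [measurable]: "\<And>n. f n \<in> borel_measurable M" "g \<in> borel_measurable M" "w \<in> borel_measurable M"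
    and lim: "AE x in M. (\<lambda>n. f n x) \<longlonglongrightarrow> g x"
    and bd: "\<And>n. AE x in M. cmod (f n x - g x) \<le> cmod (w x)" and w: "nsq M w < \<infinity>"
  shows "(\<lambda>n. nsq M (\<lambda>x. f n x - g x)) \<longlonglongrightarrow> 0"
proof -
  have "(\<lambda>n. \<integral>\<^sup>+x. ennreal ((cmod (f n x - g x))\<^sup>2) \<partial>M) \<longlonglongrightarrow> (\<integral>\<^sup>+x. 0 \<partial>M)"
  proof (rule nn_integral_dominated_convergence[where w = "\<lambda>x. ennreal ((cmod (w x))\<^sup>2)"])
    show "(\<integral>\<^sup>+x. ennreal ((cmod (w x))\<^sup>2) \<partial>M) < \<infinity>" using w by (simp add: nsq_def)
    show "AE x in M. ennreal ((cmod (f n x - g x))\<^sup>2) \<le> ennreal ((cmod (w x))\<^sup>2)" for n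
      using bd[of n] by eventually_elim (intro ennreal_leI power_mono; simp)
    show "AE x in M. (\<lambda>n. ennreal ((cmod (f n x - g x))\<^sup>2)) \<longlonglongrightarrow> 0"
      using lim
    proof eventually_elim
      fix x assume "(\<lambda>n. f n x) \<longlonglongrightarrow> g x"
      then have "(\<lambda>n. (cmod (f n x - g x))\<^sup>2) \<longlonglongrightarrow> (cmod (g x - g x))\<^sup>2"
        by (intro tendsto_intros)
      then have "(\<lambda>n. ennreal ((cmod (f n x - g x))\<^sup>2)) \<longlonglongrightarrow> ennreal ((cmod (g x - g x))\<^sup>2)"
        by (rule tendsto_ennrealI)
      then show "(\<lambda>n. ennreal ((cmod (f n x - g x))\<^sup>2)) \<longlonglongrightarrow> 0" by simp
    qed
  qed auto
  then show ?thesis by (simp add: nsq_def)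
qed

lemma nsq_indicator:
  assumes "A \<in> sets M"
  shows "nsq M (indicator A) = emeasure M A"
proof -
  have "nsq M (indicator A) = (\<integral>\<^sup>+x. indicator A x \<partial>M)"
    unfolding nsq_def by (intro nn_integral_cong) (auto simp: indicator_def)
  then show ?thesis using assms by simp
qed

text \<open>Cauchy-Schwarz against the indicator of the ball times a character. By the second claim
  a single value of the transform depends continuously on f in L2 as long as the supports stay in
  one ball.\<close>

lemma nsq_bounded_support_integrable:
  fixes f :: "'a::euclidean_space \<Rightarrow> complex"
  assumes [measurable]: "f \<in> borel_measurable borel" and fin: "nsq lborel f < \<infinity>"
    and supp: "\<And>x. norm x > R \<Longrightarrow> f x = 0"
  shows "integrable lborel f"
    and "ennreal ((cmod (ftr f \<eta>))\<^sup>2) \<le> nsq lborel f * emeasure lborel (cball 0 R :: 'a set)"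
proof -
  let ?k = "\<lambda>x. indicator (cball 0 R) x * cis (- (x \<bullet> \<eta>))"
  have [measurable]: "?k \<in> borel_measurable borel" by measurable
  have k: "nsq lborel ?k = emeasure lborel (cball 0 R :: 'a set)"
    by (subst nsq_indicator[symmetric], simp, rule nsq_cong) (simp add: norm_mult)
  have kf: "nsq lborel ?k < \<infinity>"
    unfolding k using emeasure_bounded_finite[of "cball 0 R :: 'a set"] by simp
  have eq: "f x * ?k x = cis (- (x \<bullet> \<eta>)) * f x" for x
    using supp[of x] by (auto simp: indicator_def dist_norm)
  from nsq_integrable_mult[of f lborel ?k] fin kf
  have 1: "integrable lborel (\<lambda>x. cis (- (x \<bullet> \<eta>)) * f x)"
    and "ennreal ((cmod (ftr f \<eta>))\<^sup>2) \<le> nsq lborel f * emeasure lborel (cball 0 R :: 'a set)"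
    unfolding eq k ftr_def by auto
  then show "ennreal ((cmod (ftr f \<eta>))\<^sup>2) \<le> nsq lborel f * emeasure lborel (cball 0 R :: 'a set)" by simp
  show "integrable lborel f"
    by (rule Bochner_Integration.integrable_bound[OF 1]) (auto simp: norm_mult)
qed

lemma ftr_diff:
  assumes "integrable lborel f" "integrable lborel g"
  shows "ftr (\<lambda>x. f x - g x) \<eta> = ftr f \<eta> - ftr g \<eta>"
  unfolding ftr_def using integrable_cis_mult(2)[OF assms(1), of \<eta>] integrable_cis_mult(2)[OF assms(2), of \<eta>]
  by (simp add: right_diff_distrib)

text \<open>The common ball gives pointwise convergence of the transforms, the identity for
  differences makes them Cauchy in L2, and Fatou's lemma merges both into L2 convergence to
  \<open>ftr g\<close>.\<close>

lemma plancherel_limit: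
  fixes f :: "nat \<Rightarrow> 'a::euclidean_space \<Rightarrow> complex"
  assumes [measurable]: "\<And>n. f n \<in> borel_measurable borel" "g \<in> borel_measurable borel"
    and supp: "\<And>n x. norm x > R \<Longrightarrow> f n x = 0" "\<And>x. norm x > R \<Longrightarrow> g x = 0"
    and fin: "\<And>n. nsq lborel (f n) < \<infinity>" "nsq lborel g < \<infinity>"
    and lim: "(\<lambda>n. nsq lborel (\<lambda>x. f n x - g x)) \<longlonglongrightarrow> 0"
    and pl: "\<And>n. nsq lborel (ftr (f n)) = ennreal c * nsq lborel (f n)"
      "\<And>m n. nsq lborel (ftr (\<lambda>x. f m x - f n x)) = ennreal c * nsq lborel (\<lambda>x. f m x - f n x)"
    and c: "c > 0"
  shows "nsq lborel (ftr g) = ennreal c * nsq lborel g"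
proof -
  have int: "integrable lborel (f n)" "integrable lborel g" for n
  proof -
    show "integrable lborel (f n)"
      by (rule nsq_bounded_support_integrable(1)[OF _ fin(1)]) (measurable, rule supp)
    show "integrable lborel g"
      by (rule nsq_bounded_support_integrable(1)[OF _ fin(2)]) (measurable, rule supp)
  qed
  have fl: "(\<lambda>n. ftr (f n) \<eta>) \<longlonglongrightarrow> ftr g \<eta>" for \<eta>
  proof -
    have "(\<lambda>n. ftr (\<lambda>x. f n x - g x) \<eta>) \<longlonglongrightarrow> 0"
    proof (rule ennreal_sq_tendsto_0, rule tendsto_0_squeeze_ennreal)
      show "ennreal ((cmod (ftr (\<lambda>x. f n x - g x) \<eta>))\<^sup>2) \<le>
          nsq lborel (\<lambda>x. f n x - g x) * emeasure lborel (cball 0 R :: 'a set)" for n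
      proof (rule nsq_bounded_support_integrable(2))
        show "nsq lborel (\<lambda>x. f n x - g x) < \<infinity>" by (intro nsq_add_finite fin) measurable
        show "f n x - g x = 0" if "norm x > R" for x using supp that by simp
      qed measurable
      show "(\<lambda>n. nsq lborel (\<lambda>x. f n x - g x) * emeasure lborel (cball 0 R :: 'a set)) \<longlonglongrightarrow> 0"
        using tendsto_mult_ennreal[OF lim tendsto_const[of "emeasure lborel (cball 0 R :: 'a set)"]]
          emeasure_bounded_finite[of "cball 0 R :: 'a set"] by auto
    qed
    then show ?thesis unfolding ftr_diff[OF int] by (rule LIM_zero_cancel)
  qed
  have F0: "(\<lambda>n. nsq lborel (\<lambda>\<eta>. ftr (f n) \<eta> - ftr g \<eta>)) \<longlonglongrightarrow> 0"
  proof (rule tendsto_0_squeeze_ennreal)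
    fix n
    \<comment> \<open>The supremum over the tail makes the bound independent of m, as Fatou's lemma
      requires.\<close>
    have le: "nsq lborel (\<lambda>\<eta>. ftr (f n) \<eta> - ftr (f (m + n)) \<eta>) \<le> ennreal c * (2 * nsq lborel (\<lambda>x. f n x - g x) +
        2 * (SUP m\<in>{n..}. nsq lborel (\<lambda>x. f m x - g x)))" for m
    proof -
      have "nsq lborel (\<lambda>\<eta>. ftr (f n) \<eta> - ftr (f (m + n)) \<eta>) = ennreal c * nsq lborel (\<lambda>x. f n x - f (m + n) x)"
        unfolding pl(2)[symmetric] by (subst ftr_diff[OF int(1,1), symmetric]) simp
      also have "nsq lborel (\<lambda>x. f n x - f (m + n) x) \<le> 2 * nsq lborel (\<lambda>x. f n x - g x) + 2 * nsq lborel (\<lambda>x. g x - f (m + n) x)"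
        by (rule nsq_triangle) auto
      also have "nsq lborel (\<lambda>x. g x - f (m + n) x) = nsq lborel (\<lambda>x. f (m + n) x - g x)"
        by (rule nsq_cong) (simp add: norm_minus_commute)
      also have "\<dots> \<le> (SUP m\<in>{n..}. nsq lborel (\<lambda>x. f m x - g x))"
        by (rule SUP_upper) simp
      finally show ?thesis by (simp add: mult_left_mono add_left_mono)
    qed
    show "nsq lborel (\<lambda>\<eta>. ftr (f n) \<eta> - ftr g \<eta>) \<le> ennreal c * (2 * nsq lborel (\<lambda>x. f n x - g x) +
        2 * (SUP m\<in>{n..}. nsq lborel (\<lambda>x. f m x - g x)))"
    proof (rule nsq_Fatou[OF _ _ le])
      show "AE \<eta> in lborel. (\<lambda>m. ftr (f n) \<eta> - ftr (f (m + n)) \<eta>) \<longlonglongrightarrow> ftr (f n) \<eta> - ftr g \<eta>"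
        by (intro AE_I2 tendsto_diff tendsto_const LIMSEQ_ignore_initial_segment[OF fl])
    qed measurable
  next
    have "(\<lambda>n. SUP m\<in>{n..}. nsq lborel (\<lambda>x. f m x - g x)) \<longlonglongrightarrow> 0"
    proof (rule order_tendstoI)
      fix a :: ennreal assume "0 < a"
      then obtain b where b: "0 < b" "b < a" using dense by blast
      from order_tendstoD(2)[OF lim b(1)] obtain N where N: "\<And>n. n \<ge> N \<Longrightarrow> nsq lborel (\<lambda>x. f n x - g x) < b"
        by (auto simp: eventually_sequentially)
      have "(SUP m\<in>{n..}. nsq lborel (\<lambda>x. f m x - g x)) \<le> b" if "n \<ge> N" for n
        by (rule SUP_least) (use N that in \<open>auto intro: less_imp_le\<close>)
      then show "\<forall>\<^sub>F n in sequentially. (SUP m\<in>{n..}. nsq lborel (\<lambda>x. f m x - g x)) < a"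
        using b by (auto simp: eventually_sequentially intro!: exI[of _ N] intro: order.strict_trans1)
    qed simp
    from tendsto_add[OF tendsto_mult_ennreal[OF tendsto_const[of 2] lim] tendsto_mult_ennreal[OF tendsto_const[of 2] this]]
    have "(\<lambda>n. 2 * nsq lborel (\<lambda>x. f n x - g x) + 2 * (SUP m\<in>{n..}. nsq lborel (\<lambda>x. f m x - g x))) \<longlonglongrightarrow> 0"
      by simp
    from tendsto_mult_ennreal[OF tendsto_const[of "ennreal c"] this]
    show "(\<lambda>n. ennreal c * (2 * nsq lborel (\<lambda>x. f n x - g x) + 2 * (SUP m\<in>{n..}. nsq lborel (\<lambda>x. f m x - g x)))) \<longlonglongrightarrow> 0"
      using c by simp
  qed
  have finF: "nsq lborel (ftr (f n)) < \<infinity>" for n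
    using fin(1)[of n] by (simp add: pl ennreal_mult_less_top)
  from order_tendstoD(2)[OF F0, of 1] obtain n where n: "nsq lborel (\<lambda>\<eta>. ftr (f n) \<eta> - ftr g \<eta>) < 1"
    by (auto simp: eventually_sequentially)
  have "nsq lborel (ftr g) < \<infinity>"
    using nsq_add_finite(2)[OF _ _ finF[of n], of "\<lambda>\<eta>. ftr (f n) \<eta> - ftr g \<eta>"]
      order.strict_trans[OF n ennreal_one_less_top] by simp
  from nsq_tendsto[OF _ _ this F0] have 1: "(\<lambda>n. nsq lborel (ftr (f n))) \<longlonglongrightarrow> nsq lborel (ftr g)" by simp
  from nsq_tendsto[OF _ _ fin(2) lim] have "(\<lambda>n. nsq lborel (f n)) \<longlonglongrightarrow> nsq lborel g" by simp
  from tendsto_mult_ennreal[OF tendsto_const[of "ennreal c"] this] c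
  have "(\<lambda>n. ennreal c * nsq lborel (f n)) \<longlonglongrightarrow> ennreal c * nsq lborel g" by simp
  with 1 show ?thesis unfolding pl(1) by (rule LIMSEQ_unique)
qed

lemma nsq_bounded_finite:
  fixes f :: "'a::euclidean_space \<Rightarrow> complex"
  assumes "\<And>x. norm x > R \<Longrightarrow> f x = 0" "\<And>x. cmod (f x) \<le> K"
  shows "nsq lborel f < \<infinity>"
proof -
  have "nsq lborel f \<le> nsq lborel (\<lambda>x::'a. of_real K * indicator (cball 0 R) x)"
  proof (rule nsq_mono)
    fix x :: 'a
    show "cmod (f x) \<le> cmod (of_real K * indicator (cball 0 R) x)"
      using assms(1)[of x] order_trans[OF assms(2)[of x] abs_ge_self] by (cases "norm x > R") (auto simp: norm_mult)
  qed
  also have "\<dots> = ennreal ((cmod (of_real K))\<^sup>2) * emeasure lborel (cball 0 R :: 'a set)"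
    by (subst nsq_cmult) (auto simp: nsq_indicator)
  also have "\<dots> < \<infinity>"
    using emeasure_bounded_finite[of "cball 0 R :: 'a set"] by (simp add: ennreal_mult_less_top)
  finally show ?thesis .
qed

text \<open>A measurable function is an almost everywhere limit of continuous ones. Clipping their
  values and their supports keeps them continuous and supplies the majorant for convergence in
  L2.\<close>

lemma plancherel_bounded:
  fixes f :: "'a::euclidean_space \<Rightarrow> complex"
  assumes [measurable]: "f \<in> borel_measurable borel"
    and supp: "\<And>x. norm x > R \<Longrightarrow> f x = 0" and bd: "\<And>x. cmod (f x) \<le> K"
  shows "nsq lborel (ftr f) = ennreal ((2 * pi) ^ DIM('a)) * nsq lborel f"
proof -
  define L where "L = max 1 K"
  have L: "L > 0" "cmod (f x) \<le> L" for x using bd[of x] by (auto simp: L_def)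
  have "f \<in> borel_measurable lebesgue" by (rule measurable_completion) simp
  then have "f measurable_on UNIV" by (rule lebesgue_measurable_imp_measurable_on) simp
  then obtain N g where neg: "negligible N" and cont: "\<And>n. continuous_on UNIV (g n)"
    and gl: "\<And>x. x \<notin> N \<Longrightarrow> (\<lambda>n. g n x) \<longlonglongrightarrow> f x"
    unfolding measurable_on_def by auto
  have "AE x in lebesgue. x \<notin> N"
    using neg unfolding negligible_iff_null_sets by (rule AE_not_in)
  then have AEN: "AE x in lborel. x \<notin> N" unfolding AE_completion_iff .
  \<comment> \<open>The radial retraction onto the disc of radius L: it is continuous, bounded by L
    and fixes the values of f.\<close>
  define P where "P z = of_real (L / max L (cmod z)) * z" for z
  have Pc: "continuous_on A P" for A
    unfolding P_def using L(1) by (intro continuous_intros) (auto simp: max_def)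
  have Pb: "cmod (P z) \<le> L" for z
    using L(1) by (auto simp: P_def norm_mult norm_divide max_def field_simps)
  have Pf: "P (f x) = f x" for x
    using L by (simp add: P_def max_absorb1)
  define cut where "cut x = max 0 (min 1 (R + 1 - norm x))" for x :: 'a
  have cut: "0 \<le> cut x" "cut x \<le> 1" for x by (auto simp: cut_def)
  define G where "G n x = of_real (cut x) * P (g n x)" for n x
  have Gc: "continuous_on UNIV (G n)" for n
    unfolding G_def cut_def by (intro continuous_intros continuous_on_compose2[OF Pc cont]) auto
  have Gs: "G n x = 0" if "norm x > R + 1" for n x using that by (simp add: G_def cut_def)
  have Gb: "cmod (G n x) \<le> L" for n x
    using cut[of x] Pb[of "g n x"] mult_mono[of "cut x" 1 "cmod (P (g n x))" L] by (simp add: G_def norm_mult)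
  have [measurable]: "G n \<in> borel_measurable borel" for n by (rule borel_measurable_continuous_onI[OF Gc])
  have cut_f: "of_real (cut x) * f x = f x" for x
    using supp[of x] by (cases "norm x > R") (auto simp: cut_def)
  show ?thesis
  proof (rule plancherel_limit[where f = G and R = "R + 1"])
    show "f x = 0" if "norm x > R + 1" for x using that supp by simp
    show "nsq lborel (G n) < \<infinity>" for n by (rule nsq_bounded_finite[OF Gs Gb])
    show "nsq lborel f < \<infinity>" by (rule nsq_bounded_finite[OF supp bd])
    show "nsq lborel (ftr (G n)) = ennreal ((2 * pi) ^ DIM('a)) * nsq lborel (G n)" for n
      by (rule plancherel_continuous[OF Gc Gs])
    show "nsq lborel (ftr (\<lambda>x. G m x - G n x)) = ennreal ((2 * pi) ^ DIM('a)) * nsq lborel (\<lambda>x. G m x - G n x)" for m n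
      by (rule plancherel_continuous[where R = "R + 1"]) (auto intro!: continuous_intros Gc simp: Gs)
    show "(\<lambda>n. nsq lborel (\<lambda>x. G n x - f x)) \<longlonglongrightarrow> 0"
    proof (rule nsq_dominated)
      show "AE x in lborel. (\<lambda>n. G n x) \<longlonglongrightarrow> f x"
        using AEN
      proof eventually_elim
        fix x assume "x \<notin> N"
        then have "(\<lambda>n. P (g n x)) \<longlonglongrightarrow> P (f x)"
          by (intro continuous_on_tendsto_compose[OF Pc[of UNIV] gl]) auto
        then have "(\<lambda>n. of_real (cut x) * P (g n x)) \<longlonglongrightarrow> of_real (cut x) * P (f x)"
          by (intro tendsto_intros)
        then show "(\<lambda>n. G n x) \<longlonglongrightarrow> f x" by (simp add: G_def Pf cut_f)
      qed
      show "nsq lborel (\<lambda>x::'a. of_real (2 * L) * indicator (cball 0 (R + 1)) x) < \<infinity>"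
        by (rule nsq_bounded_finite[of "R + 1" _ "2 * L"]) (use L(1) in \<open>auto simp: norm_mult indicator_def\<close>)
      fix n
      have "cmod (G n x - f x) \<le> cmod (of_real (2 * L) * indicator (cball 0 (R + 1)) x)" for x
      proof (cases "norm x > R + 1")
        case True then show ?thesis using Gs[OF True] supp[of x] by simp
      next
        case False
        then show ?thesis
          using norm_triangle_ineq4[of "G n x" "f x"] Gb[of n x] L(2)[of x] L(1) by (simp add: norm_mult)
      qed
      then show "AE x in lborel. cmod (G n x - f x) \<le> cmod (of_real (2 * L) * indicator (cball 0 (R + 1)) x)" by simp
    qed auto
  qed (auto simp: Gs)
qed

text \<open>Setting f to 0 where it is large removes the boundedness hypothesis; f itself is the
  majorant.\<close>

lemma plancherel:
  fixes f :: "'a::euclidean_space \<Rightarrow> complex"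
  assumes [measurable]: "f \<in> borel_measurable borel"
    and supp: "\<And>x. norm x > R \<Longrightarrow> f x = 0" and fin: "nsq lborel f < \<infinity>"
  shows "nsq lborel (ftr f) = ennreal ((2 * pi) ^ DIM('a)) * nsq lborel f"
proof -
  define G where "G n x = (if cmod (f x) \<le> real n then f x else 0)" for n x
  have [measurable]: "G n \<in> borel_measurable borel" for n unfolding G_def by measurable
  show ?thesis
  proof (rule plancherel_limit[where f = G and R = R])
    show Gs: "G n x = 0" if "norm x > R" for n x using that supp by (simp add: G_def)
    have Gb: "cmod (G n x) \<le> real n" for n x by (simp add: G_def)
    show "nsq lborel (G n) < \<infinity>" for n by (rule nsq_bounded_finite[OF Gs Gb])
    show "nsq lborel (ftr (G n)) = ennreal ((2 * pi) ^ DIM('a)) * nsq lborel (G n)" for n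
      by (rule plancherel_bounded[OF _ Gs Gb]) simp_all
    show "nsq lborel (ftr (\<lambda>x. G m x - G n x)) = ennreal ((2 * pi) ^ DIM('a)) * nsq lborel (\<lambda>x. G m x - G n x)" for m n
    proof (rule plancherel_bounded[where R = R and K = "real m + real n"])
      show "cmod (G m x - G n x) \<le> real m + real n" for x
        using norm_triangle_ineq4[of "G m x" "G n x"] Gb[of m x] Gb[of n x] by simp
    qed (auto simp: Gs)
    show "(\<lambda>n. nsq lborel (\<lambda>x. G n x - f x)) \<longlonglongrightarrow> 0"
    proof (rule nsq_dominated[OF _ _ _ _ _ fin])
      show "AE x in lborel. (\<lambda>n. G n x) \<longlonglongrightarrow> f x"
      proof (intro AE_I2)
        fix x
        obtain m where "cmod (f x) \<le> real m" using real_arch_simple by blast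
        then have "\<forall>\<^sub>F n in sequentially. G n x = f x"
          by (auto simp: eventually_sequentially G_def intro!: exI[of _ m])
        then show "(\<lambda>n. G n x) \<longlonglongrightarrow> f x" by (rule tendsto_eventually)
      qed
    qed (auto simp: G_def)
  qed (use supp fin in auto)
qed

section \<open>The Fourier transform of functions with a parameter\<close>

text \<open>The second variable is a parameter. An L2 function with values in a weighted L2 space is
  a scalar L2 function on a product, so the vector-valued theory reduces to slicewise Plancherel and
  Tonelli's theorem.\<close>

definition ftp :: "'a::euclidean_space set \<Rightarrow> ('a \<times> 'b \<Rightarrow> complex) \<Rightarrow> 'a \<times> 'b \<Rightarrow> complex" where
  "ftp B u p = ftr (\<lambda>y. indicator B y * u (y, snd p)) (fst p)"

lemma borel_measurable_ftp [measurable]: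
  fixes u :: "'a::euclidean_space \<times> 'b \<Rightarrow> complex"
  assumes [measurable]: "u \<in> borel_measurable (lborel \<Otimes>\<^sub>M M)" "B \<in> sets borel"
  shows "ftp B u \<in> borel_measurable (lborel \<Otimes>\<^sub>M M)"
  unfolding ftp_def ftr_def by measurable

lemma nsq_indicator_le: "nsq M (\<lambda>x. indicator (B x) (g x) * u x) \<le> nsq M u"
  by (rule nsq_mono) (simp add: norm_mult indicator_def)

context sigma_finite_measure
begin

interpretation P: pair_sigma_finite "lborel :: 'c::euclidean_space measure" M ..

lemma nsq_pair:
  fixes u :: "'c::euclidean_space \<times> 'a \<Rightarrow> complex"
  assumes [measurable]: "u \<in> borel_measurable (lborel \<Otimes>\<^sub>M M)"
  shows "nsq (lborel \<Otimes>\<^sub>M M) u = (\<integral>\<^sup>+x. nsq lborel (\<lambda>y. u (y, x)) \<partial>M)"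
  unfolding nsq_def by (subst P.nn_integral_snd) auto

lemma nsq_slice_finite:
  fixes u :: "'c::euclidean_space \<times> 'a \<Rightarrow> complex"
  assumes [measurable]: "u \<in> borel_measurable (lborel \<Otimes>\<^sub>M M)" and "nsq (lborel \<Otimes>\<^sub>M M) u < \<infinity>"
  shows "AE x in M. nsq lborel (\<lambda>y. u (y, x)) < \<infinity>"
proof -
  have "AE x in M. nsq lborel (\<lambda>y. u (y, x)) \<noteq> \<infinity>"
    using assms(2) unfolding nsq_pair[OF assms(1)]
    by (intro nn_integral_PInf_AE) (auto simp: nsq_def)
  then show ?thesis by eventually_elim (simp add: top.not_eq_extremum)
qed

lemma bounded_slice_integrable:
  fixes u :: "'c::euclidean_space \<times> 'a \<Rightarrow> complex"
  assumes [measurable]: "u \<in> borel_measurable (lborel \<Otimes>\<^sub>M M)" and fin: "nsq (lborel \<Otimes>\<^sub>M M) u < \<infinity>"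
    and [measurable]: "B \<in> sets borel" and B: "B \<subseteq> cball 0 R"
  shows "AE x in M. integrable lborel (\<lambda>y. indicator B y * u (y, x))"
  using nsq_slice_finite[OF assms(1) fin] AE_space
proof eventually_elim
  fix x assume *: "nsq lborel (\<lambda>y. u (y, x)) < \<infinity>" and [measurable]: "x \<in> space M"
  show "integrable lborel (\<lambda>y. indicator B y * u (y, x))"
  proof (rule nsq_bounded_support_integrable(1))
    show "nsq lborel (\<lambda>y. indicator B y * u (y, x)) < \<infinity>"
      using order.strict_trans1[OF nsq_indicator_le *] .
    show "indicator B y * u (y, x) = 0" if "norm y > R" for y
      using that B by (auto simp: indicator_def)
    have "(\<lambda>y. u (y, x)) \<in> borel_measurable lborel" by measurable
    then show "(\<lambda>y. indicator B y * u (y, x)) \<in> borel_measurable borel" by simp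
  qed
qed

text \<open>Slicewise Plancherel integrated over the parameter; the slices of infinite norm form a
  null set.\<close>

lemma ftp_plancherel:
  fixes u :: "'c::euclidean_space \<times> 'a \<Rightarrow> complex"
  assumes [measurable]: "u \<in> borel_measurable (lborel \<Otimes>\<^sub>M M)" and fin: "nsq (lborel \<Otimes>\<^sub>M M) u < \<infinity>"
    and [measurable]: "B \<in> sets borel" and B: "B \<subseteq> cball 0 R"
  shows "nsq (lborel \<Otimes>\<^sub>M M) (ftp B u) =
    ennreal ((2 * pi) ^ DIM('c)) * nsq (lborel \<Otimes>\<^sub>M M) (\<lambda>p. indicator B (fst p) * u p)"
proof -
  have "nsq (lborel \<Otimes>\<^sub>M M) (ftp B u) = (\<integral>\<^sup>+x. nsq lborel (ftr (\<lambda>y. indicator B y * u (y, x))) \<partial>M)"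
    by (subst nsq_pair) (auto simp: ftp_def)
  also have "\<dots> = (\<integral>\<^sup>+x. ennreal ((2 * pi) ^ DIM('c)) * nsq lborel (\<lambda>y. indicator B y * u (y, x)) \<partial>M)"
  proof (rule nn_integral_cong_AE)
    show "AE x in M. nsq lborel (ftr (\<lambda>y. indicator B y * u (y, x))) =
        ennreal ((2 * pi) ^ DIM('c)) * nsq lborel (\<lambda>y. indicator B y * u (y, x))"
      using nsq_slice_finite[OF assms(1) fin] AE_space
    proof eventually_elim
      fix x assume *: "nsq lborel (\<lambda>y. u (y, x)) < \<infinity>" and [measurable]: "x \<in> space M"
      show "nsq lborel (ftr (\<lambda>y. indicator B y * u (y, x))) =
        ennreal ((2 * pi) ^ DIM('c)) * nsq lborel (\<lambda>y. indicator B y * u (y, x))"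
      proof (rule plancherel)
        show "nsq lborel (\<lambda>y. indicator B y * u (y, x)) < \<infinity>"
          using order.strict_trans1[OF nsq_indicator_le *] .
        show "indicator B y * u (y, x) = 0" if "norm y > R" for y
          using that B by (auto simp: indicator_def)
        have "(\<lambda>y. u (y, x)) \<in> borel_measurable lborel" by measurable
        then show "(\<lambda>y. indicator B y * u (y, x)) \<in> borel_measurable borel" by simp
      qed
    qed
  qed
  also have "\<dots> = ennreal ((2 * pi) ^ DIM('c)) * nsq (lborel \<Otimes>\<^sub>M M) (\<lambda>p. indicator B (fst p) * u p)"
    by (subst nsq_pair, measurable, subst nn_integral_cmult[symmetric]) (auto simp: nsq_def)
  finally show ?thesis .
qed

lemma nsq_ftp_finite:
  fixes u :: "'c::euclidean_space \<times> 'a \<Rightarrow> complex"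
  assumes "u \<in> borel_measurable (lborel \<Otimes>\<^sub>M M)" and fin: "nsq (lborel \<Otimes>\<^sub>M M) u < \<infinity>"
  shows "nsq (lborel \<Otimes>\<^sub>M M) (ftp (cball 0 R) u) < \<infinity>"
proof -
  have "nsq (lborel \<Otimes>\<^sub>M M) (\<lambda>p. indicator (cball 0 R) (fst p) * u p) < \<infinity>"
    by (rule order.strict_trans1[OF nsq_indicator_le fin])
  then show ?thesis
    by (subst ftp_plancherel[OF assms sets_borel_cball order.refl]) (simp add: ennreal_mult_less_top)
qed

text \<open>A null set of parameters times the whole frequency space is null in the product.\<close>

lemma AE_pairI:
  assumes "AE x in M. \<forall>y. Q y x" and "\<And>p. p \<in> space (lborel \<Otimes>\<^sub>M M) \<Longrightarrow> (Q (fst p) (snd p) :: bool) \<Longrightarrow> R p"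
  shows "AE p in (lborel :: 'c::euclidean_space measure) \<Otimes>\<^sub>M M. R p"
proof -
  from assms(1) obtain N where N: "N \<in> null_sets M" "{x\<in>space M. \<not> (\<forall>y. Q y x)} \<subseteq> N"
    by (auto simp: eventually_ae_filter)
  then have "AE p in (lborel :: 'c measure) \<Otimes>\<^sub>M M. snd p \<notin> N"
  proof (intro AE_I'[of "UNIV \<times> N"])
    have "emeasure ((lborel :: 'c measure) \<Otimes>\<^sub>M M) (UNIV \<times> N) = 0"
      using N(1) by (subst emeasure_pair_measure_Times) (auto simp: null_sets_def)
    then show "UNIV \<times> N \<in> null_sets ((lborel :: 'c measure) \<Otimes>\<^sub>M M)"
      using N(1) by (auto simp: null_sets_def)
  qed auto
  with AE_space show ?thesis
  proof eventually_elim
    fix p assume p: "p \<in> space ((lborel :: 'c measure) \<Otimes>\<^sub>M M)" "snd p \<notin> N"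
    then have "snd p \<in> space M" by (auto simp: space_pair_measure)
    with p N(2) show "R p" by (intro assms(2)) auto
  qed
qed

text \<open>Linearity of the Bochner integral needs both truncated slices to be integrable, hence
  the exceptional null set.\<close>

lemma ftp_diff_set:
  fixes u :: "'c::euclidean_space \<times> 'a \<Rightarrow> complex"
  assumes "u \<in> borel_measurable (lborel \<Otimes>\<^sub>M M)" and "nsq (lborel \<Otimes>\<^sub>M M) u < \<infinity>" and "r \<le> R"
  shows "AE p in lborel \<Otimes>\<^sub>M M. ftp (cball 0 R) u p - ftp (cball 0 r) u p = ftp (cball 0 R - cball 0 r) u p"
proof (rule AE_pairI)
  show "AE x in M. \<forall>\<eta>. ftp (cball 0 R) u (\<eta>, x) - ftp (cball 0 r) u (\<eta>, x) = ftp (cball 0 R - cball 0 r) u (\<eta>, x)"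
    using bounded_slice_integrable[OF assms(1,2) sets_borel_cball order.refl, of R]
      bounded_slice_integrable[OF assms(1,2) sets_borel_cball order.refl, of r]
  proof eventually_elim
    fix x
    assume i: "integrable lborel (\<lambda>y. indicator (cball 0 R) y * u (y, x))"
      "integrable lborel (\<lambda>y. indicator (cball 0 r) y * u (y, x))"
    have eq: "indicator (cball 0 R - cball 0 r) y = indicator (cball 0 R) y - (indicator (cball 0 r) y :: complex)" for y :: 'c
      using assms(3) by (auto simp: indicator_def)
    show "\<forall>\<eta>. ftp (cball 0 R) u (\<eta>, x) - ftp (cball 0 r) u (\<eta>, x) = ftp (cball 0 R - cball 0 r) u (\<eta>, x)"
      unfolding ftp_def eq left_diff_distrib by (simp add: ftr_diff[OF i])
  qed
qed auto

definition tail :: "('c::euclidean_space \<times> 'a \<Rightarrow> complex) \<Rightarrow> real \<Rightarrow> ennreal" where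
  "tail u r = nsq (lborel \<Otimes>\<^sub>M M) (\<lambda>p. indicator (- cball 0 r) (fst p) * u p)"

lemma tail_antimono: "r \<le> R \<Longrightarrow> tail u R \<le> tail u r"
  unfolding tail_def by (rule nsq_mono) (auto simp: norm_mult indicator_def)

lemma tail_tendsto:
  fixes u :: "'c::euclidean_space \<times> 'a \<Rightarrow> complex"
  assumes [measurable]: "u \<in> borel_measurable (lborel \<Otimes>\<^sub>M M)" and fin: "nsq (lborel \<Otimes>\<^sub>M M) u < \<infinity>"
  shows "(tail u \<longlongrightarrow> 0) at_top"
proof (rule order_tendstoI)
  fix a :: ennreal assume a: "0 < a"
  have "(\<lambda>n. nsq (lborel \<Otimes>\<^sub>M M) (\<lambda>p. indicator (- cball 0 (real n)) (fst p) * u p - 0)) \<longlonglongrightarrow> 0"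
  proof (rule nsq_dominated[OF _ _ _ _ _ fin])
    show "AE p in lborel \<Otimes>\<^sub>M M. (\<lambda>n. indicator (- cball 0 (real n)) (fst p) * u p) \<longlonglongrightarrow> 0"
    proof (intro AE_I2)
      fix p :: "'c \<times> 'a"
      obtain m where "norm (fst p) \<le> real m" using real_arch_simple by blast
      then have "\<forall>\<^sub>F n in sequentially. indicator (- cball 0 (real n)) (fst p) * u p = 0"
        by (auto simp: eventually_sequentially intro!: exI[of _ m])
      then show "(\<lambda>n. indicator (- cball 0 (real n)) (fst p) * u p) \<longlonglongrightarrow> 0" by (rule tendsto_eventually)
    qed
  qed (auto simp: norm_mult indicator_def)
  from order_tendstoD(2)[OF this a] obtain n where "tail u (real n) < a"
    by (auto simp: eventually_sequentially tail_def)
  note n = this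
  show "\<forall>\<^sub>F r in at_top. tail u r < a"
    using eventually_ge_at_top[of "real n"]
    by eventually_elim (rule order.strict_trans1[OF tail_antimono n])
qed simp

text \<open>By Plancherel the difference has, up to the constant, the norm of u on the annulus
  between the two balls, which lies outside the ball of radius r.\<close>

lemma ftp_diff_le_tail:
  fixes u :: "'c::euclidean_space \<times> 'a \<Rightarrow> complex"
  assumes [measurable]: "u \<in> borel_measurable (lborel \<Otimes>\<^sub>M M)" and fin: "nsq (lborel \<Otimes>\<^sub>M M) u < \<infinity>"
    and "r \<le> S" "r \<le> S'"
  shows "nsq (lborel \<Otimes>\<^sub>M M) (\<lambda>p. ftp (cball 0 S) u p - ftp (cball 0 S') u p) \<le> ennreal ((2 * pi) ^ DIM('c)) * tail u r"
proof -
  have *: "nsq (lborel \<Otimes>\<^sub>M M) (\<lambda>p. ftp (cball 0 S) u p - ftp (cball 0 S') u p) \<le> ennreal ((2 * pi) ^ DIM('c)) * tail u r"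
    if "r \<le> S'" "S' \<le> S" for S S'
  proof -
    have "nsq (lborel \<Otimes>\<^sub>M M) (\<lambda>p. ftp (cball 0 S) u p - ftp (cball 0 S') u p) =
        nsq (lborel \<Otimes>\<^sub>M M) (ftp (cball 0 S - cball 0 S') u)"
      using ftp_diff_set[OF assms(1) fin that(2)] by (intro nsq_cong_AE) auto
    also have "\<dots> = ennreal ((2 * pi) ^ DIM('c)) * nsq (lborel \<Otimes>\<^sub>M M) (\<lambda>p. indicator (cball 0 S - cball 0 S') (fst p) * u p)"
      by (rule ftp_plancherel[OF assms(1) fin, of _ S]) auto
    also have "\<dots> \<le> ennreal ((2 * pi) ^ DIM('c)) * tail u r"
      unfolding tail_def using that
      by (intro mult_left_mono nsq_mono) (auto simp: norm_mult indicator_def)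
    finally show ?thesis .
  qed
  show ?thesis
  proof (cases "S' \<le> S")
    case True then show ?thesis using * assms by blast
  next
    case False
    have "nsq (lborel \<Otimes>\<^sub>M M) (\<lambda>p. ftp (cball 0 S) u p - ftp (cball 0 S') u p) =
        nsq (lborel \<Otimes>\<^sub>M M) (\<lambda>p. ftp (cball 0 S') u p - ftp (cball 0 S) u p)"
      by (rule nsq_cong) (simp add: norm_minus_commute)
    with False show ?thesis using *[of S S'] assms by simp
  qed
qed

lemma nsq_ftp_Cauchy:
  fixes u :: "'c::euclidean_space \<times> 'a \<Rightarrow> complex"
  assumes u: "u \<in> borel_measurable (lborel \<Otimes>\<^sub>M M)" and fin: "nsq (lborel \<Otimes>\<^sub>M M) u < \<infinity>" and e: "e > 0"
  shows "\<exists>K. \<forall>m\<ge>K. \<forall>n\<ge>K. nsq (lborel \<Otimes>\<^sub>M M) (\<lambda>p. ftp (cball 0 (real m)) u p - ftp (cball 0 (real n)) u p) \<le> ennreal e"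
proof -
  have "((\<lambda>r. ennreal ((2 * pi) ^ DIM('c)) * tail u r) \<longlongrightarrow> 0) at_top"
    using tendsto_mult_ennreal[OF tendsto_const[of "ennreal ((2 * pi) ^ DIM('c))"] tail_tendsto[OF u fin]]
    by simp
  from order_tendstoD(2)[OF this, of "ennreal e"] e
  obtain r where r: "ennreal ((2 * pi) ^ DIM('c)) * tail u r < ennreal e"
    by (auto simp: eventually_at_top_linorder)
  obtain K :: nat where K: "r \<le> real K" using real_arch_simple by blast
  show ?thesis
  proof (intro exI[of _ K] allI impI)
    fix m n assume "m \<ge> K" "n \<ge> K"
    then have "r \<le> real m" "r \<le> real n" using K by auto
    from ftp_diff_le_tail[OF u fin this] r
    show "nsq (lborel \<Otimes>\<^sub>M M) (\<lambda>p. ftp (cball 0 (real m)) u p - ftp (cball 0 (real n)) u p) \<le> ennreal e"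
      by (auto intro: order.trans less_imp_le)
  qed
qed

text \<open>The truncated transforms are Cauchy in L2 because the mass of u outside large balls
  tends to 0.\<close>

lemma ftp_exists:
  fixes u :: "'c::euclidean_space \<times> 'a \<Rightarrow> complex"
  assumes [measurable]: "u \<in> borel_measurable (lborel \<Otimes>\<^sub>M M)" and fin: "nsq (lborel \<Otimes>\<^sub>M M) u < \<infinity>"
  obtains v where "v \<in> borel_measurable (lborel \<Otimes>\<^sub>M M)" "nsq (lborel \<Otimes>\<^sub>M M) v < \<infinity>"
    "((\<lambda>R. nsq (lborel \<Otimes>\<^sub>M M) (\<lambda>p. v p - ftp (cball 0 R) u p)) \<longlongrightarrow> 0) at_top"
proof -
  let ?M = "lborel \<Otimes>\<^sub>M M" and ?c = "ennreal ((2 * pi) ^ DIM('c))"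
  obtain v where [measurable]: "v \<in> borel_measurable ?M"
    and lim: "(\<lambda>n. nsq ?M (\<lambda>p. ftp (cball 0 (real n)) u p - v p)) \<longlonglongrightarrow> 0"
    by (rule nsq_complete[OF _ nsq_ftp_Cauchy[OF assms]]) auto
  have finF: "nsq ?M (ftp (cball 0 R) u) < \<infinity>" for R by (rule nsq_ftp_finite[OF assms])
  have lim': "((\<lambda>R. nsq ?M (\<lambda>p. v p - ftp (cball 0 R) u p)) \<longlongrightarrow> 0) at_top"
  proof (rule tendsto_0_squeeze_ennreal)
    fix R :: real
    \<comment> \<open>Completeness gives a limit along integer radii only; rounding R down transfers
      it to real radii at the cost of a tail beyond \<open>min R (real ?n)\<close>.\<close>
    let ?n = "nat \<lfloor>R\<rfloor>"
    show "nsq ?M (\<lambda>p. v p - ftp (cball 0 R) u p) \<le>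
        2 * nsq ?M (\<lambda>p. ftp (cball 0 (real ?n)) u p - v p) + 2 * (?c * tail u (min R (real ?n)))"
    proof -
      have "nsq ?M (\<lambda>p. v p - ftp (cball 0 R) u p) \<le> 2 * nsq ?M (\<lambda>p. v p - ftp (cball 0 (real ?n)) u p) +
          2 * nsq ?M (\<lambda>p. ftp (cball 0 (real ?n)) u p - ftp (cball 0 R) u p)"
        by (rule nsq_triangle) auto
      also have "nsq ?M (\<lambda>p. v p - ftp (cball 0 (real ?n)) u p) = nsq ?M (\<lambda>p. ftp (cball 0 (real ?n)) u p - v p)"
        by (rule nsq_cong) (simp add: norm_minus_commute)
      also have "nsq ?M (\<lambda>p. ftp (cball 0 (real ?n)) u p - ftp (cball 0 R) u p) \<le> ?c * tail u (min R (real ?n))"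
        by (rule ftp_diff_le_tail[OF assms]) auto
      finally show ?thesis by (simp add: add_left_mono mult_left_mono)
    qed
  next
    have n: "filterlim (\<lambda>R::real. nat \<lfloor>R\<rfloor>) at_top at_top"
      by (intro filterlim_compose[OF filterlim_nat_sequentially] filterlim_floor_sequentially)
    have r: "filterlim (\<lambda>R::real. min R (real (nat \<lfloor>R\<rfloor>))) at_top at_top"
      by (intro filterlim_at_top_mono[OF filterlim_tendsto_add_at_top[OF tendsto_const[of "-1"] filterlim_ident]]
          always_eventually allI) linarith
    have "((\<lambda>R. 2 * nsq ?M (\<lambda>p. ftp (cball 0 (real (nat \<lfloor>R\<rfloor>))) u p - v p) +
        2 * (?c * tail u (min R (real (nat \<lfloor>R\<rfloor>))))) \<longlongrightarrow> 2 * 0 + 2 * (?c * 0)) at_top"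
      by (intro tendsto_add tendsto_mult_ennreal tendsto_const filterlim_compose[OF lim n]
          filterlim_compose[OF tail_tendsto[OF assms] r]) auto
    then show "((\<lambda>R. 2 * nsq ?M (\<lambda>p. ftp (cball 0 (real (nat \<lfloor>R\<rfloor>))) u p - v p) +
        2 * (?c * tail u (min R (real (nat \<lfloor>R\<rfloor>))))) \<longlongrightarrow> 0) at_top" by simp
  qed
  have "nsq ?M v < \<infinity>"
  proof -
    from order_tendstoD(2)[OF lim', of 1] obtain R where R: "nsq ?M (\<lambda>p. v p - ftp (cball 0 R) u p) < 1"
      by (auto simp: eventually_at_top_linorder)
    show ?thesis
      using nsq_add_finite(1)[OF _ _ _ finF[of R], of "\<lambda>p. v p - ftp (cball 0 R) u p"]
        order.strict_trans[OF R ennreal_one_less_top] by simp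
  qed
  with lim' show thesis by (intro that[of v]) auto
qed

text \<open>The kernel is symmetric in y and \<eta>, so the transform is its own transpose for the
  bilinear pairing. The two truncations make the slices integrable, so that Fubini's theorem
  applies.\<close>

lemma ftp_duality:
  fixes u w :: "'c::euclidean_space \<times> 'a \<Rightarrow> complex"
  assumes [measurable]: "u \<in> borel_measurable (lborel \<Otimes>\<^sub>M M)" "w \<in> borel_measurable (lborel \<Otimes>\<^sub>M M)"
    and fin: "nsq (lborel \<Otimes>\<^sub>M M) u < \<infinity>" "nsq (lborel \<Otimes>\<^sub>M M) w < \<infinity>"
  shows "(LINT p|(lborel \<Otimes>\<^sub>M M). ftp (cball 0 R) u p * (indicator (cball 0 S) (fst p) * w p)) =
    (LINT p|(lborel \<Otimes>\<^sub>M M). (indicator (cball 0 R) (fst p) * u p) * ftp (cball 0 S) w p)"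
proof -
  let ?M = "lborel \<Otimes>\<^sub>M M"
  have finI: "nsq ?M (\<lambda>p. indicator (cball 0 R) (fst p) * u p) < \<infinity>" if "nsq ?M u < \<infinity>"
    for R and u :: "'c::euclidean_space \<times> 'a \<Rightarrow> complex"
    by (rule order.strict_trans1[OF nsq_indicator_le that])
  let ?l = "\<lambda>\<eta> x. ftp (cball 0 R) u (\<eta>, x) * (indicator (cball 0 S) \<eta> * w (\<eta>, x))"
  let ?r = "\<lambda>y x. (indicator (cball 0 R) y * u (y, x)) * ftp (cball 0 S) w (y, x)"
  have "(LINT p|?M. ftp (cball 0 R) u p * (indicator (cball 0 S) (fst p) * w p)) = (LINT x|M. LINT \<eta>|lborel. ?l \<eta> x)"
    using nsq_integrable_mult(1)[OF _ _ nsq_ftp_finite[OF assms(1) fin(1), of R] finI[OF fin(2), of S]]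
    by (subst P.integral_snd) (auto simp: case_prod_unfold)
  also have "\<dots> = (LINT x|M. LINT y|lborel. ?r y x)"
  proof (rule integral_cong_AE)
    show "(\<lambda>x. LINT \<eta>|lborel. ?l \<eta> x) \<in> borel_measurable M" by measurable
    show "(\<lambda>x. LINT y|lborel. ?r y x) \<in> borel_measurable M" by measurable
    show "AE x in M. (LINT \<eta>|lborel. ?l \<eta> x) = (LINT y|lborel. ?r y x)"
      using bounded_slice_integrable[OF assms(1) fin(1) sets_borel_cball order.refl, of R]
        bounded_slice_integrable[OF assms(2) fin(2) sets_borel_cball order.refl, of S]
    proof eventually_elim
      fix x
      assume i: "integrable lborel (\<lambda>y. indicator (cball 0 R) y * u (y, x))"
        "integrable lborel (\<lambda>y. indicator (cball 0 S) y * w (y, x))"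
      define f where "f y = indicator (cball 0 R) y * u (y, x)" for y
      define g where "g y = indicator (cball 0 S) y * w (y, x)" for y
      have f: "integrable lborel f" and g: "integrable lborel g" using i by (simp_all add: f_def[abs_def] g_def[abs_def])
      note [measurable] = borel_measurable_integrable[OF f] borel_measurable_integrable[OF g]
      have "(LINT \<eta>|lborel. ?l \<eta> x) = (LINT \<eta>|lborel. LINT y|lborel. g \<eta> * (cis (- (y \<bullet> \<eta>)) * f y))"
      proof (rule Bochner_Integration.integral_cong[OF refl])
        fix \<eta>
        have "?l \<eta> x = g \<eta> * ftr f \<eta>" by (simp add: ftp_def f_def[abs_def] g_def mult.commute)
        also have "\<dots> = (LINT y|lborel. g \<eta> * (cis (- (y \<bullet> \<eta>)) * f y))"
          unfolding ftr_def using integrable_cis_mult(2)[OF f] by simp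
        finally show "?l \<eta> x = (LINT y|lborel. g \<eta> * (cis (- (y \<bullet> \<eta>)) * f y))" .
      qed
      also have "\<dots> = (LINT y|lborel. LINT \<eta>|lborel. g \<eta> * (cis (- (y \<bullet> \<eta>)) * f y))"
        by (rule lborel_pair.Fubini_integral[symmetric], subst case_prod_unfold,
            rule lborel_pair.integrable_product_bound[OF g f]) (auto simp: norm_mult)
      also have "\<dots> = (LINT y|lborel. LINT \<eta>|lborel. f y * (cis (- (\<eta> \<bullet> y)) * g \<eta>))"
        by (intro Bochner_Integration.integral_cong refl) (simp add: mult_ac inner_commute)
      also have "\<dots> = (LINT y|lborel. ?r y x)"
      proof (rule Bochner_Integration.integral_cong[OF refl])
        fix y
        have "?r y x = f y * ftr g y" by (simp add: ftp_def g_def[abs_def] f_def)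
        also have "\<dots> = (LINT \<eta>|lborel. f y * (cis (- (\<eta> \<bullet> y)) * g \<eta>))"
          unfolding ftr_def using integrable_cis_mult(2)[OF g] by simp
        finally show "(LINT \<eta>|lborel. f y * (cis (- (\<eta> \<bullet> y)) * g \<eta>)) = ?r y x" ..
      qed
      finally show "(LINT \<eta>|lborel. ?l \<eta> x) = (LINT y|lborel. ?r y x)" .
    qed
  qed
  also have "\<dots> = (LINT p|?M. (indicator (cball 0 R) (fst p) * u p) * ftp (cball 0 S) w p)"
    using nsq_integrable_mult(1)[OF _ _ finI[OF fin(1), of R] nsq_ftp_finite[OF assms(2) fin(2), of S]]
    by (subst P.integral_snd) (auto simp: case_prod_unfold)
  finally show ?thesis .
qed

text \<open>
  For the candidate \<open>h\<close>, the limit of the inverse transforms of the truncations of \<open>v\<close>, the Plancherel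
  identity and the duality relation give \<open>\<parallel>F\<^sub>S h - v\<parallel>\<^sup>2 = \<parallel>v\<parallel>\<^sup>2 - c \<parallel>1\<^sub>S h\<parallel>\<^sup>2\<close>, which tends to \<open>0\<close>.
\<close>

lemma ftp_surjective:
  fixes v :: "'c::euclidean_space \<times> 'a \<Rightarrow> complex"
  assumes [measurable]: "v \<in> borel_measurable (lborel \<Otimes>\<^sub>M M)" and fin: "nsq (lborel \<Otimes>\<^sub>M M) v < \<infinity>"
  obtains h where "h \<in> borel_measurable (lborel \<Otimes>\<^sub>M M)" "nsq (lborel \<Otimes>\<^sub>M M) h < \<infinity>"
    "((\<lambda>R. nsq (lborel \<Otimes>\<^sub>M M) (\<lambda>p. v p - ftp (cball 0 R) h p)) \<longlongrightarrow> 0) at_top"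
proof -
  let ?M = "lborel \<Otimes>\<^sub>M M"
  define c where "c = (2 * pi) ^ DIM('c)"
  have c: "c > 0" by (simp add: c_def)
  let ?v = "\<lambda>p. cnj (v p)"
  have vc [measurable]: "?v \<in> borel_measurable ?M" by measurable
  have finc: "nsq ?M ?v < \<infinity>" using fin by simp
  define k where "k n p = ftp (cball 0 (real n)) ?v p" for n p
  have [measurable]: "k n \<in> borel_measurable ?M" for n unfolding k_def by measurable
  obtain K where [measurable]: "K \<in> borel_measurable ?M" and Kfin: "nsq ?M K < \<infinity>"
    and Klim: "((\<lambda>R. nsq ?M (\<lambda>p. K p - ftp (cball 0 R) ?v p)) \<longlongrightarrow> 0) at_top"
    by (rule ftp_exists[OF vc finc])
  have kK: "(\<lambda>n. nsq ?M (\<lambda>p. k n p - K p)) \<longlonglongrightarrow> 0"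
    using filterlim_compose[OF Klim filterlim_real_sequentially]
    by (simp add: k_def nsq_def norm_minus_commute)
  have nsqk: "nsq ?M (k n) = ennreal c * nsq ?M (\<lambda>p. indicator (cball 0 (real n)) (fst p) * ?v p)" for n
    unfolding k_def c_def by (rule ftp_plancherel[OF vc finc]) auto
  have trunc: "(\<lambda>n. nsq ?M (\<lambda>p. indicator (cball 0 (real n)) (fst p) * u p - u p)) \<longlonglongrightarrow> 0"
    if [measurable]: "u \<in> borel_measurable ?M" and "nsq ?M u < \<infinity>" for u :: "'c \<times> 'a \<Rightarrow> complex"
  proof -
    have "nsq ?M (\<lambda>p. indicator (cball 0 (real n)) (fst p) * u p - u p) = tail u (real n)" for n
      unfolding tail_def by (rule nsq_cong) (auto simp: indicator_def)
    then show ?thesis using filterlim_compose[OF tail_tendsto[OF that] filterlim_real_sequentially] by simp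
  qed
  have nsqK: "nsq ?M K = ennreal c * nsq ?M v"
  proof (rule LIMSEQ_unique)
    show "(\<lambda>n. nsq ?M (k n)) \<longlonglongrightarrow> nsq ?M K" by (rule nsq_tendsto[OF _ _ Kfin kK]) measurable
    have "(\<lambda>n. nsq ?M (\<lambda>p. indicator (cball 0 (real n)) (fst p) * ?v p)) \<longlonglongrightarrow> nsq ?M ?v"
      by (rule nsq_tendsto[OF _ _ finc trunc[OF vc finc]]) measurable
    from tendsto_mult_ennreal[OF tendsto_const[of "ennreal c"] this] c
    show "(\<lambda>n. nsq ?M (k n)) \<longlonglongrightarrow> ennreal c * nsq ?M v" by (simp add: nsqk)
  qed
  \<comment> \<open>The inverse kernel is the conjugate of the forward one, so the inverse transform
    of v is the conjugate of the transform K of \<open>cnj v\<close>, divided by the Plancherel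
    constant.\<close>
  define h where "h p = of_real (1 / c) * cnj (K p)" for p
  have hm [measurable]: "h \<in> borel_measurable ?M" unfolding h_def by measurable
  have nsqh: "nsq ?M h = ennreal (1 / c) * nsq ?M v"
  proof -
    have "nsq ?M h = ennreal ((1 / c)\<^sup>2) * (ennreal c * nsq ?M v)"
      unfolding h_def using c by (subst nsq_cmult) (auto simp: nsqK norm_divide)
    also have "\<dots> = ennreal ((1 / c)\<^sup>2 * c) * nsq ?M v"
      using c by (simp add: ennreal_mult mult.assoc)
    also have "(1 / c)\<^sup>2 * c = 1 / c" using c by (simp add: power2_eq_square)
    finally show ?thesis .
  qed
  then have hfin: "nsq ?M h < \<infinity>" using fin by (simp add: ennreal_mult_less_top)
  define F where "F R p = ftp (cball 0 R) h p" for R p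
  have [measurable]: "F R \<in> borel_measurable ?M" for R unfolding F_def by measurable
  define hR where "hR R p = indicator (cball 0 R) (fst p) * h p" for R p
  have [measurable]: "hR R \<in> borel_measurable ?M" for R unfolding hR_def by measurable
  have hRfin: "nsq ?M (hR R) < \<infinity>" for R
    unfolding hR_def by (rule order.strict_trans1[OF nsq_indicator_le hfin])
  have nsqF: "nsq ?M (F R) = ennreal c * nsq ?M (hR R)" for R
    unfolding F_def hR_def c_def by (rule ftp_plancherel[OF hm hfin _ order.refl]) auto
  have Ffin: "nsq ?M (F R) < \<infinity>" for R
    using hRfin[of R] by (simp add: nsqF ennreal_mult_less_top)
  \<comment> \<open>By duality the pairing of \<open>F R\<close> with \<open>cnj v\<close> equals
    that of \<open>hR R\<close> with K, and K is c times the conjugate of h. So \<open>F R\<close>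
    is related to v like an orthogonal projection.\<close>
  have inner: "(LINT p|?M. F R p * ?v p) = of_real (enn2real (nsq ?M (F R)))" for R
  proof (rule LIMSEQ_unique)
    have "(\<lambda>n. LINT p|?M. (indicator (cball 0 (real n)) (fst p) * ?v p) * F R p) \<longlonglongrightarrow> (LINT p|?M. ?v p * F R p)"
      by (rule nsq_inner_tendsto[OF _ _ _ order.strict_trans1[OF nsq_indicator_le finc] finc Ffin trunc[OF vc finc]]) measurable
    then show "(\<lambda>n. LINT p|?M. F R p * (indicator (cball 0 (real n)) (fst p) * ?v p)) \<longlonglongrightarrow> (LINT p|?M. F R p * ?v p)"
      by (simp only: mult.commute)
    have kfin: "nsq ?M (k n) < \<infinity>" for n
      unfolding k_def by (rule nsq_ftp_finite[OF vc finc])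
    have "(\<lambda>n. LINT p|?M. k n p * hR R p) \<longlonglongrightarrow> (LINT p|?M. K p * hR R p)"
      by (rule nsq_inner_tendsto[OF _ _ _ kfin Kfin hRfin kK]) measurable
    moreover have "(LINT p|?M. F R p * (indicator (cball 0 (real n)) (fst p) * ?v p)) = (LINT p|?M. k n p * hR R p)" for n
      unfolding F_def k_def hR_def using ftp_duality[OF hm vc hfin finc, of R "real n"] by (simp add: mult_ac)
    moreover have "(LINT p|?M. K p * hR R p) = of_real (enn2real (nsq ?M (F R)))"
    proof -
      have e: "K p * hR R p = of_real c * (hR R p * cnj (hR R p))" for p
      proof -
        have "K p = of_real c * cnj (h p)" using c by (simp add: h_def)
        then show ?thesis by (auto simp: hR_def indicator_def)
      qed
      have "(LINT p|?M. K p * hR R p) = of_real c * (LINT p|?M. hR R p * cnj (hR R p))"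
        unfolding e by (rule integral_mult_right_zero)
      also have "\<dots> = of_real (c * enn2real (nsq ?M (hR R)))"
        by (simp add: nsq_eq_inner[OF _ hRfin, symmetric])
      also have "c * enn2real (nsq ?M (hR R)) = enn2real (nsq ?M (F R))"
        using c by (simp add: nsqF enn2real_mult)
      finally show ?thesis .
    qed
    ultimately show "(\<lambda>n. LINT p|?M. F R p * (indicator (cball 0 (real n)) (fst p) * ?v p)) \<longlonglongrightarrow> of_real (enn2real (nsq ?M (F R)))"
      by simp
  qed
  have dist: "nsq ?M (\<lambda>p. v p - F R p) = ennreal (enn2real (nsq ?M v) - enn2real (nsq ?M (F R)))" for R
  proof -
    let ?d = "\<lambda>p. v p - F R p"
    have dfin: "nsq ?M ?d < \<infinity>" by (rule nsq_add_finite(2)[OF _ _ fin Ffin]) measurable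
    have i: "integrable ?M (\<lambda>p. f p * cnj (g p))" if [measurable]: "f \<in> borel_measurable ?M" "g \<in> borel_measurable ?M"
      and "nsq ?M f < \<infinity>" "nsq ?M g < \<infinity>" for f g
      by (rule nsq_integrable_mult(1)) (use that in simp_all)
    have "of_real (enn2real (nsq ?M ?d)) = (LINT p|?M. ?d p * cnj (?d p))"
      by (rule nsq_eq_inner[OF _ dfin]) measurable
    also have "\<dots> = (LINT p|?M. ((v p * cnj (v p) - F R p * cnj (v p)) - v p * cnj (F R p)) + F R p * cnj (F R p))"
      by (simp add: algebra_simps)
    also have "\<dots> = (LINT p|?M. v p * cnj (v p)) - (LINT p|?M. F R p * cnj (v p)) - (LINT p|?M. v p * cnj (F R p)) + (LINT p|?M. F R p * cnj (F R p))"
      using i[of v v] i[of "F R" v] i[of v "F R"] i[of "F R" "F R"] fin Ffin[of R] by simp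
    also have "(LINT p|?M. v p * cnj (F R p)) = cnj (LINT p|?M. F R p * cnj (v p))"
      by (subst Bochner_Integration.integral_cnj[symmetric]) (simp add: mult.commute)
    also have "(LINT p|?M. F R p * cnj (v p)) = of_real (enn2real (nsq ?M (F R)))" by (rule inner)
    also have "(LINT p|?M. v p * cnj (v p)) = of_real (enn2real (nsq ?M v))"
      by (rule nsq_eq_inner[symmetric, OF _ fin]) measurable
    also have "(LINT p|?M. F R p * cnj (F R p)) = of_real (enn2real (nsq ?M (F R)))"
      by (rule nsq_eq_inner[symmetric, OF _ Ffin]) measurable
    finally have "complex_of_real (enn2real (nsq ?M ?d)) = of_real (enn2real (nsq ?M v) - enn2real (nsq ?M (F R)))"
      by simp
    then have "enn2real (nsq ?M ?d) = enn2real (nsq ?M v) - enn2real (nsq ?M (F R))"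
      by (simp only: of_real_eq_iff)
    then show ?thesis using dfin by (metis ennreal_enn2real infinity_ennreal_def)
  qed
  have "((\<lambda>R. nsq ?M (F R)) \<longlongrightarrow> nsq ?M v) at_top"
  proof -
    have "nsq ?M (\<lambda>p. hR R p - h p) = tail h R" for R
      unfolding tail_def by (rule nsq_cong) (auto simp: indicator_def hR_def)
    then have "((\<lambda>R. nsq ?M (\<lambda>p. hR R p - h p)) \<longlongrightarrow> 0) at_top"
      using tail_tendsto[OF hm hfin] by simp
    from nsq_tendsto[OF _ hm hfin this] have "((\<lambda>R. nsq ?M (hR R)) \<longlongrightarrow> nsq ?M h) at_top" by simp
    from tendsto_mult_ennreal[OF tendsto_const[of "ennreal c"] this] c
    have "((\<lambda>R. nsq ?M (F R)) \<longlongrightarrow> ennreal c * nsq ?M h) at_top" by (simp add: nsqF)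
    also have "ennreal c * nsq ?M h = nsq ?M v"
      using c by (simp add: nsqh mult.assoc[symmetric] ennreal_mult[symmetric])
    finally show ?thesis .
  qed
  then have "((\<lambda>R. enn2real (nsq ?M (F R))) \<longlongrightarrow> enn2real (nsq ?M v)) at_top"
    using fin by (intro tendsto_enn2real) (auto simp: )
  then have "((\<lambda>R. ennreal (enn2real (nsq ?M v) - enn2real (nsq ?M (F R)))) \<longlongrightarrow> ennreal (enn2real (nsq ?M v) - enn2real (nsq ?M v))) at_top"
    by (intro tendsto_ennrealI tendsto_diff tendsto_const)
  then have "((\<lambda>R. nsq ?M (\<lambda>p. v p - F R p)) \<longlongrightarrow> 0) at_top" by (simp add: dist)
  then show thesis using hfin by (intro that[of h]) (auto simp: F_def)
qed

end

section \<open>Finite combinations of point evaluations\<close>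

text \<open>Generated by single evaluations, so that linearity, measurability in a parameter and
  passage through moments follow by rule induction. The evaluation points are the t > 0 for the
  coefficient functionals \<open>cf\<close>, and pairs of end points of intervals in
  \<open>dual_functions\<close>.\<close>

inductive fcomb :: "'x set \<Rightarrow> (('x \<Rightarrow> complex) \<Rightarrow> complex) \<Rightarrow> bool" for X where
  fcomb_zero: "fcomb X (\<lambda>f. 0)"
| fcomb_step: "fcomb X L \<Longrightarrow> x \<in> X \<Longrightarrow> fcomb X (\<lambda>f. L f + c * f x)"

lemma fcomb_eval: "x \<in> X \<Longrightarrow> fcomb X (\<lambda>f. f x)"
  using fcomb_step[OF fcomb_zero, of x X 1] by simp

lemma fcomb_add: "fcomb X L' \<Longrightarrow> fcomb X L \<Longrightarrow> fcomb X (\<lambda>f. L f + L' f)"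
proof (induction rule: fcomb.induct)
  case (fcomb_step L' x c)
  from fcomb.fcomb_step[OF fcomb_step.IH[OF fcomb_step.prems] fcomb_step.hyps(2), of c]
  show ?case by (simp add: add.assoc)
qed simp

lemma fcomb_scale: "fcomb X L \<Longrightarrow> fcomb X (\<lambda>f. k * L f)"
proof (induction rule: fcomb.induct)
  case fcomb_zero
  then show ?case using fcomb.fcomb_zero by simp
next
  case (fcomb_step L x c)
  from fcomb.fcomb_step[OF fcomb_step.IH fcomb_step.hyps(2), of "k * c"]
  show ?case by (simp add: algebra_simps)
qed

lemma fcomb_sum: "finite I \<Longrightarrow> (\<And>i. i \<in> I \<Longrightarrow> fcomb X (L i)) \<Longrightarrow> fcomb X (\<lambda>f. \<Sum>i\<in>I. L i f)"
  by (induction I rule: finite_induct) (auto intro: fcomb_zero fcomb_add)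

lemma fcomb_linear: "fcomb X L \<Longrightarrow> L (\<lambda>x. f x + c * g x) = L f + c * L g"
  by (induction rule: fcomb.induct) (auto simp: algebra_simps)

lemma fcomb_zero_arg: "fcomb X L \<Longrightarrow> L (\<lambda>x. 0) = 0"
  by (induction rule: fcomb.induct) auto

lemma fcomb_sum_arg:
  assumes L: "fcomb X L"
  shows "finite I \<Longrightarrow> L (\<lambda>x. \<Sum>i\<in>I. c i * f i x) = (\<Sum>i\<in>I. c i * L (f i))"
proof (induction I rule: finite_induct)
  case (insert i I)
  have "L (\<lambda>x. \<Sum>i\<in>insert i I. c i * f i x) = L (\<lambda>x. (\<Sum>i\<in>I. c i * f i x) + c i * f i x)"
    using insert by (simp add: add.commute)
  then show ?case using insert fcomb_linear[OF L] by simp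
qed (simp add: fcomb_zero_arg[OF L])

lemma fcomb_cong: "fcomb X L \<Longrightarrow> (\<And>x. x \<in> X \<Longrightarrow> f x = g x) \<Longrightarrow> L f = L g"
  by (induction rule: fcomb.induct) auto

lemma fcomb_measurable:
  "fcomb X L \<Longrightarrow> (\<And>x. x \<in> X \<Longrightarrow> (\<lambda>y. f y x) \<in> borel_measurable M) \<Longrightarrow> (\<lambda>y. L (f y)) \<in> borel_measurable M"
  by (induction rule: fcomb.induct) auto

text \<open>Linearly independent functions on X are separated by finitely many evaluations. The
  induction resembles Gauss-Jordan elimination: what remains of the new function after subtracting
  its components along the old ones is nonzero at some point, and evaluation there yields the new
  dual functional.\<close>

lemma dual_family:
  fixes \<phi> :: "'i \<Rightarrow> 'x \<Rightarrow> complex"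
  assumes "finite I"
    and "\<And>c. (\<And>x. x \<in> X \<Longrightarrow> (\<Sum>i\<in>I. c i * \<phi> i x) = 0) \<Longrightarrow> \<forall>i\<in>I. c i = 0"
  shows "\<exists>L. \<forall>i\<in>I. fcomb X (L i) \<and> (\<forall>j\<in>I. L i (\<phi> j) = (if i = j then 1 else 0))"
  using assms
proof (induction I rule: finite_induct)
  case (insert k I)
  have "\<exists>L. \<forall>i\<in>I. fcomb X (L i) \<and> (\<forall>j\<in>I. L i (\<phi> j) = (if i = j then 1 else 0))"
  proof (rule insert.IH)
    fix c assume c: "\<And>x. x \<in> X \<Longrightarrow> (\<Sum>i\<in>I. c i * \<phi> i x) = 0"
    have "\<forall>i\<in>insert k I. (c(k := 0)) i = 0"
    proof (rule insert.prems)
      fix x assume "x \<in> X"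
      have "(\<Sum>i\<in>insert k I. (c(k := 0)) i * \<phi> i x) = (\<Sum>i\<in>I. c i * \<phi> i x)"
        using insert.hyps by (auto intro!: sum.cong)
      then show "(\<Sum>i\<in>insert k I. (c(k := 0)) i * \<phi> i x) = 0" using c[OF \<open>x \<in> X\<close>] by simp
    qed
    then show "\<forall>i\<in>I. c i = 0" using insert.hyps by (metis fun_upd_other insertCI)
  qed
  then obtain L where L: "\<And>i. i \<in> I \<Longrightarrow> fcomb X (L i)"
    and Ld: "\<And>i j. i \<in> I \<Longrightarrow> j \<in> I \<Longrightarrow> L i (\<phi> j) = (if i = j then 1 else 0)" by blast
  define \<psi> where "\<psi> f x = f x - (\<Sum>i\<in>I. L i f * \<phi> i x)" for f x
  have "\<exists>x\<in>X. \<psi> (\<phi> k) x \<noteq> 0"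
  proof (rule ccontr)
    assume "\<not> (\<exists>x\<in>X. \<psi> (\<phi> k) x \<noteq> 0)"
    then have 0: "\<psi> (\<phi> k) x = 0" if "x \<in> X" for x using that by blast
    have "\<forall>i\<in>insert k I. (\<lambda>i. if i = k then 1 else - L i (\<phi> k)) i = 0"
    proof (rule insert.prems)
      fix x assume "x \<in> X"
      have "(\<Sum>i\<in>I. (if i = k then 1 else - L i (\<phi> k)) * \<phi> i x) = (\<Sum>i\<in>I. - (L i (\<phi> k) * \<phi> i x))"
        using insert.hyps by (intro sum.cong) auto
      then show "(\<Sum>i\<in>insert k I. (if i = k then 1 else - L i (\<phi> k)) * \<phi> i x) = 0"
        using 0[OF \<open>x \<in> X\<close>] insert.hyps by (simp add: \<psi>_def sum_negf)
    qed
    then show False by auto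
  qed
  then obtain x0 where x0: "x0 \<in> X" "\<psi> (\<phi> k) x0 \<noteq> 0" by blast
  define Lk where "Lk f = inverse (\<psi> (\<phi> k) x0) * \<psi> f x0" for f
  have "fcomb X (\<lambda>f. f x0 + (\<Sum>i\<in>I. (- \<phi> i x0) * L i f))"
    by (intro fcomb_add fcomb_sum fcomb_scale fcomb_eval x0 L insert.hyps)
  from fcomb_scale[OF this, of "inverse (\<psi> (\<phi> k) x0)"]
  have Lk: "fcomb X Lk"
    by (simp add: Lk_def[abs_def] \<psi>_def sum_negf mult.commute)
  have Lkk: "Lk (\<phi> k) = 1" using x0 by (simp add: Lk_def)
  have Lkj: "Lk (\<phi> j) = 0" if "j \<in> I" for j
  proof -
    have "(\<Sum>i\<in>I. L i (\<phi> j) * \<phi> i x0) = (\<Sum>i\<in>I. if i = j then \<phi> j x0 else 0)"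
      using that Ld by (intro sum.cong) auto
    then show ?thesis using that insert.hyps by (simp add: Lk_def \<psi>_def)
  qed
  \<comment> \<open>The old functionals are corrected so as to vanish on the new function.\<close>
  define L' where "L' i f = (if i = k then Lk f else L i f + (- L i (\<phi> k)) * Lk f)" for i f
  show ?case
  proof (intro exI[of _ L'] ballI conjI)
    fix i assume i: "i \<in> insert k I"
    show "fcomb X (L' i)"
    proof (cases "i = k")
      case True then show ?thesis using Lk by (simp add: L'_def[abs_def])
    next
      case False
      then have "fcomb X (\<lambda>f. L i f + (- L i (\<phi> k)) * Lk f)"
        using i by (intro fcomb_add fcomb_scale L Lk) auto
      then show ?thesis using False by (simp add: L'_def[abs_def])
    qed
    fix j assume j: "j \<in> insert k I"
    show "L' i (\<phi> j) = (if i = j then 1 else 0)"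
      using i j Lkk Lkj Ld insert.hyps by (auto simp: L'_def)
  qed
qed simp

section \<open>The scalar Fourier transform on square integrable functions\<close>

text \<open>The scalar counterpart of \<open>is_ft\<close>; a relation, since the transform g is
  determined only almost everywhere.\<close>

definition sft :: "('a::euclidean_space \<Rightarrow> complex) \<Rightarrow> ('a \<Rightarrow> complex) \<Rightarrow> bool" where
  "sft h g \<longleftrightarrow> ((\<lambda>R. nsq lborel (\<lambda>\<eta>. g \<eta> - ftr (\<lambda>y. indicator (cball 0 R) y * h y) \<eta>)) \<longlongrightarrow> 0) at_top"

lemma truncated_integrable:
  fixes h :: "'a::euclidean_space \<Rightarrow> complex"
  assumes [measurable]: "h \<in> borel_measurable borel" and fin: "nsq lborel h < \<infinity>"
  shows "integrable lborel (\<lambda>y. indicator (cball 0 R) y * h y)"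
  by (rule nsq_bounded_support_integrable(1)[where R = R])
     (use order.strict_trans1[OF nsq_indicator_le[where g = "\<lambda>x. x" and B = "\<lambda>_. cball 0 R"] fin] in auto)

lemma sft_surjective:
  fixes g :: "'a::euclidean_space \<Rightarrow> complex"
  assumes [measurable]: "g \<in> borel_measurable borel" and "nsq lborel g < \<infinity>"
  obtains h where "h \<in> borel_measurable borel" "nsq lborel h < \<infinity>" "sft h g"
proof -
  \<comment> \<open>A one-point parameter space turns the parametrised theorem into the scalar
    one.\<close>
  let ?U = "count_space {()}"
  interpret sigma_finite_measure ?U by (rule sigma_finite_measure_count_space_finite) simp
  have nsqU: "nsq (lborel \<Otimes>\<^sub>M ?U) u = nsq lborel (\<lambda>y. u (y, ()))" if "u \<in> borel_measurable (lborel \<Otimes>\<^sub>M ?U)"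
    for u :: "'a \<times> unit \<Rightarrow> complex"
    unfolding nsq_pair[OF that] by (subst nn_integral_count_space_finite) auto
  have m: "(\<lambda>p. g (fst p)) \<in> borel_measurable (lborel \<Otimes>\<^sub>M ?U)" by measurable
  have "nsq (lborel \<Otimes>\<^sub>M ?U) (\<lambda>p. g (fst p)) < \<infinity>" unfolding nsqU[OF m] using assms by simp
  from ftp_surjective[OF m this] obtain h where [measurable]: "h \<in> borel_measurable (lborel \<Otimes>\<^sub>M ?U)"
    and fin: "nsq (lborel \<Otimes>\<^sub>M ?U) h < \<infinity>"
    and lim: "((\<lambda>R. nsq (lborel \<Otimes>\<^sub>M ?U) (\<lambda>p. g (fst p) - ftp (cball 0 R) h p)) \<longlongrightarrow> 0) at_top" by blast
  show thesis
  proof (rule that[of "\<lambda>y. h (y, ())"])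
    show "(\<lambda>y. h (y, ())) \<in> borel_measurable borel" by measurable
    show "nsq lborel (\<lambda>y. h (y, ())) < \<infinity>" using fin by (simp add: nsqU)
    have "nsq (lborel \<Otimes>\<^sub>M ?U) (\<lambda>p. g (fst p) - ftp (cball 0 R) h p) =
        nsq lborel (\<lambda>\<eta>. g \<eta> - ftr (\<lambda>y. indicator (cball 0 R) y * h (y, ())) \<eta>)" for R
      by (subst nsqU) (simp_all add: ftp_def)
    then show "sft (\<lambda>y. h (y, ())) g" using lim by (simp add: sft_def)
  qed
qed

lemma sft_unique:
  fixes h :: "'a::euclidean_space \<Rightarrow> complex"
  assumes [measurable]: "h \<in> borel_measurable borel" "g \<in> borel_measurable borel" "g' \<in> borel_measurable borel"
    and "sft h g" "sft h g'"
  shows "AE \<eta> in lborel. g \<eta> = g' \<eta>"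
proof -
  let ?F = "\<lambda>R. ftr (\<lambda>y. indicator (cball 0 R) y * h y)"
  have lim: "((\<lambda>R. 2 * nsq lborel (\<lambda>\<eta>. g \<eta> - ?F R \<eta>) + 2 * nsq lborel (\<lambda>\<eta>. g' \<eta> - ?F R \<eta>)) \<longlongrightarrow> 2 * 0 + 2 * 0) at_top"
    using assms(4,5) unfolding sft_def by (intro tendsto_add tendsto_mult_ennreal tendsto_const) auto
  have le: "nsq lborel (\<lambda>\<eta>. g \<eta> - g' \<eta>) \<le> 2 * nsq lborel (\<lambda>\<eta>. g \<eta> - ?F R \<eta>) + 2 * nsq lborel (\<lambda>\<eta>. g' \<eta> - ?F R \<eta>)" for R
  proof -
    have "nsq lborel (\<lambda>\<eta>. g \<eta> - g' \<eta>) \<le> 2 * nsq lborel (\<lambda>\<eta>. g \<eta> - ?F R \<eta>) + 2 * nsq lborel (\<lambda>\<eta>. ?F R \<eta> - g' \<eta>)"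
      by (rule nsq_triangle) auto
    also have "nsq lborel (\<lambda>\<eta>. ?F R \<eta> - g' \<eta>) = nsq lborel (\<lambda>\<eta>. g' \<eta> - ?F R \<eta>)"
      by (rule nsq_cong) (simp add: norm_minus_commute)
    finally show ?thesis .
  qed
  have "nsq lborel (\<lambda>\<eta>. g \<eta> - g' \<eta>) \<le> 2 * 0 + 2 * 0"
    by (rule tendsto_lowerbound[OF lim always_eventually[OF allI[OF le]]]) simp
  then have "nsq lborel (\<lambda>\<eta>. g \<eta> - g' \<eta>) = 0" by simp
  then show ?thesis
    unfolding nsq_def by (subst (asm) nn_integral_0_iff_AE) auto
qed

lemma sft_add_scale:
  fixes h h' :: "'a::euclidean_space \<Rightarrow> complex"
  assumes [measurable]: "h \<in> borel_measurable borel" "h' \<in> borel_measurable borel"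
      "g \<in> borel_measurable borel" "g' \<in> borel_measurable borel"
    and fin: "nsq lborel h < \<infinity>" "nsq lborel h' < \<infinity>" and ft: "sft h g" "sft h' g'"
  shows "sft (\<lambda>y. h y + c * h' y) (\<lambda>\<eta>. g \<eta> + c * g' \<eta>)"
proof -
  let ?I = "\<lambda>R y. indicator (cball 0 R) y :: complex"
  have lin: "ftr (\<lambda>y. ?I R y * (h y + c * h' y)) \<eta> = ftr (\<lambda>y. ?I R y * h y) \<eta> + c * ftr (\<lambda>y. ?I R y * h' y) \<eta>" for R \<eta>
  proof -
    note i = integrable_cis_mult(2)[OF truncated_integrable[OF assms(1) fin(1), of R], of \<eta>]
      integrable_cis_mult(2)[OF truncated_integrable[OF assms(2) fin(2), of R], of \<eta>]
    have e: "cis (- (x \<bullet> \<eta>)) * (?I R x * (h x + c * h' x)) =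
        cis (- (x \<bullet> \<eta>)) * (?I R x * h x) + c * (cis (- (x \<bullet> \<eta>)) * (?I R x * h' x))" for x
      by (simp add: algebra_simps)
    show ?thesis unfolding ftr_def e using i by simp
  qed
  have split: "g \<eta> + c * g' \<eta> - (a + c * b) = (g \<eta> - a) + c * (g' \<eta> - b)" for \<eta> a b
    by (simp add: algebra_simps)
  show ?thesis
    unfolding sft_def lin split
  proof (rule tendsto_0_squeeze_ennreal)
    fix R
    have "nsq lborel (\<lambda>\<eta>. (g \<eta> - ftr (\<lambda>y. ?I R y * h y) \<eta>) + c * (g' \<eta> - ftr (\<lambda>y. ?I R y * h' y) \<eta>)) \<le>
      2 * nsq lborel (\<lambda>\<eta>. g \<eta> - ftr (\<lambda>y. ?I R y * h y) \<eta>) + 2 * nsq lborel (\<lambda>\<eta>. c * (g' \<eta> - ftr (\<lambda>y. ?I R y * h' y) \<eta>))"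
      by (rule nsq_add_le) measurable
    also have "nsq lborel (\<lambda>\<eta>. c * (g' \<eta> - ftr (\<lambda>y. ?I R y * h' y) \<eta>)) =
        ennreal ((cmod c)\<^sup>2) * nsq lborel (\<lambda>\<eta>. g' \<eta> - ftr (\<lambda>y. ?I R y * h' y) \<eta>)"
      by (rule nsq_cmult) measurable
    finally show "nsq lborel (\<lambda>\<eta>. (g \<eta> - ftr (\<lambda>y. ?I R y * h y) \<eta>) + c * (g' \<eta> - ftr (\<lambda>y. ?I R y * h' y) \<eta>)) \<le>
      2 * nsq lborel (\<lambda>\<eta>. g \<eta> - ftr (\<lambda>y. ?I R y * h y) \<eta>) + 2 * (ennreal ((cmod c)\<^sup>2) * nsq lborel (\<lambda>\<eta>. g' \<eta> - ftr (\<lambda>y. ?I R y * h' y) \<eta>))" .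
  next
    have "((\<lambda>R. 2 * nsq lborel (\<lambda>\<eta>. g \<eta> - ftr (\<lambda>y. ?I R y * h y) \<eta>) + 2 * (ennreal ((cmod c)\<^sup>2) * nsq lborel (\<lambda>\<eta>. g' \<eta> - ftr (\<lambda>y. ?I R y * h' y) \<eta>)))
       \<longlongrightarrow> 2 * 0 + 2 * (ennreal ((cmod c)\<^sup>2) * 0)) at_top"
      using ft unfolding sft_def by (intro tendsto_add tendsto_mult_ennreal tendsto_const) auto
    then show "((\<lambda>R. 2 * nsq lborel (\<lambda>\<eta>. g \<eta> - ftr (\<lambda>y. ?I R y * h y) \<eta>) + 2 * (ennreal ((cmod c)\<^sup>2) * nsq lborel (\<lambda>\<eta>. g' \<eta> - ftr (\<lambda>y. ?I R y * h' y) \<eta>)))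
       \<longlongrightarrow> 0) at_top" by simp
  qed
qed

section \<open>Function spaces on the half-line\<close>

lemma space_halfline [simp]: "space halfline = {0<..}"
  by (simp add: halfline_def)

lemma sigma_finite_halfline: "sigma_finite_measure halfline"
  unfolding halfline_def by (rule sigma_finite_measure_restrict_space) (auto intro: lborel.sigma_finite_measure_axioms)

lemma measurable_halfline_continuous:
  fixes f :: "real \<Rightarrow> 'a::topological_space"
  assumes "continuous_on {0<..} f"
  shows "f \<in> borel_measurable halfline"
proof -
  have "borel_measurable halfline = (borel_measurable (restrict_space borel {0<..}) :: (real \<Rightarrow> 'a) set)"
    by (intro measurable_cong_sets refl) (simp add: halfline_def sets_restrict_space)
  then show ?thesis using borel_measurable_continuous_on_restrict[OF assms] by simp
qed

lemma cutoff_continuous: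
  assumes "cutoff \<omega>"
  shows "continuous_on {0<..} \<omega>"
proof -
  have "(hd_deriv ^^ 0) \<omega> differentiable (at t within {0..})" if "t \<ge> 0" for t
    using assms that unfolding cutoff_def smooth_upto0_on_def by blast
  then have "continuous_on {0..} \<omega>"
    by (intro differentiable_imp_continuous_on) (simp add: differentiable_on_def)
  then show ?thesis by (rule continuous_on_subset) auto
qed

lemma cutoff_measurable: "cutoff \<omega> \<Longrightarrow> \<omega> \<in> borel_measurable halfline"
  by (intro measurable_halfline_continuous cutoff_continuous)

lemma halfline_section_measurable:
  assumes "(\<lambda>(y,t). u y t) \<in> borel_measurable Omega" "t > 0"
  shows "(\<lambda>y. u y t) \<in> borel_measurable borel"
proof -
  have "(\<lambda>y. (y, t)) \<in> measurable lborel Omega"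
    unfolding Omega_def using assms(2) by (intro measurable_Pair) auto
  from measurable_compose[OF this assms(1)] show ?thesis by simp
qed

lemma ft_on_eq_ftr: "ft_on B u \<eta> t = ftr (\<lambda>y. indicator B y * u y t) \<eta>"
  unfolding ft_on_def ftr_def set_lebesgue_integral_def
  by (intro Bochner_Integration.integral_cong) (auto simp: indicator_def)

text \<open>Covers both \<open>L2_sq\<close> and \<open>K_sq\<close> with s = 0: each is an integral
  of |u|^2 against a measure with the measurable sets of the half-line, and nonmeasurable functions
  get the value \<infinity>.\<close>

locale weighted_L2 = sigma_finite_measure M
  for M :: "real measure" +
  fixes N :: "(real \<Rightarrow> complex) \<Rightarrow> ennreal"
  assumes sets_M: "sets M = sets halfline"
    and N_eq: "\<And>u. N u = (if u \<in> borel_measurable halfline then nsq M u else \<infinity>)"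
begin

lemma measurable_M: "borel_measurable M = borel_measurable halfline"
  by (rule measurable_cong_sets[OF sets_M refl])

lemma measurable_Omega: "borel_measurable ((lborel :: (real^'q) measure) \<Otimes>\<^sub>M M) = borel_measurable Omega"
  unfolding Omega_def by (intro measurable_cong_sets sets_pair_measure_cong sets_M refl)

lemma section_measurable:
  fixes u :: "real^'q \<Rightarrow> real \<Rightarrow> complex"
  assumes "(\<lambda>(y,t). u y t) \<in> borel_measurable Omega"
  shows "u y \<in> borel_measurable halfline"
  using measurable_Pair2[of "\<lambda>(y,t). u y t" lborel M, of borel y] assms
  by (simp add: measurable_Omega measurable_M)

lemma nn_integral_N:
  fixes u :: "real^'q \<Rightarrow> real \<Rightarrow> complex"
  assumes u: "(\<lambda>(y,t). u y t) \<in> borel_measurable Omega"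
  shows "(\<integral>\<^sup>+y. N (u y) \<partial>lborel) = nsq (lborel \<Otimes>\<^sub>M M) (\<lambda>(y,t). u y t)"
proof -
  have m: "(\<lambda>(y,t). u y t) \<in> borel_measurable (lborel \<Otimes>\<^sub>M M)" using u by (simp add: measurable_Omega)
  have "nsq (lborel \<Otimes>\<^sub>M M) (\<lambda>(y,t). u y t) = (\<integral>\<^sup>+y. nsq M (u y) \<partial>lborel)"
    unfolding nsq_def using m by (subst nn_integral_fst[symmetric]) (auto simp: case_prod_unfold)
  then show ?thesis using section_measurable[OF u] by (simp add: N_eq)
qed

lemma L2H_iff:
  fixes u :: "real^'q \<Rightarrow> real \<Rightarrow> complex"
  shows "u \<in> L2H N \<longleftrightarrow> (\<lambda>(y,t). u y t) \<in> borel_measurable Omega \<and> (\<forall>y. nsq M (u y) < \<infinity>) \<and>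
    nsq (lborel \<Otimes>\<^sub>M M) (\<lambda>(y,t). u y t) < \<infinity>"
proof (cases "(\<lambda>(y,t). u y t) \<in> borel_measurable Omega")
  case True
  then have "N (u y) = nsq M (u y)" for y using section_measurable[OF True] by (simp add: N_eq)
  then show ?thesis using nn_integral_N[OF True] True by (simp add: L2H_def)
qed (simp add: L2H_def)

text \<open>Membership in \<open>L2H\<close> demands a finite norm at every y, whereas finiteness of
  the double integral yields it almost everywhere; the bad slices are replaced by 0.\<close>

lemma ae_modification:
  fixes v :: "(real^'q) \<times> real \<Rightarrow> complex"
  assumes v: "v \<in> borel_measurable (lborel \<Otimes>\<^sub>M M)" and fin: "nsq (lborel \<Otimes>\<^sub>M M) v < \<infinity>"
  obtains v' where "v' \<in> L2H N" "AE p in lborel \<Otimes>\<^sub>M M. v' (fst p) (snd p) = v p"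
proof -
  note [measurable] = v
  interpret P: pair_sigma_finite "lborel :: (real^'q) measure" M ..
  have [measurable]: "(\<lambda>y. nsq M (\<lambda>t. v (y, t))) \<in> borel_measurable lborel"
    unfolding nsq_def by measurable
  have [measurable]: "(\<lambda>p. nsq M (\<lambda>t. v (fst p, t))) \<in> borel_measurable (lborel \<Otimes>\<^sub>M M)"
    unfolding nsq_def by measurable
  define v' where "v' y t = (if nsq M (\<lambda>t. v (y, t)) < \<infinity> then v (y, t) else 0)" for y t
  have eq: "nsq (lborel \<Otimes>\<^sub>M M) v = (\<integral>\<^sup>+y. nsq M (\<lambda>t. v (y, t)) \<partial>lborel)"
    unfolding nsq_def by (subst nn_integral_fst[symmetric]) auto
  have "AE y in lborel. nsq M (\<lambda>t. v (y, t)) \<noteq> \<infinity>"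
    using fin unfolding eq by (intro nn_integral_PInf_AE) auto
  then have "AE p in lborel \<Otimes>\<^sub>M M. nsq M (\<lambda>t. v (fst p, t)) \<noteq> \<infinity>"
    by (intro P.AE_pair_measure) (measurable, auto elim!: eventually_mono)
  then have ae: "AE p in lborel \<Otimes>\<^sub>M M. v' (fst p) (snd p) = v p"
    by eventually_elim (simp add: v'_def top.not_eq_extremum)
  have m: "(\<lambda>(y,t). v' y t) \<in> borel_measurable (lborel \<Otimes>\<^sub>M M)"
    unfolding v'_def by measurable
  have "nsq (lborel \<Otimes>\<^sub>M M) (\<lambda>(y,t). v' y t) = nsq (lborel \<Otimes>\<^sub>M M) v"
    using ae by (intro nsq_cong_AE) (auto simp: case_prod_unfold)
  moreover have "nsq M (v' y) < \<infinity>" for y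
    by (cases "nsq M (\<lambda>t. v (y, t)) < \<infinity>") (simp_all add: v'_def[abs_def], simp add: nsq_def)
  ultimately have "v' \<in> L2H N"
    unfolding L2H_iff using m fin by (simp add: measurable_Omega)
  then show thesis using ae by (rule that)
qed

lemma ft_on_eq_ftp: "ft_on B u \<eta> t = ftp B (\<lambda>(y,t). u y t) (\<eta>, t)"
  by (simp add: ft_on_eq_ftr ftp_def)

lemma is_ft_iff:
  fixes u v :: "real^'q \<Rightarrow> real \<Rightarrow> complex"
  shows "is_ft N u v \<longleftrightarrow> u \<in> L2H N \<and> v \<in> L2H N \<and>
    ((\<lambda>R. nsq (lborel \<Otimes>\<^sub>M M) (\<lambda>p. v (fst p) (snd p) - ftp (cball 0 R) (\<lambda>(y,t). u y t) p)) \<longlongrightarrow> 0) at_top"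
proof -
  have "(\<integral>\<^sup>+\<eta>. N (\<lambda>t. v \<eta> t - ft_on (cball 0 R) u \<eta> t) \<partial>lborel) =
      nsq (lborel \<Otimes>\<^sub>M M) (\<lambda>p. v (fst p) (snd p) - ftp (cball 0 R) (\<lambda>(y,t). u y t) p)"
    if uv: "u \<in> L2H N" "v \<in> L2H N" for R
  proof -
    have [measurable]: "(\<lambda>(y,t). u y t) \<in> borel_measurable (lborel \<Otimes>\<^sub>M M)" "(\<lambda>(y,t). v y t) \<in> borel_measurable (lborel \<Otimes>\<^sub>M M)"
      using uv by (simp_all add: L2H_iff measurable_Omega)
    have "(\<lambda>p. (\<lambda>(y,t). v y t) p - ftp (cball 0 R) (\<lambda>(y,t). u y t) p) \<in> borel_measurable (lborel \<Otimes>\<^sub>M M)"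
      by measurable
    then have "(\<lambda>(\<eta>,t). v \<eta> t - ft_on (cball 0 R) u \<eta> t) \<in> borel_measurable Omega"
      by (simp add: measurable_Omega case_prod_unfold ft_on_eq_ftp)
    from nn_integral_N[OF this] show ?thesis by (simp add: case_prod_unfold ft_on_eq_ftp)
  qed
  then show ?thesis unfolding is_ft_def by (auto cong: conj_cong)
qed

lemma is_ft_exists:
  fixes u :: "real^'q \<Rightarrow> real \<Rightarrow> complex"
  assumes u: "u \<in> L2H N"
  obtains v where "is_ft N u v"
proof -
  from u have m: "(\<lambda>(y,t). u y t) \<in> borel_measurable (lborel \<Otimes>\<^sub>M M)" and fin: "nsq (lborel \<Otimes>\<^sub>M M) (\<lambda>(y,t). u y t) < \<infinity>"
    by (simp_all add: L2H_iff measurable_Omega)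
  from ftp_exists[OF m fin] obtain v where v: "v \<in> borel_measurable (lborel \<Otimes>\<^sub>M M)" "nsq (lborel \<Otimes>\<^sub>M M) v < \<infinity>"
    and lim: "((\<lambda>R. nsq (lborel \<Otimes>\<^sub>M M) (\<lambda>p. v p - ftp (cball 0 R) (\<lambda>(y,t). u y t) p)) \<longlongrightarrow> 0) at_top" by blast
  from ae_modification[OF v] obtain v' where v': "v' \<in> L2H N" "AE p in lborel \<Otimes>\<^sub>M M. v' (fst p) (snd p) = v p" by blast
  have "nsq (lborel \<Otimes>\<^sub>M M) (\<lambda>p. v' (fst p) (snd p) - ftp (cball 0 R) (\<lambda>(y,t). u y t) p) =
      nsq (lborel \<Otimes>\<^sub>M M) (\<lambda>p. v p - ftp (cball 0 R) (\<lambda>(y,t). u y t) p)" for R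
    using v'(2) by (intro nsq_cong_AE) auto
  then have "is_ft N u v'" using u v' lim by (simp add: is_ft_iff)
  then show thesis by (rule that)
qed

lemma is_ft_surjective:
  fixes v :: "real^'q \<Rightarrow> real \<Rightarrow> complex"
  assumes v: "v \<in> L2H N"
  obtains u where "is_ft N u v"
proof -
  from v have m: "(\<lambda>(y,t). v y t) \<in> borel_measurable (lborel \<Otimes>\<^sub>M M)" and fin: "nsq (lborel \<Otimes>\<^sub>M M) (\<lambda>(y,t). v y t) < \<infinity>"
    by (simp_all add: L2H_iff measurable_Omega)
  from ftp_surjective[OF m fin] obtain h where h: "h \<in> borel_measurable (lborel \<Otimes>\<^sub>M M)" "nsq (lborel \<Otimes>\<^sub>M M) h < \<infinity>"
    and lim: "((\<lambda>R. nsq (lborel \<Otimes>\<^sub>M M) (\<lambda>p. (\<lambda>(y,t). v y t) p - ftp (cball 0 R) h p)) \<longlongrightarrow> 0) at_top" by blast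
  from ae_modification[OF h] obtain u where u: "u \<in> L2H N" "AE p in lborel \<Otimes>\<^sub>M M. u (fst p) (snd p) = h p" by blast
  have um: "(\<lambda>(y,t). u y t) \<in> borel_measurable (lborel \<Otimes>\<^sub>M M)" and ufin: "nsq (lborel \<Otimes>\<^sub>M M) (\<lambda>(y,t). u y t) < \<infinity>"
    using u(1) by (simp_all add: L2H_iff measurable_Omega)
  \<comment> \<open>Passing from h to its modification u changes the truncated transforms only on a
    null set, by Plancherel applied to a difference of norm 0.\<close>
  have d0: "nsq (lborel \<Otimes>\<^sub>M M) (\<lambda>p. ftp (cball 0 R) h p - ftp (cball 0 R) (\<lambda>(y,t). u y t) p) = 0" for R
  proof -
    have dm: "(\<lambda>p. h p - (\<lambda>(y,t). u y t) p) \<in> borel_measurable (lborel \<Otimes>\<^sub>M M)" using h um by measurable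
    have d: "nsq (lborel \<Otimes>\<^sub>M M) (\<lambda>p. h p - (\<lambda>(y,t). u y t) p) = 0"
      unfolding nsq_def using u(2) dm
      by (subst nn_integral_0_iff_AE) (auto simp: case_prod_unfold elim!: eventually_mono)
    have "nsq (lborel \<Otimes>\<^sub>M M) (ftp (cball 0 R) (\<lambda>p. h p - (\<lambda>(y,t). u y t) p)) = 0"
      by (subst ftp_plancherel[OF dm _ sets_borel_cball order.refl])
         (use d order_trans[OF nsq_indicator_le eq_refl[OF d]] in auto)
    moreover have "AE p in lborel \<Otimes>\<^sub>M M. ftp (cball 0 R) h p - ftp (cball 0 R) (\<lambda>(y,t). u y t) p =
        ftp (cball 0 R) (\<lambda>p. h p - (\<lambda>(y,t). u y t) p) p"
    proof (rule AE_pairI)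
      show "AE t in M. \<forall>\<eta>. ftp (cball 0 R) h (\<eta>, t) - ftp (cball 0 R) (\<lambda>(y,t). u y t) (\<eta>, t) =
          ftp (cball 0 R) (\<lambda>p. h p - (\<lambda>(y,t). u y t) p) (\<eta>, t)"
        using bounded_slice_integrable[OF h sets_borel_cball order.refl, of R]
          bounded_slice_integrable[OF um ufin sets_borel_cball order.refl, of R]
        by eventually_elim (simp add: ftp_def right_diff_distrib ftr_diff)
    qed auto
    ultimately show ?thesis
      by (subst nsq_cong_AE) (auto elim!: eventually_mono)
  qed
  have "((\<lambda>R. nsq (lborel \<Otimes>\<^sub>M M) (\<lambda>p. v (fst p) (snd p) - ftp (cball 0 R) (\<lambda>(y,t). u y t) p)) \<longlongrightarrow> 0) at_top"
  proof (rule tendsto_0_squeeze_ennreal)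
    fix R
    have "nsq (lborel \<Otimes>\<^sub>M M) (\<lambda>p. (\<lambda>(y,t). v y t) p - ftp (cball 0 R) (\<lambda>(y,t). u y t) p) \<le>
      2 * nsq (lborel \<Otimes>\<^sub>M M) (\<lambda>p. (\<lambda>(y,t). v y t) p - ftp (cball 0 R) h p) +
      2 * nsq (lborel \<Otimes>\<^sub>M M) (\<lambda>p. ftp (cball 0 R) h p - ftp (cball 0 R) (\<lambda>(y,t). u y t) p)"
      by (rule nsq_triangle[OF m]) (use h um in measurable)
    then show "nsq (lborel \<Otimes>\<^sub>M M) (\<lambda>p. v (fst p) (snd p) - ftp (cball 0 R) (\<lambda>(y,t). u y t) p) \<le>
      2 * nsq (lborel \<Otimes>\<^sub>M M) (\<lambda>p. (\<lambda>(y,t). v y t) p - ftp (cball 0 R) h p)"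
      by (simp add: d0[unfolded case_prod_unfold] case_prod_unfold)
    show "((\<lambda>R. 2 * nsq (lborel \<Otimes>\<^sub>M M) (\<lambda>p. (\<lambda>(y,t). v y t) p - ftp (cball 0 R) h p)) \<longlongrightarrow> 0) at_top"
      using tendsto_mult_ennreal[OF tendsto_const[of 2] lim] by simp
  qed
  then have "is_ft N u v" using u v by (simp add: is_ft_iff)
  then show thesis by (rule that)
qed

end

section \<open>The weighted spaces\<close>

lemma weighted_L2_L2_sq: "weighted_L2 halfline L2_sq"
proof -
  interpret sigma_finite_measure halfline by (rule sigma_finite_halfline)
  show ?thesis by unfold_locales (auto simp: L2_sq_def nsq_def)
qed

text \<open>For s = 0 the two parts of \<open>K_sq\<close> are integrals of |u|^2 against two
  weights; this is their sum.\<close>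

definition K_weight :: "(real \<Rightarrow> complex) \<Rightarrow> real \<Rightarrow> real \<Rightarrow> real" where
  "K_weight \<omega> \<gamma> t = (cmod (1 - \<omega> t))\<^sup>2 + (t powr (- \<gamma>) * cmod (\<omega> t))\<^sup>2"

lemma K_sq_0: "K_sq \<omega> 0 \<gamma> u = L2_sq (\<lambda>t. (1 - \<omega> t) * u t) + L2_sq (\<lambda>t. of_real (t powr (- \<gamma>)) * (\<omega> t * u t))"
  by (simp add: K_sq_def Sobolev_sq_def Fuchs_sq_def)

lemma weighted_L2_K_sq:
  assumes "cutoff \<omega>"
  shows "weighted_L2 (density halfline (\<lambda>t. ennreal (K_weight \<omega> \<gamma> t))) (K_sq \<omega> 0 \<gamma>)"
proof -
  interpret sigma_finite_measure halfline by (rule sigma_finite_halfline)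
  note [measurable] = cutoff_measurable[OF assms]
  have pm: "(\<lambda>t. complex_of_real (t powr a)) \<in> borel_measurable halfline" for a
    by (rule measurable_halfline_continuous) (auto intro!: continuous_intros)
  have [measurable]: "(\<lambda>t. t powr a) \<in> borel_measurable halfline" for a
    by (rule measurable_halfline_continuous) (auto intro!: continuous_intros)
  have [measurable]: "K_weight \<omega> \<gamma> \<in> borel_measurable halfline"
    unfolding K_weight_def[abs_def] by measurable
  let ?M = "density halfline (\<lambda>t. ennreal (K_weight \<omega> \<gamma> t))"
  have sf: "sigma_finite_measure ?M"
    by (subst sigma_finite_iff_density_finite) auto
  show ?thesis
  proof (intro weighted_L2.intro sf weighted_L2_axioms.intro)
    show "sets ?M = sets halfline" by simp
    fix u
    show "K_sq \<omega> 0 \<gamma> u = (if u \<in> borel_measurable halfline then nsq ?M u else \<infinity>)"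
    proof (cases "u \<in> borel_measurable halfline")
      case True
      note [measurable] = True
      have "nsq ?M u = (\<integral>\<^sup>+t. ennreal (K_weight \<omega> \<gamma> t) * ennreal ((cmod (u t))\<^sup>2) \<partial>halfline)"
        unfolding nsq_def by (rule nn_integral_density) measurable
      also have "\<dots> = (\<integral>\<^sup>+t. ennreal ((cmod ((1 - \<omega> t) * u t))\<^sup>2) +
          ennreal ((cmod (of_real (t powr (- \<gamma>)) * (\<omega> t * u t)))\<^sup>2) \<partial>halfline)"
        by (intro nn_integral_cong)
           (simp add: K_weight_def norm_mult power_mult_distrib distrib_right flip: ennreal_mult ennreal_plus)
      also have "\<dots> = K_sq \<omega> 0 \<gamma> u"
        unfolding K_sq_0 L2_sq_def using pm by (subst nn_integral_add) auto
      finally show ?thesis using True by simp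
    next
      case False
      have "\<not> ((\<lambda>t. (1 - \<omega> t) * u t) \<in> borel_measurable halfline \<and>
          (\<lambda>t. of_real (t powr (- \<gamma>)) * (\<omega> t * u t)) \<in> borel_measurable halfline)"
      proof
        assume *: "(\<lambda>t. (1 - \<omega> t) * u t) \<in> borel_measurable halfline \<and>
          (\<lambda>t. of_real (t powr (- \<gamma>)) * (\<omega> t * u t)) \<in> borel_measurable halfline"
        \<comment> \<open>u is recovered from its two weighted parts, so for nonmeasurable u at
          least one of them is nonmeasurable and has norm \<infinity>.\<close>
        have "(\<lambda>t. (1 - \<omega> t) * u t + of_real (t powr \<gamma>) * (of_real (t powr (- \<gamma>)) * (\<omega> t * u t))) \<in> borel_measurable halfline"
          by (rule borel_measurable_add[OF conjunct1[OF *] borel_measurable_times[OF pm conjunct2[OF *]]])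
        also have "?this \<longleftrightarrow> u \<in> borel_measurable halfline"
          by (rule measurable_cong) (simp add: algebra_simps powr_minus flip: of_real_mult)
        finally show False using False by simp
      qed
      then have "K_sq \<omega> 0 \<gamma> u = \<infinity>" unfolding K_sq_0 L2_sq_def by auto
      with False show ?thesis by simp
    qed
  qed
qed

lemma cutoff_one:
  assumes "cutoff \<omega>" obtains \<epsilon> where "\<epsilon> > 0" "\<And>t. 0 \<le> t \<Longrightarrow> t < \<epsilon> \<Longrightarrow> \<omega> t = 1"
  using assms unfolding cutoff_def by blast

lemma cutoff_support:
  assumes "cutoff \<omega>" obtains R where "R > 0" "\<And>t. t > R \<Longrightarrow> \<omega> t = 0"
proof -
  from assms obtain R where "\<And>t. t > R \<Longrightarrow> \<omega> t = 0" unfolding cutoff_def by blast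
  then show thesis by (intro that[of "max R 1"]) auto
qed

text \<open>The weight t^(-\<gamma>) is built into the norm only for \<omega> u. For the remaining
  part it is at most \<epsilon>^(-\<gamma>), since 1 - \<omega> vanishes below \<epsilon> and
  \<gamma> \<ge> 0.\<close>

lemma K_sq_local_bound:
  assumes \<omega>: "cutoff \<omega>" and \<gamma>: "\<gamma> \<ge> 0"
  obtains C where "C \<ge> 0" "\<And>u. u \<in> borel_measurable halfline \<Longrightarrow>
    nsq halfline (\<lambda>t. of_real (t powr (- \<gamma>) * indicator {0<..R} t) * u t) \<le> ennreal C * K_sq \<omega> 0 \<gamma> u"
proof -
  obtain \<epsilon> where \<epsilon>: "\<epsilon> > 0" "\<And>t. 0 \<le> t \<Longrightarrow> t < \<epsilon> \<Longrightarrow> \<omega> t = 1" using cutoff_one[OF \<omega>] by metis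
  note [measurable] = cutoff_measurable[OF \<omega>]
  have [measurable]: "(\<lambda>t. complex_of_real (t powr a)) \<in> borel_measurable halfline" for a
    by (rule measurable_halfline_continuous) (auto intro!: continuous_intros)
  define D where "D = \<epsilon> powr (- \<gamma>)"
  have "nsq halfline (\<lambda>t. of_real (t powr (- \<gamma>) * indicator {0<..R} t) * u t) \<le> ennreal (2 + 2 * D\<^sup>2) * K_sq \<omega> 0 \<gamma> u"
    if [measurable]: "u \<in> borel_measurable halfline" for u
  proof -
    let ?a = "\<lambda>t. of_real D * ((1 - \<omega> t) * u t)" and ?b = "\<lambda>t. of_real (t powr (- \<gamma>)) * (\<omega> t * u t)"
    have "nsq halfline (\<lambda>t. of_real (t powr (- \<gamma>) * indicator {0<..R} t) * u t) \<le>
      (\<integral>\<^sup>+t. ennreal (2 * (cmod (?a t))\<^sup>2 + 2 * (cmod (?b t))\<^sup>2) \<partial>halfline)"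
      unfolding nsq_def
    proof (intro nn_integral_mono ennreal_leI)
      fix t assume "t \<in> space halfline"
      then have t: "t > 0" by simp
      have "cmod (of_real (t powr (- \<gamma>)) * ((1 - \<omega> t) * u t)) \<le> cmod (?a t)"
      proof (cases "t < \<epsilon>")
        case True then show ?thesis using \<epsilon>(2)[of t] t by simp
      next
        case False
        then have "t powr (- \<gamma>) \<le> D" unfolding D_def using \<epsilon>(1) \<gamma> by (intro powr_mono2') auto
        then show ?thesis by (simp add: norm_mult mult_right_mono D_def)
      qed
      then have 1: "(cmod (of_real (t powr (- \<gamma>)) * ((1 - \<omega> t) * u t)))\<^sup>2 \<le> (cmod (?a t))\<^sup>2"
        by (rule power_mono) simp
      have "(cmod (of_real (t powr (- \<gamma>) * indicator {0<..R} t) * u t))\<^sup>2 \<le> (cmod (of_real (t powr (- \<gamma>)) * u t))\<^sup>2"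
        by (intro power_mono) (auto simp: norm_mult indicator_def)
      also have "of_real (t powr (- \<gamma>)) * u t = of_real (t powr (- \<gamma>)) * ((1 - \<omega> t) * u t) + ?b t"
        by (simp add: algebra_simps)
      also have "(cmod \<dots>)\<^sup>2 \<le> 2 * (cmod (of_real (t powr (- \<gamma>)) * ((1 - \<omega> t) * u t)))\<^sup>2 + 2 * (cmod (?b t))\<^sup>2"
        by (rule cmod_add_sq_le)
      finally show "(cmod (of_real (t powr (- \<gamma>) * indicator {0<..R} t) * u t))\<^sup>2 \<le> 2 * (cmod (?a t))\<^sup>2 + 2 * (cmod (?b t))\<^sup>2"
        using 1 by linarith
    qed
    also have "\<dots> = 2 * nsq halfline ?a + 2 * nsq halfline ?b"
      unfolding nsq_def by (simp add: nn_integral_add nn_integral_cmult ennreal_mult)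
    also have "nsq halfline ?a = ennreal (D\<^sup>2) * L2_sq (\<lambda>t. (1 - \<omega> t) * u t)"
      by (subst nsq_cmult) (auto simp: L2_sq_def nsq_def)
    also have "nsq halfline ?b = L2_sq ?b" by (simp add: L2_sq_def nsq_def)
    also have "2 * (ennreal (D\<^sup>2) * L2_sq (\<lambda>t. (1 - \<omega> t) * u t)) + 2 * L2_sq ?b \<le>
        ennreal (2 + 2 * D\<^sup>2) * L2_sq (\<lambda>t. (1 - \<omega> t) * u t) + ennreal (2 + 2 * D\<^sup>2) * L2_sq ?b"
    proof (rule add_mono)
      show "2 * (ennreal (D\<^sup>2) * L2_sq (\<lambda>t. (1 - \<omega> t) * u t)) \<le> ennreal (2 + 2 * D\<^sup>2) * L2_sq (\<lambda>t. (1 - \<omega> t) * u t)"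
        unfolding mult.assoc[symmetric]
        by (intro mult_right_mono) (simp_all add: ennreal_mult[symmetric] flip: ennreal_numeral)
      show "2 * L2_sq ?b \<le> ennreal (2 + 2 * D\<^sup>2) * L2_sq ?b"
        by (intro mult_right_mono) (simp_all flip: ennreal_numeral)
    qed
    also have "\<dots> = ennreal (2 + 2 * D\<^sup>2) * K_sq \<omega> 0 \<gamma> u" by (simp add: K_sq_0 distrib_left)
    finally show ?thesis .
  qed
  then show thesis by (intro that[of "2 + 2 * D\<^sup>2"]) auto
qed

section \<open>The finite-dimensional spaces of singular functions\<close>

lemma poly_tendsto_0_imp_eq_0:
  fixes p :: "complex poly"
  assumes "((\<lambda>s::real. poly p (of_real s)) \<longlongrightarrow> 0) at_top"
  shows "p = 0"
proof (cases "degree p = 0")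
  case True
  then obtain a where p: "p = [:a:]" by (elim degree_eq_zeroE)
  with assms have "((\<lambda>s::real. a) \<longlongrightarrow> 0) at_top" by simp
  then have "a = 0" by (simp add: tendsto_const_iff)
  with p show ?thesis by simp
next
  case False
  have inf: "filterlim (\<lambda>s::real. poly p (of_real s)) at_infinity at_top"
    using False by (intro filterlim_compose[OF filterlim_poly_at_infinity filterlim_of_real_at_infinity]) auto
  have False by (rule not_tendsto_and_filterlim_at_infinity[OF _ assms inf]) simp
  then show ?thesis ..
qed

lemma exp_poly_tendsto_0:
  fixes p :: "complex poly"
  assumes "c > 0"
  shows "((\<lambda>s::real. of_real (exp (- (c * s))) * poly p (of_real s)) \<longlongrightarrow> 0) at_top"
proof -
  have 1: "((\<lambda>s::real. s ^ i * exp (- (c * s))) \<longlongrightarrow> 0) at_top" for i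
    using assms by real_asymp
  have "((\<lambda>s::real. \<Sum>i\<le>degree p. coeff p i * of_real (s ^ i * exp (- (c * s)))) \<longlongrightarrow> (\<Sum>i\<le>degree p. coeff p i * of_real 0)) at_top"
    by (intro tendsto_intros 1)
  then show ?thesis by (simp add: poly_altdef sum_distrib_left mult_ac)
qed

text \<open>\<open>comb C\<close> runs through \<open>\<E>\<^sub>S\<close>; \<open>cf k\<close> recovers the coefficients, being a finite combination of
  point evaluations, so that measurability passes from functions to coefficients.\<close>

locale E_space =
  fixes \<omega> :: "real \<Rightarrow> complex" and \<sigma> :: complex and n m :: nat
  assumes cutoff: "cutoff \<omega>"
begin

definition K :: "(nat \<times> nat) set" where "K = {..n} \<times> {..m}"

definition S :: "(complex \<times> nat) set" where "S = (\<lambda>l. (\<sigma> - of_nat l, m)) ` {..n}"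

definition e :: "nat \<times> nat \<Rightarrow> real \<Rightarrow> complex" where
  "e k t = \<omega> t * (of_real t powr (- (\<sigma> - of_nat (fst k))) * of_real (ln t ^ snd k))"

definition comb :: "(nat \<times> nat \<Rightarrow> complex) \<Rightarrow> real \<Rightarrow> complex" where
  "comb C t = (\<Sum>k\<in>K. C k * e k t)"

lemma finite_K [simp]: "finite K" by (simp add: K_def)

lemma sum_S: "(\<Sum>(p,n)\<in>S. \<Sum>j\<le>n. F p j) = (\<Sum>k\<in>K. F (\<sigma> - of_nat (fst k)) (snd k))"
proof -
  have inj: "inj_on (\<lambda>l. (\<sigma> - of_nat l, m)) {..n}" by (auto simp: inj_on_def)
  show ?thesis
    unfolding S_def K_def
    by (simp add: sum.reindex[OF inj] sum.cartesian_product case_prod_unfold o_def)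
qed

lemma E_fun_eq: "E_fun \<omega> S c t = comb (\<lambda>k. c (\<sigma> - of_nat (fst k)) (snd k)) t"
  unfolding E_fun_def sum_S comb_def e_def by (simp add: sum_distrib_left mult_ac)

lemma e_measurable [measurable]: "e k \<in> borel_measurable halfline"
  unfolding e_def[abs_def]
  by (intro borel_measurable_times cutoff_measurable[OF cutoff] measurable_halfline_continuous)
     (auto intro!: continuous_intros)

text \<open>With t = exp (- s) a relation near t = 0 becomes a sum of exp (- l s) times polynomials
  in s. Multiplying by exp (l s) for the least l left and letting s tend to infinity shows that the
  polynomial belonging to l has limit 0, so it is the zero polynomial.\<close>

lemma e_independent:
  assumes 0: "\<And>t. t \<in> {0<..} \<Longrightarrow> (\<Sum>k\<in>K. C k * e k t) = 0"
  shows "\<forall>k\<in>K. C k = 0"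
proof -
  obtain \<epsilon> where \<epsilon>: "\<epsilon> > 0" "\<And>t. 0 \<le> t \<Longrightarrow> t < \<epsilon> \<Longrightarrow> \<omega> t = 1" using cutoff_one[OF cutoff] by metis
  define P where "P l = (\<Sum>j\<le>m. monom (C (l, j) * (-1) ^ j) j)" for l
  have Pc: "coeff (P l) j = (if j \<le> m then C (l, j) * (-1) ^ j else 0)" for l j
    by (simp add: P_def coeff_sum)
  have eq: "(\<Sum>l\<le>n. of_real (exp (- (real l * s))) * poly (P l) (of_real s)) = 0" if s: "s > - ln \<epsilon>" for s
  proof -
    define t where "t = exp (- s)"
    have t: "t > 0" "t < \<epsilon>" "ln t = - s"
    proof -
      show "t > 0" "ln t = - s" by (simp_all add: t_def)
      have "exp (- s) < exp (ln \<epsilon>)" using s by (subst exp_less_cancel_iff) simp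
      then show "t < \<epsilon>" using \<epsilon>(1) by (simp add: t_def)
    qed
    have ek: "e (l, j) t = exp (\<sigma> * of_real s) * (of_real (exp (- (real l * s))) * ((-1) ^ j * of_real s ^ j))" for l j
    proof -
      have "of_real t powr (- (\<sigma> - of_nat l)) = exp (- (\<sigma> - of_nat l) * of_real (- s))"
        using t by (simp add: powr_def Ln_of_real)
      also have "\<dots> = exp (\<sigma> * of_real s) * exp (of_real (- (real l * s)))"
        by (simp add: exp_add[symmetric] algebra_simps)
      finally show ?thesis
        using \<epsilon>(2)[of t] t by (simp add: e_def power_minus[of "of_real s"] flip: exp_of_real)
    qed
    have "0 = (\<Sum>l\<le>n. \<Sum>j\<le>m. C (l, j) * e (l, j) t)"
      using 0[of t] t unfolding K_def by (simp add: sum.cartesian_product case_prod_unfold)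
    also have "\<dots> = exp (\<sigma> * of_real s) * (\<Sum>l\<le>n. of_real (exp (- (real l * s))) * poly (P l) (of_real s))"
      unfolding P_def ek poly_sum poly_monom by (simp add: sum_distrib_left mult_ac)
    finally show ?thesis by simp
  qed
  have "P l = 0" if "l \<le> n" for l
    using that
  proof (induction l rule: less_induct)
    case (less l)
    have "((\<lambda>s. - (\<Sum>l'\<in>{Suc l..n}. of_real (exp (- (real (l' - l) * s))) * poly (P l') (of_real s))) \<longlongrightarrow>
        - (\<Sum>l'\<in>{Suc l..n}. 0)) at_top"
      by (intro tendsto_minus tendsto_sum exp_poly_tendsto_0) auto
    moreover have "\<forall>\<^sub>F s in at_top. - (\<Sum>l'\<in>{Suc l..n}. of_real (exp (- (real (l' - l) * s))) * poly (P l') (of_real s)) = poly (P l) (of_real s)"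
      using eventually_gt_at_top[of "- ln \<epsilon>"]
    proof eventually_elim
      fix s assume s: "s > - ln \<epsilon>"
      let ?f = "\<lambda>l. of_real (exp (- (real l * s))) * poly (P l) (of_real s)"
      have split: "{..n} = {..<l} \<union> {l} \<union> {Suc l..n}" using less.prems by auto
      have "(\<Sum>l\<in>{..n}. ?f l) = (\<Sum>l\<in>{..<l} \<union> {l}. ?f l) + (\<Sum>l'\<in>{Suc l..n}. ?f l')"
        unfolding split by (rule sum.union_disjoint) auto
      also have "(\<Sum>l\<in>{..<l} \<union> {l}. ?f l) = (\<Sum>l\<in>{..<l}. ?f l) + ?f l"
        by (subst sum.union_disjoint) auto
      finally have "0 = (\<Sum>l\<in>{..<l}. ?f l) + ?f l + (\<Sum>l'\<in>{Suc l..n}. ?f l')"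
        using eq[OF s] by simp
      also have "(\<Sum>l\<in>{..<l}. ?f l) = 0"
        using less.IH less.prems by (intro sum.neutral) auto
      finally have sum0: "?f l + (\<Sum>l'\<in>{Suc l..n}. ?f l') = 0" by simp
      have e: "of_real (exp (real l * s)) * complex_of_real (exp (- (real l' * s))) = of_real (exp (- (real (l' - l) * s)))"
        if "l \<le> l'" for l'
        using that by (simp add: exp_add[symmetric] of_nat_diff algebra_simps flip: of_real_mult)
      have "0 = of_real (exp (real l * s)) * (?f l + (\<Sum>l'\<in>{Suc l..n}. ?f l'))" by (simp only: sum0 mult_zero_right)
      also have "\<dots> = (of_real (exp (real l * s)) * of_real (exp (- (real l * s)))) * poly (P l) (of_real s) +
          (\<Sum>l'\<in>{Suc l..n}. (of_real (exp (real l * s)) * of_real (exp (- (real l' * s)))) * poly (P l') (of_real s))"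
        by (simp only: distrib_left sum_distrib_left mult.assoc)
      also have "\<dots> = poly (P l) (of_real s) +
          (\<Sum>l'\<in>{Suc l..n}. of_real (exp (- (real (l' - l) * s))) * poly (P l') (of_real s))"
        by (intro arg_cong2[where f = "(+)"] sum.cong refl) (auto simp: e)
      finally show "- (\<Sum>l'\<in>{Suc l..n}. of_real (exp (- (real (l' - l) * s))) * poly (P l') (of_real s)) = poly (P l) (of_real s)"
        by (simp only: eq_commute[of 0] add_eq_0_iff2 minus_minus)
    qed
    ultimately have "((\<lambda>s. poly (P l) (of_real s)) \<longlongrightarrow> 0) at_top"
      by (simp add: tendsto_cong)
    then show "P l = 0" by (rule poly_tendsto_0_imp_eq_0)
  qed
  then have "C (l, j) * (-1) ^ j = 0" if "l \<le> n" "j \<le> m" for l j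
    using Pc[of l j] that by simp
  then show ?thesis by (auto simp: K_def)
qed

definition cf :: "nat \<times> nat \<Rightarrow> (real \<Rightarrow> complex) \<Rightarrow> complex" where
  "cf = (SOME L. \<forall>k\<in>K. fcomb {0<..} (L k) \<and> (\<forall>k'\<in>K. L k (e k') = (if k = k' then 1 else 0)))"

lemma cf:
  assumes "k \<in> K"
  shows cf_fcomb: "fcomb {0<..} (cf k)" and cf_e: "k' \<in> K \<Longrightarrow> cf k (e k') = (if k = k' then 1 else 0)"
proof -
  have "\<exists>L. \<forall>k\<in>K. fcomb {0<..} (L k) \<and> (\<forall>k'\<in>K. L k (e k') = (if k = k' then 1 else 0))"
    by (rule dual_family[OF finite_K e_independent])
  from someI_ex[OF this] assms show "fcomb {0<..} (cf k)" "k' \<in> K \<Longrightarrow> cf k (e k') = (if k = k' then 1 else 0)"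
    unfolding cf_def by auto
qed

lemma cf_comb:
  assumes "\<And>t. t > 0 \<Longrightarrow> f t = comb C t" and k: "k \<in> K"
  shows "cf k f = C k"
proof -
  have "cf k f = cf k (\<lambda>t. \<Sum>k\<in>K. C k * e k t)"
    by (rule fcomb_cong[OF cf_fcomb[OF k]]) (use assms in \<open>auto simp: comb_def\<close>)
  also have "\<dots> = (\<Sum>k'\<in>K. C k' * cf k (e k'))"
    by (rule fcomb_sum_arg[OF cf_fcomb[OF k]]) simp
  also have "\<dots> = C k" using k by (simp add: cf_e if_distrib cong: if_cong)
  finally show ?thesis .
qed

lemma comb_cong: "(\<And>k. k \<in> K \<Longrightarrow> C k = D k) \<Longrightarrow> comb C t = comb D t"
  by (simp add: comb_def)

text \<open>The coefficients are unique, so the infimum in \<open>E_sq\<close> runs over a constant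
  family.\<close>

lemma E_sq_comb:
  assumes f: "\<And>t. t > 0 \<Longrightarrow> f t = comb C t"
  shows "E_sq \<omega> S f = (\<Sum>k\<in>K. ennreal ((cmod (C k))\<^sup>2))"
proof -
  let ?A = "{c. \<forall>t>0. f t = E_fun \<omega> S c t}"
  have val: "(\<Sum>(p,n)\<in>S. \<Sum>j\<le>n. ennreal ((cmod (c p j))\<^sup>2)) = (\<Sum>k\<in>K. ennreal ((cmod (C k))\<^sup>2))" if "c \<in> ?A" for c
  proof -
    have "f t = comb (\<lambda>k. c (\<sigma> - of_nat (fst k)) (snd k)) t" if "t > 0" for t
      using \<open>c \<in> ?A\<close> that by (simp add: E_fun_eq)
    from cf_comb[OF this] cf_comb[OF f] have "c (\<sigma> - of_nat (fst k)) (snd k) = C k" if "k \<in> K" for k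
      using that by simp
    then show ?thesis unfolding sum_S by simp
  qed
  \<comment> \<open>\<open>E_sq\<close> labels coefficients by the exponent p = \<sigma> - l, which
    determines l as the integer part of Re (\<sigma> - p).\<close>
  define c where "c p j = C (nat \<lfloor>Re (\<sigma> - p)\<rfloor>, j)" for p j
  have "c \<in> ?A" unfolding E_fun_eq using f by (simp add: c_def)
  then have "?A \<noteq> {}" by blast
  then show ?thesis unfolding E_sq_def by (rule INF_eq_const[OF _ val])
qed

text \<open>The infimum over the empty set is \<infinity>, so a finite value forces a
  representation.\<close>

lemma E_sq_finite:
  assumes "E_sq \<omega> S f < \<infinity>" and t: "t > 0"
  shows "f t = comb (\<lambda>k. cf k f) t"
proof -
  have "{c. \<forall>t>0. f t = E_fun \<omega> S c t} \<noteq> {}"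
  proof
    assume "{c. \<forall>t>0. f t = E_fun \<omega> S c t} = {}"
    with assms(1) show False unfolding E_sq_def by simp
  qed
  then obtain c where c: "\<And>t. t > 0 \<Longrightarrow> f t = comb (\<lambda>k. c (\<sigma> - of_nat (fst k)) (snd k)) t"
    by (auto simp: E_fun_eq)
  from cf_comb[OF c] c[OF t] show ?thesis by (simp cong: comb_cong)
qed

lemma L2H_E_I:
  fixes u :: "real^'q \<Rightarrow> real \<Rightarrow> complex"
  assumes m: "\<And>k. k \<in> K \<Longrightarrow> h k \<in> borel_measurable borel" and fin: "\<And>k. k \<in> K \<Longrightarrow> nsq lborel (h k) < \<infinity>"
    and u: "\<And>y t. t > 0 \<Longrightarrow> u y t = comb (\<lambda>k. h k y) t"
  shows "u \<in> L2H (E_sq \<omega> S)"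
proof -
  have "(\<lambda>p. \<Sum>k\<in>K. h k (fst p) * e k (snd p)) \<in> borel_measurable (lborel \<Otimes>\<^sub>M halfline)"
    by (intro borel_measurable_sum borel_measurable_times measurable_compose[OF measurable_fst]
        measurable_compose[OF measurable_snd]) (auto simp: m)
  also have "?this \<longleftrightarrow> (\<lambda>(y,t). u y t) \<in> borel_measurable (lborel \<Otimes>\<^sub>M halfline)"
    by (rule measurable_cong) (auto simp: u comb_def space_pair_measure)
  finally have um: "(\<lambda>(y,t). u y t) \<in> borel_measurable Omega" by (simp add: Omega_def)
  have E: "E_sq \<omega> S (u y) = (\<Sum>k\<in>K. ennreal ((cmod (h k y))\<^sup>2))" for y
    by (rule E_sq_comb) (rule u)
  have "(\<integral>\<^sup>+y. E_sq \<omega> S (u y) \<partial>lborel) = (\<Sum>k\<in>K. nsq lborel (h k))"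
  proof -
    have "(\<lambda>y. ennreal ((cmod (h k y))\<^sup>2)) \<in> borel_measurable lborel" if "k \<in> K" for k
      using m[OF that] by measurable
    then show ?thesis unfolding E nsq_def by (rule nn_integral_sum)
  qed
  also have "\<dots> < \<infinity>" using fin by (simp add: sum_Pinfty top.not_eq_extremum)
  finally show ?thesis using um by (auto simp: L2H_def E)
qed

lemma L2H_E_D:
  fixes u :: "real^'q \<Rightarrow> real \<Rightarrow> complex"
  assumes u: "u \<in> L2H (E_sq \<omega> S)"
  shows "k \<in> K \<Longrightarrow> (\<lambda>y. cf k (u y)) \<in> borel_measurable borel"
    and "k \<in> K \<Longrightarrow> nsq lborel (\<lambda>y. cf k (u y)) < \<infinity>"
    and "t > 0 \<Longrightarrow> u y t = comb (\<lambda>k. cf k (u y)) t"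
    and "E_sq \<omega> S (u y) = (\<Sum>k\<in>K. ennreal ((cmod (cf k (u y)))\<^sup>2))"
proof -
  have um: "(\<lambda>(y,t). u y t) \<in> borel_measurable Omega" and ufin: "\<And>y. E_sq \<omega> S (u y) < \<infinity>"
    and uint: "(\<integral>\<^sup>+y. E_sq \<omega> S (u y) \<partial>lborel) < \<infinity>"
    using u by (auto simp: L2H_def)
  show c: "u y t = comb (\<lambda>k. cf k (u y)) t" if "t > 0" for y t by (rule E_sq_finite[OF ufin that])
  show E: "E_sq \<omega> S (u y) = (\<Sum>k\<in>K. ennreal ((cmod (cf k (u y)))\<^sup>2))" for y
    by (rule E_sq_comb) (rule c)
  show "(\<lambda>y. cf k (u y)) \<in> borel_measurable borel" if "k \<in> K"
    by (rule fcomb_measurable[OF cf_fcomb[OF that]]) (use halfline_section_measurable[OF um] in auto)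
  show "nsq lborel (\<lambda>y. cf k (u y)) < \<infinity>" if k: "k \<in> K"
  proof -
    have "nsq lborel (\<lambda>y. cf k (u y)) \<le> (\<integral>\<^sup>+y. E_sq \<omega> S (u y) \<partial>lborel)"
      unfolding nsq_def E by (intro nn_integral_mono member_le_sum[OF k]) auto
    also note uint
    finally show ?thesis .
  qed
qed

text \<open>The truncated Fourier integral commutes with the finite expansion into the functions
  \<open>e k\<close>, so it acts on coefficients; and a finite sum of norms tends to 0 exactly if
  each of them does.\<close>

lemma is_ft_E_iff:
  fixes u v :: "real^'q \<Rightarrow> real \<Rightarrow> complex"
  shows "is_ft (E_sq \<omega> S) u v \<longleftrightarrow> u \<in> L2H (E_sq \<omega> S) \<and> v \<in> L2H (E_sq \<omega> S) \<and>
    (\<forall>k\<in>K. sft (\<lambda>y. cf k (u y)) (\<lambda>\<eta>. cf k (v \<eta>)))"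
proof -
  have "((\<lambda>R. \<integral>\<^sup>+\<eta>. E_sq \<omega> S (\<lambda>t. v \<eta> t - ft_on (cball 0 R) u \<eta> t) \<partial>lborel) \<longlongrightarrow> 0) at_top \<longleftrightarrow>
    (\<forall>k\<in>K. sft (\<lambda>y. cf k (u y)) (\<lambda>\<eta>. cf k (v \<eta>)))"
    if u: "u \<in> L2H (E_sq \<omega> S)" and v: "v \<in> L2H (E_sq \<omega> S)"
  proof -
    let ?F = "\<lambda>k R. ftr (\<lambda>y. indicator (cball 0 R) y * cf k (u y))"
    have ft: "ft_on (cball 0 R) u \<eta> t = comb (\<lambda>k. ?F k R \<eta>) t" if t: "t > 0" for R \<eta> t
    proof -
      have i: "integrable lborel (\<lambda>y. cis (- (y \<bullet> \<eta>)) * (indicator (cball 0 R) y * cf k (u y)))" if "k \<in> K" for k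
        by (rule integrable_cis_mult(2)[OF truncated_integrable[OF L2H_E_D(1,2)[OF u that]]])
      have "ft_on (cball 0 R) u \<eta> t =
          (LINT y|lborel. (\<Sum>k\<in>K. (cis (- (y \<bullet> \<eta>)) * (indicator (cball 0 R) y * cf k (u y))) * e k t))"
        unfolding ft_on_eq_ftr ftr_def
        by (intro Bochner_Integration.integral_cong refl)
           (simp only: L2H_E_D(3)[OF u t] comb_def sum_distrib_left mult.assoc)
      also have "\<dots> = (\<Sum>k\<in>K. (LINT y|lborel. cis (- (y \<bullet> \<eta>)) * (indicator (cball 0 R) y * cf k (u y))) * e k t)"
        by (subst Bochner_Integration.integral_sum) (auto simp: i)
      finally show ?thesis by (simp add: comb_def ftr_def)
    qed
    have E: "E_sq \<omega> S (\<lambda>t. v \<eta> t - ft_on (cball 0 R) u \<eta> t) = (\<Sum>k\<in>K. ennreal ((cmod (cf k (v \<eta>) - ?F k R \<eta>))\<^sup>2))" for R \<eta>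
    proof (rule E_sq_comb)
      fix t :: real assume t: "t > 0"
      have "v \<eta> t - ft_on (cball 0 R) u \<eta> t = comb (\<lambda>k. cf k (v \<eta>)) t - comb (\<lambda>k. ?F k R \<eta>) t"
        by (simp only: L2H_E_D(3)[OF v t, symmetric] ft[OF t])
      then show "v \<eta> t - ft_on (cball 0 R) u \<eta> t = comb (\<lambda>k. cf k (v \<eta>) - ?F k R \<eta>) t"
        by (simp add: comb_def sum_subtractf left_diff_distrib)
    qed
    have tot: "(\<integral>\<^sup>+\<eta>. E_sq \<omega> S (\<lambda>t. v \<eta> t - ft_on (cball 0 R) u \<eta> t) \<partial>lborel) =
        (\<Sum>k\<in>K. nsq lborel (\<lambda>\<eta>. cf k (v \<eta>) - ?F k R \<eta>))" for R
    proof -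
      have "(\<lambda>\<eta>. ennreal ((cmod (cf k (v \<eta>) - ?F k R \<eta>))\<^sup>2)) \<in> borel_measurable lborel" if "k \<in> K" for k
        using L2H_E_D(1)[OF u that] L2H_E_D(1)[OF v that] by measurable
      then show ?thesis unfolding E nsq_def by (subst nn_integral_sum) auto
    qed
    show ?thesis
      unfolding tot sft_def
    proof (intro iffI ballI)
      fix k assume *: "((\<lambda>R. \<Sum>k\<in>K. nsq lborel (\<lambda>\<eta>. cf k (v \<eta>) - ?F k R \<eta>)) \<longlongrightarrow> 0) at_top" and k: "k \<in> K"
      show "((\<lambda>R. nsq lborel (\<lambda>\<eta>. cf k (v \<eta>) - ?F k R \<eta>)) \<longlongrightarrow> 0) at_top"
        by (rule tendsto_0_squeeze_ennreal[OF *]) (rule member_le_sum[OF k], auto)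
    next
      assume *: "\<forall>k\<in>K. ((\<lambda>R. nsq lborel (\<lambda>\<eta>. cf k (v \<eta>) - ?F k R \<eta>)) \<longlongrightarrow> 0) at_top"
      have "((\<lambda>R. \<Sum>k\<in>K. nsq lborel (\<lambda>\<eta>. cf k (v \<eta>) - ?F k R \<eta>)) \<longlongrightarrow> (\<Sum>k\<in>K. 0)) at_top"
        by (rule tendsto_sum) (use * in auto)
      then show "((\<lambda>R. \<Sum>k\<in>K. nsq lborel (\<lambda>\<eta>. cf k (v \<eta>) - ?F k R \<eta>)) \<longlongrightarrow> 0) at_top" by simp
    qed
  qed
  then show ?thesis unfolding is_ft_def by blast
qed

lemma is_ft_E_surjective:
  fixes v :: "real^'q \<Rightarrow> real \<Rightarrow> complex"
  assumes v: "v \<in> L2H (E_sq \<omega> S)"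
  obtains w where "is_ft (E_sq \<omega> S) w v"
proof -
  have "\<forall>k\<in>K. \<exists>h. h \<in> borel_measurable borel \<and> nsq lborel h < \<infinity> \<and> sft h (\<lambda>\<eta>. cf k (v \<eta>))"
    using sft_surjective[OF L2H_E_D(1,2)[OF v]] by metis
  then obtain h where h: "\<And>k. k \<in> K \<Longrightarrow> h k \<in> borel_measurable borel" "\<And>k. k \<in> K \<Longrightarrow> nsq lborel (h k) < \<infinity>"
    "\<And>k. k \<in> K \<Longrightarrow> sft (h k) (\<lambda>\<eta>. cf k (v \<eta>))" by metis
  define w where "w y = comb (\<lambda>k. h k y)" for y
  have w: "w \<in> L2H (E_sq \<omega> S)" by (rule L2H_E_I[OF h(1,2)]) (auto simp: w_def)
  have "cf k (w y) = h k y" if "k \<in> K" for k y by (rule cf_comb[OF _ that]) (simp add: w_def)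
  then have "is_ft (E_sq \<omega> S) w v" unfolding is_ft_E_iff using w v h(3) by simp
  then show thesis by (rule that)
qed

text \<open>Allows the transform to be replaced by another representative; needed because the
  relations describing the range hold only for almost every frequency.\<close>

lemma is_ft_E_cong_AE:
  fixes u v v' :: "real^'q \<Rightarrow> real \<Rightarrow> complex"
  assumes ft: "is_ft (E_sq \<omega> S) u v" and v': "v' \<in> L2H (E_sq \<omega> S)"
    and ae: "\<And>k. k \<in> K \<Longrightarrow> AE \<eta> in lborel. cf k (v \<eta>) = cf k (v' \<eta>)"
  shows "is_ft (E_sq \<omega> S) u v'"
proof -
  have "sft (\<lambda>y. cf k (u y)) (\<lambda>\<eta>. cf k (v' \<eta>))" if k: "k \<in> K" for k
  proof -
    have "nsq lborel (\<lambda>\<eta>. cf k (v' \<eta>) - ftr (\<lambda>y. indicator (cball 0 R) y * cf k (u y)) \<eta>) =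
        nsq lborel (\<lambda>\<eta>. cf k (v \<eta>) - ftr (\<lambda>y. indicator (cball 0 R) y * cf k (u y)) \<eta>)" for R
      using ae[OF k] by (intro nsq_cong_AE) auto
    moreover have "sft (\<lambda>y. cf k (u y)) (\<lambda>\<eta>. cf k (v \<eta>))" using ft k by (simp add: is_ft_E_iff)
    ultimately show ?thesis by (simp add: sft_def)
  qed
  then show ?thesis using ft v' by (simp add: is_ft_E_iff)
qed

lemma is_ft_E_unique:
  fixes u v v' :: "real^'q \<Rightarrow> real \<Rightarrow> complex"
  assumes ft: "is_ft (E_sq \<omega> S) u v" "is_ft (E_sq \<omega> S) u v'" and k: "k \<in> K"
  shows "AE \<eta> in lborel. cf k (v \<eta>) = cf k (v' \<eta>)"
  by (rule sft_unique[of "\<lambda>y. cf k (u y)"]) (use ft k in \<open>auto simp: is_ft_E_iff intro: L2H_E_D(1)\<close>)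

lemma comb_add_scale: "comb C t + c * comb D t = comb (\<lambda>k. C k + c * D k) t"
  by (simp add: comb_def sum_distrib_left algebra_simps sum.distrib)

lemma L2H_E_add_scale:
  fixes u u' :: "real^'q \<Rightarrow> real \<Rightarrow> complex"
  assumes u: "u \<in> L2H (E_sq \<omega> S)" "u' \<in> L2H (E_sq \<omega> S)"
  shows "(\<lambda>y t. u y t + c * u' y t) \<in> L2H (E_sq \<omega> S)"
    and "k \<in> K \<Longrightarrow> cf k (\<lambda>t. u y t + c * u' y t) = cf k (u y) + c * cf k (u' y)"
proof -
  have e: "u y t + c * u' y t = comb (\<lambda>k. cf k (u y) + c * cf k (u' y)) t" if "t > 0" for y t
    using L2H_E_D(3)[OF u(1) that, of y] L2H_E_D(3)[OF u(2) that, of y] comb_add_scale by metis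
  note m = L2H_E_D(1)[OF u(1)] L2H_E_D(1)[OF u(2)]
  show "(\<lambda>y t. u y t + c * u' y t) \<in> L2H (E_sq \<omega> S)"
  proof (rule L2H_E_I[OF _ _ e])
    fix k assume k: "k \<in> K"
    note [measurable] = m[OF k]
    show "(\<lambda>y. cf k (u y) + c * cf k (u' y)) \<in> borel_measurable borel" by measurable
    show "nsq lborel (\<lambda>y. cf k (u y) + c * cf k (u' y)) < \<infinity>"
    proof (rule nsq_add_finite)
      show "nsq lborel (\<lambda>y. c * cf k (u' y)) < \<infinity>"
        using L2H_E_D(2)[OF u(2) k] by (subst nsq_cmult) (auto simp: ennreal_mult_less_top)
      show "nsq lborel (\<lambda>y. cf k (u y)) < \<infinity>" by (rule L2H_E_D(2)[OF u(1) k])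
    qed measurable
  qed
  show "cf k (\<lambda>t. u y t + c * u' y t) = cf k (u y) + c * cf k (u' y)" if "k \<in> K"
    by (rule cf_comb[OF e that])
qed

lemma is_ft_E_add_scale:
  fixes u v u' v' :: "real^'q \<Rightarrow> real \<Rightarrow> complex"
  assumes "is_ft (E_sq \<omega> S) u v" "is_ft (E_sq \<omega> S) u' v'"
  shows "is_ft (E_sq \<omega> S) (\<lambda>y t. u y t + c * u' y t) (\<lambda>\<eta> t. v \<eta> t + c * v' \<eta> t)"
proof -
  have mem: "u \<in> L2H (E_sq \<omega> S)" "v \<in> L2H (E_sq \<omega> S)" "u' \<in> L2H (E_sq \<omega> S)" "v' \<in> L2H (E_sq \<omega> S)"
    using assms by (auto simp: is_ft_E_iff)
  show ?thesis
    unfolding is_ft_E_iff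
  proof (intro conjI ballI L2H_E_add_scale mem)
    fix k assume k: "k \<in> K"
    show "sft (\<lambda>y. cf k (\<lambda>t. u y t + c * u' y t)) (\<lambda>\<eta>. cf k (\<lambda>t. v \<eta> t + c * v' \<eta> t))"
      unfolding L2H_E_add_scale(2)[OF mem(1,3) k] L2H_E_add_scale(2)[OF mem(2,4) k]
      by (rule sft_add_scale[OF L2H_E_D(1)[OF mem(1) k] L2H_E_D(1)[OF mem(3) k] L2H_E_D(1)[OF mem(2) k]
            L2H_E_D(1)[OF mem(4) k] L2H_E_D(2)[OF mem(1) k] L2H_E_D(2)[OF mem(3) k]])
         (use assms k in \<open>auto simp: is_ft_E_iff\<close>)
  qed
qed

end

unbundle fps_syntax

section \<open>Families of Laurent series\<close>

text \<open>Stated with arbitrary lower bounds instead of subdegrees, since a family over \<eta> has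
  a common lower bound while its subdegrees may jump.\<close>

lemma fls_mult_nth_bounds:
  fixes f g :: "complex fls"
  assumes f: "\<And>k. k < n \<Longrightarrow> f $$ k = 0" and g: "\<And>k. k < m \<Longrightarrow> g $$ k = 0"
  shows "(f * g) $$ k = (\<Sum>i=n..k-m. f $$ i * g $$ (k - i))"
proof (cases "f = 0 \<or> g = 0")
  case False
  then have 1: "n \<le> fls_subdegree f" "m \<le> fls_subdegree g"
    using f g by (auto intro: fls_subdegree_geI)
  show ?thesis
    unfolding fls_times_nth(2)
  proof (rule sum.mono_neutral_left)
    show "\<forall>i\<in>{n..k - m} - {fls_subdegree f..k - fls_subdegree g}. f $$ i * g $$ (k - i) = 0"
      by (auto simp: not_le)
  qed (use 1 in auto)
qed auto

lemma fls_mult_nth_eq_0: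
  fixes f g :: "complex fls"
  assumes f: "\<And>k. k < n \<Longrightarrow> f $$ k = 0" and g: "\<And>k. k < m \<Longrightarrow> g $$ k = 0" and "k < n + m"
  shows "(f * g) $$ k = 0"
  using assms(3) by (subst fls_mult_nth_bounds[OF f g]) auto

text \<open>A bookkeeping of orders in \<eta>: the lower bound for the exponents is common to the
  family, and the constant C may depend on the index k. In use q is 1, [\<eta>]^\<mu>, its inverse,
  or such a weight times the norm of \<open>v \<eta>\<close>.\<close>

definition lfam :: "('e::topological_space \<Rightarrow> real) \<Rightarrow> ('e \<Rightarrow> complex fls) \<Rightarrow> bool" where
  "lfam q F \<longleftrightarrow> (\<exists>n. \<forall>\<eta>. \<forall>k<n. F \<eta> $$ k = 0) \<and>
     (\<forall>k. (\<lambda>\<eta>. F \<eta> $$ k) \<in> borel_measurable borel \<and> (\<exists>C\<ge>0. \<forall>\<eta>. cmod (F \<eta> $$ k) \<le> C * q \<eta>))"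

lemma lfam_bound:
  assumes "lfam q F" obtains C where "C \<ge> 0" "\<And>\<eta>. cmod (F \<eta> $$ k) \<le> C * q \<eta>"
  using assms unfolding lfam_def by blast

lemma lfam_measurable: "lfam q F \<Longrightarrow> (\<lambda>\<eta>. F \<eta> $$ k) \<in> borel_measurable borel"
  by (simp add: lfam_def)

lemma lfam_const: "lfam (\<lambda>_. 1) (\<lambda>_. F)"
  unfolding lfam_def
  by (auto intro!: exI[of _ "fls_subdegree F"] exI[of _ "cmod (F $$ _)"])

lemma lfam_0: "lfam q (\<lambda>_. 0)"
  unfolding lfam_def by (auto intro!: exI[of _ "0::real"])

lemma lfam_add:
  assumes "lfam q F" "lfam q G"
  shows "lfam q (\<lambda>\<eta>. F \<eta> + G \<eta>)"
proof -
  from assms obtain n n' where n: "\<And>\<eta> k. k < n \<Longrightarrow> F \<eta> $$ k = 0" and n': "\<And>\<eta> k. k < n' \<Longrightarrow> G \<eta> $$ k = 0"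
    unfolding lfam_def by meson
  have bd: "\<exists>C\<ge>0. \<forall>\<eta>. cmod (F \<eta> $$ k + G \<eta> $$ k) \<le> C * q \<eta>" for k
  proof -
    obtain C where C: "C \<ge> 0" "\<And>\<eta>. cmod (F \<eta> $$ k) \<le> C * q \<eta>" by (rule lfam_bound[OF assms(1), where k = k]) (rule that)
    obtain D where D: "D \<ge> 0" "\<And>\<eta>. cmod (G \<eta> $$ k) \<le> D * q \<eta>" by (rule lfam_bound[OF assms(2), where k = k]) (rule that)
    have "cmod (F \<eta> $$ k + G \<eta> $$ k) \<le> (C + D) * q \<eta>" for \<eta>
      using norm_triangle_ineq[of "F \<eta> $$ k" "G \<eta> $$ k"] C(2)[of \<eta>] D(2)[of \<eta>] by (simp add: distrib_right)
    then show ?thesis using C(1) D(1) by (intro exI[of _ "C + D"]) auto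
  qed
  have "(F \<eta> + G \<eta>) $$ k = 0" if "k < min n n'" for \<eta> k using that n n' by simp
  then show ?thesis
    unfolding lfam_def fls_plus_nth using bd
    by (auto intro!: exI[of _ "min n n'"] borel_measurable_add lfam_measurable assms)
qed

lemma lfam_sum: "finite I \<Longrightarrow> (\<And>i. i \<in> I \<Longrightarrow> lfam q (F i)) \<Longrightarrow> lfam q (\<lambda>\<eta>. \<Sum>i\<in>I. F i \<eta>)"
  by (induction I rule: finite_induct) (auto intro: lfam_add lfam_0)

text \<open>The common lower bounds make every coefficient of the product a finite sum over a range
  independent of \<eta>.\<close>

lemma lfam_mult:
  assumes F: "lfam q F" and G: "lfam q' G" and q: "\<And>\<eta>. q \<eta> \<ge> 0" "\<And>\<eta>. q' \<eta> \<ge> 0"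
  shows "lfam (\<lambda>\<eta>. q \<eta> * q' \<eta>) (\<lambda>\<eta>. F \<eta> * G \<eta>)"
proof -
  from assms obtain n n' where n: "\<And>\<eta> k. k < n \<Longrightarrow> F \<eta> $$ k = 0" and n': "\<And>\<eta> k. k < n' \<Longrightarrow> G \<eta> $$ k = 0"
    unfolding lfam_def by meson
  have nth: "(F \<eta> * G \<eta>) $$ k = (\<Sum>i=n..k-n'. F \<eta> $$ i * G \<eta> $$ (k - i))" for \<eta> k
    by (rule fls_mult_nth_bounds[OF n n'])
  have bd: "\<exists>C\<ge>0. \<forall>\<eta>. cmod (\<Sum>i=n..k-n'. F \<eta> $$ i * G \<eta> $$ (k - i)) \<le> C * (q \<eta> * q' \<eta>)" for k
  proof -
    have "\<forall>i. \<exists>C\<ge>0. \<forall>\<eta>. cmod (F \<eta> $$ i) \<le> C * q \<eta>" using F unfolding lfam_def by blast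
    then obtain C where C: "\<And>i. C i \<ge> 0" "\<And>i \<eta>. cmod (F \<eta> $$ i) \<le> C i * q \<eta>" by metis
    have "\<forall>i. \<exists>C\<ge>0. \<forall>\<eta>. cmod (G \<eta> $$ i) \<le> C * q' \<eta>" using G unfolding lfam_def by blast
    then obtain D where D: "\<And>i. D i \<ge> 0" "\<And>i \<eta>. cmod (G \<eta> $$ i) \<le> D i * q' \<eta>" by metis
    have "cmod (\<Sum>i=n..k-n'. F \<eta> $$ i * G \<eta> $$ (k - i)) \<le> (\<Sum>i=n..k-n'. C i * D (k - i)) * (q \<eta> * q' \<eta>)" for \<eta>
    proof -
      have "cmod (\<Sum>i=n..k-n'. F \<eta> $$ i * G \<eta> $$ (k - i)) \<le> (\<Sum>i=n..k-n'. (C i * q \<eta>) * (D (k - i) * q' \<eta>))"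
        using C D q by (intro sum_norm_le) (auto simp: norm_mult intro!: mult_mono)
      also have "\<dots> = (\<Sum>i=n..k-n'. C i * D (k - i)) * (q \<eta> * q' \<eta>)"
        by (simp add: sum_distrib_left sum_distrib_right mult_ac)
      finally show ?thesis .
    qed
    then show ?thesis using C(1) D(1)
      by (intro exI[of _ "\<Sum>i=n..k-n'. C i * D (k - i)"]) (auto intro!: sum_nonneg)
  qed
  have 0: "(F \<eta> * G \<eta>) $$ k = 0" if "k < n + n'" for \<eta> k by (rule fls_mult_nth_eq_0[OF n n' that])
  have m: "(\<lambda>\<eta>. (F \<eta> * G \<eta>) $$ k) \<in> borel_measurable borel" for k
    unfolding nth by (intro borel_measurable_sum borel_measurable_times lfam_measurable[OF F] lfam_measurable[OF G])
  show ?thesis unfolding lfam_def using 0 m bd[folded nth] by blast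
qed

lemma lfam_scalar:
  assumes "\<phi> \<in> borel_measurable borel" "\<And>\<eta>. cmod (\<phi> \<eta>) \<le> C * q \<eta>" "\<And>\<eta>. q \<eta> \<ge> 0"
  shows "lfam q (\<lambda>\<eta>. fls_const (\<phi> \<eta>))"
  unfolding lfam_def
proof (intro conjI allI)
  show "\<exists>n. \<forall>\<eta>. \<forall>k<n. fls_const (\<phi> \<eta>) $$ k = 0" by (intro exI[of _ 0]) auto
  fix k
  show "(\<lambda>\<eta>. fls_const (\<phi> \<eta>) $$ k) \<in> borel_measurable borel"
    using assms(1) by (cases "k = 0") auto
  show "\<exists>C\<ge>0. \<forall>\<eta>. cmod (fls_const (\<phi> \<eta>) $$ k) \<le> C * q \<eta>"
  proof (intro exI[of _ "max 0 C"] conjI allI)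
    fix \<eta>
    have "C * q \<eta> \<le> max 0 C * q \<eta>" using assms(3) by (intro mult_right_mono) auto
    with assms(2)[of \<eta>] show "cmod (fls_const (\<phi> \<eta>) $$ k) \<le> max 0 C * q \<eta>"
      using assms(3)[of \<eta>] by (cases "k = 0") auto
  qed simp
qed

lemma lfam_cong: "lfam q F \<Longrightarrow> (\<And>\<eta>. q \<eta> = q' \<eta>) \<Longrightarrow> (\<And>\<eta>. F \<eta> = F' \<eta>) \<Longrightarrow> lfam q' F'"
  by (metis ext)

section \<open>Expansions at a point\<close>

text \<open>The expansion of p at a in powers of z - a, obtained by substituting a + X, which keeps
  it visibly linear in the coefficients of p.\<close>

definition pl :: "complex poly \<Rightarrow> complex \<Rightarrow> complex fls" where
  "pl p a = (\<Sum>i\<le>degree p. fls_const (coeff p i) * (fls_const a + fls_X) ^ i)"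

lemma pl_eq: "degree p \<le> n \<Longrightarrow> pl p a = (\<Sum>i\<le>n. fls_const (coeff p i) * (fls_const a + fls_X) ^ i)"
  unfolding pl_def by (intro sum.mono_neutral_left) (auto simp: coeff_eq_0)

lemma pl_expansion: "(\<lambda>z. poly p (a + z)) has_laurent_expansion pl p a"
  unfolding poly_altdef pl_def by (intro laurent_expansion_intros)

lemma pl_smult: "pl (smult c p) a = fls_const c * pl p a"
  by (simp add: pl_eq[of _ "degree p"] sum_distrib_left mult.assoc fls_const_mult_const flip: fls_const_mult_const)

lemma pl_nonneg:
  assumes "k < 0"
  shows "pl p a $$ k = 0"
proof -
  have "((fls_const a + fls_X) ^ i) $$ k = 0" if "k < 0" for i and k :: int
    using that
  proof (induction i arbitrary: k)
    case (Suc i)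
    show ?case
      unfolding power_Suc by (rule fls_mult_nth_eq_0[where n = 0 and m = 0]) (use Suc in auto)
  qed auto
  then have 0: "(fls_const c * (fls_const a + fls_X) ^ i) $$ k = 0" if "k < 0" for i c and k :: int
    using that by (intro fls_mult_nth_eq_0[where n = 0 and m = 0]) auto
  show ?thesis
    unfolding pl_def fls_nth_sum by (rule sum.neutral) (use 0 assms in blast)
qed

lemma pl_nonzero:
  assumes "p \<noteq> 0"
  shows "pl p a \<noteq> 0"
proof
  assume "pl p a = 0"
  then have "\<forall>\<^sub>F z in at a. poly p z = 0"
    using has_laurent_expansion_eventually_zero_iff[OF pl_expansion[of p a]] by simp
  moreover have "\<forall>\<^sub>F z in at a. poly p z \<noteq> 0"
    using poly_roots_finite[OF assms] islimpt_finite[of "{z. poly p z = 0}" a]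
    by (simp add: islimpt_iff_eventually)
  ultimately have "\<forall>\<^sub>F z in at a. False" by eventually_elim simp
  then show False by simp
qed

lemma lfam_pl:
  assumes deg: "\<And>\<eta>. degree (P \<eta>) \<le> n" and m: "\<And>j. (\<lambda>\<eta>. coeff (P \<eta>) j) \<in> borel_measurable borel"
    and bd: "\<And>j. j \<le> n \<Longrightarrow> \<exists>C. \<forall>\<eta>. cmod (coeff (P \<eta>) j) \<le> C * q \<eta>" and q: "\<And>\<eta>. q \<eta> \<ge> 0"
  shows "lfam q (\<lambda>\<eta>. pl (P \<eta>) a)"
proof -
  have "lfam q (\<lambda>\<eta>. fls_const (coeff (P \<eta>) j) * (fls_const a + fls_X) ^ j)" if j: "j \<le> n" for j
  proof -
    obtain C where C: "\<And>\<eta>. cmod (coeff (P \<eta>) j) \<le> C * q \<eta>" using bd[OF j] by blast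
    have "lfam (\<lambda>\<eta>. q \<eta> * 1) (\<lambda>\<eta>. fls_const (coeff (P \<eta>) j) * (fls_const a + fls_X) ^ j)"
      by (rule lfam_mult[OF lfam_scalar[OF m C q] lfam_const]) (use q in auto)
    then show ?thesis by simp
  qed
  then have "lfam q (\<lambda>\<eta>. \<Sum>j\<le>n. fls_const (coeff (P \<eta>) j) * (fls_const a + fls_X) ^ j)"
    by (intro lfam_sum) auto
  then show ?thesis by (simp add: pl_eq[OF deg])
qed

definition prp :: "complex fls \<Rightarrow> complex fls" where
  "prp X = X - fps_to_fls (fls_regpart X)"

lemma prp_nth: "prp X $$ k = (if k < 0 then X $$ k else 0)"
  by (simp add: prp_def)

text \<open>\<open>fls_prpart\<close> is a polynomial in 1 / (z - \<sigma>); inserting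
  \<open>fls_X_inv\<close> turns it back into the Laurent series \<open>prp\<close>.\<close>

lemma principal_part_expansion:
  "(\<lambda>z. principal_part \<sigma> h (\<sigma> + z)) has_laurent_expansion prp (laurent_expansion h \<sigma>)"
proof -
  let ?X = "laurent_expansion h \<sigma>"
  let ?F = "\<Sum>i\<le>degree (fls_prpart ?X). fls_const (coeff (fls_prpart ?X) i) * fls_X_inv ^ i"
  have "(\<lambda>z. \<Sum>i\<le>degree (fls_prpart ?X). coeff (fls_prpart ?X) i * inverse z ^ i) has_laurent_expansion ?F"
    by (intro laurent_expansion_intros)
  moreover have "?F = prp ?X"
  proof (rule fls_eqI)
    fix k
    have "?F $$ k = (\<Sum>i\<le>degree (fls_prpart ?X). if int i = - k then coeff (fls_prpart ?X) i else 0)"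
      by (simp add: fls_nth_sum if_distrib cong: if_cong) (intro sum.cong; auto)
    also have "\<dots> = prp ?X $$ k"
    proof (cases "k < 0")
      case False
      then have "(\<Sum>i\<le>degree (fls_prpart ?X). if int i = - k then coeff (fls_prpart ?X) i else 0) = 0"
        by (intro sum.neutral) auto
      with False show ?thesis by (simp add: prp_nth)
    next
      case True
      have "(\<Sum>i\<le>degree (fls_prpart ?X). if int i = - k then coeff (fls_prpart ?X) i else 0) =
          (\<Sum>i\<le>degree (fls_prpart ?X). if i = nat (- k) then coeff (fls_prpart ?X) (nat (- k)) else 0)"
        using True by (intro sum.cong) auto
      also have "\<dots> = coeff (fls_prpart ?X) (nat (- k))"
        by (auto simp: not_le intro: coeff_eq_0[symmetric])
      finally show ?thesis using True by (simp add: prp_nth)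
    qed
    finally show "?F $$ k = prp ?X $$ k" .
  qed
  ultimately show ?thesis by (simp add: principal_part_def poly_altdef)
qed

text \<open>The coefficient of 1 / (z - \<sigma>) in exp (- (z - \<sigma>) ln t) F, for F with a
  pole of order at most d + 1. It is a polynomial in ln t of degree at most d.\<close>

definition Phi :: "nat \<Rightarrow> complex fls \<Rightarrow> real \<Rightarrow> complex" where
  "Phi d F t = (\<Sum>j\<le>d. of_real ((- ln t) ^ j / fact j) * F $$ (- 1 - int j))"

text \<open>The residue is a coefficient of a product of two Laurent series; the exponential one has
  no negative exponents and F starts at -1 - d, so just the terms of \<open>Phi\<close>
  remain.\<close>

lemma residue_powr:
  assumes B: "(\<lambda>z. B (\<sigma> + z)) has_laurent_expansion F" and F: "\<And>k. k < - 1 - int d \<Longrightarrow> F $$ k = 0" and t: "t > 0"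
  shows "residue (\<lambda>z. of_real t powr (- z) * B z) \<sigma> = of_real t powr (- \<sigma>) * Phi d F t"
proof -
  let ?E = "fps_to_fls (fps_exp (- of_real (ln t))) :: complex fls"
  have "(\<lambda>z. exp (- of_real (ln t) * z)) has_laurent_expansion ?E"
    by (intro has_laurent_expansion_fps fps_expansion_intros)
  then have "(\<lambda>z. of_real t powr (- \<sigma>) * (exp (- of_real (ln t) * z) * B (\<sigma> + z))) has_laurent_expansion
      fls_const (of_real t powr (- \<sigma>)) * (?E * F)"
    by (intro laurent_expansion_intros B)
  also have "(\<lambda>z. of_real t powr (- \<sigma>) * (exp (- of_real (ln t) * z) * B (\<sigma> + z))) =
      (\<lambda>z. of_real t powr (- (\<sigma> + z)) * B (\<sigma> + z))"
  proof
    fix z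
    have "complex_of_real t powr (- (\<sigma> + z)) = of_real t powr (- \<sigma>) * exp (- of_real (ln t) * z)"
      using t by (simp add: powr_def Ln_of_real exp_add[symmetric] algebra_simps)
    then show "of_real t powr (- \<sigma>) * (exp (- of_real (ln t) * z) * B (\<sigma> + z)) = of_real t powr (- (\<sigma> + z)) * B (\<sigma> + z)"
      by (simp add: mult.assoc)
  qed
  finally have "residue (\<lambda>z. of_real t powr (- z) * B z) \<sigma> = of_real t powr (- \<sigma>) * (?E * F) $$ (- 1)"
    by (subst has_laurent_expansion_residue) auto
  also have "(?E * F) $$ (- 1) = (\<Sum>i=0..int d. ?E $$ i * F $$ (- 1 - i))"
    by (subst fls_mult_nth_bounds[where n = 0 and m = "- 1 - int d"]) (auto simp: F)
  also have "\<dots> = Phi d F t"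
    unfolding Phi_def
  proof (rule sum.reindex_bij_witness[of _ int nat])
    show "of_real ((- ln t) ^ nat i / fact (nat i)) * F $$ (- 1 - int (nat i)) = ?E $$ i * F $$ (- 1 - i)"
      if "i \<in> {0..int d}" for i using that by simp
  qed auto
  finally show ?thesis .
qed

section \<open>Powers and logarithms near zero\<close>

lemma power_le_exp: "x \<ge> 0 \<Longrightarrow> x ^ k / fact k \<le> exp (x::real)"
  using sum_le_suminf[OF summable_exp_generic[of x], of "{k}"]
  by (simp add: exp_def divide_inverse mult.commute)

text \<open>The factor exp (\<delta> |ln t|) stands in for arbitrary powers of the logarithm. Its
  square is at most t^(2 \<delta>) + t^(-2 \<delta>), and \<delta> < a + 1/2 keeps the exponents 2 a
  + 2 \<delta> and 2 a - 2 \<delta> above -1.\<close>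

lemma nsq_powr_exp_finite:
  assumes a: "a > - 1 / 2" and \<delta>: "0 \<le> \<delta>" "\<delta> < a + 1 / 2"
  shows "nsq halfline (\<lambda>t. of_real (exp (\<delta> * \<bar>ln t\<bar>) * t powr a * indicator {0<..R} t)) < \<infinity>"
proof -
  have fin: "(\<integral>\<^sup>+t. ennreal (t powr b * indicator {0<..R} t) \<partial>halfline) < \<infinity>" if b: "b > -1" for b
  proof -
    define r where "r = max 0 R"
    have hi: "((\<lambda>x. if x \<in> {0..r} then x powr b else 0) has_integral (r powr (b+1) / (b+1))) UNIV"
      using has_integral_powr_from_0[OF b, of r] by (subst has_integral_restrict_UNIV) (simp add: r_def)
    have "(\<integral>\<^sup>+t. ennreal (t powr b * indicator {0<..R} t) \<partial>halfline) =
        (\<integral>\<^sup>+t. ennreal (t powr b * indicator {0<..R} t) * indicator {0<..} t \<partial>lborel)"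
      unfolding halfline_def by (rule nn_integral_restrict_space) simp
    also have "\<dots> \<le> (\<integral>\<^sup>+x. ennreal (if x \<in> {0..r} then x powr b else 0) \<partial>lborel)"
      by (intro nn_integral_mono) (auto simp: indicator_def r_def)
    also have "\<dots> = ennreal (r powr (b+1) / (b+1))"
      by (rule nn_integral_has_integral_lborel[OF _ _ hi]) auto
    finally show ?thesis by (auto intro: order.strict_trans1)
  qed
  have m: "(\<lambda>t. ennreal (t powr b * indicator {0<..R} t)) \<in> borel_measurable halfline" for b
  proof -
    have "(\<lambda>t. t powr b * indicator {0<..R} t) \<in> borel_measurable borel" by measurable
    then show ?thesis unfolding halfline_def by (intro measurable_restrict_space1) simp
  qed
  have "nsq halfline (\<lambda>t. of_real (exp (\<delta> * \<bar>ln t\<bar>) * t powr a * indicator {0<..R} t)) \<le>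
      (\<integral>\<^sup>+t. ennreal (t powr (2 * a + 2 * \<delta>) * indicator {0<..R} t) + ennreal (t powr (2 * a - 2 * \<delta>) * indicator {0<..R} t) \<partial>halfline)"
    unfolding nsq_def
  proof (intro nn_integral_mono)
    fix t assume "t \<in> space halfline"
    then have t: "t > 0" by simp
    have p: "t powr b = exp (b * ln t)" for b using t by (simp add: powr_def)
    have "(cmod (of_real (exp (\<delta> * \<bar>ln t\<bar>) * t powr a * indicator {0<..R} t)))\<^sup>2 =
        exp (2 * \<delta> * \<bar>ln t\<bar>) * t powr (2 * a) * indicator {0<..R} t"
      by (auto simp: indicator_def p abs_mult power_mult_distrib exp_double[symmetric] algebra_simps norm_mult)
    also have "\<dots> \<le> (t powr (2 * \<delta>) + t powr (- 2 * \<delta>)) * t powr (2 * a) * indicator {0<..R} t"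
      by (intro mult_right_mono) (auto simp: p abs_if)
    also have "\<dots> = t powr (2 * a + 2 * \<delta>) * indicator {0<..R} t + t powr (2 * a - 2 * \<delta>) * indicator {0<..R} t"
      by (simp add: p distrib_right exp_add[symmetric] algebra_simps)
    finally show "ennreal ((cmod (of_real (exp (\<delta> * \<bar>ln t\<bar>) * t powr a * indicator {0<..R} t)))\<^sup>2) \<le>
        ennreal (t powr (2 * a + 2 * \<delta>) * indicator {0<..R} t) + ennreal (t powr (2 * a - 2 * \<delta>) * indicator {0<..R} t)"
      by (subst ennreal_plus[symmetric]; (rule ennreal_leI)?) (auto simp del: of_real_mult)
  qed
  also have "\<dots> = (\<integral>\<^sup>+t. ennreal (t powr (2 * a + 2 * \<delta>) * indicator {0<..R} t) \<partial>halfline) +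
      (\<integral>\<^sup>+t. ennreal (t powr (2 * a - 2 * \<delta>) * indicator {0<..R} t) \<partial>halfline)"
    by (rule nn_integral_add) (rule m)+
  also have "\<dots> < \<infinity>"
    using fin[of "2 * a + 2 * \<delta>"] fin[of "2 * a - 2 * \<delta>"] a \<delta> by (auto simp: less_top)
  finally show ?thesis .
qed

lemma cutoff_bounded:
  assumes "cutoff \<omega>" obtains B where "B > 0" "\<And>t. t > 0 \<Longrightarrow> cmod (\<omega> t) \<le> B"
proof -
  obtain \<epsilon> where \<epsilon>: "\<epsilon> > 0" "\<And>t. 0 \<le> t \<Longrightarrow> t < \<epsilon> \<Longrightarrow> \<omega> t = 1" using cutoff_one[OF assms] by metis
  obtain R where R: "R > 0" "\<And>t. t > R \<Longrightarrow> \<omega> t = 0" using cutoff_support[OF assms] by metis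
  have "continuous_on {\<epsilon>/2..R} \<omega>"
    by (rule continuous_on_subset[OF cutoff_continuous[OF assms]]) (use \<epsilon>(1) in auto)
  then have "bounded (\<omega> ` {\<epsilon>/2..R})"
    by (intro compact_imp_bounded compact_continuous_image compact_Icc)
  then obtain B where B: "\<And>t. t \<in> {\<epsilon>/2..R} \<Longrightarrow> cmod (\<omega> t) \<le> B"
    unfolding bounded_iff by blast
  show thesis
  proof (rule that[of "max 1 B"])
    fix t :: real assume "t > 0"
    consider "t < \<epsilon>" | "t > R" | "t \<ge> \<epsilon>" "t \<le> R" by linarith
    then show "cmod (\<omega> t) \<le> max 1 B"
    proof cases
      case 1 then show ?thesis using \<epsilon>(2)[of t] \<open>t > 0\<close> by simp
    next
      case 2 then show ?thesis using R(2)[of t] by simp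
    next
      case 3
      then have "cmod (\<omega> t) \<le> B" using \<epsilon>(1) by (intro B) auto
      then show ?thesis by simp
    qed
  qed simp
qed

section \<open>The Mellin transform near the pole\<close>

locale mellin_setup =
  fixes \<omega> \<omega>0 :: "real \<Rightarrow> complex" and \<mu> :: nat and \<sigma> :: complex
  assumes cutoff: "cutoff \<omega>" and cutoff0: "cutoff \<omega>0" and \<sigma>: "Re \<sigma> > 1/2 - real \<mu>"
begin

text \<open>The Taylor coefficients at \<sigma> of the Mellin transform of \<omega>0 u, see
  \<open>mellin_expansion\<close>.\<close>

definition mom :: "nat \<Rightarrow> (real \<Rightarrow> complex) \<Rightarrow> complex" where
  "mom k u = (LINT t|halfline. of_real (ln t ^ k / fact k) * (of_real t powr (\<sigma> - 1) * (\<omega>0 t * u t)))"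

text \<open>The integrand of every moment is split into a fixed factor \<open>A k\<close> and a
  factor \<open>H u\<close> whose L2 norm is controlled by the norm of u, so that Cauchy-Schwarz
  applies. \<open>D\<close> records that \<open>A 0\<close> stays in L2 after multiplication by exp
  (\<delta> |ln t|), which absorbs all powers of ln t.\<close>

lemma mellin_analysis:
  obtains A :: "nat \<Rightarrow> real \<Rightarrow> complex" and H :: "(real \<Rightarrow> complex) \<Rightarrow> real \<Rightarrow> complex"
    and D :: "real \<Rightarrow> complex" and \<delta> C :: real where
    "\<And>k. A k \<in> borel_measurable halfline" "D \<in> borel_measurable halfline"
    "nsq halfline D < \<infinity>" "\<delta> > 0" "C \<ge> 0"
    "\<And>k t. t > 0 \<Longrightarrow> A k t = of_real (ln t ^ k / fact k) * A 0 t"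
    "\<And>t. t > 0 \<Longrightarrow> cmod (A 0 t) * exp (\<delta> * \<bar>ln t\<bar>) = cmod (D t)"
    "\<And>k t u. t > 0 \<Longrightarrow> of_real (ln t ^ k / fact k) * (of_real t powr (\<sigma> - 1) * (\<omega>0 t * u t)) = A k t * H u t"
    "\<And>u. u \<in> borel_measurable halfline \<Longrightarrow> H u \<in> borel_measurable halfline"
    "\<And>u. u \<in> borel_measurable halfline \<Longrightarrow> nsq halfline (H u) \<le> ennreal C * K_sq \<omega> 0 (real \<mu>) u"
proof -
  obtain R where R: "R > 0" "\<And>t. t > R \<Longrightarrow> \<omega>0 t = 0" using cutoff_support[OF cutoff0] by metis
  obtain B where B: "B > 0" "\<And>t. t > 0 \<Longrightarrow> cmod (\<omega>0 t) \<le> B" using cutoff_bounded[OF cutoff0] by metis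
  obtain C where C: "C \<ge> 0" "\<And>u. u \<in> borel_measurable halfline \<Longrightarrow>
    nsq halfline (\<lambda>t. of_real (t powr (- real \<mu>) * indicator {0<..R} t) * u t) \<le> ennreal C * K_sq \<omega> 0 (real \<mu>) u"
    by (rule K_sq_local_bound[OF cutoff, of "real \<mu>" R]) auto
  \<comment> \<open>\<open>A 0\<close> is of size t^a near 0: t^(Re \<sigma> - 1) comes from the
    Mellin kernel and t^\<mu> from the weight. The bound Re \<sigma> > 1/2 - \<mu> says a > -1/2,
    and \<delta> takes half of the surplus.\<close>
  define a where "a = Re \<sigma> - 1 + real \<mu>"
  define \<delta> where "\<delta> = (a + 1 / 2) / 2"
  have \<delta>: "\<delta> > 0" "a > - 1 / 2" "\<delta> < a + 1 / 2" using \<sigma> by (simp_all add: \<delta>_def a_def)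
  define A where "A k t = of_real (ln t ^ k / fact k) * (of_real t powr (\<sigma> - 1) * of_real (t powr real \<mu>) * \<omega>0 t)" for k t
  define D where "D t = of_real (exp (\<delta> * \<bar>ln t\<bar>)) * A 0 t" for t
  define H :: "(real \<Rightarrow> complex) \<Rightarrow> real \<Rightarrow> complex" where "H u t = of_real (t powr (- real \<mu>) * indicator {0<..R} t) * u t" for u t
  note [measurable] = cutoff_measurable[OF cutoff0]
  have [measurable]: "(\<lambda>t. complex_of_real t powr b) \<in> borel_measurable halfline" for b
    by (rule measurable_halfline_continuous) (auto intro!: continuous_intros)
  have [measurable]: "(\<lambda>t. complex_of_real (t powr b)) \<in> borel_measurable halfline" for b
    by (rule measurable_halfline_continuous) (auto intro!: continuous_intros)
  have [measurable]: "(\<lambda>t. complex_of_real (ln t ^ k / fact k)) \<in> borel_measurable halfline" for k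
    by (rule measurable_halfline_continuous) (auto intro!: continuous_intros)
  have [measurable]: "(\<lambda>t. complex_of_real (exp (\<delta> * \<bar>ln t\<bar>))) \<in> borel_measurable halfline"
    by (rule measurable_halfline_continuous) (auto intro!: continuous_intros)
  have Am [measurable]: "A k \<in> borel_measurable halfline" for k unfolding A_def[abs_def] by measurable
  have Dm: "D \<in> borel_measurable halfline" unfolding D_def[abs_def] by measurable
  have pn: "cmod (of_real t powr z) = t powr (Re z)" if "t > 0" for t z
    using that by (simp add: norm_powr_real_powr)
  have Anorm: "cmod (A 0 t) \<le> B * (t powr a * indicator {0<..R} t)" if t: "t > 0" for t
  proof (cases "t \<le> R")
    case True
    have "t powr (Re \<sigma> - 1) * t powr real \<mu> = t powr a" by (simp add: a_def powr_add)
    then show ?thesis using t True B(2)[OF t] by (simp add: A_def norm_mult pn mult_left_mono mult.commute)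
  next
    case False then show ?thesis using R(2)[of t] by (simp add: A_def)
  qed
  have "nsq halfline D \<le> nsq halfline (\<lambda>t. of_real B * of_real (exp (\<delta> * \<bar>ln t\<bar>) * t powr a * indicator {0<..R} t))"
  proof (rule nsq_mono)
    fix t assume "t \<in> space halfline"
    then have t: "t > 0" by simp
    have "cmod (D t) = exp (\<delta> * \<bar>ln t\<bar>) * cmod (A 0 t)" by (simp add: D_def norm_mult)
    also have "\<dots> \<le> exp (\<delta> * \<bar>ln t\<bar>) * (B * (t powr a * indicator {0<..R} t))"
      by (intro mult_left_mono Anorm t) simp
    finally show "cmod (D t) \<le> cmod (of_real B * of_real (exp (\<delta> * \<bar>ln t\<bar>) * t powr a * indicator {0<..R} t))"
      using B(1) by (simp add: norm_mult abs_mult mult_ac)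
  qed
  also have "\<dots> < \<infinity>"
  proof (subst nsq_cmult)
    have "(\<lambda>t. exp (\<delta> * \<bar>ln t\<bar>) * t powr a * indicator {0<..R} t) \<in> borel_measurable borel" by measurable
    then have "(\<lambda>t. exp (\<delta> * \<bar>ln t\<bar>) * t powr a * indicator {0<..R} t) \<in> borel_measurable halfline"
      unfolding halfline_def by (intro measurable_restrict_space1) simp
    then show "(\<lambda>t. complex_of_real (exp (\<delta> * \<bar>ln t\<bar>) * t powr a * indicator {0<..R} t)) \<in> borel_measurable halfline"
      by measurable
    show "ennreal ((cmod (of_real B))\<^sup>2) * nsq halfline (\<lambda>t. of_real (exp (\<delta> * \<bar>ln t\<bar>) * t powr a * indicator {0<..R} t)) < \<infinity>"
      using nsq_powr_exp_finite[OF \<delta>(2) _ \<delta>(3), of R] \<delta>(1) by (simp add: ennreal_mult_less_top)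
  qed
  finally have Dfin: "nsq halfline D < \<infinity>" .
  have eq: "of_real (ln t ^ k / fact k) * (of_real t powr (\<sigma> - 1) * (\<omega>0 t * u t)) = A k t * H u t" if t: "t > 0" for k t u
  proof (cases "t \<le> R")
    case True
    have "complex_of_real (t powr real \<mu>) * of_real (t powr (- real \<mu>)) = 1"
      using t by (simp add: powr_minus flip: of_real_mult)
    then have e: "of_real (t powr real \<mu>) * (of_real (t powr (- real \<mu>)) * z) = z" for z :: complex
      by (simp add: mult.assoc[symmetric])
    show ?thesis using True t by (simp add: A_def H_def mult_ac e)
  next
    case False then show ?thesis using R(2)[of t] by (simp add: A_def)
  qed
  show thesis
  proof (rule that[of A D \<delta> C H])
    show "H u \<in> borel_measurable halfline" if [measurable]: "u \<in> borel_measurable halfline" for u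
    proof -
      have "(\<lambda>t. complex_of_real (indicator {0<..R} t)) \<in> borel_measurable borel" by measurable
      then have [measurable]: "(\<lambda>t. complex_of_real (indicator {0<..R} t)) \<in> borel_measurable halfline"
        unfolding halfline_def by (intro measurable_restrict_space1) simp
      have "(\<lambda>t. (of_real (t powr (- real \<mu>)) * of_real (indicator {0<..R} t)) * u t) \<in> borel_measurable halfline" by measurable
      then show ?thesis by (simp add: H_def[abs_def])
    qed
    show "nsq halfline (H u) \<le> ennreal C * K_sq \<omega> 0 (real \<mu>) u" if "u \<in> borel_measurable halfline" for u
      using C(2)[OF that] by (simp add: H_def[abs_def])
    show "cmod (A 0 t) * exp (\<delta> * \<bar>ln t\<bar>) = cmod (D t)" if "t > 0" for t by (simp add: D_def norm_mult)
    show "A k t = of_real (ln t ^ k / fact k) * A 0 t" if "t > 0" for k t by (simp add: A_def)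
  qed (use Am Dm Dfin \<delta> C eq in auto)
qed

lemma K_sq_measurable: "K_sq \<omega> 0 (real \<mu>) u < \<infinity> \<Longrightarrow> u \<in> borel_measurable halfline"
proof -
  interpret W: weighted_L2 "density halfline (\<lambda>t. ennreal (K_weight \<omega> (real \<mu>) t))" "K_sq \<omega> 0 (real \<mu>)"
    by (rule weighted_L2_K_sq[OF cutoff])
  show "K_sq \<omega> 0 (real \<mu>) u < \<infinity> \<Longrightarrow> u \<in> borel_measurable halfline"
    using W.N_eq[of u] by (auto split: if_splits)
qed

lemma mom_bound:
  obtains C where "C \<ge> 0" "\<And>u. K_sq \<omega> 0 (real \<mu>) u < \<infinity> \<Longrightarrow> cmod (mom k u) \<le> C * sqrt (enn2real (K_sq \<omega> 0 (real \<mu>) u))"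
proof -
  obtain A :: "nat \<Rightarrow> real \<Rightarrow> complex" and H :: "(real \<Rightarrow> complex) \<Rightarrow> real \<Rightarrow> complex"
      and D :: "real \<Rightarrow> complex" and \<delta> C :: real where A [measurable]: "\<And>k. A k \<in> borel_measurable halfline"
    and D [measurable]: "D \<in> borel_measurable halfline" "nsq halfline D < \<infinity>" and \<delta>: "\<delta> > 0" and C: "C \<ge> 0"
    and Ak: "\<And>k t. t > 0 \<Longrightarrow> A k t = of_real (ln t ^ k / fact k) * A 0 t"
    and AD: "\<And>t. t > 0 \<Longrightarrow> cmod (A 0 t) * exp (\<delta> * \<bar>ln t\<bar>) = cmod (D t)"
    and eq: "\<And>k t u. t > 0 \<Longrightarrow> of_real (ln t ^ k / fact k) * (of_real t powr (\<sigma> - 1) * (\<omega>0 t * u t)) = A k t * H u t"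
    and H: "\<And>u. u \<in> borel_measurable halfline \<Longrightarrow> H u \<in> borel_measurable halfline"
    and HC: "\<And>u. u \<in> borel_measurable halfline \<Longrightarrow> nsq halfline (H u) \<le> ennreal C * K_sq \<omega> 0 (real \<mu>) u"
    by (rule mellin_analysis) (rule that)
  \<comment> \<open>A single term of the exponential series of \<delta> |ln t|.\<close>
  have lk: "cmod (of_real (ln t ^ k / fact k)) \<le> exp (\<delta> * \<bar>ln t\<bar>) / \<delta> ^ k" for t
  proof -
    have "(\<delta> * \<bar>ln t\<bar>) ^ k / fact k \<le> exp (\<delta> * \<bar>ln t\<bar>)" using \<delta> by (intro power_le_exp) auto
    then show ?thesis using \<delta> by (simp add: norm_divide norm_power power_mult_distrib field_simps)
  qed
  have "nsq halfline (A k) \<le> nsq halfline (\<lambda>t. of_real (1 / \<delta> ^ k) * D t)"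
  proof (rule nsq_mono)
    fix t assume "t \<in> space halfline"
    then have t: "t > 0" by simp
    have "cmod (A k t) = cmod (of_real (ln t ^ k / fact k)) * cmod (A 0 t)" unfolding Ak[OF t, of k] norm_mult ..
    also have "\<dots> \<le> (exp (\<delta> * \<bar>ln t\<bar>) / \<delta> ^ k) * cmod (A 0 t)" by (intro mult_right_mono lk) simp
    also have "\<dots> = cmod (D t) / \<delta> ^ k" unfolding AD[OF t, symmetric] by simp
    finally show "cmod (A k t) \<le> cmod (of_real (1 / \<delta> ^ k) * D t)"
      using \<delta> by (simp add: norm_mult norm_divide norm_power)
  qed
  also have "\<dots> < \<infinity>" using D by (subst nsq_cmult) (auto simp: ennreal_mult_less_top)
  finally have Afin: "nsq halfline (A k) < \<infinity>" .
  let ?c = "enn2real (nsq halfline (A k)) * C"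
  have "cmod (mom k u) \<le> sqrt ?c * sqrt (enn2real (K_sq \<omega> 0 (real \<mu>) u))" if fin: "K_sq \<omega> 0 (real \<mu>) u < \<infinity>" for u
  proof -
    have um: "u \<in> borel_measurable halfline" by (rule K_sq_measurable[OF fin])
    have Hfin: "nsq halfline (H u) < \<infinity>"
      using HC[OF um] fin by (auto simp: ennreal_mult_less_top intro: order.strict_trans1)
    have "mom k u = (LINT t|halfline. A k t * H u t)"
      unfolding mom_def by (intro Bochner_Integration.integral_cong refl) (simp only: eq space_halfline greaterThan_iff)
    then have "ennreal ((cmod (mom k u))\<^sup>2) \<le> nsq halfline (A k) * nsq halfline (H u)"
      using nsq_integrable_mult(2)[OF A H[OF um] Afin Hfin] by simp
    also have "\<dots> \<le> nsq halfline (A k) * (ennreal C * K_sq \<omega> 0 (real \<mu>) u)"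
      by (intro mult_left_mono HC um) simp
    also have "\<dots> = ennreal (?c * enn2real (K_sq \<omega> 0 (real \<mu>) u))"
      using Afin fin C by (simp add: ennreal_mult mult_ac)
    finally have "(cmod (mom k u))\<^sup>2 \<le> ?c * enn2real (K_sq \<omega> 0 (real \<mu>) u)"
      using C by (subst (asm) ennreal_le_iff) auto
    from real_sqrt_le_mono[OF this] show ?thesis by (simp add: real_sqrt_mult)
  qed
  then show thesis using C by (intro that[of "sqrt ?c"]) auto
qed

text \<open>For |z| \<le> \<delta> the partial sums of the series of t^z in powers of z ln t,
  multiplied by \<open>A 0\<close>, are dominated by \<open>D\<close>. The series may thus be
  integrated term by term against \<open>H u\<close>, and the moments come out as its
  coefficients.\<close>

lemma mellin_expansion:
  assumes fin: "K_sq \<omega> 0 (real \<mu>) u < \<infinity>"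
  shows "(\<lambda>z. mellin (\<lambda>t. \<omega>0 t * u t) (\<sigma> + z)) has_laurent_expansion fps_to_fls (Abs_fps (\<lambda>k. mom k u))"
proof -
  obtain A :: "nat \<Rightarrow> real \<Rightarrow> complex" and H :: "(real \<Rightarrow> complex) \<Rightarrow> real \<Rightarrow> complex"
      and D :: "real \<Rightarrow> complex" and \<delta> C :: real where A [measurable]: "\<And>k. A k \<in> borel_measurable halfline"
    and D [measurable]: "D \<in> borel_measurable halfline" and Dfin: "nsq halfline D < \<infinity>" and \<delta>: "\<delta> > 0" and C: "C \<ge> 0"
    and Ak: "\<And>k t. t > 0 \<Longrightarrow> A k t = of_real (ln t ^ k / fact k) * A 0 t"
    and AD: "\<And>t. t > 0 \<Longrightarrow> cmod (A 0 t) * exp (\<delta> * \<bar>ln t\<bar>) = cmod (D t)"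
    and eq: "\<And>k t u. t > 0 \<Longrightarrow> of_real (ln t ^ k / fact k) * (of_real t powr (\<sigma> - 1) * (\<omega>0 t * u t)) = A k t * H u t"
    and H: "\<And>u. u \<in> borel_measurable halfline \<Longrightarrow> H u \<in> borel_measurable halfline"
    and HC: "\<And>u. u \<in> borel_measurable halfline \<Longrightarrow> nsq halfline (H u) \<le> ennreal C * K_sq \<omega> 0 (real \<mu>) u"
    by (rule mellin_analysis) (rule that)
  have um: "u \<in> borel_measurable halfline" by (rule K_sq_measurable[OF fin])
  note [measurable] = H[OF um]
  have Hfin: "nsq halfline (H u) < \<infinity>"
    using HC[OF um] fin by (auto simp: ennreal_mult_less_top intro: order.strict_trans1)
  define G where "G t = cmod (D t * H u t)" for t
  have Gi: "integrable halfline G"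
    unfolding G_def by (intro integrable_norm nsq_integrable_mult(1) Dfin Hfin) measurable
  have momA: "mom k u = (LINT t|halfline. A k t * H u t)" for k
    unfolding mom_def by (intro Bochner_Integration.integral_cong refl) (simp only: eq space_halfline greaterThan_iff)
  have sums: "(\<lambda>k. mom k u * z ^ k) sums mellin (\<lambda>t. \<omega>0 t * u t) (\<sigma> + z)" if z: "cmod z \<le> \<delta>" for z
  proof -
    define f where "f k t = z ^ k * (A k t * H u t)" for k t
    have fm [measurable]: "f k \<in> borel_measurable halfline" for k unfolding f_def by measurable
    have fk: "f k t = (of_real (ln t) * z) ^ k /\<^sub>R fact k * (A 0 t * H u t)" if "t > 0" for k t
      unfolding f_def Ak[OF that, of k] by (simp add: power_mult_distrib scaleR_conv_of_real divide_inverse mult_ac)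
    have fsum: "(\<lambda>k. norm (f k t)) sums (exp (\<bar>ln t\<bar> * cmod z) * cmod (A 0 t * H u t))" if t: "t > 0" for t
    proof -
      have "(\<lambda>k. (\<bar>ln t\<bar> * cmod z) ^ k /\<^sub>R fact k * cmod (A 0 t * H u t)) sums (exp (\<bar>ln t\<bar> * cmod z) * cmod (A 0 t * H u t))"
        by (intro sums_mult2 exp_converges)
      then show ?thesis unfolding fk[OF t] by (simp add: norm_mult norm_power power_mult_distrib mult_ac)
    qed
    have fG: "exp (\<bar>ln t\<bar> * cmod z) * cmod (A 0 t * H u t) \<le> G t" if t: "t > 0" for t
    proof -
      have "exp (\<bar>ln t\<bar> * cmod z) * cmod (A 0 t * H u t) \<le> exp (\<delta> * \<bar>ln t\<bar>) * cmod (A 0 t * H u t)"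
        using z by (intro mult_right_mono) (auto intro: mult_right_mono simp: mult.commute[of "\<bar>ln t\<bar>"])
      also have "\<dots> = (cmod (A 0 t) * exp (\<delta> * \<bar>ln t\<bar>)) * cmod (H u t)" by (simp add: norm_mult mult_ac)
      also have "\<dots> = G t" unfolding AD[OF t] G_def norm_mult ..
      finally show ?thesis .
    qed
    have psum: "(\<Sum>k<n. norm (f k t)) \<le> G t" if t: "t > 0" for n t
    proof -
      have "(\<Sum>k<n. norm (f k t)) \<le> (\<Sum>k. norm (f k t))"
        using fsum[OF t] by (intro sum_le_suminf) (auto simp: sums_iff)
      also have "\<dots> \<le> G t" using fsum[OF t] fG[OF t] by (simp add: sums_iff)
      finally show ?thesis .
    qed
    have fi: "integrable halfline (f k)" for k
    proof (rule Bochner_Integration.integrable_bound[OF Gi fm], rule AE_I2)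
      fix t assume "t \<in> space halfline"
      then have t: "t > 0" by simp
      have "norm (f k t) \<le> (\<Sum>k<Suc k. norm (f k t))" by (rule member_le_sum) auto
      also note psum[OF t]
      finally show "norm (f k t) \<le> norm (G t)" by simp
    qed
    have "(\<lambda>k. integral\<^sup>L halfline (f k)) sums (LINT t|halfline. (\<Sum>k. f k t))"
    proof (rule sums_integral[OF fi])
      show "AE t in halfline. summable (\<lambda>k. norm (f k t))"
        using fsum by (intro AE_I2) (auto simp: sums_iff)
      show "summable (\<lambda>k. LINT t|halfline. norm (f k t))"
      proof (rule summableI_nonneg_bounded)
        fix n
        have "(\<Sum>k<n. LINT t|halfline. norm (f k t)) = (LINT t|halfline. (\<Sum>k<n. norm (f k t)))"
          using fi by (subst Bochner_Integration.integral_sum) auto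
        also have "\<dots> \<le> integral\<^sup>L halfline G"
          using fi psum by (intro integral_mono Gi) auto
        finally show "(\<Sum>k<n. LINT t|halfline. norm (f k t)) \<le> integral\<^sup>L halfline G" .
      qed simp
    qed
    moreover have "integral\<^sup>L halfline (f k) = mom k u * z ^ k" for k
      unfolding f_def momA by simp
    moreover have "(LINT t|halfline. (\<Sum>k. f k t)) = mellin (\<lambda>t. \<omega>0 t * u t) (\<sigma> + z)"
      unfolding mellin_def
    proof (intro Bochner_Integration.integral_cong refl)
      fix t assume "t \<in> space halfline"
      then have t: "t > 0" by simp
      have "(\<lambda>k. f k t) sums (exp (of_real (ln t) * z) * (A 0 t * H u t))"
        unfolding fk[OF t] by (intro sums_mult2 exp_converges)
      then have "(\<Sum>k. f k t) = exp (of_real (ln t) * z) * (A 0 t * H u t)" by (rule sums_unique[symmetric])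
      also have "A 0 t * H u t = of_real t powr (\<sigma> - 1) * (\<omega>0 t * u t)" using eq[OF t, of 0 u] by simp
      also have "exp (of_real (ln t) * z) * (of_real t powr (\<sigma> - 1) * (\<omega>0 t * u t)) = of_real t powr (\<sigma> + z - 1) * (\<omega>0 t * u t)"
      proof -
        have "of_real t powr (\<sigma> + z - 1) = exp (of_real (ln t) * z) * of_real t powr (\<sigma> - 1)"
          using t by (simp add: powr_def Ln_of_real exp_add[symmetric] algebra_simps)
        then show ?thesis by simp
      qed
      finally show "(\<Sum>k. f k t) = of_real t powr (\<sigma> + z - 1) * (\<omega>0 t * u t)" .
    qed
    ultimately show ?thesis by simp
  qed
  let ?F = "Abs_fps (\<lambda>k. mom k u)"
  \<comment> \<open>Convergence at the single point \<delta> bounds the radius of convergence from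
    below.\<close>
  have "summable (\<lambda>k. fps_nth ?F k * of_real \<delta> ^ k)" using sums[of "of_real \<delta>"] \<delta> by (simp add: sums_iff)
  then have cr: "fps_conv_radius ?F \<ge> ereal \<delta>"
    unfolding fps_conv_radius_def using conv_radius_geI[of "fps_nth ?F" "of_real \<delta>"] \<delta> by simp
  have "(\<lambda>z. mellin (\<lambda>t. \<omega>0 t * u t) (\<sigma> + z)) has_fps_expansion ?F"
    unfolding has_fps_expansion_def
  proof
    show "0 < fps_conv_radius ?F" using cr \<delta> by (auto intro: less_le_trans[of 0 "ereal \<delta>"])
    have "\<forall>\<^sub>F z in nhds 0. z \<in> ball 0 \<delta>" using \<delta> by (intro eventually_nhds_in_open) auto
    then show "\<forall>\<^sub>F z in nhds 0. eval_fps ?F z = mellin (\<lambda>t. \<omega>0 t * u t) (\<sigma> + z)"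
    proof eventually_elim
      fix z assume "z \<in> ball (0::complex) \<delta>"
      then have "cmod z \<le> \<delta>" by simp
      from sums[OF this] show "eval_fps ?F z = mellin (\<lambda>t. \<omega>0 t * u t) (\<sigma> + z)"
        by (simp add: eval_fps_def sums_iff)
    qed
  qed
  then show ?thesis by (rule has_laurent_expansion_fps)
qed

end

section \<open>Bounds for the symbols\<close>

lemma smooth_Rq_continuous: "smooth_Rq f \<Longrightarrow> continuous_on UNIV f"
  unfolding smooth_Rq_def by metis

lemma bracket_lower_bound:
  fixes br :: "real^'q \<Rightarrow> real"
  assumes "bracket br" obtains c where "c > 0" "\<And>\<eta>. c \<le> br \<eta>"
proof -
  have cont: "continuous_on UNIV br" using assms by (simp add: bracket_def smooth_Rq_continuous)
  have "\<exists>x\<in>cball 0 1. \<forall>y\<in>cball 0 1. br x \<le> br y"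
    by (rule continuous_attains_inf[OF _ _ continuous_on_subset[OF cont]]) auto
  then obtain x where "\<forall>y\<in>cball 0 1. br x \<le> br y" by blast
  then have x: "\<And>y. norm y \<le> 1 \<Longrightarrow> br x \<le> br y" by simp
  show thesis
  proof (rule that[of "min 1 (br x)"])
    show "min 1 (br x) > 0" using assms by (simp add: bracket_def)
    fix \<eta> :: "real^'q"
    show "min 1 (br x) \<le> br \<eta>"
      using assms x[of \<eta>] by (cases "norm \<eta> \<le> 1") (auto simp: bracket_def not_le)
  qed
qed

lemma bracket_upper_bound:
  fixes br :: "real^'q \<Rightarrow> real"
  assumes "bracket br" obtains B where "B > 0" "\<And>\<eta>. (br \<eta>)\<^sup>2 \<le> B * (1 + (norm \<eta>)\<^sup>2)"
proof -
  have cont: "continuous_on UNIV br" using assms by (simp add: bracket_def smooth_Rq_continuous)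
  have "\<exists>x\<in>cball 0 1. \<forall>y\<in>cball 0 1. br y \<le> br x"
    by (rule continuous_attains_sup[OF _ _ continuous_on_subset[OF cont]]) auto
  then obtain x where "\<forall>y\<in>cball 0 1. br y \<le> br x" by blast
  then have x: "\<And>y. norm y \<le> 1 \<Longrightarrow> br y \<le> br x" by simp
  have pos: "br \<eta> > 0" for \<eta> using assms by (simp add: bracket_def)
  show thesis
  proof (rule that[of "max 1 ((br x)\<^sup>2)"])
    fix \<eta> :: "real^'q"
    show "(br \<eta>)\<^sup>2 \<le> max 1 ((br x)\<^sup>2) * (1 + (norm \<eta>)\<^sup>2)"
    proof (cases "norm \<eta> \<le> 1")
      case True
      then have "(br \<eta>)\<^sup>2 \<le> (br x)\<^sup>2" using x pos[of \<eta>] by (intro power_mono) (auto intro: less_imp_le)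
      also have "\<dots> \<le> max 1 ((br x)\<^sup>2) * 1" by simp
      also have "\<dots> \<le> max 1 ((br x)\<^sup>2) * (1 + (norm \<eta>)\<^sup>2)" by (intro mult_left_mono) auto
      finally show ?thesis .
    next
      case False
      then have "(br \<eta>)\<^sup>2 = (norm \<eta>)\<^sup>2" using assms by (simp add: bracket_def)
      also have "\<dots> \<le> 1 * (1 + (norm \<eta>)\<^sup>2)" by simp
      also have "\<dots> \<le> max 1 ((br x)\<^sup>2) * (1 + (norm \<eta>)\<^sup>2)" by (intro mult_right_mono) auto
      finally show ?thesis .
    qed
  qed simp
qed

text \<open>Outside the unit ball [\<eta>] is |\<eta>|; inside, the positive lower bound c takes
  over. One constant serves both inequalities.\<close>

lemma bracket_norm_bound:
  fixes br :: "real^'q \<Rightarrow> real"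
  assumes "bracket br" obtains A where "A > 0" "\<And>\<eta>. norm \<eta> \<le> A * br \<eta>" "\<And>\<eta>. 1 + (norm \<eta>)\<^sup>2 \<le> A * (br \<eta>)\<^sup>2"
proof -
  obtain c where c: "c > 0" "\<And>\<eta>. c \<le> br \<eta>" using bracket_lower_bound[OF assms] by metis
  define A where "A = max 1 (1 / c)"
  have A: "A \<ge> 1" by (simp add: A_def)
  have nb: "norm \<eta> \<le> A * br \<eta>" for \<eta>
  proof (cases "norm \<eta> \<le> 1")
    case True
    also have "1 = (1 / c) * c" using c(1) by simp
    also have "\<dots> \<le> A * br \<eta>" using c by (intro mult_mono) (auto simp: A_def)
    finally show ?thesis .
  next
    case False
    then have "norm \<eta> = 1 * br \<eta>" using assms by (simp add: bracket_def)
    also have "\<dots> \<le> A * br \<eta>" using A c(2)[of \<eta>] c(1) by (intro mult_right_mono) auto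
    finally show ?thesis .
  qed
  have one: "1 \<le> A * br \<eta>" for \<eta>
  proof -
    have "1 = (1 / c) * c" using c(1) by simp
    also have "\<dots> \<le> A * br \<eta>" using c by (intro mult_mono) (auto simp: A_def)
    finally show ?thesis .
  qed
  have "1 + (norm \<eta>)\<^sup>2 \<le> (2 * A\<^sup>2) * (br \<eta>)\<^sup>2" for \<eta>
  proof -
    have "1\<^sup>2 + (norm \<eta>)\<^sup>2 \<le> (A * br \<eta>)\<^sup>2 + (A * br \<eta>)\<^sup>2"
      by (intro add_mono power_mono nb one) auto
    then show ?thesis by (simp add: power_mult_distrib)
  qed
  moreover have "norm \<eta> \<le> (2 * A\<^sup>2) * br \<eta>" for \<eta>
  proof -
    have "A * 1 \<le> (2 * A) * A" using A by (intro mult_mono) auto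
    then have "A * br \<eta> \<le> (2 * A\<^sup>2) * br \<eta>"
      using c(2)[of \<eta>] c(1) by (intro mult_right_mono) (auto simp: power2_eq_square)
    with nb[of \<eta>] show ?thesis by linarith
  qed
  ultimately show thesis using A by (intro that[of "2 * A\<^sup>2"]) auto
qed

lemma mi_pow_bound: "cmod (mi_pow \<eta> \<alpha>) \<le> norm \<eta> ^ mi_len \<alpha>"
proof -
  have "cmod (mi_pow \<eta> \<alpha>) = (\<Prod>i\<in>UNIV. \<bar>vec_nth \<eta> i\<bar> ^ \<alpha> i)"
    unfolding mi_pow_def by (simp add: prod_norm[symmetric] norm_power)
  also have "\<dots> \<le> (\<Prod>i\<in>UNIV. norm \<eta> ^ \<alpha> i)"
    by (intro prod_mono conjI power_mono component_le_norm_cart) auto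
  also have "\<dots> = norm \<eta> ^ mi_len \<alpha>" by (simp add: power_sum)
  finally show ?thesis .
qed

lemma continuous_mi_pow: "continuous_on UNIV (\<lambda>\<eta>. mi_pow \<eta> \<alpha>)"
  unfolding mi_pow_def by (intro continuous_intros)

text \<open>\<eta>^\<alpha> is only of order |\<alpha>|, possibly less than l; since [\<eta>] is
  bounded below, the missing l - |\<alpha>| powers cost just a constant. So \<open>ftilde\<close> is
  of order \<mu> for every l.\<close>

lemma symbol_bound:
  fixes br :: "real^'q \<Rightarrow> real"
  assumes br: "bracket br" and \<alpha>: "mi_len \<alpha> \<le> l"
  obtains C where "C \<ge> 0" "\<And>\<eta>. cmod (of_real (br \<eta> powi (int \<mu> - int l)) * mi_pow \<eta> \<alpha>) \<le> C * br \<eta> ^ \<mu>"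
proof -
  obtain c where c: "c > 0" "\<And>\<eta>. c \<le> br \<eta>" using bracket_lower_bound[OF br] by metis
  obtain A where A: "A > 0" "\<And>\<eta>. norm \<eta> \<le> A * br \<eta>" using bracket_norm_bound[OF br] by metis
  have pos: "br \<eta> > 0" for \<eta> using br by (simp add: bracket_def)
  let ?k = "mi_len \<alpha>"
  show thesis
  proof (rule that[of "A ^ ?k / c ^ (l - ?k)"])
    fix \<eta>
    have "cmod (mi_pow \<eta> \<alpha>) \<le> (A * br \<eta>) ^ ?k"
      by (rule order_trans[OF mi_pow_bound power_mono[OF A(2)]]) simp
    also have "\<dots> = A ^ ?k * br \<eta> ^ ?k" by (rule power_mult_distrib)
    also have "\<dots> \<le> A ^ ?k * (br \<eta> ^ l / c ^ (l - ?k))"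
    proof (intro mult_left_mono)
      have "br \<eta> ^ ?k * c ^ (l - ?k) \<le> br \<eta> ^ ?k * br \<eta> ^ (l - ?k)"
        using c pos[of \<eta>] by (intro mult_left_mono power_mono) (auto intro: less_imp_le)
      also have "\<dots> = br \<eta> ^ l" using \<alpha> by (simp flip: power_add)
      finally show "br \<eta> ^ ?k \<le> br \<eta> ^ l / c ^ (l - ?k)" using c(1) by (simp add: pos_le_divide_eq)
    qed (use A in auto)
    finally have m: "cmod (mi_pow \<eta> \<alpha>) \<le> A ^ ?k * (br \<eta> ^ l / c ^ (l - ?k))" .
    have "cmod (of_real (br \<eta> powi (int \<mu> - int l)) * mi_pow \<eta> \<alpha>) = br \<eta> powi (int \<mu> - int l) * cmod (mi_pow \<eta> \<alpha>)"
      unfolding norm_mult norm_of_real using pos[of \<eta>] by simp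
    also have "\<dots> \<le> br \<eta> powi (int \<mu> - int l) * (A ^ ?k * (br \<eta> ^ l / c ^ (l - ?k)))"
      using pos[of \<eta>] by (intro mult_left_mono m) simp
    also have "\<dots> = (br \<eta> powi (int \<mu> - int l) * br \<eta> ^ l) * (A ^ ?k / c ^ (l - ?k))" by simp
    also have "br \<eta> powi (int \<mu> - int l) * br \<eta> ^ l = br \<eta> ^ \<mu>"
      using pos[of \<eta>] by (simp add: power_int_diff)
    finally show "cmod (of_real (br \<eta> powi (int \<mu> - int l)) * mi_pow \<eta> \<alpha>) \<le> A ^ ?k / c ^ (l - ?k) * br \<eta> ^ \<mu>"
      by (simp add: mult.commute)
  qed (use A c in auto)
qed

lemma coeff_ftilde:
  fixes br :: "real^'q \<Rightarrow> real"
  shows "coeff (ftilde br \<mu> a l \<eta>) j = (\<Sum>(k,\<alpha>) | k + mi_len \<alpha> = l.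
     (if j \<le> \<mu> - mi_len \<alpha> then taylor (a j \<alpha>) k else 0) * (of_real (br \<eta> powi (int \<mu> - int l)) * mi_pow \<eta> \<alpha>))"
proof -
  have "coeff (\<Sum>i\<le>\<mu> - mi_len \<alpha>. monom (taylor (a i \<alpha>) k * mi_pow \<eta> \<alpha>) i) j =
      (if j \<le> \<mu> - mi_len \<alpha> then taylor (a j \<alpha>) k else 0) * mi_pow \<eta> \<alpha>" for k and \<alpha> :: "'q \<Rightarrow> nat"
    by (simp add: coeff_sum)
  then show ?thesis
    unfolding ftilde_def by (simp add: coeff_sum case_prod_unfold sum_distrib_left mult_ac)
qed

lemma degree_ftilde: "degree (ftilde br \<mu> a l \<eta>) \<le> \<mu>"
  by (rule degree_le) (auto simp: coeff_ftilde intro!: sum.neutral)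

lemma coeff_ftilde_measurable:
  fixes br :: "real^'q \<Rightarrow> real"
  assumes "bracket br"
  shows "(\<lambda>\<eta>. coeff (ftilde br \<mu> a l \<eta>) j) \<in> borel_measurable borel"
proof -
  have cont: "continuous_on UNIV br" and pos: "\<And>\<eta>. br \<eta> > 0"
    using assms by (simp_all add: bracket_def smooth_Rq_continuous)
  have "continuous_on UNIV (\<lambda>\<eta>. coeff (ftilde br \<mu> a l \<eta>) j)"
    unfolding coeff_ftilde case_prod_unfold
    using pos by (intro continuous_intros cont continuous_mi_pow) (auto simp: less_le)
  then show ?thesis by (rule borel_measurable_continuous_onI)
qed

lemma coeff_ftilde_bound:
  fixes br :: "real^'q \<Rightarrow> real"
  assumes br: "bracket br"
  shows "\<exists>C. \<forall>\<eta>. cmod (coeff (ftilde br \<mu> a l \<eta>) j) \<le> C * br \<eta> ^ \<mu>"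
proof -
  let ?I = "{(k, \<alpha> :: 'q \<Rightarrow> nat). k + mi_len \<alpha> = l}"
  let ?t = "\<lambda>i. (if j \<le> \<mu> - mi_len (snd i) then taylor (a j (snd i)) (fst i) else 0)"
  have "\<forall>i\<in>?I. \<exists>C. \<forall>\<eta>. cmod (of_real (br \<eta> powi (int \<mu> - int l)) * mi_pow \<eta> (snd i)) \<le> C * br \<eta> ^ \<mu>"
  proof
    fix i assume "i \<in> ?I"
    then have "mi_len (snd i) \<le> l" by auto
    from symbol_bound[OF br this] show "\<exists>C. \<forall>\<eta>. cmod (of_real (br \<eta> powi (int \<mu> - int l)) * mi_pow \<eta> (snd i)) \<le> C * br \<eta> ^ \<mu>"
      by metis
  qed
  then obtain C where C: "\<And>i \<eta>. i \<in> ?I \<Longrightarrow> cmod (of_real (br \<eta> powi (int \<mu> - int l)) * mi_pow \<eta> (snd i)) \<le> C i * br \<eta> ^ \<mu>"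
    by metis
  have "cmod (coeff (ftilde br \<mu> a l \<eta>) j) \<le> (\<Sum>i\<in>?I. cmod (?t i) * C i) * br \<eta> ^ \<mu>" for \<eta>
  proof -
    have "cmod (coeff (ftilde br \<mu> a l \<eta>) j) \<le> (\<Sum>i\<in>?I. cmod (?t i) * (C i * br \<eta> ^ \<mu>))"
      unfolding coeff_ftilde case_prod_unfold norm_mult
      by (rule sum_norm_le) (use C in \<open>auto simp: norm_mult case_prod_unfold intro!: mult_left_mono\<close>)
    then show ?thesis by (simp add: sum_distrib_right mult.assoc)
  qed
  then show ?thesis by blast
qed

lemma ftilde_0:
  fixes br :: "real^'q \<Rightarrow> real"
  shows "ftilde br \<mu> a 0 \<eta> = smult (of_real (br \<eta> ^ \<mu>)) (conormal \<mu> a)"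
proof -
  have "{(k, \<alpha> :: 'q \<Rightarrow> nat). k + mi_len \<alpha> = 0} = {(0, \<lambda>_. 0)}"
    by (auto simp: fun_eq_iff)
  then show ?thesis
    by (simp add: ftilde_def conormal_def taylor_def mi_pow_def)
qed

section \<open>The range of the singular Green operator\<close>

locale edge_op =
  fixes \<mu> :: nat and \<omega> \<omega>0 :: "real \<Rightarrow> complex" and br :: "real^'q \<Rightarrow> real"
    and a :: "nat \<Rightarrow> ('q \<Rightarrow> nat) \<Rightarrow> real \<Rightarrow> complex" and N :: "complex \<Rightarrow> nat \<Rightarrow> nat" and \<sigma> :: complex
  assumes cutoff: "cutoff \<omega>" and cutoff0: "cutoff \<omega>0" and bracket: "bracket br"
    and adm: "admissible_N br \<mu> a N" and \<sigma>_pole: "\<sigma> \<in> Sigma_poles \<mu> a"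
begin

abbreviation ms where "ms \<equiv> mu_sig \<mu> \<sigma>"
abbreviation md where "md \<equiv> m_sig \<mu> a N \<sigma>"
abbreviation ns where "ns \<equiv> n_sig \<mu> a \<sigma>"
abbreviation Ksq where "Ksq \<equiv> K_sq \<omega> 0 (real \<mu>)"

lemma \<sigma>_bounds: "Re \<sigma> > 1/2 - real \<mu>" "Re \<sigma> < 1/2"
  using \<sigma>_pole by (simp_all add: Sigma_poles_def)

end

sublocale edge_op < E: E_space \<omega> \<sigma> "mu_sig \<mu> \<sigma>" "m_sig \<mu> a N \<sigma>"
  by unfold_locales (rule cutoff)

sublocale edge_op < MT: mellin_setup \<omega> \<omega>0 \<mu> \<sigma>
  by unfold_locales (rule cutoff cutoff0 \<sigma>_bounds)+

sublocale edge_op < KW: weighted_L2 "density halfline (\<lambda>t. ennreal (K_weight \<omega> (real \<mu>) t))" "K_sq \<omega> 0 (real \<mu>)"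
  by (rule weighted_L2_K_sq[OF cutoff])

context edge_op
begin

lemma E_S: "S_sig \<mu> a N \<sigma> = E.S"
  by (simp add: S_sig_def E.S_def)

lemma br_pos: "br \<eta> > 0" using bracket by (simp add: bracket_def)

lemma br_measurable [measurable]: "br \<in> borel_measurable borel"
  using bracket by (intro borel_measurable_continuous_onI smooth_Rq_continuous) (simp add: bracket_def)

lemma lfam_ftilde: "lfam (\<lambda>\<eta>. br \<eta> ^ \<mu>) (\<lambda>\<eta>. pl (ftilde br \<mu> a l \<eta>) z)"
  by (rule lfam_pl[OF degree_ftilde coeff_ftilde_measurable[OF bracket] coeff_ftilde_bound[OF bracket]])
     (simp add: br_pos less_imp_le)

text \<open>The expansion of \<open>gtilde\<close> at \<sigma>, with the recursion carried out in
  the field of formal Laurent series. The factor [\<eta>]^(-\<mu>) coming from the inverse of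
  \<open>ftilde\<close> with index 0 is split off, so that \<open>lfam\<close> can track the order
  in \<eta>.\<close>

fun gls :: "nat \<Rightarrow> real^'q \<Rightarrow> complex fls" where
  "gls l \<eta> = (if l = 0 then 1 else
     - (fls_const (inverse (of_real (br \<eta> ^ \<mu>))) * inverse (pl (conormal \<mu> a) (\<sigma> - of_nat l))) *
       (\<Sum>j<l. pl (ftilde br \<mu> a (l - j) \<eta>) (\<sigma> - of_nat j) * gls j \<eta>))"

declare gls.simps [simp del]

lemma gls_expansion: "(\<lambda>z. gtilde br \<mu> a l \<eta> (\<sigma> + z)) has_laurent_expansion gls l \<eta>"
proof (induction l rule: less_induct)
  case (less l)
  show ?case
  proof (cases "l = 0")
    case True then show ?thesis by (simp add: gtilde.simps[of _ _ _ 0] gls.simps[of 0])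
  next
    case False
    let ?f = "\<lambda>z. - (inverse (of_real (br \<eta> ^ \<mu>)) * inverse (poly (conormal \<mu> a) (\<sigma> - of_nat l + z))) *
      (\<Sum>j<l. poly (ftilde br \<mu> a (l - j) \<eta>) (\<sigma> - of_nat j + z) * gtilde br \<mu> a j \<eta> (\<sigma> + z))"
    have "?f has_laurent_expansion gls l \<eta>"
      using False less
      by (subst gls.simps) (auto intro!: laurent_expansion_intros pl_expansion)
    also have "?f = (\<lambda>z. gtilde br \<mu> a l \<eta> (\<sigma> + z))"
      using False by (subst gtilde.simps) (simp add: ftilde_0 fun_eq_iff algebra_simps)
    finally show ?thesis .
  qed
qed

lemma lfam_br_inverse: "lfam (\<lambda>\<eta>. inverse (br \<eta> ^ \<mu>)) (\<lambda>\<eta>. fls_const (inverse (of_real (br \<eta> ^ \<mu>))))"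
  by (rule lfam_scalar[of _ 1]) (auto simp: norm_inverse norm_power br_pos less_imp_le)

lemma lfam_gls: "lfam (\<lambda>_. 1) (gls l)"
proof (induction l rule: less_induct)
  case (less l)
  show ?case
  proof (cases "l = 0")
    case True then show ?thesis using lfam_const[of 1] by (simp add: gls.simps[of 0] lfam_def)
  next
    case False
    have pos: "0 \<le> br \<eta> ^ \<mu>" "0 \<le> inverse (br \<eta> ^ \<mu>)" for \<eta> using br_pos[of \<eta>] by simp_all
    have 1: "lfam (\<lambda>\<eta>. br \<eta> ^ \<mu> * 1) (\<lambda>\<eta>. pl (ftilde br \<mu> a (l - j) \<eta>) (\<sigma> - of_nat j) * gls j \<eta>)" if "j < l" for j
      by (rule lfam_mult[OF lfam_ftilde less[OF that]]) (use pos in auto)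
    have 2: "lfam (\<lambda>\<eta>. br \<eta> ^ \<mu> * 1) (\<lambda>\<eta>. \<Sum>j<l. pl (ftilde br \<mu> a (l - j) \<eta>) (\<sigma> - of_nat j) * gls j \<eta>)"
      by (rule lfam_sum) (use 1 in auto)
    have 3: "lfam (\<lambda>\<eta>. inverse (br \<eta> ^ \<mu>) * 1) (\<lambda>\<eta>. fls_const (inverse (of_real (br \<eta> ^ \<mu>))) * (- inverse (pl (conormal \<mu> a) (\<sigma> - of_nat l))))"
      by (rule lfam_mult[OF lfam_br_inverse lfam_const]) (use pos in auto)
    have "lfam (\<lambda>\<eta>. (inverse (br \<eta> ^ \<mu>) * 1) * (br \<eta> ^ \<mu> * 1)) (\<lambda>\<eta>. (fls_const (inverse (of_real (br \<eta> ^ \<mu>))) *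
        (- inverse (pl (conormal \<mu> a) (\<sigma> - of_nat l)))) * (\<Sum>j<l. pl (ftilde br \<mu> a (l - j) \<eta>) (\<sigma> - of_nat j) * gls j \<eta>))"
      by (rule lfam_mult[OF 3 2]) (use pos in auto)
    then show ?thesis
    proof (rule lfam_cong)
      fix \<eta>
      show "(inverse (br \<eta> ^ \<mu>) * 1) * (br \<eta> ^ \<mu> * 1) = 1" using br_pos[of \<eta>] by simp
      show "(fls_const (inverse (of_real (br \<eta> ^ \<mu>))) * (- inverse (pl (conormal \<mu> a) (\<sigma> - of_nat l)))) *
          (\<Sum>j<l. pl (ftilde br \<mu> a (l - j) \<eta>) (\<sigma> - of_nat j) * gls j \<eta>) = gls l \<eta>"
        using False by (subst (2) gls.simps) simp
    qed
  qed
qed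

lemma gls_0 [simp]: "gls 0 \<eta> = 1" by (simp add: gls.simps)

text \<open>Admissibility speaks of \<open>laurent_expansion\<close>; uniqueness of expansions
  carries it over to \<open>gls\<close>.\<close>

lemma gls_below: "l \<le> ms \<Longrightarrow> k < - int (N \<sigma> l) \<Longrightarrow> gls l \<eta> $$ k = 0"
  using adm \<sigma>_pole unfolding admissible_N_def laurent_expansion_eqI[OF gls_expansion[of l \<eta>], symmetric]
  by blast

definition P0 :: "complex fls" where "P0 = pl (conormal \<mu> a) \<sigma>"

lemma conormal_nonzero: "conormal \<mu> a \<noteq> 0"
proof
  assume "conormal \<mu> a = 0"
  then have "is_pole (\<lambda>_. 0 :: complex) \<sigma>" using \<sigma>_pole by (simp add: Sigma_poles_def)
  then show False by simp
qed

lemma P0_nonzero: "P0 \<noteq> 0" unfolding P0_def by (rule pl_nonzero[OF conormal_nonzero])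

lemma f0_inv_expansion: "(\<lambda>z. f0_inv \<mu> a (\<sigma> + z)) has_laurent_expansion inverse P0"
  unfolding P0_def by (intro laurent_expansion_intros pl_expansion)

text \<open>\<open>n_sig\<close> is the pole order minus 1, whence \<open>Suc ns\<close>; the
  subtraction of naturals loses nothing because \<sigma> is a genuine pole.\<close>

lemma P0_subdegree: "fls_subdegree (inverse P0) = - int (Suc ns)" "fls_subdegree P0 = int (Suc ns)"
proof -
  have nz: "inverse P0 \<noteq> 0" using P0_nonzero by simp
  have z: "zorder (f0_inv \<mu> a) \<sigma> = fls_subdegree (inverse P0)"
    by (rule has_laurent_expansion_zorder[OF f0_inv_expansion nz])
  have "fls_subdegree (inverse P0) < 0"
    using \<sigma>_pole is_pole_imp_neg_fls_subdegree[OF f0_inv_expansion] by (simp add: Sigma_poles_def)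
  then show 1: "fls_subdegree (inverse P0) = - int (Suc ns)"
    by (simp add: n_sig_def z)
  show "fls_subdegree P0 = int (Suc ns)"
    using 1 by (simp add: fls_inverse_subdegree)
qed

definition Mf :: "(real \<Rightarrow> complex) \<Rightarrow> complex fls" where
  "Mf u = fps_to_fls (Abs_fps (\<lambda>k. MT.mom k u))"

lemma Mf_nth: "Mf u $$ k = (if k < 0 then 0 else MT.mom (nat k) u)"
  by (simp add: Mf_def)

text \<open>A coefficient of the principal part of f0^(-1) times the Mellin transform, free of
  \<eta>; the factor [\<eta>]^(-\<mu>) enters only in \<open>Hf\<close>.\<close>

definition pq :: "nat \<Rightarrow> (real \<Rightarrow> complex) \<Rightarrow> complex" where
  "pq j u = (inverse P0 * Mf u) $$ (- 1 - int j)"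

lemma pq_eq: "pq j u = (\<Sum>i=- int (Suc ns)..- 1 - int j. inverse P0 $$ i * MT.mom (nat (- 1 - int j - i)) u)"
proof -
  have "(inverse P0 * Mf u) $$ (- 1 - int j) = (\<Sum>i=- int (Suc ns)..- 1 - int j - 0. inverse P0 $$ i * Mf u $$ (- 1 - int j - i))"
    by (rule fls_mult_nth_bounds) (auto simp: Mf_nth P0_subdegree)
  then show ?thesis unfolding pq_def by (simp add: Mf_nth)
qed

definition Hf :: "real^'q \<Rightarrow> (real \<Rightarrow> complex) \<Rightarrow> complex fls" where
  "Hf \<eta> u = fls_const (inverse (of_real (br \<eta> ^ \<mu>))) * prp (inverse P0 * Mf u)"

lemma Hf_expansion:
  assumes u: "Ksq u < \<infinity>"
  shows "(\<lambda>z. principal_part \<sigma> (\<lambda>z. inverse (poly (ftilde br \<mu> a 0 \<eta>) z) * mellin (\<lambda>t. \<omega>0 t * u t) z) (\<sigma> + z))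
    has_laurent_expansion Hf \<eta> u"
proof -
  let ?c = "inverse (of_real (br \<eta> ^ \<mu>)) :: complex"
  have "(\<lambda>z. (?c * f0_inv \<mu> a (\<sigma> + z)) * mellin (\<lambda>t. \<omega>0 t * u t) (\<sigma> + z)) has_laurent_expansion (fls_const ?c * inverse P0) * Mf u"
    unfolding Mf_def by (intro laurent_expansion_intros f0_inv_expansion MT.mellin_expansion u)
  then have "laurent_expansion (\<lambda>z. inverse (poly (ftilde br \<mu> a 0 \<eta>) z) * mellin (\<lambda>t. \<omega>0 t * u t) z) \<sigma> = (fls_const ?c * inverse P0) * Mf u"
    by (intro laurent_expansion_eqI) (simp add: ftilde_0)
  moreover have "prp ((fls_const ?c * inverse P0) * Mf u) = Hf \<eta> u"
    unfolding Hf_def by (rule fls_eqI) (simp add: prp_nth mult.assoc)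
  ultimately show ?thesis using principal_part_expansion by metis
qed

lemma Hf_nth: "Hf \<eta> u $$ k = (if k < 0 \<and> k \<ge> - int (Suc ns) then inverse (of_real (br \<eta> ^ \<mu>)) * pq (nat (- 1 - k)) u else 0)"
proof -
  have "(inverse P0 * Mf u) $$ k = 0" if "k < - int (Suc ns)"
    by (rule fls_mult_nth_eq_0[where n = "- int (Suc ns)" and m = 0]) (use that in \<open>auto simp: P0_subdegree Mf_nth\<close>)
  then show ?thesis by (auto simp: Hf_def prp_nth pq_def)
qed

text \<open>\<open>T (l, j) \<eta> F\<close> is the coefficient of \<open>t\<^bsup>l-\<sigma>\<^esup> log\<^sup>j t\<close> contributed by the principal part \<open>F\<close>;
  \<open>tc\<close> is the matrix of \<open>T\<close> in the basis of negative powers.\<close>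

definition T :: "nat \<times> nat \<Rightarrow> real^'q \<Rightarrow> complex fls \<Rightarrow> complex" where
  "T k \<eta> F = of_real ((-1) ^ snd k / fact (snd k)) * (gls (fst k) \<eta> * F) $$ (- 1 - int (snd k))"

definition tc :: "nat \<times> nat \<Rightarrow> nat \<Rightarrow> real^'q \<Rightarrow> complex" where
  "tc k j \<eta> = T k \<eta> (fls_X_inv ^ Suc j)"

definition pf :: "(nat \<Rightarrow> complex) \<Rightarrow> complex fls" where
  "pf P = (\<Sum>j\<le>ns. fls_const (P j) * fls_X_inv ^ Suc j)"

lemma pf_nth: "pf P $$ k = (if k < 0 \<and> k \<ge> - int (Suc ns) then P (nat (- 1 - k)) else 0)"
proof -
  have "pf P $$ k = (\<Sum>j\<le>ns. if - 1 - k = int j then P j else 0)"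
    unfolding pf_def fls_nth_sum by (intro sum.cong refl) (auto simp del: power_Suc)
  also have "\<dots> = (if k < 0 \<and> k \<ge> - int (Suc ns) then P (nat (- 1 - k)) else 0)"
  proof (cases "k < 0 \<and> k \<ge> - int (Suc ns)")
    case True
    have "(\<Sum>j\<le>ns. if - 1 - k = int j then P j else 0) = (\<Sum>j\<le>ns. if j = nat (- 1 - k) then P (nat (- 1 - k)) else 0)"
      using True by (intro sum.cong) auto
    also have "\<dots> = P (nat (- 1 - k))" using True by auto
    finally show ?thesis using True by simp
  qed (auto intro!: sum.neutral)
  finally show ?thesis .
qed

lemma Hf_pf: "Hf \<eta> u = pf (\<lambda>j. inverse (of_real (br \<eta> ^ \<mu>)) * pq j u)"
  by (rule fls_eqI) (simp add: Hf_nth pf_nth)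

lemma T_pf: "T k \<eta> (pf P) = (\<Sum>j\<le>ns. P j * tc k j \<eta>)"
proof -
  have e: "gls (fst k) \<eta> * pf P = (\<Sum>j\<le>ns. fls_const (P j) * (gls (fst k) \<eta> * fls_X_inv ^ Suc j))"
    unfolding pf_def sum_distrib_left by (simp add: mult_ac)
  show ?thesis
    unfolding T_def tc_def e fls_nth_sum by (simp add: sum_distrib_left mult_ac del: power_Suc)
qed

text \<open>From g_0 = 1: the block of the matrix with l = 0 and j \<le> ns is diagonal with nonzero
  entries, so the principal part can be recovered from the coefficients.\<close>

lemma tc_0: "j' \<le> ns \<Longrightarrow> tc (0, j) j' \<eta> = (if j = j' then of_real ((-1) ^ j / fact j) else 0)"
  by (simp add: tc_def T_def del: power_Suc)

lemma tc_measurable [measurable]: "tc k j \<in> borel_measurable borel"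
  and tc_bound: "\<exists>C\<ge>0. \<forall>\<eta>. cmod (tc k j \<eta>) \<le> C"
proof -
  have l: "lfam (\<lambda>_. 1 * 1) (\<lambda>\<eta>. gls (fst k) \<eta> * fls_X_inv ^ Suc j)"
    by (rule lfam_mult[OF lfam_gls lfam_const]) auto
  note [measurable] = lfam_measurable[OF l]
  show "tc k j \<in> borel_measurable borel" unfolding tc_def[abs_def] T_def by measurable
  obtain C where C: "C \<ge> 0" "\<And>\<eta>. cmod ((gls (fst k) \<eta> * fls_X_inv ^ Suc j) $$ (- 1 - int (snd k))) \<le> C * (1 * 1)"
    by (rule lfam_bound[OF l]) (rule that)
  have "cmod (tc k j \<eta>) \<le> cmod (of_real ((-1) ^ snd k / fact (snd k))) * C" for \<eta>
    unfolding tc_def T_def norm_mult by (rule mult_left_mono) (use C(2)[of \<eta>] in auto)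
  then show "\<exists>C\<ge>0. \<forall>\<eta>. cmod (tc k j \<eta>) \<le> C"
    using C(1) by (intro exI[of _ "cmod (of_real ((-1) ^ snd k / fact (snd k))) * C"]) auto
qed

lemma N_le_md: "l \<le> ms \<Longrightarrow> N \<sigma> l + ns \<le> md"
  unfolding m_sig_def by (intro Max_ge) auto

lemma ns_le_md: "ns \<le> md"
  using N_le_md[of 0] by simp

text \<open>Pole orders add up to at most N + (ns + 1), which is at most md + 1 by the choice of
  \<open>m_sig\<close>. Hence logarithms up to the power md suffice.\<close>

lemma gls_Hf_below:
  assumes "l \<le> ms" "k < - 1 - int md"
  shows "(gls l \<eta> * Hf \<eta> u) $$ k = 0"
proof (rule fls_mult_nth_eq_0)
  show "gls l \<eta> $$ k = 0" if "k < - int (N \<sigma> l)" for k by (rule gls_below[OF assms(1) that])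
  show "Hf \<eta> u $$ k = 0" if "k < - int (Suc ns)" for k using that by (simp add: Hf_nth)
  show "k < - int (N \<sigma> l) + - int (Suc ns)" using assms(2) N_le_md[OF assms(1)] by linarith
qed

lemma g_part_eq:
  assumes u: "Ksq u < \<infinity>" and l: "l \<le> ms" and t: "t > 0"
  shows "g_part br \<omega> \<omega>0 \<mu> a \<sigma> l \<eta> u t = \<omega> t * (of_real t ^ l * of_real t powr (- \<sigma>) * Phi md (gls l \<eta> * Hf \<eta> u) t)"
proof -
  have "residue (\<lambda>z. of_real t powr (- z) * (gtilde br \<mu> a l \<eta> z *
      principal_part \<sigma> (\<lambda>z. inverse (poly (ftilde br \<mu> a 0 \<eta>) z) * mellin (\<lambda>t. \<omega>0 t * u t) z) z)) \<sigma> =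
      of_real t powr (- \<sigma>) * Phi md (gls l \<eta> * Hf \<eta> u) t"
    by (rule residue_powr[OF _ gls_Hf_below[OF l] t]) (intro laurent_expansion_intros gls_expansion Hf_expansion u)
  then show ?thesis unfolding g_part_def by (simp add: mult.assoc)
qed

lemma powr_shift:
  assumes t: "t > 0"
  shows "of_real t ^ l * of_real t powr (- \<sigma>) = of_real t powr (- (\<sigma> - of_nat l))"
proof -
  have "of_real t ^ l = exp (of_nat l * complex_of_real (ln t))"
    using t by (simp add: exp_of_nat_mult exp_of_real)
  then have "of_real t ^ l * of_real t powr (- \<sigma>) = exp (of_nat l * of_real (ln t)) * exp (- \<sigma> * of_real (ln t))"
    using t by (simp add: powr_def Ln_of_real)
  also have "\<dots> = exp (- (\<sigma> - of_nat l) * of_real (ln t))"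
    by (simp add: exp_add[symmetric] algebra_simps)
  finally show ?thesis using t by (simp add: powr_def Ln_of_real)
qed

lemma g_sig_comb:
  assumes u: "Ksq u < \<infinity>" and t: "t > 0"
  shows "g_sig br \<omega> \<omega>0 \<mu> a \<sigma> \<eta> u t = E.comb (\<lambda>k. inverse (of_real (br \<eta> ^ \<mu>)) * (\<Sum>j\<le>ns. pq j u * tc k j \<eta>)) t"
proof -
  have "g_sig br \<omega> \<omega>0 \<mu> a \<sigma> \<eta> u t = (\<Sum>l\<le>ms. \<Sum>j\<le>md. T (l, j) \<eta> (Hf \<eta> u) * E.e (l, j) t)"
    unfolding g_sig_def
  proof (intro sum.cong refl)
    fix l assume "l \<in> {..ms}"
    then have l: "l \<le> ms" by simp
    show "g_part br \<omega> \<omega>0 \<mu> a \<sigma> l \<eta> u t = (\<Sum>j\<le>md. T (l, j) \<eta> (Hf \<eta> u) * E.e (l, j) t)"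
      unfolding g_part_eq[OF u l t] powr_shift[OF t] Phi_def sum_distrib_left
    proof (intro sum.cong refl)
      fix j
      have "complex_of_real ((- ln t) ^ j / fact j) = of_real ((- 1) ^ j / fact j) * of_real (ln t ^ j)"
        by (simp add: power_minus[of "ln t"])
      then show "\<omega> t * (of_real t powr (- (\<sigma> - of_nat l)) * (of_real ((- ln t) ^ j / fact j) * (gls l \<eta> * Hf \<eta> u) $$ (- 1 - int j))) =
          T (l, j) \<eta> (Hf \<eta> u) * E.e (l, j) t"
        by (simp add: T_def E.e_def mult_ac)
    qed
  qed
  also have "\<dots> = E.comb (\<lambda>k. T k \<eta> (Hf \<eta> u)) t"
    unfolding E.comb_def E.K_def by (simp add: sum.cartesian_product case_prod_unfold)
  also have "\<dots> = E.comb (\<lambda>k. inverse (of_real (br \<eta> ^ \<mu>)) * (\<Sum>j\<le>ns. pq j u * tc k j \<eta>)) t"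
    by (rule E.comb_cong) (simp add: Hf_pf T_pf sum_distrib_left mult_ac)
  finally show ?thesis .
qed

lemma cf_g_sig:
  assumes u: "Ksq u < \<infinity>" and k: "k \<in> E.K"
  shows "E.cf k (g_sig br \<omega> \<omega>0 \<mu> a \<sigma> \<eta> u) = inverse (of_real (br \<eta> ^ \<mu>)) * (\<Sum>j\<le>ns. pq j u * tc k j \<eta>)"
  by (rule E.cf_comb[OF g_sig_comb[OF u] k])

text \<open>The norm, not its square. In the estimates below \<open>q0 (v \<eta>)\<close> is the
  square integrable scalar that bounds the dependence on \<eta>.\<close>

definition q0 :: "(real \<Rightarrow> complex) \<Rightarrow> real" where "q0 u = sqrt (enn2real (Ksq u))"

lemma pq_bound: obtains C where "C \<ge> 0" "\<And>u. Ksq u < \<infinity> \<Longrightarrow> cmod (pq j u) \<le> C * q0 u"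
proof -
  have "\<forall>k. \<exists>C. C \<ge> 0 \<and> (\<forall>u. Ksq u < \<infinity> \<longrightarrow> cmod (MT.mom k u) \<le> C * q0 u)"
    unfolding q0_def using MT.mom_bound by metis
  then obtain C where C: "\<And>k. C k \<ge> 0" "\<And>k u. Ksq u < \<infinity> \<Longrightarrow> cmod (MT.mom k u) \<le> C k * q0 u" by metis
  let ?I = "{- int (Suc ns)..- 1 - int j}"
  let ?C = "\<Sum>i\<in>?I. cmod (inverse P0 $$ i) * C (nat (- 1 - int j - i))"
  have "cmod (pq j u) \<le> ?C * q0 u" if "Ksq u < \<infinity>" for u
  proof -
    have "cmod (pq j u) \<le> (\<Sum>i\<in>?I. cmod (inverse P0 $$ i) * (C (nat (- 1 - int j - i)) * q0 u))"
      unfolding pq_eq by (rule sum_norm_le) (auto simp: norm_mult intro!: mult_left_mono C that)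
    then show ?thesis by (simp add: sum_distrib_right mult.assoc)
  qed
  then show thesis using C(1) by (intro that[of ?C]) (auto intro!: sum_nonneg)
qed

lemma mom_measurable:
  assumes v: "v \<in> L2H Ksq"
  shows "(\<lambda>\<eta>. MT.mom k (v \<eta>)) \<in> borel_measurable borel"
proof -
  interpret sigma_finite_measure halfline by (rule sigma_finite_halfline)
  have vm [measurable]: "(\<lambda>p. v (fst p) (snd p)) \<in> borel_measurable (lborel \<Otimes>\<^sub>M halfline)"
    using v by (simp add: L2H_def Omega_def case_prod_unfold)
  note [measurable] = cutoff_measurable[OF cutoff0]
  have [measurable]: "(\<lambda>t. complex_of_real t powr (\<sigma> - 1)) \<in> borel_measurable halfline"
    by (rule measurable_halfline_continuous) (auto intro!: continuous_intros)
  have [measurable]: "(\<lambda>t. complex_of_real (ln t ^ k / fact k)) \<in> borel_measurable halfline"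
    by (rule measurable_halfline_continuous) (auto intro!: continuous_intros)
  have "(\<lambda>p. of_real (ln (snd p) ^ k / fact k) * (of_real (snd p) powr (\<sigma> - 1) * (\<omega>0 (snd p) * v (fst p) (snd p))))
      \<in> borel_measurable (lborel \<Otimes>\<^sub>M halfline)"
    by (intro borel_measurable_times vm; (rule measurable_compose[OF measurable_snd])?) measurable
  then have "(\<lambda>\<eta>. LINT t|halfline. of_real (ln t ^ k / fact k) * (of_real t powr (\<sigma> - 1) * (\<omega>0 t * v \<eta> t))) \<in> borel_measurable lborel"
    by (intro borel_measurable_lebesgue_integral) (simp add: case_prod_unfold)
  then show ?thesis by (simp add: MT.mom_def)
qed

lemma pq_measurable: "v \<in> L2H Ksq \<Longrightarrow> (\<lambda>\<eta>. pq j (v \<eta>)) \<in> borel_measurable borel"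
  unfolding pq_eq by (intro borel_measurable_sum borel_measurable_times borel_measurable_const mom_measurable)

lemma q0_measurable:
  assumes v: "v \<in> L2H Ksq"
  shows "(\<lambda>\<eta>. q0 (v \<eta>)) \<in> borel_measurable borel"
    and "nsq lborel (\<lambda>\<eta>. of_real (q0 (v \<eta>))) < \<infinity>"
proof -
  let ?M = "density halfline (\<lambda>t. ennreal (K_weight \<omega> (real \<mu>) t))"
  have fin: "Ksq (v \<eta>) < \<infinity>" for \<eta> using v by (simp add: L2H_def)
  have um: "(\<lambda>(y,t). v y t) \<in> borel_measurable Omega" using v by (simp add: L2H_def)
  then have [measurable]: "(\<lambda>p. v (fst p) (snd p)) \<in> borel_measurable (lborel \<Otimes>\<^sub>M ?M)"
    unfolding KW.measurable_Omega by (simp add: case_prod_unfold)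
  have e: "Ksq (v \<eta>) = (\<integral>\<^sup>+t. ennreal ((cmod (v \<eta> t))\<^sup>2) \<partial>?M)" for \<eta>
    using KW.section_measurable[OF um, of \<eta>] by (simp add: KW.N_eq nsq_def)
  have "(\<lambda>p. ennreal ((cmod (v (fst p) (snd p)))\<^sup>2)) \<in> borel_measurable (lborel \<Otimes>\<^sub>M ?M)" by measurable
  then have "(\<lambda>\<eta>. \<integral>\<^sup>+t. ennreal ((cmod (v \<eta> t))\<^sup>2) \<partial>?M) \<in> borel_measurable lborel"
    by (intro KW.borel_measurable_nn_integral) (simp add: case_prod_unfold)
  then have [measurable]: "(\<lambda>\<eta>. Ksq (v \<eta>)) \<in> borel_measurable borel" by (simp add: e)
  show "(\<lambda>\<eta>. q0 (v \<eta>)) \<in> borel_measurable borel" unfolding q0_def by measurable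
  have "ennreal ((cmod (of_real (q0 (v \<eta>))))\<^sup>2) = Ksq (v \<eta>)" for \<eta>
    using fin[of \<eta>] by (simp add: q0_def)
  then have "nsq lborel (\<lambda>\<eta>. of_real (q0 (v \<eta>))) = (\<integral>\<^sup>+\<eta>. Ksq (v \<eta>) \<partial>lborel)" by (simp add: nsq_def)
  then show "nsq lborel (\<lambda>\<eta>. of_real (q0 (v \<eta>))) < \<infinity>" using v by (simp add: L2H_def)
qed

lemma nsq_dominated_finite:
  assumes "\<And>x. cmod (f x) \<le> C * g x" "g \<in> borel_measurable M" "nsq M (\<lambda>x. of_real (g x)) < \<infinity>"
  shows "nsq M f < \<infinity>"
proof -
  have "nsq M f \<le> nsq M (\<lambda>x. of_real C * of_real (g x))"
    by (rule nsq_mono) (metis assms(1) abs_ge_self norm_of_real of_real_mult order_trans)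
  also have "\<dots> < \<infinity>" using assms(2,3) by (subst nsq_cmult) (auto simp: ennreal_mult_less_top)
  finally show ?thesis .
qed

lemma nsq_sum_finite:
  "finite I \<Longrightarrow> (\<And>i. i \<in> I \<Longrightarrow> f i \<in> borel_measurable M) \<Longrightarrow> (\<And>i. i \<in> I \<Longrightarrow> nsq M (f i) < \<infinity>) \<Longrightarrow>
    nsq M (\<lambda>x. \<Sum>i\<in>I. f i x) < \<infinity>"
proof (induction I rule: finite_induct)
  case empty then show ?case by (simp add: nsq_def)
next
  case (insert i I)
  then show ?case by (simp add: nsq_add_finite(1)[simplified])
qed

text \<open>The coefficients are [\<eta>]^(-\<mu>) times sums bounded by a multiple of
  \<open>q0 (v \<eta>)\<close>. This order -\<mu> is what places the image in H^\<mu>; as [\<eta>]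
  is bounded below it also gives L2.\<close>

lemma g_sig_L2H:
  assumes v: "v \<in> L2H Ksq"
  shows "(\<lambda>\<eta>. g_sig br \<omega> \<omega>0 \<mu> a \<sigma> \<eta> (v \<eta>)) \<in> L2H (E_sq \<omega> E.S)"
    and "k \<in> E.K \<Longrightarrow> nsq lborel (\<lambda>\<eta>. of_real (br \<eta> ^ \<mu>) * E.cf k (g_sig br \<omega> \<omega>0 \<mu> a \<sigma> \<eta> (v \<eta>))) < \<infinity>"
proof -
  have fin: "Ksq (v \<eta>) < \<infinity>" for \<eta> using v by (simp add: L2H_def)
  define s where "s k \<eta> = (\<Sum>j\<le>ns. pq j (v \<eta>) * tc k j \<eta>)" for k \<eta>
  have sm [measurable]: "s k \<in> borel_measurable borel" for k
    unfolding s_def[abs_def] by (intro borel_measurable_sum borel_measurable_times pq_measurable[OF v] tc_measurable)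
  have sfin: "nsq lborel (s k) < \<infinity>" for k
    unfolding s_def[abs_def]
  proof (rule nsq_sum_finite)
    fix j
    obtain C where C: "C \<ge> 0" "\<And>u. Ksq u < \<infinity> \<Longrightarrow> cmod (pq j u) \<le> C * q0 u" by (rule pq_bound[of j]) (rule that)
    obtain D where D: "D \<ge> 0" "\<And>\<eta>. cmod (tc k j \<eta>) \<le> D" using tc_bound[of k j] by blast
    show "nsq lborel (\<lambda>\<eta>. pq j (v \<eta>) * tc k j \<eta>) < \<infinity>"
    proof (rule nsq_dominated_finite)
      fix \<eta>
      have "cmod (pq j (v \<eta>) * tc k j \<eta>) \<le> (C * q0 (v \<eta>)) * D"
        unfolding norm_mult using C D fin by (intro mult_mono) (auto simp: q0_def)
      then show "cmod (pq j (v \<eta>) * tc k j \<eta>) \<le> (C * D) * q0 (v \<eta>)" by (simp add: mult_ac)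
    qed (use q0_measurable[OF v] in auto)
  qed (auto intro!: borel_measurable_times pq_measurable[OF v])
  obtain c where c: "c > 0" "\<And>\<eta>. c \<le> br \<eta>" using bracket_lower_bound[OF bracket] by metis
  have ifin: "nsq lborel (\<lambda>\<eta>. inverse (of_real (br \<eta> ^ \<mu>)) * s k \<eta>) < \<infinity>" for k
  proof -
    have "nsq lborel (\<lambda>\<eta>. inverse (of_real (br \<eta> ^ \<mu>)) * s k \<eta>) \<le> nsq lborel (\<lambda>\<eta>. of_real (inverse (c ^ \<mu>)) * s k \<eta>)"
    proof (rule nsq_mono)
      fix \<eta>
      have "inverse (br \<eta> ^ \<mu>) \<le> inverse (c ^ \<mu>)" using c br_pos[of \<eta>] by (intro le_imp_inverse_le power_mono) auto
      then show "cmod (inverse (of_real (br \<eta> ^ \<mu>)) * s k \<eta>) \<le> cmod (of_real (inverse (c ^ \<mu>)) * s k \<eta>)"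
        using c br_pos[of \<eta>] by (simp add: norm_mult norm_inverse norm_power mult_right_mono)
    qed
    also have "\<dots> < \<infinity>" using sfin[of k] by (subst nsq_cmult) (auto simp: ennreal_mult_less_top)
    finally show ?thesis .
  qed
  show "(\<lambda>\<eta>. g_sig br \<omega> \<omega>0 \<mu> a \<sigma> \<eta> (v \<eta>)) \<in> L2H (E_sq \<omega> E.S)"
  proof (rule E.L2H_E_I)
    show "(\<lambda>\<eta>. inverse (of_real (br \<eta> ^ \<mu>)) * s k \<eta>) \<in> borel_measurable borel" for k by measurable
    show "nsq lborel (\<lambda>\<eta>. inverse (of_real (br \<eta> ^ \<mu>)) * s k \<eta>) < \<infinity>" for k by (rule ifin)
    show "g_sig br \<omega> \<omega>0 \<mu> a \<sigma> \<eta> (v \<eta>) t = E.comb (\<lambda>k. inverse (of_real (br \<eta> ^ \<mu>)) * s k \<eta>) t" if "t > 0" for \<eta> t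
      unfolding s_def by (rule g_sig_comb[OF fin that])
  qed
  show "nsq lborel (\<lambda>\<eta>. of_real (br \<eta> ^ \<mu>) * E.cf k (g_sig br \<omega> \<omega>0 \<mu> a \<sigma> \<eta> (v \<eta>))) < \<infinity>" if k: "k \<in> E.K"
  proof -
    have "of_real (br \<eta> ^ \<mu>) * E.cf k (g_sig br \<omega> \<omega>0 \<mu> a \<sigma> \<eta> (v \<eta>)) = s k \<eta>" for \<eta>
      unfolding cf_g_sig[OF fin k] s_def using br_pos[of \<eta>] by simp
    then show ?thesis using sfin by simp
  qed
qed

end

lemma nsq_zero [simp]: "nsq M (\<lambda>x. 0) = 0"
  by (simp add: nsq_def)

lemma nsq_mult_bounded:
  assumes "f \<in> borel_measurable M" "\<And>x. cmod (g x) \<le> C"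
  shows "nsq M (\<lambda>x. f x * g x) \<le> ennreal (C\<^sup>2) * nsq M f"
proof -
  have "nsq M (\<lambda>x. f x * g x) \<le> nsq M (\<lambda>x. of_real C * f x)"
  proof (rule nsq_mono)
    fix x
    have "cmod (f x) * cmod (g x) \<le> cmod (f x) * \<bar>C\<bar>"
      by (intro mult_left_mono order_trans[OF assms(2) abs_ge_self]) simp
    then show "cmod (f x * g x) \<le> cmod (of_real C * f x)" by (simp add: norm_mult mult.commute)
  qed
  then show ?thesis using assms(1) by (simp add: nsq_cmult)
qed

lemma nsq_sum_tendsto_0:
  assumes "finite I" "\<And>i n. i \<in> I \<Longrightarrow> f n i \<in> borel_measurable M" "\<And>i. i \<in> I \<Longrightarrow> ((\<lambda>n. nsq M (f n i)) \<longlongrightarrow> 0) F"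
  shows "((\<lambda>n. nsq M (\<lambda>x. \<Sum>i\<in>I. f n i x)) \<longlongrightarrow> 0) F"
  using assms
proof (induction I rule: finite_induct)
  case (insert i I)
  have "((\<lambda>n. 2 * nsq M (f n i) + 2 * nsq M (\<lambda>x. \<Sum>i\<in>I. f n i x)) \<longlongrightarrow> 2 * 0 + 2 * 0) F"
    using insert by (intro tendsto_add tendsto_mult_ennreal tendsto_const) auto
  then have l: "((\<lambda>n. 2 * nsq M (f n i) + 2 * nsq M (\<lambda>x. \<Sum>i\<in>I. f n i x)) \<longlongrightarrow> 0) F" by simp
  have le: "nsq M (\<lambda>x. \<Sum>i\<in>insert i I. f n i x) \<le> 2 * nsq M (f n i) + 2 * nsq M (\<lambda>x. \<Sum>i\<in>I. f n i x)" for n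
  proof -
    have "nsq M (\<lambda>x. f n i x + (\<Sum>i\<in>I. f n i x)) \<le> 2 * nsq M (f n i) + 2 * nsq M (\<lambda>x. \<Sum>i\<in>I. f n i x)"
      using insert.prems by (intro nsq_add_le borel_measurable_sum) auto
    then show ?thesis using insert.hyps by simp
  qed
  show ?case by (rule tendsto_0_squeeze_ennreal[OF l le])
qed simp

section \<open>Functions on the half-line with prescribed moments\<close>

context mellin_setup
begin

interpretation KW: weighted_L2 "density halfline (\<lambda>t. ennreal (K_weight \<omega> (real \<mu>) t))" "K_sq \<omega> 0 (real \<mu>)"
  by (rule weighted_L2_K_sq[OF cutoff])

text \<open>\<open>mom_bound\<close> estimates only the value of the integral; linearity of the
  moments requires integrability.\<close>

lemma mom_integrable:
  assumes fin: "K_sq \<omega> 0 (real \<mu>) u < \<infinity>"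
  shows "integrable halfline (\<lambda>t. of_real (ln t ^ k / fact k) * (of_real t powr (\<sigma> - 1) * (\<omega>0 t * u t)))"
proof -
  obtain A :: "nat \<Rightarrow> real \<Rightarrow> complex" and H :: "(real \<Rightarrow> complex) \<Rightarrow> real \<Rightarrow> complex"
      and D :: "real \<Rightarrow> complex" and \<delta> C :: real where A [measurable]: "\<And>k. A k \<in> borel_measurable halfline"
    and D [measurable]: "D \<in> borel_measurable halfline" "nsq halfline D < \<infinity>" and \<delta>: "\<delta> > 0" and C: "C \<ge> 0"
    and Ak: "\<And>k t. t > 0 \<Longrightarrow> A k t = of_real (ln t ^ k / fact k) * A 0 t"
    and AD: "\<And>t. t > 0 \<Longrightarrow> cmod (A 0 t) * exp (\<delta> * \<bar>ln t\<bar>) = cmod (D t)"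
    and eq: "\<And>k t u. t > 0 \<Longrightarrow> of_real (ln t ^ k / fact k) * (of_real t powr (\<sigma> - 1) * (\<omega>0 t * u t)) = A k t * H u t"
    and H: "\<And>u. u \<in> borel_measurable halfline \<Longrightarrow> H u \<in> borel_measurable halfline"
    and HC: "\<And>u. u \<in> borel_measurable halfline \<Longrightarrow> nsq halfline (H u) \<le> ennreal C * K_sq \<omega> 0 (real \<mu>) u"
    by (rule mellin_analysis) (rule that)
  have um: "u \<in> borel_measurable halfline" by (rule K_sq_measurable[OF fin])
  note [measurable] = H[OF um]
  have Hfin: "nsq halfline (H u) < \<infinity>"
    using HC[OF um] fin by (auto simp: ennreal_mult_less_top intro: order.strict_trans1)
  have "integrable halfline (\<lambda>t. of_real (1 / \<delta> ^ k) * (D t * H u t))"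
    by (intro integrable_mult_right nsq_integrable_mult(1) D Hfin) measurable
  then have "integrable halfline (\<lambda>t. A k t * H u t)"
  proof (rule Bochner_Integration.integrable_bound)
    show "AE t in halfline. norm (A k t * H u t) \<le> norm (of_real (1 / \<delta> ^ k) * (D t * H u t))"
    proof (rule AE_I2)
      fix t assume "t \<in> space halfline"
      then have t: "t > 0" by simp
      have "(\<delta> * \<bar>ln t\<bar>) ^ k / fact k \<le> exp (\<delta> * \<bar>ln t\<bar>)" using \<delta> by (intro power_le_exp) auto
      then have lk: "cmod (of_real (ln t ^ k / fact k)) \<le> exp (\<delta> * \<bar>ln t\<bar>) / \<delta> ^ k"
        using \<delta> by (simp add: norm_divide norm_power power_mult_distrib field_simps)
      have "cmod (A k t) = cmod (of_real (ln t ^ k / fact k)) * cmod (A 0 t)" unfolding Ak[OF t, of k] norm_mult ..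
      also have "\<dots> \<le> (exp (\<delta> * \<bar>ln t\<bar>) / \<delta> ^ k) * cmod (A 0 t)" by (intro mult_right_mono lk) simp
      also have "\<dots> = cmod (D t) / \<delta> ^ k" unfolding AD[OF t, symmetric] by simp
      finally have "cmod (A k t) * cmod (H u t) \<le> (cmod (D t) / \<delta> ^ k) * cmod (H u t)" by (rule mult_right_mono) simp
      then show "norm (A k t * H u t) \<le> norm (of_real (1 / \<delta> ^ k) * (D t * H u t))"
        using \<delta> by (simp add: norm_mult norm_divide norm_power)
    qed
  qed measurable
  then show ?thesis by (subst Bochner_Integration.integrable_cong[OF refl eq]) auto
qed

lemma K_sq_add_scale:
  assumes "K_sq \<omega> 0 (real \<mu>) u < \<infinity>" "K_sq \<omega> 0 (real \<mu>) w < \<infinity>"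
  shows "K_sq \<omega> 0 (real \<mu>) (\<lambda>t. u t + c * w t) < \<infinity>"
proof -
  have m: "u \<in> borel_measurable halfline" "w \<in> borel_measurable halfline"
    using assms K_sq_measurable by auto
  note [measurable] = m
  note [measurable] = m[folded KW.measurable_M]
  have "nsq (density halfline (\<lambda>t. ennreal (K_weight \<omega> (real \<mu>) t))) (\<lambda>t. u t + c * w t) < \<infinity>"
  proof (rule nsq_add_finite(1))
    show "nsq (density halfline (\<lambda>t. ennreal (K_weight \<omega> (real \<mu>) t))) (\<lambda>t. c * w t) < \<infinity>"
      using assms(2) m by (subst nsq_cmult) (auto simp: KW.N_eq ennreal_mult_less_top)
    show "nsq (density halfline (\<lambda>t. ennreal (K_weight \<omega> (real \<mu>) t))) u < \<infinity>"
      using assms(1) m by (simp add: KW.N_eq)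
  qed measurable
  moreover have "(\<lambda>t. u t + c * w t) \<in> borel_measurable halfline" by measurable
  ultimately show ?thesis by (simp add: KW.N_eq)
qed

lemma K_sq_zero: "K_sq \<omega> 0 (real \<mu>) (\<lambda>t. 0) < \<infinity>"
  by (simp add: KW.N_eq)

lemma mom_add_scale:
  assumes "K_sq \<omega> 0 (real \<mu>) u < \<infinity>" "K_sq \<omega> 0 (real \<mu>) w < \<infinity>"
  shows "mom k (\<lambda>t. u t + c * w t) = mom k u + c * mom k w"
proof -
  have e: "of_real (ln t ^ k / fact k) * (of_real t powr (\<sigma> - 1) * (\<omega>0 t * (u t + c * w t))) =
      of_real (ln t ^ k / fact k) * (of_real t powr (\<sigma> - 1) * (\<omega>0 t * u t)) +
      c * (of_real (ln t ^ k / fact k) * (of_real t powr (\<sigma> - 1) * (\<omega>0 t * w t)))" for t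
    by (simp add: algebra_simps)
  show ?thesis
    unfolding mom_def e
      Bochner_Integration.integral_add[OF mom_integrable[OF assms(1)] integrable_mult_right[OF mom_integrable[OF assms(2)]]]
    by (simp only: integral_mult_right_zero)
qed

lemma mom_zero: "mom k (\<lambda>t. 0) = 0"
  by (simp add: mom_def)

lemma mom_sum:
  "finite I \<Longrightarrow> (\<And>i. i \<in> I \<Longrightarrow> K_sq \<omega> 0 (real \<mu>) (f i) < \<infinity>) \<Longrightarrow>
    K_sq \<omega> 0 (real \<mu>) (\<lambda>t. \<Sum>i\<in>I. c i * f i t) < \<infinity> \<and> mom k (\<lambda>t. \<Sum>i\<in>I. c i * f i t) = (\<Sum>i\<in>I. c i * mom k (f i))"
proof (induction I rule: finite_induct)
  case empty then show ?case using K_sq_zero mom_zero by simp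
next
  case (insert i I)
  then have 1: "K_sq \<omega> 0 (real \<mu>) (\<lambda>t. \<Sum>i\<in>I. c i * f i t) < \<infinity>" and 2: "K_sq \<omega> 0 (real \<mu>) (f i) < \<infinity>"
    and 3: "mom k (\<lambda>t. \<Sum>i\<in>I. c i * f i t) = (\<Sum>i\<in>I. c i * mom k (f i))" by auto
  from K_sq_add_scale[OF 1 2, of "c i"] mom_add_scale[OF 1 2, of k "c i"] insert.hyps 3
  show ?case by (simp add: add.commute)
qed

text \<open>Where \<omega>0 equals 1 the powers of t cancel to 1 / t, and the integrand (ln t)^k /
  (k! t) has the primitive (ln t)^(k+1) / (k+1)!. The norm is finite because the support is compact
  in (0,\<infinity>).\<close>

lemma mom_interval:
  assumes \<epsilon>: "\<And>t. 0 \<le> t \<Longrightarrow> t < \<epsilon> \<Longrightarrow> \<omega> t = 1" "\<And>t. 0 \<le> t \<Longrightarrow> t < \<epsilon> \<Longrightarrow> \<omega>0 t = 1"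
    and xy: "0 < x" "x < y" "y < \<epsilon>"
  defines "f \<equiv> \<lambda>t. of_real t powr (- \<sigma>) * indicator {x..y} t"
  shows "K_sq \<omega> 0 (real \<mu>) f < \<infinity>" and "mom k f = of_real ((ln y ^ Suc k - ln x ^ Suc k) / fact (Suc k))"
proof -
  have "(\<lambda>t. complex_of_real t powr (- \<sigma>)) \<in> borel_measurable halfline"
    by (rule measurable_halfline_continuous) (auto intro!: continuous_intros)
  moreover have "(\<lambda>t. indicator {x..y} t :: complex) \<in> borel_measurable halfline"
    unfolding halfline_def by (intro measurable_restrict_space1) simp
  ultimately have fm [measurable]: "f \<in> borel_measurable halfline" unfolding f_def by measurable
  have z: "L2_sq (\<lambda>t. (1 - \<omega> t) * f t) = 0"
  proof -
    have "(1 - \<omega> t) * f t = 0" if "t > 0" for t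
      using that \<epsilon>(1)[of t] xy by (auto simp: f_def indicator_def)
    then have "nsq halfline (\<lambda>t. (1 - \<omega> t) * f t) = nsq halfline (\<lambda>t. 0)" by (intro nsq_cong) simp
    moreover have "(\<lambda>t. (1 - \<omega> t) * f t) \<in> borel_measurable halfline"
      using cutoff_measurable[OF cutoff] by measurable
    ultimately show ?thesis by (simp add: L2_sq_def nsq_def)
  qed
  have pm: "(\<lambda>t. complex_of_real (t powr b)) \<in> borel_measurable halfline" for b
    by (rule measurable_halfline_continuous) (auto intro!: continuous_intros)
  have "continuous_on {x..y} (\<lambda>t. t powr (- real \<mu>) * t powr (- Re \<sigma>))"
    using xy by (intro continuous_intros) auto
  then have "bounded ((\<lambda>t. t powr (- real \<mu>) * t powr (- Re \<sigma>)) ` {x..y})"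
    by (intro compact_imp_bounded compact_continuous_image) auto
  then obtain B where "\<forall>z\<in>(\<lambda>t. t powr (- real \<mu>) * t powr (- Re \<sigma>)) ` {x..y}. norm z \<le> B"
    unfolding bounded_iff by blast
  then have B: "\<bar>t powr (- real \<mu>) * t powr (- Re \<sigma>)\<bar> \<le> B" if "t \<in> {x..y}" for t
    using that unfolding real_norm_def by blast
  have "nsq halfline (\<lambda>t. of_real (t powr (- real \<mu>)) * (\<omega> t * f t)) \<le> nsq halfline (\<lambda>t. of_real B * indicator {x..y} t)"
  proof (rule nsq_mono)
    fix t assume "t \<in> space halfline"
    then have t: "t > 0" by simp
    show "cmod (of_real (t powr (- real \<mu>)) * (\<omega> t * f t)) \<le> cmod (of_real B * indicator {x..y} t)"
    proof (cases "t \<in> {x..y}")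
      case True
      then have "\<omega> t = 1" using \<epsilon>(1)[of t] xy by auto
      then have "cmod (of_real (t powr (- real \<mu>)) * (\<omega> t * f t)) = \<bar>t powr (- real \<mu>) * t powr (- Re \<sigma>)\<bar>"
        using True t by (simp add: f_def norm_mult norm_powr_real_powr abs_mult)
      also have "\<dots> \<le> \<bar>B\<bar>" using B[OF True] by linarith
      finally show ?thesis using True by (simp add: norm_mult)
    qed (simp add: f_def)
  qed
  also have "\<dots> = ennreal ((cmod (of_real B))\<^sup>2) * nsq halfline (indicator {x..y})"
    unfolding halfline_def by (intro nsq_cmult measurable_restrict_space1) simp
  also have "nsq halfline (indicator {x..y}) = emeasure halfline {x..y}"
    by (rule nsq_indicator) (use xy in \<open>auto simp: halfline_def sets_restrict_space_iff\<close>)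
  also have "\<dots> = ennreal (y - x)"
    unfolding halfline_def using xy by (subst emeasure_restrict_space) auto
  also have "ennreal ((cmod (of_real B))\<^sup>2) * ennreal (y - x) < \<infinity>" by (simp add: ennreal_mult_less_top)
  finally have nf: "nsq halfline (\<lambda>t. of_real (t powr (- real \<mu>)) * (\<omega> t * f t)) < \<infinity>" .
  have "(\<lambda>t. of_real (t powr (- real \<mu>)) * (\<omega> t * f t)) \<in> borel_measurable halfline"
    using cutoff_measurable[OF cutoff] pm by measurable
  then show "K_sq \<omega> 0 (real \<mu>) f < \<infinity>"
    using nf by (simp add: K_sq_0 z) (simp add: L2_sq_def nsq_def)
  define F where "F t = ln t ^ Suc k / fact (Suc k)" for t :: real
  have dF: "(F has_real_derivative ln t ^ k / fact k / t) (at t)" if "t > 0" for t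
  proof -
    have "(F has_real_derivative (real (Suc k) * (1 / t * ln t ^ (Suc k - Suc 0))) / fact (Suc k)) (at t)"
      unfolding F_def by (intro DERIV_cdivide DERIV_power DERIV_ln_divide that)
    moreover have "(real (Suc k) * (1 / t * ln t ^ (Suc k - Suc 0))) / fact (Suc k) = ln t ^ k / fact k / t"
      by (simp add: field_simps del: of_nat_Suc)
    ultimately show ?thesis by (simp only:)
  qed
  have "mom k f = (LINT t|lborel. indicator {0<..} t *\<^sub>R (of_real (ln t ^ k / fact k) * (of_real t powr (\<sigma> - 1) * (\<omega>0 t * f t))))"
    unfolding mom_def halfline_def by (rule integral_restrict_space) simp
  also have "\<dots> = (LINT t|lborel. of_real (ln t ^ k / fact k / t * indicator {x..y} t))"
  proof (intro Bochner_Integration.integral_cong refl)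
    fix t :: real
    show "indicator {0<..} t *\<^sub>R (of_real (ln t ^ k / fact k) * (of_real t powr (\<sigma> - 1) * (\<omega>0 t * f t))) =
        complex_of_real (ln t ^ k / fact k / t * indicator {x..y} t)"
    proof (cases "t \<in> {x..y}")
      case True
      then have t: "t > 0" "\<omega>0 t = 1" using \<epsilon>(2)[of t] xy by auto
      have "of_real t powr (\<sigma> - 1) * of_real t powr (- \<sigma>) = of_real t powr (- 1 :: complex)"
        using t by (simp flip: powr_add)
      also have "\<dots> = of_real (1 / t)" using t by (simp add: powr_minus divide_inverse)
      finally show ?thesis using t True by (simp add: f_def)
    qed (simp add: f_def)
  qed
  also have "\<dots> = of_real (LINT t|lborel. ln t ^ k / fact k / t * indicator {x..y} t)"
    by (rule integral_complex_of_real)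
  also have "(LINT t|lborel. ln t ^ k / fact k / t * indicator {x..y} t) = F y - F x"
  proof (rule integral_FTC_Icc_real)
    fix t assume "x \<le> t" "t \<le> y"
    then have t: "t > 0" using xy by simp
    show "DERIV F t :> ln t ^ k / fact k / t" by (rule dF[OF t])
    show "isCont (\<lambda>t. ln t ^ k / fact k / t) t" using t by (intro continuous_intros) auto
  qed (use xy in simp)
  finally show "mom k f = of_real ((ln y ^ Suc k - ln x ^ Suc k) / fact (Suc k))"
    by (simp only: F_def diff_divide_distrib)
qed

text \<open>The moments of \<open>t\<^bsup>-\<sigma>\<^esup> 1\<^bsub>[x,y]\<^esub>\<close> are differences of powers of logarithms, hence the moment
  functionals are linearly independent.\<close>

lemma dual_functions:
  obtains \<phi> where "\<And>k. k \<le> n \<Longrightarrow> K_sq \<omega> 0 (real \<mu>) (\<phi> k) < \<infinity>"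
    "\<And>i k. i \<le> n \<Longrightarrow> k \<le> n \<Longrightarrow> mom i (\<phi> k) = (if i = k then 1 else 0)"
proof -
  obtain \<epsilon>1 where \<epsilon>1: "\<epsilon>1 > 0" "\<And>t. 0 \<le> t \<Longrightarrow> t < \<epsilon>1 \<Longrightarrow> \<omega> t = 1" using cutoff_one[OF cutoff] by metis
  obtain \<epsilon>2 where \<epsilon>2: "\<epsilon>2 > 0" "\<And>t. 0 \<le> t \<Longrightarrow> t < \<epsilon>2 \<Longrightarrow> \<omega>0 t = 1" using cutoff_one[OF cutoff0] by metis
  define \<epsilon> where "\<epsilon> = min \<epsilon>1 \<epsilon>2"
  have \<epsilon>: "\<epsilon> > 0" "\<And>t. 0 \<le> t \<Longrightarrow> t < \<epsilon> \<Longrightarrow> \<omega> t = 1" "\<And>t. 0 \<le> t \<Longrightarrow> t < \<epsilon> \<Longrightarrow> \<omega>0 t = 1"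
    using \<epsilon>1 \<epsilon>2 by (auto simp: \<epsilon>_def)
  define X where "X = {p :: real \<times> real. 0 < fst p \<and> fst p < snd p \<and> snd p < \<epsilon>}"
  define f where "f p t = of_real t powr (- \<sigma>) * indicator {fst p..snd p} t" for p and t :: real
  have fK: "K_sq \<omega> 0 (real \<mu>) (f p) < \<infinity>" if "p \<in> X" for p
    unfolding f_def using that by (intro mom_interval(1)[OF \<epsilon>(2,3)]) (auto simp: X_def)
  have fm: "mom k (f p) = of_real ((ln (snd p) ^ Suc k - ln (fst p) ^ Suc k) / fact (Suc k))" if "p \<in> X" for p k
    unfolding f_def using that by (intro mom_interval(2)[OF \<epsilon>(2,3)]) (auto simp: X_def)
  have "\<exists>L. \<forall>i\<in>{..n}. fcomb X (L i) \<and> (\<forall>j\<in>{..n}. L i (\<lambda>p. mom j (f p)) = (if i = j then 1 else 0))"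
  proof (rule dual_family)
    fix c :: "nat \<Rightarrow> complex" assume c: "\<And>p. p \<in> X \<Longrightarrow> (\<Sum>i\<in>{..n}. c i * mom i (f p)) = 0"
    \<comment> \<open>The relation on the interval from x to y says p (ln y) = p (ln x). With x
      fixed and y varying, p minus a constant has infinitely many zeros, so all coefficients of p of
      positive degree vanish; up to factorials these are the c i.\<close>
    define p where "p = (\<Sum>i\<le>n. monom (c i / fact (Suc i)) (Suc i))"
    define x where "x = \<epsilon> / 2"
    have x: "0 < x" "x < \<epsilon>" using \<epsilon>(1) by (simp_all add: x_def)
    define r where "r = p - [:poly p (of_real (ln x)):]"
    have root: "poly r (of_real s) = 0" if s: "s \<in> {ln x<..<ln \<epsilon>}" for s
    proof -
      define y where "y = exp s"
      have "exp (ln x) < y" "y < exp (ln \<epsilon>)" using s by (simp_all only: y_def exp_less_cancel_iff greaterThanLessThan_iff)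
      then have "(x, y) \<in> X" using x by (simp add: X_def)
      from c[OF this] have "(\<Sum>i\<le>n. c i * of_real ((s ^ Suc i - ln x ^ Suc i) / fact (Suc i))) = 0"
        unfolding fm[OF \<open>(x, y) \<in> X\<close>] by (simp add: y_def)
      also have "(\<Sum>i\<le>n. c i * of_real ((s ^ Suc i - ln x ^ Suc i) / fact (Suc i))) = poly p (of_real s) - poly p (of_real (ln x))"
        unfolding p_def poly_sum poly_monom sum_subtractf[symmetric]
        by (intro sum.cong refl) (simp add: diff_divide_distrib right_diff_distrib del: power_Suc fact_Suc)
      finally show ?thesis by (simp add: r_def)
    qed
    have "r = 0"
    proof (rule ccontr)
      assume "r \<noteq> 0"
      then have "finite {z. poly r z = 0}" by (rule poly_roots_finite)
      then have "finite (complex_of_real ` {ln x<..<ln \<epsilon>})"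
        by (rule finite_subset[rotated]) (use root in auto)
      then have "finite {ln x<..<ln \<epsilon>}" by (rule finite_imageD) (simp add: inj_on_def)
      moreover have "ln x < ln \<epsilon>" using x by (intro ln_less_cancel_iff[THEN iffD2]) auto
      ultimately show False by (simp add: infinite_Ioo)
    qed
    then have "coeff p (Suc i) = 0" for i
    proof -
      have "coeff r (Suc i) = coeff p (Suc i)" by (simp add: r_def)
      then show ?thesis using \<open>r = 0\<close> by simp
    qed
    moreover have "coeff p (Suc i) = c i / fact (Suc i)" if "i \<le> n" for i
      using that by (simp add: p_def coeff_sum del: fact_Suc)
    ultimately show "\<forall>i\<in>{..n}. c i = 0" by (auto simp del: fact_Suc)
  qed simp
  then obtain L where L: "\<And>i. i \<le> n \<Longrightarrow> fcomb X (L i)"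
    and Ld: "\<And>i j. i \<le> n \<Longrightarrow> j \<le> n \<Longrightarrow> L i (\<lambda>p. mom j (f p)) = (if i = j then 1 else 0)" by auto
  \<comment> \<open>Moments are linear, so a combination of evaluations in p may be applied to the
    functions \<open>f p\<close> themselves.\<close>
  have Lf: "K_sq \<omega> 0 (real \<mu>) (\<lambda>t. L (\<lambda>p. f p t)) < \<infinity> \<and> mom i (\<lambda>t. L (\<lambda>p. f p t)) = L (\<lambda>p. mom i (f p))"
    if "fcomb X L" for L i
    using that
  proof (induction rule: fcomb.induct)
    case fcomb_zero then show ?case using K_sq_zero mom_zero by simp
  next
    case (fcomb_step L x c)
    then show ?case using K_sq_add_scale[OF _ fK] mom_add_scale[OF _ fK] by auto
  qed
  show thesis
  proof (rule that[of "\<lambda>k t. L k (\<lambda>p. f p t)"])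
    show "K_sq \<omega> 0 (real \<mu>) (\<lambda>t. L k (\<lambda>p. f p t)) < \<infinity>" if "k \<le> n" for k using Lf[OF L[OF that]] by blast
    show "mom i (\<lambda>t. L k (\<lambda>p. f p t)) = (if i = k then 1 else 0)" if "i \<le> n" "k \<le> n" for i k
      using Lf[OF L[OF that(2)], of i] Ld[OF that(2,1)] by auto
  qed
qed

end

section \<open>Characterisation and closedness of the range\<close>

context edge_op
begin

abbreviation NE where "NE \<equiv> E_sq \<omega> E.S"

abbreviation gs where "gs \<equiv> g_sig br \<omega> \<omega>0 \<mu> a \<sigma>"

definition pc :: "nat \<Rightarrow> (real \<Rightarrow> complex) \<Rightarrow> complex" where
  "pc j f = of_real ((-1) ^ j * fact j) * E.cf (0, j) f"

text \<open>By \<open>tc_0\<close>, the numbers \<open>pc j\<close> are read off from the coefficients of \<open>t\<^bsup>-\<sigma>\<^esup> log\<^sup>j t\<close>; in the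
  range they determine all other coefficients.\<close>

definition Rg :: "(real^'q \<Rightarrow> real \<Rightarrow> complex) \<Rightarrow> bool" where
  "Rg w \<longleftrightarrow> (\<exists>w'. is_ft NE w w' \<and> (\<forall>k\<in>E.K. nsq lborel (\<lambda>\<eta>. of_real (br \<eta> ^ \<mu>) * E.cf k (w' \<eta>)) < \<infinity>) \<and>
     (AE \<eta> in lborel. \<forall>k\<in>E.K. E.cf k (w' \<eta>) = (\<Sum>j\<le>ns. pc j (w' \<eta>) * tc k j \<eta>)))"

lemma K_0: "j \<le> ns \<Longrightarrow> (0, j) \<in> E.K"
  using ns_le_md by (auto simp: E.K_def)

lemma pc_g_sig:
  assumes u: "Ksq u < \<infinity>" and j: "j \<le> ns"
  shows "pc j (gs \<eta> u) = inverse (of_real (br \<eta> ^ \<mu>)) * pq j u"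
proof -
  have "(\<Sum>j'\<le>ns. pq j' u * tc (0, j) j' \<eta>) = (\<Sum>j'\<le>ns. if j' = j then pq j u * of_real ((-1) ^ j / fact j) else 0)"
    by (intro sum.cong refl) (auto simp: tc_0)
  also have "\<dots> = pq j u * of_real ((-1) ^ j / fact j)" using j by simp
  finally show ?thesis
    unfolding pc_def cf_g_sig[OF u K_0[OF j]] by (simp flip: power_mult_distrib)
qed

lemma is_op_imp_Rg:
  assumes "is_op Ksq NE gs u w"
  shows "Rg w"
proof -
  from assms obtain v where v: "is_ft Ksq u v" and w: "is_ft NE w (\<lambda>\<eta>. gs \<eta> (v \<eta>))" unfolding is_op_def by blast
  from v have vL: "v \<in> L2H Ksq" by (simp add: is_ft_def)
  then have fin: "Ksq (v \<eta>) < \<infinity>" for \<eta> by (simp add: L2H_def)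
  have "E.cf k (gs \<eta> (v \<eta>)) = (\<Sum>j\<le>ns. pc j (gs \<eta> (v \<eta>)) * tc k j \<eta>)" if "k \<in> E.K" for k \<eta>
    unfolding cf_g_sig[OF fin that] by (simp add: pc_g_sig[OF fin] sum_distrib_left mult_ac)
  then show ?thesis
    unfolding Rg_def using w g_sig_L2H(2)[OF vL] by (intro exI[of _ "\<lambda>\<eta>. gs \<eta> (v \<eta>)"]) auto
qed

lemma nsq_tensor:
  fixes f :: "real^'q \<Rightarrow> complex"
  assumes [measurable]: "f \<in> borel_measurable borel" "g \<in> borel_measurable M" and sf: "sigma_finite_measure M"
  shows "nsq (lborel \<Otimes>\<^sub>M M) (\<lambda>p. f (fst p) * g (snd p)) = nsq lborel f * nsq M g"
proof -
  interpret sigma_finite_measure M by (rule sf)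
  have "nsq (lborel \<Otimes>\<^sub>M M) (\<lambda>p. f (fst p) * g (snd p)) = (\<integral>\<^sup>+y. \<integral>\<^sup>+x. ennreal ((cmod (f y))\<^sup>2) * ennreal ((cmod (g x))\<^sup>2) \<partial>M \<partial>lborel)"
    unfolding nsq_def by (subst nn_integral_fst[symmetric]) (auto simp: norm_mult power_mult_distrib ennreal_mult)
  then show ?thesis by (simp add: nsq_def nn_integral_cmult nn_integral_multc)
qed

text \<open>A preimage is built on the Fourier side. The principal part read off from w' prescribes
  the first ns + 1 moments, the functions dual to the moments realise them with coefficients
  depending on \<eta>, and the relation in \<open>Rg\<close> then settles the remaining
  coefficients.\<close>

lemma Rg_imp_is_op:
  assumes "Rg w"
  obtains u where "u \<in> L2H Ksq" "is_op Ksq NE gs u w"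
proof -
  let ?M = "density halfline (\<lambda>t. ennreal (K_weight \<omega> (real \<mu>) t))"
  from assms obtain w' where w: "is_ft NE w w'" and fin: "\<And>k. k \<in> E.K \<Longrightarrow> nsq lborel (\<lambda>\<eta>. of_real (br \<eta> ^ \<mu>) * E.cf k (w' \<eta>)) < \<infinity>"
    and ae: "AE \<eta> in lborel. \<forall>k\<in>E.K. E.cf k (w' \<eta>) = (\<Sum>j\<le>ns. pc j (w' \<eta>) * tc k j \<eta>)"
    unfolding Rg_def by blast
  have w'L: "w' \<in> L2H NE" using w by (simp add: is_ft_def)
  obtain \<phi> where \<phi>K: "\<And>k. k \<le> ns \<Longrightarrow> Ksq (\<phi> k) < \<infinity>"
    and \<phi>m: "\<And>i k. i \<le> ns \<Longrightarrow> k \<le> ns \<Longrightarrow> MT.mom i (\<phi> k) = (if i = k then 1 else 0)"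
    using MT.dual_functions[of ns] by metis
  \<comment> \<open>If f0^(-1) times the Mellin transform is to have the principal part
    [\<eta>]^\<mu> F, with F given by the \<open>pc j\<close>, the transform has to agree with
    [\<eta>]^\<mu> f0 F up to order ns. The factor [\<eta>]^\<mu> compensates the inverse one in
    \<open>Hf\<close>.\<close>
  define m where "m k \<eta> = of_real (br \<eta> ^ \<mu>) * (P0 * pf (\<lambda>j. pc j (w' \<eta>))) $$ int k" for k \<eta>
  have m_sum: "m k \<eta> = (\<Sum>j\<le>ns. (of_real (br \<eta> ^ \<mu>) * E.cf (0, j) (w' \<eta>)) * (of_real ((-1) ^ j * fact j) * (P0 * fls_X_inv ^ Suc j) $$ int k))" for k \<eta>
  proof -
    have e: "P0 * pf (\<lambda>j. pc j (w' \<eta>)) = (\<Sum>j\<le>ns. fls_const (pc j (w' \<eta>)) * (P0 * fls_X_inv ^ Suc j))"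
      unfolding pf_def sum_distrib_left by (simp add: mult_ac)
    have "(P0 * pf (\<lambda>j. pc j (w' \<eta>))) $$ int k = (\<Sum>j\<le>ns. pc j (w' \<eta>) * (P0 * fls_X_inv ^ Suc j) $$ int k)"
      unfolding e fls_nth_sum by (simp del: power_Suc)
    then show ?thesis unfolding m_def by (simp only: sum_distrib_left pc_def mult_ac)
  qed
  have cm: "(\<lambda>\<eta>. E.cf (0, j) (w' \<eta>)) \<in> borel_measurable borel" if "j \<le> ns" for j
    by (rule E.L2H_E_D(1)[OF w'L K_0[OF that]])
  have mm [measurable]: "m k \<in> borel_measurable borel" for k
    unfolding m_sum[abs_def] by (intro borel_measurable_sum borel_measurable_times cm) auto
  have mfin: "nsq lborel (m k) < \<infinity>" for k
    unfolding m_sum[abs_def]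
  proof (rule nsq_sum_finite)
    fix j assume "j \<in> {..ns}"
    then have j: "j \<le> ns" by simp
    have bm: "(\<lambda>\<eta>. of_real (br \<eta> ^ \<mu>) * E.cf (0, j) (w' \<eta>)) \<in> borel_measurable lborel"
      using cm[OF j] by measurable
    then show "(\<lambda>\<eta>. (of_real (br \<eta> ^ \<mu>) * E.cf (0, j) (w' \<eta>)) * (of_real ((-1) ^ j * fact j) * (P0 * fls_X_inv ^ Suc j) $$ int k)) \<in> borel_measurable lborel"
      by (rule borel_measurable_times) simp
    show "nsq lborel (\<lambda>\<eta>. (of_real (br \<eta> ^ \<mu>) * E.cf (0, j) (w' \<eta>)) * (of_real ((-1) ^ j * fact j) * (P0 * fls_X_inv ^ Suc j) $$ int k)) < \<infinity>"
      by (rule order.strict_trans1[OF nsq_mult_bounded[OF bm order.refl]])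
         (use fin[OF K_0[OF j]] in \<open>simp add: ennreal_mult_less_top\<close>)
  qed simp
  define v where "v \<eta> t = (\<Sum>k\<le>ns. m k \<eta> * \<phi> k t)" for \<eta> t
  have vK: "Ksq (v \<eta>) < \<infinity>" and vm: "i \<le> ns \<Longrightarrow> MT.mom i (v \<eta>) = m i \<eta>" for \<eta> i
  proof -
    have *: "Ksq (v \<eta>) < \<infinity> \<and> MT.mom i (v \<eta>) = (\<Sum>k\<le>ns. m k \<eta> * MT.mom i (\<phi> k))" for i
      unfolding v_def[abs_def] by (rule MT.mom_sum) (use \<phi>K in auto)
    then show "Ksq (v \<eta>) < \<infinity>" by blast
    show "MT.mom i (v \<eta>) = m i \<eta>" if "i \<le> ns"
      using * that by (simp add: \<phi>m if_distrib cong: if_cong)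
  qed
  have \<phi>M: "\<phi> k \<in> borel_measurable ?M" "nsq ?M (\<phi> k) < \<infinity>" if "k \<le> ns" for k
    using \<phi>K[OF that] MT.K_sq_measurable[OF \<phi>K[OF that]] by (simp_all add: KW.N_eq KW.measurable_M)
  have vL: "v \<in> L2H Ksq"
    unfolding KW.L2H_iff
  proof (intro conjI allI)
    have pm: "(\<lambda>p. m k (fst p) * \<phi> k (snd p)) \<in> borel_measurable (lborel \<Otimes>\<^sub>M ?M)" if "k \<le> ns" for k
      by (intro borel_measurable_times measurable_compose[OF measurable_fst] measurable_compose[OF measurable_snd \<phi>M(1)[OF that]]) simp
    have "(\<lambda>p. \<Sum>k\<le>ns. m k (fst p) * \<phi> k (snd p)) \<in> borel_measurable (lborel \<Otimes>\<^sub>M ?M)"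
      by (intro borel_measurable_sum pm) simp
    then show "(\<lambda>(y,t). v y t) \<in> borel_measurable Omega"
      by (simp add: v_def case_prod_unfold KW.measurable_Omega)
    show "nsq ?M (v \<eta>) < \<infinity>" for \<eta>
      using vK[of \<eta>] MT.K_sq_measurable[OF vK[of \<eta>]] by (simp add: KW.N_eq)
    have "nsq (lborel \<Otimes>\<^sub>M ?M) (\<lambda>p. \<Sum>k\<le>ns. m k (fst p) * \<phi> k (snd p)) < \<infinity>"
    proof (rule nsq_sum_finite)
      fix k assume "k \<in> {..ns}"
      then have k: "k \<le> ns" by simp
      show "(\<lambda>p. m k (fst p) * \<phi> k (snd p)) \<in> borel_measurable (lborel \<Otimes>\<^sub>M ?M)" by (rule pm[OF k])
      show "nsq (lborel \<Otimes>\<^sub>M ?M) (\<lambda>p. m k (fst p) * \<phi> k (snd p)) < \<infinity>"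
        by (subst nsq_tensor[OF mm \<phi>M(1)[OF k] KW.sigma_finite_measure_axioms])
           (use mfin[of k] \<phi>M(2)[OF k] in \<open>simp add: ennreal_mult_less_top\<close>)
    qed simp
    then show "nsq (lborel \<Otimes>\<^sub>M ?M) (\<lambda>(y,t). v y t) < \<infinity>" by (simp add: v_def case_prod_unfold)
  qed
  have pqv: "pq j (v \<eta>) = of_real (br \<eta> ^ \<mu>) * pc j (w' \<eta>)" if j: "j \<le> ns" for j \<eta>
  proof -
    let ?F = "pf (\<lambda>j. pc j (w' \<eta>))"
    \<comment> \<open>f0 vanishes at \<sigma> to the order ns + 1 and F has a pole of at most that
      order, so f0 F is a power series, as the expansion of a Mellin transform at \<sigma> must
      be.\<close>
    have below: "(P0 * ?F) $$ k = 0" if "k < 0" for k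
      by (rule fls_mult_nth_eq_0[where n = "int (Suc ns)" and m = "- int (Suc ns)"])
         (use that in \<open>auto simp: P0_subdegree pf_nth\<close>)
    have "pq j (v \<eta>) = (\<Sum>i=- int (Suc ns)..- 1 - int j. inverse P0 $$ i * MT.mom (nat (- 1 - int j - i)) (v \<eta>))"
      by (rule pq_eq)
    also have "\<dots> = (\<Sum>i=- int (Suc ns)..- 1 - int j. inverse P0 $$ i * (of_real (br \<eta> ^ \<mu>) * (P0 * ?F) $$ (- 1 - int j - i)))"
    proof (intro sum.cong refl)
      fix i assume i: "i \<in> {- int (Suc ns)..- 1 - int j}"
      \<comment> \<open>Only the prescribed moments enter, since i \<ge> - (ns + 1) and j \<ge>
        0.\<close>
      then have "nat (- 1 - int j - i) \<le> ns" by auto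
      from vm[OF this, of \<eta>] i show "inverse P0 $$ i * MT.mom (nat (- 1 - int j - i)) (v \<eta>) =
          inverse P0 $$ i * (of_real (br \<eta> ^ \<mu>) * (P0 * ?F) $$ (- 1 - int j - i))"
        by (simp add: m_def)
    qed
    also have "\<dots> = of_real (br \<eta> ^ \<mu>) * (\<Sum>i=- int (Suc ns)..- 1 - int j - 0. inverse P0 $$ i * (P0 * ?F) $$ (- 1 - int j - i))"
      by (simp add: sum_distrib_left mult_ac)
    also have "(\<Sum>i=- int (Suc ns)..- 1 - int j - 0. inverse P0 $$ i * (P0 * ?F) $$ (- 1 - int j - i)) = (inverse P0 * (P0 * ?F)) $$ (- 1 - int j)"
      by (rule fls_mult_nth_bounds[symmetric]) (use below in \<open>auto simp: P0_subdegree\<close>)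
    also have "inverse P0 * (P0 * ?F) = ?F" using P0_nonzero by (simp add: mult.assoc[symmetric])
    also have "?F $$ (- 1 - int j) = pc j (w' \<eta>)" using j by (simp add: pf_nth)
    finally show ?thesis .
  qed
  obtain u where u: "is_ft Ksq u v" by (rule KW.is_ft_surjective[OF vL])
  have "is_ft NE w (\<lambda>\<eta>. gs \<eta> (v \<eta>))"
  proof (rule E.is_ft_E_cong_AE[OF w g_sig_L2H(1)[OF vL]])
    fix k assume k: "k \<in> E.K"
    show "AE \<eta> in lborel. E.cf k (w' \<eta>) = E.cf k (gs \<eta> (v \<eta>))"
      using ae
    proof eventually_elim
      fix \<eta> assume "\<forall>k\<in>E.K. E.cf k (w' \<eta>) = (\<Sum>j\<le>ns. pc j (w' \<eta>) * tc k j \<eta>)"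
      then have "E.cf k (w' \<eta>) = (\<Sum>j\<le>ns. pc j (w' \<eta>) * tc k j \<eta>)" using k by blast
      also have "\<dots> = inverse (of_real (br \<eta> ^ \<mu>)) * (\<Sum>j\<le>ns. pq j (v \<eta>) * tc k j \<eta>)"
        unfolding sum_distrib_left using br_pos[of \<eta>] by (intro sum.cong refl) (simp add: pqv)
      also have "\<dots> = E.cf k (gs \<eta> (v \<eta>))" by (rule cf_g_sig[OF vK k, symmetric])
      finally show "E.cf k (w' \<eta>) = E.cf k (gs \<eta> (v \<eta>))" .
    qed
  qed
  with u have "is_op Ksq NE gs u w" unfolding is_op_def by blast
  moreover have "u \<in> L2H Ksq" using u by (simp add: is_ft_def)
  ultimately show thesis by (intro that)
qed

lemma range_eq: "range_g br \<omega> \<omega>0 \<mu> a N \<sigma> = {w. Rg w}"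
  unfolding range_g_def E_S using is_op_imp_Rg Rg_imp_is_op by blast

lemma E_weight_integral:
  fixes v :: "real^'q \<Rightarrow> real \<Rightarrow> complex"
  assumes v: "v \<in> L2H NE" and [measurable]: "\<rho> \<in> borel_measurable borel" and \<rho>: "\<And>\<eta>. 0 \<le> \<rho> \<eta>"
  shows "(\<integral>\<^sup>+\<eta>. ennreal ((\<rho> \<eta>)\<^sup>2) * NE (v \<eta>) \<partial>lborel) = (\<Sum>k\<in>E.K. nsq lborel (\<lambda>\<eta>. of_real (\<rho> \<eta>) * E.cf k (v \<eta>)))"
proof -
  have m: "(\<lambda>\<eta>. ennreal ((cmod (of_real (\<rho> \<eta>) * E.cf k (v \<eta>)))\<^sup>2)) \<in> borel_measurable lborel" if "k \<in> E.K" for k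
    using E.L2H_E_D(1)[OF v that] by measurable
  have "ennreal ((\<rho> \<eta>)\<^sup>2) * NE (v \<eta>) = (\<Sum>k\<in>E.K. ennreal ((cmod (of_real (\<rho> \<eta>) * E.cf k (v \<eta>)))\<^sup>2))" for \<eta>
    unfolding E.L2H_E_D(4)[OF v] sum_distrib_left
    by (intro sum.cong refl) (simp add: norm_mult power_mult_distrib ennreal_mult)
  then show ?thesis unfolding nsq_def by (simp only: nn_integral_sum[OF m])
qed

text \<open>[\<eta>]^2 and 1 + |\<eta>|^2 are bounded by multiples of each other, so the Sobolev
  condition may be tested with [\<eta>]^\<mu> on each coefficient.\<close>

lemma Hs_iff: "w \<in> Hs NE \<mu> \<longleftrightarrow> (\<exists>w'. is_ft NE w w' \<and> (\<forall>k\<in>E.K. nsq lborel (\<lambda>\<eta>. of_real (br \<eta> ^ \<mu>) * E.cf k (w' \<eta>)) < \<infinity>))"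
proof
  obtain B where B: "B > 0" "\<And>\<eta>. (br \<eta>)\<^sup>2 \<le> B * (1 + (norm \<eta>)\<^sup>2)" using bracket_upper_bound[OF bracket] by metis
  assume "w \<in> Hs NE \<mu>"
  then have "Hs_sq NE \<mu> w < \<infinity>" by (simp add: Hs_def)
  then obtain v where v: "is_ft NE w v" and fin: "(\<integral>\<^sup>+\<eta>. ennreal ((1 + (norm \<eta>)\<^sup>2) ^ \<mu>) * NE (v \<eta>) \<partial>lborel) < \<infinity>"
    unfolding Hs_sq_def INF_less_iff by blast
  have vL: "v \<in> L2H NE" using v by (simp add: is_ft_def)
  have NEm: "(\<lambda>\<eta>. ennreal ((1 + (norm \<eta>)\<^sup>2) ^ \<mu>) * NE (v \<eta>)) \<in> borel_measurable lborel"
  proof -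
    have "(\<lambda>\<eta>. \<Sum>k\<in>E.K. ennreal ((cmod (E.cf k (v \<eta>)))\<^sup>2)) \<in> borel_measurable lborel"
    proof (rule borel_measurable_sum)
      fix k assume "k \<in> E.K"
      from E.L2H_E_D(1)[OF vL this] show "(\<lambda>\<eta>. ennreal ((cmod (E.cf k (v \<eta>)))\<^sup>2)) \<in> borel_measurable lborel" by measurable
    qed
    moreover have "(\<lambda>\<eta>::real^'q. ennreal ((1 + (norm \<eta>)\<^sup>2) ^ \<mu>)) \<in> borel_measurable lborel" by measurable
    ultimately show ?thesis unfolding E.L2H_E_D(4)[OF vL] by (rule borel_measurable_times_ennreal[rotated])
  qed
  have "(\<Sum>k\<in>E.K. nsq lborel (\<lambda>\<eta>. of_real (br \<eta> ^ \<mu>) * E.cf k (v \<eta>))) = (\<integral>\<^sup>+\<eta>. ennreal ((br \<eta> ^ \<mu>)\<^sup>2) * NE (v \<eta>) \<partial>lborel)"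
    by (rule E_weight_integral[OF vL, symmetric]) (auto simp: br_pos less_imp_le)
  also have "\<dots> \<le> (\<integral>\<^sup>+\<eta>. ennreal (B ^ \<mu>) * (ennreal ((1 + (norm \<eta>)\<^sup>2) ^ \<mu>) * NE (v \<eta>)) \<partial>lborel)"
  proof (rule nn_integral_mono)
    fix \<eta>
    have "(br \<eta> ^ \<mu>)\<^sup>2 = ((br \<eta>)\<^sup>2) ^ \<mu>" by (simp add: mult.commute flip: power_mult)
    also have "\<dots> \<le> (B * (1 + (norm \<eta>)\<^sup>2)) ^ \<mu>" by (rule power_mono[OF B(2)]) simp
    finally have "ennreal ((br \<eta> ^ \<mu>)\<^sup>2) \<le> ennreal (B ^ \<mu> * (1 + (norm \<eta>)\<^sup>2) ^ \<mu>)"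
      by (intro ennreal_leI) (simp add: power_mult_distrib)
    then show "ennreal ((br \<eta> ^ \<mu>)\<^sup>2) * NE (v \<eta>) \<le> ennreal (B ^ \<mu>) * (ennreal ((1 + (norm \<eta>)\<^sup>2) ^ \<mu>) * NE (v \<eta>))"
      using B(1) by (simp add: ennreal_mult mult.assoc[symmetric] mult_right_mono)
  qed
  also have "\<dots> = ennreal (B ^ \<mu>) * (\<integral>\<^sup>+\<eta>. ennreal ((1 + (norm \<eta>)\<^sup>2) ^ \<mu>) * NE (v \<eta>) \<partial>lborel)"
    by (rule nn_integral_cmult[OF NEm])
  also have "\<dots> < \<infinity>" using fin by (simp add: ennreal_mult_less_top)
  finally have "\<forall>k\<in>E.K. nsq lborel (\<lambda>\<eta>. of_real (br \<eta> ^ \<mu>) * E.cf k (v \<eta>)) < \<infinity>"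
    by (auto simp: sum_Pinfty less_top)
  with v show "\<exists>w'. is_ft NE w w' \<and> (\<forall>k\<in>E.K. nsq lborel (\<lambda>\<eta>. of_real (br \<eta> ^ \<mu>) * E.cf k (w' \<eta>)) < \<infinity>)" by blast
next
  obtain A where A: "A > 0" "\<And>\<eta>. 1 + (norm \<eta>)\<^sup>2 \<le> A * (br \<eta>)\<^sup>2" using bracket_norm_bound[OF bracket] by metis
  assume "\<exists>w'. is_ft NE w w' \<and> (\<forall>k\<in>E.K. nsq lborel (\<lambda>\<eta>. of_real (br \<eta> ^ \<mu>) * E.cf k (w' \<eta>)) < \<infinity>)"
  then obtain v where v: "is_ft NE w v" and fin: "\<And>k. k \<in> E.K \<Longrightarrow> nsq lborel (\<lambda>\<eta>. of_real (br \<eta> ^ \<mu>) * E.cf k (v \<eta>)) < \<infinity>" by blast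
  have vL: "v \<in> L2H NE" and wL: "w \<in> L2H NE" using v by (simp_all add: is_ft_def)
  have "Hs_sq NE \<mu> w \<le> (\<integral>\<^sup>+\<eta>. ennreal ((1 + (norm \<eta>)\<^sup>2) ^ \<mu>) * NE (v \<eta>) \<partial>lborel)"
    unfolding Hs_sq_def by (rule INF_lower) (use v in simp)
  also have "\<dots> \<le> (\<integral>\<^sup>+\<eta>. ennreal ((sqrt (A ^ \<mu>) * br \<eta> ^ \<mu>)\<^sup>2) * NE (v \<eta>) \<partial>lborel)"
  proof (rule nn_integral_mono, rule mult_right_mono, rule ennreal_leI)
    fix \<eta>
    have "(1 + (norm \<eta>)\<^sup>2) ^ \<mu> \<le> (A * (br \<eta>)\<^sup>2) ^ \<mu>" by (rule power_mono[OF A(2)]) simp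
    also have "\<dots> = (sqrt (A ^ \<mu>) * br \<eta> ^ \<mu>)\<^sup>2"
      using A(1) by (simp add: power_mult_distrib real_sqrt_pow2 mult.commute flip: power_mult)
    finally show "(1 + (norm \<eta>)\<^sup>2) ^ \<mu> \<le> (sqrt (A ^ \<mu>) * br \<eta> ^ \<mu>)\<^sup>2" .
  qed simp
  also have "\<dots> = (\<Sum>k\<in>E.K. nsq lborel (\<lambda>\<eta>. of_real (sqrt (A ^ \<mu>) * br \<eta> ^ \<mu>) * E.cf k (v \<eta>)))"
    by (rule E_weight_integral[OF vL]) (use A in \<open>auto simp: br_pos less_imp_le\<close>)
  also have "\<dots> < \<infinity>"
  proof -
    have "nsq lborel (\<lambda>\<eta>. of_real (sqrt (A ^ \<mu>) * br \<eta> ^ \<mu>) * E.cf k (v \<eta>)) < \<infinity>" if k: "k \<in> E.K" for k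
    proof -
      have "(\<lambda>\<eta>. of_real (br \<eta> ^ \<mu>) * E.cf k (v \<eta>)) \<in> borel_measurable lborel"
        using E.L2H_E_D(1)[OF vL k] by measurable
      from nsq_cmult[OF this, of "of_real (sqrt (A ^ \<mu>))"] fin[OF k]
      show ?thesis by (simp add: mult.assoc ennreal_mult_less_top)
    qed
    then show ?thesis by (simp add: sum_Pinfty less_top)
  qed
  finally show "w \<in> Hs NE \<mu>" using wL by (simp add: Hs_def)
qed

lemma Rg_imp_Hs: "Rg w \<Longrightarrow> w \<in> Hs NE \<mu>"
  unfolding Rg_def Hs_iff by blast

text \<open>\<open>is_op\<close> is only a relation; this lemma supplies the existence of values,
  and with them the mapping into H^\<mu>.\<close>

lemma g_sig_defined:
  assumes u: "u \<in> L2H Ksq"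
  obtains w where "w \<in> Hs NE \<mu>" "is_op Ksq NE gs u w"
proof -
  obtain v where v: "is_ft Ksq u v" by (rule KW.is_ft_exists[OF u])
  then have vL: "v \<in> L2H Ksq" by (simp add: is_ft_def)
  obtain w where w: "is_ft NE w (\<lambda>\<eta>. gs \<eta> (v \<eta>))" by (rule E.is_ft_E_surjective[OF g_sig_L2H(1)[OF vL]])
  have "is_op Ksq NE gs u w" using v w unfolding is_op_def by blast
  then show thesis by (intro that[of w] Rg_imp_Hs is_op_imp_Rg)
qed

lemma pc_add_scale:
  assumes "u \<in> L2H NE" "u' \<in> L2H NE" "j \<le> ns"
  shows "pc j (\<lambda>t. u \<eta> t + c * u' \<eta> t) = pc j (u \<eta>) + c * pc j (u' \<eta>)"
  unfolding pc_def E.L2H_E_add_scale(2)[OF assms(1,2) K_0[OF assms(3)]] by (simp add: algebra_simps)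

lemma Rg_add_scale:
  assumes "Rg u" "Rg w"
  shows "Rg (\<lambda>y t. u y t + c * w y t)"
proof -
  from assms(1) obtain u' where u: "is_ft NE u u'" and ufin: "\<And>k. k \<in> E.K \<Longrightarrow> nsq lborel (\<lambda>\<eta>. of_real (br \<eta> ^ \<mu>) * E.cf k (u' \<eta>)) < \<infinity>"
    and uae: "AE \<eta> in lborel. \<forall>k\<in>E.K. E.cf k (u' \<eta>) = (\<Sum>j\<le>ns. pc j (u' \<eta>) * tc k j \<eta>)"
    unfolding Rg_def by blast
  from assms(2) obtain w' where w: "is_ft NE w w'" and wfin: "\<And>k. k \<in> E.K \<Longrightarrow> nsq lborel (\<lambda>\<eta>. of_real (br \<eta> ^ \<mu>) * E.cf k (w' \<eta>)) < \<infinity>"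
    and wae: "AE \<eta> in lborel. \<forall>k\<in>E.K. E.cf k (w' \<eta>) = (\<Sum>j\<le>ns. pc j (w' \<eta>) * tc k j \<eta>)"
    unfolding Rg_def by blast
  have L: "u' \<in> L2H NE" "w' \<in> L2H NE" using u w by (simp_all add: is_ft_def)
  note cfl = E.L2H_E_add_scale(2)[OF L]
  show ?thesis
    unfolding Rg_def
  proof (intro exI conjI ballI)
    show "is_ft NE (\<lambda>y t. u y t + c * w y t) (\<lambda>\<eta> t. u' \<eta> t + c * w' \<eta> t)" by (rule E.is_ft_E_add_scale[OF u w])
    fix k assume k: "k \<in> E.K"
    have m: "(\<lambda>\<eta>. of_real (br \<eta> ^ \<mu>) * E.cf k (u' \<eta>)) \<in> borel_measurable lborel"
      "(\<lambda>\<eta>. of_real (br \<eta> ^ \<mu>) * E.cf k (w' \<eta>)) \<in> borel_measurable lborel"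
      using E.L2H_E_D(1)[OF L(1) k] E.L2H_E_D(1)[OF L(2) k] by measurable
    have "nsq lborel (\<lambda>\<eta>. of_real (br \<eta> ^ \<mu>) * E.cf k (u' \<eta>) + c * (of_real (br \<eta> ^ \<mu>) * E.cf k (w' \<eta>))) < \<infinity>"
    proof (rule nsq_add_finite(1)[OF m(1) _ ufin[OF k]])
      show "nsq lborel (\<lambda>\<eta>. c * (of_real (br \<eta> ^ \<mu>) * E.cf k (w' \<eta>))) < \<infinity>"
        unfolding nsq_cmult[OF m(2)] using wfin[OF k] by (simp add: ennreal_mult_less_top)
    qed (use m in measurable)
    then show "nsq lborel (\<lambda>\<eta>. of_real (br \<eta> ^ \<mu>) * E.cf k (\<lambda>t. u' \<eta> t + c * w' \<eta> t)) < \<infinity>"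
      unfolding cfl[OF k] by (simp add: algebra_simps)
  next
    show "AE \<eta> in lborel. \<forall>k\<in>E.K. E.cf k (\<lambda>t. u' \<eta> t + c * w' \<eta> t) = (\<Sum>j\<le>ns. pc j (\<lambda>t. u' \<eta> t + c * w' \<eta> t) * tc k j \<eta>)"
      using uae wae
    proof eventually_elim
      fix \<eta>
      assume 1: "\<forall>k\<in>E.K. E.cf k (u' \<eta>) = (\<Sum>j\<le>ns. pc j (u' \<eta>) * tc k j \<eta>)"
        and 2: "\<forall>k\<in>E.K. E.cf k (w' \<eta>) = (\<Sum>j\<le>ns. pc j (w' \<eta>) * tc k j \<eta>)"
      show "\<forall>k\<in>E.K. E.cf k (\<lambda>t. u' \<eta> t + c * w' \<eta> t) = (\<Sum>j\<le>ns. pc j (\<lambda>t. u' \<eta> t + c * w' \<eta> t) * tc k j \<eta>)"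
      proof
        fix k assume k: "k \<in> E.K"
        have "(\<Sum>j\<le>ns. pc j (\<lambda>t. u' \<eta> t + c * w' \<eta> t) * tc k j \<eta>) = (\<Sum>j\<le>ns. (pc j (u' \<eta>) + c * pc j (w' \<eta>)) * tc k j \<eta>)"
          by (intro sum.cong refl) (simp add: pc_add_scale[OF L])
        also have "\<dots> = E.cf k (u' \<eta>) + c * E.cf k (w' \<eta>)"
          using 1 2 k by (simp add: sum.distrib distrib_right sum_distrib_left mult.assoc)
        finally show "E.cf k (\<lambda>t. u' \<eta> t + c * w' \<eta> t) = (\<Sum>j\<le>ns. pc j (\<lambda>t. u' \<eta> t + c * w' \<eta> t) * tc k j \<eta>)"
          by (simp add: cfl[OF k])
      qed
    qed
  qed
qed

lemma Rg_zero: "Rg (\<lambda>_ _. 0)"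
proof -
  have c0: "E.cf k (\<lambda>t. 0) = 0" if "k \<in> E.K" for k
    using E.cf_comb[of "\<lambda>t. 0" "\<lambda>_. 0", OF _ that] by (simp add: E.comb_def)
  have L: "(\<lambda>_ _. 0) \<in> L2H NE"
    by (rule E.L2H_E_I[where h = "\<lambda>_ _. 0"]) (auto simp: E.comb_def)
  have "is_ft NE (\<lambda>_ _. 0) (\<lambda>_ _. 0)"
    unfolding E.is_ft_E_iff using L by (simp add: c0 sft_def ftr_def)
  then show ?thesis
    unfolding Rg_def by (intro exI[of _ "\<lambda>_ _. 0"]) (auto simp: c0 pc_def K_0)
qed

text \<open>\<open>Hs_sq\<close> is an infimum over transforms, but these agree almost everywhere,
  and the Sobolev weight is at least 1. Convergence in H^\<mu> thus gives L2 convergence of every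
  coefficient.\<close>

lemma Hs_sq_ge:
  assumes ft: "is_ft NE f d" and k: "k \<in> E.K"
  shows "nsq lborel (\<lambda>\<eta>. E.cf k (d \<eta>)) \<le> Hs_sq NE \<mu> f"
  unfolding Hs_sq_def
proof (rule INF_greatest)
  fix v assume "v \<in> {v. is_ft NE f v}"
  then have v: "is_ft NE f v" by simp
  then have vL: "v \<in> L2H NE" by (simp add: is_ft_def)
  have "nsq lborel (\<lambda>\<eta>. E.cf k (d \<eta>)) = nsq lborel (\<lambda>\<eta>. E.cf k (v \<eta>))"
    using E.is_ft_E_unique[OF ft v k] by (intro nsq_cong_AE) auto
  also have "\<dots> \<le> (\<integral>\<^sup>+\<eta>. ennreal ((1 + (norm \<eta>)\<^sup>2) ^ \<mu>) * NE (v \<eta>) \<partial>lborel)"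
    unfolding nsq_def
  proof (rule nn_integral_mono)
    fix \<eta>
    have "ennreal ((cmod (E.cf k (v \<eta>)))\<^sup>2) \<le> NE (v \<eta>)"
      unfolding E.L2H_E_D(4)[OF vL] by (rule member_le_sum[OF k]) auto
    also have "\<dots> = 1 * NE (v \<eta>)" by simp
    also have "\<dots> \<le> ennreal ((1 + (norm \<eta>)\<^sup>2) ^ \<mu>) * NE (v \<eta>)"
      by (intro mult_right_mono) (auto simp: one_le_power)
    finally show "ennreal ((cmod (E.cf k (v \<eta>)))\<^sup>2) \<le> ennreal ((1 + (norm \<eta>)\<^sup>2) ^ \<mu>) * NE (v \<eta>)" .
  qed
  finally show "nsq lborel (\<lambda>\<eta>. E.cf k (d \<eta>)) \<le> (\<integral>\<^sup>+\<eta>. ennreal ((1 + (norm \<eta>)\<^sup>2) ^ \<mu>) * NE (v \<eta>) \<partial>lborel)" .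
qed

text \<open>The defining relation of the range is an almost everywhere identity between the coefficients,
  with bounded factors \<open>tc\<close>; it therefore survives limits in \<open>L\<^sup>2\<close>.\<close>

lemma Rg_closed:
  assumes w: "\<And>n. Rg (w n)" and u: "u \<in> Hs NE \<mu>"
    and lim: "(\<lambda>n. Hs_sq NE \<mu> (\<lambda>y t. w n y t - u y t)) \<longlonglongrightarrow> 0"
  shows "Rg u"
proof -
  from u obtain u' where u': "is_ft NE u u'" and ufin: "\<And>k. k \<in> E.K \<Longrightarrow> nsq lborel (\<lambda>\<eta>. of_real (br \<eta> ^ \<mu>) * E.cf k (u' \<eta>)) < \<infinity>"
    unfolding Hs_iff by blast
  have "\<forall>n. \<exists>v. is_ft NE (w n) v \<and> (AE \<eta> in lborel. \<forall>k\<in>E.K. E.cf k (v \<eta>) = (\<Sum>j\<le>ns. pc j (v \<eta>) * tc k j \<eta>))"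
  proof
    fix n
    from w[of n] obtain v where "is_ft NE (w n) v" "AE \<eta> in lborel. \<forall>k\<in>E.K. E.cf k (v \<eta>) = (\<Sum>j\<le>ns. pc j (v \<eta>) * tc k j \<eta>)"
      unfolding Rg_def by blast
    then show "\<exists>v. is_ft NE (w n) v \<and> (AE \<eta> in lborel. \<forall>k\<in>E.K. E.cf k (v \<eta>) = (\<Sum>j\<le>ns. pc j (v \<eta>) * tc k j \<eta>))"
      by (intro exI conjI)
  qed
  from choice[OF this] obtain v where v: "\<And>n. is_ft NE (w n) (v n)"
    and vae: "\<And>n. AE \<eta> in lborel. \<forall>k\<in>E.K. E.cf k (v n \<eta>) = (\<Sum>j\<le>ns. pc j (v n \<eta>) * tc k j \<eta>)" by blast
  have L: "u' \<in> L2H NE" "v n \<in> L2H NE" for n using u' v by (simp_all add: is_ft_def)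
  define d where "d n \<eta> t = v n \<eta> t + (- 1) * u' \<eta> t" for n \<eta> t
  have dft: "is_ft NE (\<lambda>y t. w n y t - u y t) (d n)" for n
    using E.is_ft_E_add_scale[OF v u', of n "- 1"] by (simp add: d_def[abs_def])
  have dL: "d n \<in> L2H NE" for n using dft by (simp add: is_ft_def)
  have cd: "E.cf k (d n \<eta>) = E.cf k (v n \<eta>) - E.cf k (u' \<eta>)" if "k \<in> E.K" for k n \<eta>
    using E.L2H_E_add_scale(2)[OF L(2) L(1) that, of n \<eta> "- 1"] by (simp add: d_def[abs_def])
  have pd: "pc j (d n \<eta>) = pc j (v n \<eta>) - pc j (u' \<eta>)" if "j \<le> ns" for j n \<eta>
    by (simp add: pc_def cd[OF K_0[OF that]] algebra_simps)
  have d0: "(\<lambda>n. nsq lborel (\<lambda>\<eta>. E.cf k (d n \<eta>))) \<longlonglongrightarrow> 0" if "k \<in> E.K" for k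
    by (rule tendsto_0_squeeze_ennreal[OF lim Hs_sq_ge[OF dft that]])
  have dm [measurable]: "(\<lambda>\<eta>. E.cf k (d n \<eta>)) \<in> borel_measurable lborel" if "k \<in> E.K" for k n
    using E.L2H_E_D(1)[OF dL that] by simp
  have ae: "AE \<eta> in lborel. E.cf k (u' \<eta>) - (\<Sum>j\<le>ns. pc j (u' \<eta>) * tc k j \<eta>) = 0" if k: "k \<in> E.K" for k
  proof -
    let ?r = "\<lambda>\<eta>. E.cf k (u' \<eta>) - (\<Sum>j\<le>ns. pc j (u' \<eta>) * tc k j \<eta>)"
    have t0: "(\<lambda>n. nsq lborel (\<lambda>\<eta>. \<Sum>j\<le>ns. E.cf (0, j) (d n \<eta>) * (of_real ((-1) ^ j * fact j) * tc k j \<eta>))) \<longlonglongrightarrow> 0"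
    proof (rule nsq_sum_tendsto_0)
      fix j assume "j \<in> {..ns}"
      then have j: "(0, j) \<in> E.K" by (simp add: K_0)
      obtain C where C: "C \<ge> 0" "\<And>\<eta>. cmod (tc k j \<eta>) \<le> C" using tc_bound[of k j] by blast
      have b: "cmod (of_real ((-1) ^ j * fact j) * tc k j \<eta>) \<le> fact j * C" for \<eta>
        using C(2)[of \<eta>] by (simp add: norm_mult norm_power)
      show "(\<lambda>\<eta>. E.cf (0, j) (d n \<eta>) * (of_real ((-1) ^ j * fact j) * tc k j \<eta>)) \<in> borel_measurable lborel" for n
        using dm[OF j] by measurable
      have "(\<lambda>n. ennreal ((fact j * C)\<^sup>2) * nsq lborel (\<lambda>\<eta>. E.cf (0, j) (d n \<eta>))) \<longlonglongrightarrow> 0"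
        using tendsto_mult_ennreal[OF tendsto_const[of "ennreal ((fact j * C)\<^sup>2)"] d0[OF j]] by simp
      then show "(\<lambda>n. nsq lborel (\<lambda>\<eta>. E.cf (0, j) (d n \<eta>) * (of_real ((-1) ^ j * fact j) * tc k j \<eta>))) \<longlonglongrightarrow> 0"
        by (rule tendsto_0_squeeze_ennreal) (rule nsq_mult_bounded[OF dm[OF j] b])
    qed simp
    \<comment> \<open>The transform of w n satisfies the relation almost everywhere, so the defect
      of u' is minus the defect of the difference d n, which tends to 0 with n.\<close>
    have le: "nsq lborel ?r \<le> 2 * nsq lborel (\<lambda>\<eta>. \<Sum>j\<le>ns. E.cf (0, j) (d n \<eta>) * (of_real ((-1) ^ j * fact j) * tc k j \<eta>)) +
        2 * nsq lborel (\<lambda>\<eta>. E.cf k (d n \<eta>))" for n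
    proof -
      have "nsq lborel ?r = nsq lborel (\<lambda>\<eta>. (\<Sum>j\<le>ns. E.cf (0, j) (d n \<eta>) * (of_real ((-1) ^ j * fact j) * tc k j \<eta>)) - E.cf k (d n \<eta>))"
      proof (rule nsq_cong_AE)
        show "AE \<eta> in lborel. cmod (?r \<eta>) = cmod ((\<Sum>j\<le>ns. E.cf (0, j) (d n \<eta>) * (of_real ((-1) ^ j * fact j) * tc k j \<eta>)) - E.cf k (d n \<eta>))"
          using vae[of n]
        proof eventually_elim
          fix \<eta> assume *: "\<forall>k\<in>E.K. E.cf k (v n \<eta>) = (\<Sum>j\<le>ns. pc j (v n \<eta>) * tc k j \<eta>)"
          have "(\<Sum>j\<le>ns. E.cf (0, j) (d n \<eta>) * (of_real ((-1) ^ j * fact j) * tc k j \<eta>)) = (\<Sum>j\<le>ns. pc j (d n \<eta>) * tc k j \<eta>)"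
            by (simp add: pc_def mult_ac)
          also have "\<dots> = (\<Sum>j\<le>ns. pc j (v n \<eta>) * tc k j \<eta> - pc j (u' \<eta>) * tc k j \<eta>)"
            by (intro sum.cong refl) (simp add: pd left_diff_distrib)
          also have "\<dots> = E.cf k (v n \<eta>) - (\<Sum>j\<le>ns. pc j (u' \<eta>) * tc k j \<eta>)"
            using * k by (simp add: sum_subtractf)
          finally show "cmod (?r \<eta>) = cmod ((\<Sum>j\<le>ns. E.cf (0, j) (d n \<eta>) * (of_real ((-1) ^ j * fact j) * tc k j \<eta>)) - E.cf k (d n \<eta>))"
            by (simp add: cd[OF k])
        qed
      qed
      also have "\<dots> \<le> 2 * nsq lborel (\<lambda>\<eta>. \<Sum>j\<le>ns. E.cf (0, j) (d n \<eta>) * (of_real ((-1) ^ j * fact j) * tc k j \<eta>)) + 2 * nsq lborel (\<lambda>\<eta>. E.cf k (d n \<eta>))"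
      proof (rule nsq_diff_le[OF _ dm[OF k]], rule borel_measurable_sum)
        fix j assume "j \<in> {..ns}"
        then have j: "(0, j) \<in> E.K" by (simp add: K_0)
        show "(\<lambda>\<eta>. E.cf (0, j) (d n \<eta>) * (of_real ((-1) ^ j * fact j) * tc k j \<eta>)) \<in> borel_measurable lborel"
          using dm[OF j] by measurable
      qed
      finally show ?thesis .
    qed
    have "(\<lambda>n. 2 * nsq lborel (\<lambda>\<eta>. \<Sum>j\<le>ns. E.cf (0, j) (d n \<eta>) * (of_real ((-1) ^ j * fact j) * tc k j \<eta>)) +
        2 * nsq lborel (\<lambda>\<eta>. E.cf k (d n \<eta>))) \<longlonglongrightarrow> 2 * 0 + 2 * 0"
      by (intro tendsto_add tendsto_mult_ennreal tendsto_const t0 d0[OF k]) auto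
    from tendsto_lowerbound[OF this always_eventually[OF allI[OF le]]] have z: "nsq lborel ?r = 0" by simp
    have cm: "(\<lambda>\<eta>. E.cf k (u' \<eta>)) \<in> borel_measurable lborel" if "k \<in> E.K" for k
      using E.L2H_E_D(1)[OF L(1) that] by simp
    have "(\<lambda>\<eta>. \<Sum>j\<le>ns. pc j (u' \<eta>) * tc k j \<eta>) \<in> borel_measurable lborel"
    proof (rule borel_measurable_sum)
      fix j assume "j \<in> {..ns}"
      then have "(0, j) \<in> E.K" by (simp add: K_0)
      from cm[OF this] show "(\<lambda>\<eta>. pc j (u' \<eta>) * tc k j \<eta>) \<in> borel_measurable lborel"
        unfolding pc_def by measurable
    qed
    then have "?r \<in> borel_measurable lborel" using cm[OF k] by (rule borel_measurable_diff[rotated])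
    then have "AE \<eta> in lborel. ennreal ((cmod (?r \<eta>))\<^sup>2) = 0"
      using z unfolding nsq_def by (subst (asm) nn_integral_0_iff_AE) auto
    then show ?thesis by eventually_elim simp
  qed
  have "AE \<eta> in lborel. \<forall>k\<in>E.K. E.cf k (u' \<eta>) = (\<Sum>j\<le>ns. pc j (u' \<eta>) * tc k j \<eta>)"
    using ae by (subst AE_finite_all[OF E.finite_K]) (auto elim!: eventually_mono)
  then show ?thesis unfolding Rg_def using u' ufin by blast
qed

lemma range_closed: "closed_subspace (Hs_sq NE \<mu>) (Hs NE \<mu>) {w. Rg w}"
proof -
  have "Rg (\<lambda>y t. c * u y t)" if "Rg u" for c u
    using Rg_add_scale[OF Rg_zero that, of c] by simp
  moreover have "Rg (\<lambda>y t. u y t + w y t)" if "Rg u" "Rg w" for u w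
    using Rg_add_scale[OF that, of 1] by simp
  ultimately show ?thesis
    unfolding closed_subspace_def using Rg_zero Rg_imp_Hs Rg_closed by blast
qed

end

section \<open>Smooth functions on the half-line\<close>

text \<open>Finite differentiability on (0,\<infinity>) with existentially chosen derivatives.
  Closure under sums and products becomes a plain induction, without computing iterates of
  \<open>hd_deriv\<close>.\<close>

fun diff_upto :: "nat \<Rightarrow> (real \<Rightarrow> complex) \<Rightarrow> bool" where
  "diff_upto 0 f = True"
| "diff_upto (Suc n) f = (\<exists>g. (\<forall>t>0. (f has_vector_derivative g t) (at t)) \<and> diff_upto n g)"

lemma diff_upto_cong:
  assumes "diff_upto n f" "\<And>t. t > 0 \<Longrightarrow> g t = f t"
  shows "diff_upto n g"
  using assms by (cases n) (auto intro: hd_deriv_pos_eqI(2))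

lemma diff_upto_Suc_D: "diff_upto (Suc n) f \<Longrightarrow> diff_upto n f"
proof (induction n arbitrary: f)
  case (Suc n)
  then obtain g where g: "\<forall>t>0. (f has_vector_derivative g t) (at t)" "diff_upto (Suc n) g"
    unfolding diff_upto.simps(2)[of "Suc n"] by blast
  from Suc.IH[OF g(2)] g(1) show ?case unfolding diff_upto.simps(2) by blast
qed simp

text \<open>Uniqueness of derivatives identifies the chosen ones with \<open>hd_deriv\<close> at
  each t > 0.\<close>

lemma smooth_if_diff_upto:
  assumes "\<And>n. diff_upto n f"
  shows "smooth_upto0_on {0<..} f"
proof -
  have "(hd_deriv ^^ k) f differentiable (at t)" if "diff_upto (Suc k) f" "t > 0" for k t f
    using that
  proof (induction k arbitrary: f)
    case 0 then show ?case by (auto intro: differentiableI_vector)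
  next
    case (Suc k)
    from Suc.prems(1) obtain g where g: "\<forall>t>0. (f has_vector_derivative g t) (at t)" "diff_upto (Suc k) g"
      unfolding diff_upto.simps(2)[of "Suc k"] by blast
    have "hd_deriv f t = g t" if "t > 0" for t
      using g(1) that by (intro hd_deriv_pos_eqI(1)[of f]) auto
    then have "diff_upto (Suc k) (hd_deriv f)" by (intro diff_upto_cong[OF g(2)])
    from Suc.IH[OF this Suc.prems(2)] show ?case by (simp add: funpow_swap1)
  qed
  then show ?thesis using assms unfolding smooth_upto0_on_def by (auto simp: at_within_pos simp del: diff_upto.simps)
qed

lemma diff_upto_if_smooth:
  assumes "smooth_upto0_on {0<..} f"
  shows "diff_upto n f"
proof -
  have "diff_upto n ((hd_deriv ^^ k) f)" for k
  proof (induction n arbitrary: k)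
    case (Suc n)
    show ?case
      unfolding diff_upto.simps(2) using smooth_upto0_on_D[OF assms, of _ k] Suc.IH[of "Suc k"] by blast
  qed simp
  from this[of 0] show ?thesis by simp
qed

lemma diff_upto_const: "diff_upto n (\<lambda>_. c)"
  by (induction n arbitrary: c) (auto intro!: exI[of _ "\<lambda>_. 0"])

lemma diff_upto_add: "diff_upto n f \<Longrightarrow> diff_upto n g \<Longrightarrow> diff_upto n (\<lambda>t. f t + g t)"
proof (induction n arbitrary: f g)
  case (Suc n)
  then obtain f' g' where 1: "\<forall>t>0. (f has_vector_derivative f' t) (at t)" "diff_upto n f'"
    and 2: "\<forall>t>0. (g has_vector_derivative g' t) (at t)" "diff_upto n g'"
    unfolding diff_upto.simps(2) by blast
  then show ?case
    unfolding diff_upto.simps(2)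
    by (intro exI[of _ "\<lambda>t. f' t + g' t"]) (auto intro: has_vector_derivative_add Suc.IH)
qed simp

lemma diff_upto_mult: "diff_upto n f \<Longrightarrow> diff_upto n g \<Longrightarrow> diff_upto n (\<lambda>t. f t * g t)"
proof (induction n arbitrary: f g)
  case (Suc n)
  then obtain f' g' where 1: "\<forall>t>0. (f has_vector_derivative f' t) (at t)" "diff_upto n f'"
    and 2: "\<forall>t>0. (g has_vector_derivative g' t) (at t)" "diff_upto n g'"
    unfolding diff_upto.simps(2) by blast
  then show ?case
    unfolding diff_upto.simps(2)
    by (intro exI[of _ "\<lambda>t. f t * g' t + f' t * g t"] conjI diff_upto_add Suc.IH
          diff_upto_Suc_D[OF Suc.prems(1)] diff_upto_Suc_D[OF Suc.prems(2)])
       (auto intro: has_vector_derivative_mult)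
qed simp

lemma diff_upto_power: "diff_upto n f \<Longrightarrow> diff_upto n (\<lambda>t. f t ^ j)"
  by (induction j) (auto intro: diff_upto_mult diff_upto_const)

lemma diff_upto_sum: "(\<And>i. i \<in> I \<Longrightarrow> diff_upto n (f i)) \<Longrightarrow> diff_upto n (\<lambda>t. \<Sum>i\<in>I. f i t)"
  by (induction I rule: infinite_finite_induct) (auto intro: diff_upto_add diff_upto_const)

lemma has_vector_derivative_powr:
  fixes p :: complex
  assumes "t > 0"
  shows "((\<lambda>t. of_real t powr p) has_vector_derivative p * of_real t powr (p - 1)) (at t)"
proof -
  have "((\<lambda>z. z powr p) has_field_derivative p * of_real t powr (p - 1)) (at (complex_of_real t))"
    by (rule has_field_derivative_powr) (use assms in auto)
  from has_vector_derivative_real_field[OF this] show ?thesis .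
qed

lemma has_vector_derivative_ln:
  assumes "t > 0"
  shows "((\<lambda>t. complex_of_real (ln t)) has_vector_derivative of_real t powr (- 1)) (at t)"
proof -
  have "((\<lambda>t. complex_of_real (ln t)) has_vector_derivative of_real (1 / t)) (at t)"
    by (rule has_vector_derivative_of_real)
       (use assms in \<open>auto intro: DERIV_ln_divide simp flip: has_real_derivative_iff_has_vector_derivative\<close>)
  then show ?thesis using assms by (simp add: powr_minus divide_inverse)
qed

lemma diff_upto_powr: "diff_upto n (\<lambda>t. of_real t powr p)"
proof (induction n arbitrary: p)
  case (Suc n)
  show ?case
    unfolding diff_upto.simps(2)
    by (intro exI[of _ "\<lambda>t. p * of_real t powr (p - 1)"])
       (auto intro: has_vector_derivative_powr diff_upto_mult diff_upto_const Suc.IH)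
qed simp

lemma diff_upto_ln: "diff_upto n (\<lambda>t. of_real (ln t))"
  by (rule diff_upto_Suc_D) (auto intro!: exI[of _ "\<lambda>t. of_real t powr (- 1)"] has_vector_derivative_ln diff_upto_powr)

lemma cutoff_diff_upto: "cutoff \<omega> \<Longrightarrow> diff_upto n \<omega>"
  by (rule diff_upto_if_smooth) (auto simp: cutoff_def smooth_upto0_on_def)

lemma (in E_space) e_smooth: "smooth_upto0_on {0<..} (e k)"
proof (rule smooth_if_diff_upto)
  show "diff_upto n (e k)" for n
    unfolding e_def[abs_def] of_real_power
    by (intro diff_upto_mult cutoff_diff_upto[OF cutoff] diff_upto_powr diff_upto_power diff_upto_ln)
qed

lemma smooth_sum:
  assumes "\<And>i. i \<in> I \<Longrightarrow> smooth_upto0_on {0<..} (f i)" "\<And>t. t > 0 \<Longrightarrow> u t = (\<Sum>i\<in>I. c i * f i t)"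
  shows "smooth_upto0_on {0<..} u"
proof (rule smooth_if_diff_upto)
  fix n
  have "diff_upto n (\<lambda>t. \<Sum>i\<in>I. c i * f i t)"
    using assms(1) by (intro diff_upto_sum diff_upto_mult diff_upto_const) (auto intro: diff_upto_if_smooth)
  then show "diff_upto n u" by (rule diff_upto_cong) (rule assms(2))
qed

lemma smooth_mtd_funpow: "smooth_upto0_on {0<..} f \<Longrightarrow> smooth_upto0_on {0<..} ((mtd ^^ j) f)"
  by (induction j) (simp_all add: smooth_upto0_on_mtd)

lemma smooth_continuous:
  assumes "smooth_upto0_on {0<..} f"
  shows "continuous_on {0<..} f"
proof (rule continuous_at_imp_continuous_on, rule ballI)
  fix t :: real assume "t \<in> {0<..}"
  then show "isCont f t"
    using smooth_upto0_on_D[OF assms, of t 0] by (auto intro: has_vector_derivative_continuous)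
qed

lemma mtd_funpow_Suc: "(mtd ^^ Suc j) u t = - of_real t * hd_deriv ((mtd ^^ j) u) t"
  by (simp add: mtd_def[of "(mtd ^^ j) u"])

lemma mtd_funpow_sum:
  assumes f: "\<And>i. i \<in> I \<Longrightarrow> smooth_upto0_on {0<..} (f i)" and u: "\<And>t. t > 0 \<Longrightarrow> u t = (\<Sum>i\<in>I. c i * f i t)" and t: "t > 0"
  shows "(mtd ^^ j) u t = (\<Sum>i\<in>I. c i * (mtd ^^ j) (f i) t)"
  using t
proof (induction j arbitrary: t)
  case 0 then show ?case by (simp add: u)
next
  case (Suc j)
  have "((\<lambda>t. \<Sum>i\<in>I. c i * (mtd ^^ j) (f i) t) has_vector_derivative (\<Sum>i\<in>I. c i * hd_deriv ((mtd ^^ j) (f i)) t)) (at t)"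
    using smooth_upto0_on_D[OF smooth_mtd_funpow[OF f] Suc.prems, of _ 0 j]
    by (intro has_vector_derivative_sum has_vector_derivative_mult_right) simp
  from hd_deriv_pos_eqI(1)[OF this Suc.prems Suc.IH]
  show ?case
    unfolding mtd_funpow_Suc sum_distrib_left by (simp add: sum_distrib_left mult_ac)
qed

lemma mtd_funpow_zero:
  assumes "\<And>t. t > R \<Longrightarrow> u t = 0" "t > R" "R > 0"
  shows "(mtd ^^ j) u t = 0"
  using assms(2)
proof (induction j arbitrary: t)
  case 0 then show ?case by (simp add: assms(1))
next
  case (Suc j)
  have "((mtd ^^ j) u has_vector_derivative 0) (at t)"
    by (rule has_vector_derivative_transform_within_open[of "\<lambda>_. 0" 0 t "{R<..}"]) (use Suc in auto)
  then have "hd_deriv ((mtd ^^ j) u) t = 0"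
    using Suc.prems assms(3) by (simp add: hd_deriv_def at_within_pos vector_derivative_at)
  then show ?case unfolding mtd_funpow_Suc by simp
qed

section \<open>The Mellin symbol calculus near the edge\<close>

text \<open>The residue at s of t^(-z) times a function with Laurent series F there, see
  \<open>residue_powr\<close>. Multiplication by t^l amounts to replacing s by s - l.\<close>

definition psi :: "nat \<Rightarrow> complex \<Rightarrow> complex fls \<Rightarrow> real \<Rightarrow> complex" where
  "psi d s F t = of_real t powr (- s) * Phi d F t"

lemma Phi_sum: "Phi d (\<Sum>i\<in>I. F i) t = (\<Sum>i\<in>I. Phi d (F i) t)"
  unfolding Phi_def fls_nth_sum sum_distrib_left by (rule sum.swap)

lemma Phi_add: "Phi d (F + G) t = Phi d F t + Phi d G t"
  by (simp add: Phi_def distrib_left sum.distrib)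

lemma Phi_const: "Phi d (fls_const c * F) t = c * Phi d F t"
  by (simp add: Phi_def sum_distrib_left mult_ac)

text \<open>The operator -t d/dt corresponds to multiplication of F by X, which shifts the
  coefficients by one. The coefficient of F at -2 - d would enter with the power d of ln t, so its
  vanishing keeps the truncation at d exact.\<close>

lemma has_vector_derivative_Phi:
  assumes F: "F $$ (- 2 - int d) = 0" and t: "t > 0"
  shows "(Phi d F has_vector_derivative - (Phi d (fls_X * F) t / of_real t)) (at t)"
proof -
  define g where "g j = of_real (real j * (- (1 / t) * (- ln t) ^ (j - Suc 0)) / fact j) * F $$ (- 1 - int j)" for j
  have "((\<lambda>t. (- ln t) ^ j / fact j) has_real_derivative real j * (- (1 / t) * (- ln t) ^ (j - Suc 0)) / fact j) (at t)" for j
    by (intro DERIV_cdivide DERIV_power DERIV_minus DERIV_ln_divide t)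
  then have "(Phi d F has_vector_derivative (\<Sum>j\<le>d. g j)) (at t)"
    unfolding Phi_def[abs_def] g_def
    by (intro has_vector_derivative_sum has_vector_derivative_mult_left has_vector_derivative_of_real)
       (simp flip: has_real_derivative_iff_has_vector_derivative)
  also have "(\<Sum>j\<le>d. g j) = (\<Sum>j\<le>Suc d. g j)" using F by (simp add: g_def)
  also have "\<dots> = (\<Sum>j\<le>d. g (Suc j))" unfolding sum.atMost_Suc_shift by (simp add: g_def)
  also have "\<dots> = - (Phi d (fls_X * F) t / of_real t)"
    unfolding Phi_def sum_divide_distrib sum_negf[symmetric]
  proof (intro sum.cong refl)
    fix j
    have 1: "real (Suc j) * (- (1 / t) * (- ln t) ^ j) / fact (Suc j) = - ((- ln t) ^ j / fact j / t)"
      by (simp add: field_simps del: of_nat_Suc)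
    have "- 1 - int (Suc j) = - 1 - int j - 1" by simp
    then have "(fls_X * F) $$ (- 1 - int j) = F $$ (- 1 - int (Suc j))"
      by (simp only: fls_X_times_conv_shift fls_shift_nth) simp
    then show "g (Suc j) = - (of_real ((- ln t) ^ j / fact j) * (fls_X * F) $$ (- 1 - int j) / of_real t)"
      unfolding g_def diff_Suc_Suc diff_zero 1 by simp
  qed
  finally show ?thesis .
qed

lemma has_vector_derivative_psi:
  assumes F: "F $$ (- 2 - int d) = 0" and t: "t > 0"
  shows "(psi d s F has_vector_derivative - (psi d s ((fls_const s + fls_X) * F) t / of_real t)) (at t)"
proof -
  have "(psi d s F has_vector_derivative of_real t powr (- s) * - (Phi d (fls_X * F) t / of_real t) +
      (- s * of_real t powr (- s - 1)) * Phi d F t) (at t)"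
    unfolding psi_def[abs_def]
    by (intro has_vector_derivative_mult has_vector_derivative_powr has_vector_derivative_Phi assms)
  also have "of_real t powr (- s - 1) = of_real t powr (- s) / of_real t"
    using t by (simp add: powr_diff)
  also have "of_real t powr (- s) * - (Phi d (fls_X * F) t / of_real t) + (- s * (of_real t powr (- s) / of_real t)) * Phi d F t =
      - (psi d s ((fls_const s + fls_X) * F) t / of_real t)"
    unfolding psi_def distrib_right Phi_add Phi_const by (simp add: distrib_left add_divide_distrib mult_ac)
  finally show ?thesis .
qed

lemma pl_monom: "pl (monom 1 j) s = (fls_const s + fls_X) ^ j"
proof -
  have "pl (monom 1 j) s = (\<Sum>i\<le>j. if i = j then (fls_const s + fls_X) ^ j else 0)"
    unfolding pl_eq[OF degree_monom_le] by (intro sum.cong refl) simp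
  then show ?thesis by simp
qed

lemma pl_mult_below:
  assumes "\<And>k. k < - 1 - int d \<Longrightarrow> F $$ k = 0" "k < - 1 - int d"
  shows "(pl p s * F) $$ k = 0"
  by (rule fls_mult_nth_eq_0[where n = 0 and m = "- 1 - int d"]) (use assms pl_nonneg in auto)

text \<open>An identity on the open interval (0,\<epsilon>) survives differentiation, so the cutoff
  can be ignored where it equals 1.\<close>

lemma mtd_funpow_psi:
  assumes F: "\<And>i k. i \<in> I \<Longrightarrow> k < - 1 - int d \<Longrightarrow> F i $$ k = 0"
    and u: "\<And>t. 0 < t \<Longrightarrow> t < \<epsilon> \<Longrightarrow> u t = (\<Sum>i\<in>I. psi d (s i) (F i) t)" and t: "0 < t" "t < \<epsilon>"
  shows "(mtd ^^ j) u t = (\<Sum>i\<in>I. psi d (s i) ((fls_const (s i) + fls_X) ^ j * F i) t)"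
  using t
proof (induction j arbitrary: t)
  case 0 then show ?case by (simp add: u)
next
  case (Suc j)
  let ?G = "\<lambda>j i. (fls_const (s i) + fls_X) ^ j * F i"
  let ?D = "\<Sum>i\<in>I. - (psi d (s i) ((fls_const (s i) + fls_X) * ?G j i) t / of_real t)"
  have "((\<lambda>t. \<Sum>i\<in>I. psi d (s i) (?G j i) t) has_vector_derivative ?D) (at t)"
    using pl_mult_below[OF F, where k = "- 2 - int d" and p = "monom 1 j"] Suc.prems
    by (intro has_vector_derivative_sum has_vector_derivative_psi) (auto simp: pl_monom)
  then have "((mtd ^^ j) u has_vector_derivative ?D) (at t)"
    by (rule has_vector_derivative_transform_within_open[of _ _ _ "{0<..<\<epsilon>}"]) (use Suc in auto)
  then have "hd_deriv ((mtd ^^ j) u) t = ?D"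
    using Suc.prems by (simp add: hd_deriv_def at_within_pos vector_derivative_at)
  then show ?case
    unfolding mtd_funpow_Suc using Suc.prems by (simp add: sum_distrib_left sum_negf mult.assoc)
qed

lemma poly_mtd_psi:
  assumes F: "\<And>i k. i \<in> I \<Longrightarrow> k < - 1 - int d \<Longrightarrow> F i $$ k = 0"
    and u: "\<And>t. 0 < t \<Longrightarrow> t < \<epsilon> \<Longrightarrow> u t = (\<Sum>i\<in>I. psi d (s i) (F i) t)" and t: "0 < t" "t < \<epsilon>"
  shows "poly_mtd p u t = (\<Sum>i\<in>I. psi d (s i) (pl p (s i) * F i) t)"
proof -
  have "poly_mtd p u t = (\<Sum>j\<le>degree p. \<Sum>i\<in>I. coeff p j * psi d (s i) ((fls_const (s i) + fls_X) ^ j * F i) t)"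
    unfolding poly_mtd_def sum_distrib_left[symmetric]
    by (intro sum.cong refl arg_cong2[where f = times] mtd_funpow_psi[OF F u t])
  also have "\<dots> = (\<Sum>i\<in>I. \<Sum>j\<le>degree p. coeff p j * psi d (s i) ((fls_const (s i) + fls_X) ^ j * F i) t)"
    by (rule sum.swap)
  also have "\<dots> = (\<Sum>i\<in>I. psi d (s i) (pl p (s i) * F i) t)"
    unfolding pl_def sum_distrib_right psi_def Phi_sum sum_distrib_left mult.assoc Phi_const
    by (simp add: mult_ac)
  finally show ?thesis .
qed

text \<open>Every power of ln t is absorbed by exp (\<delta> |ln t|), see
  \<open>power_le_exp\<close>.\<close>

lemma Phi_bound:
  assumes \<delta>: "\<delta> > 0" and F: "\<And>j. j \<le> d \<Longrightarrow> cmod (F $$ (- 1 - int j)) \<le> C j * q"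
  shows "cmod (Phi d F t) \<le> (\<Sum>j\<le>d. C j / \<delta> ^ j) * q * exp (\<delta> * \<bar>ln t\<bar>)"
proof -
  have "cmod (of_real ((- ln t) ^ j / fact j) * F $$ (- 1 - int j)) \<le> C j / \<delta> ^ j * q * exp (\<delta> * \<bar>ln t\<bar>)" if "j \<le> d" for j
  proof -
    have "(\<delta> * \<bar>ln t\<bar>) ^ j / fact j \<le> exp (\<delta> * \<bar>ln t\<bar>)" using \<delta> by (intro power_le_exp) auto
    then have "cmod (of_real ((- ln t) ^ j / fact j)) \<le> exp (\<delta> * \<bar>ln t\<bar>) / \<delta> ^ j"
      using \<delta> by (simp add: norm_divide norm_power power_mult_distrib field_simps)
    then have "cmod (of_real ((- ln t) ^ j / fact j)) * cmod (F $$ (- 1 - int j)) \<le> (exp (\<delta> * \<bar>ln t\<bar>) / \<delta> ^ j) * (C j * q)"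
      using F[OF that] \<delta> by (intro mult_mono) auto
    then show ?thesis unfolding norm_mult by (simp only: mult_ac times_divide_eq_left times_divide_eq_right)
  qed
  then show ?thesis unfolding Phi_def sum_distrib_right by (intro sum_norm_le) auto
qed

section \<open>The conjugated operator on the range\<close>

context edge_op
begin

definition gc :: "nat \<times> nat \<Rightarrow> real^'q \<Rightarrow> (real \<Rightarrow> complex) \<Rightarrow> complex" where
  "gc k \<eta> u = inverse (of_real (br \<eta> ^ \<mu>)) * (\<Sum>j\<le>ns. pq j u * tc k j \<eta>)"

lemma g_sig_sum: "Ksq u < \<infinity> \<Longrightarrow> t > 0 \<Longrightarrow> gs \<eta> u t = (\<Sum>k\<in>E.K. gc k \<eta> u * E.e k t)"
  unfolding gc_def using g_sig_comb by (simp add: E.comb_def)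

lemma g_sig_smooth: "Ksq u < \<infinity> \<Longrightarrow> smooth_upto0_on {0<..} (gs \<eta> u)"
  by (rule smooth_sum[OF E.e_smooth g_sig_sum])

text \<open>With \<open>bf\<close>, a separation of variables: an index (m, j, k) selects the m-th
  polynomial \<open>ftilde\<close> with its factor t^m, the power j of -t d/dt and the singular
  function \<open>e k\<close>. \<open>af\<close> carries \<eta> and u, \<open>bf\<close> carries
  t.\<close>

definition af :: "nat \<times> nat \<times> nat \<times> nat \<Rightarrow> real^'q \<Rightarrow> (real \<Rightarrow> complex) \<Rightarrow> complex" where
  "af i \<eta> u = coeff (ftilde br \<mu> a (fst i) \<eta>) (fst (snd i)) * gc (snd (snd i)) \<eta> u"

definition bf :: "nat \<times> nat \<times> nat \<times> nat \<Rightarrow> real \<Rightarrow> complex" where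
  "bf i t = of_real t ^ fst i / of_real t ^ \<mu> * (mtd ^^ fst (snd i)) (E.e (snd (snd i))) t"

abbreviation AI where "AI \<equiv> {..\<mu>} \<times> {..\<mu>} \<times> E.K"

text \<open>The explicit form \<open>atilde_eq\<close> applies because the values of the symbol are
  smooth on (0,\<infinity>); the dependence on t is then confined to finitely many fixed
  functions.\<close>

lemma atilde_sum:
  assumes u: "Ksq u < \<infinity>" and t: "t > 0"
  shows "atilde br \<mu> a \<eta> (gs \<eta> u) t = (\<Sum>i\<in>AI. af i \<eta> u * bf i t)"
proof -
  have m: "(mtd ^^ j) (gs \<eta> u) t = (\<Sum>k\<in>E.K. gc k \<eta> u * (mtd ^^ j) (E.e k) t)" for j
    by (rule mtd_funpow_sum[OF E.e_smooth g_sig_sum[OF u] t])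
  have "atilde br \<mu> a \<eta> (gs \<eta> u) t = (\<Sum>m\<le>\<mu>. \<Sum>j\<le>\<mu>. \<Sum>k\<in>E.K. af (m, j, k) \<eta> u * bf (m, j, k) t)"
    unfolding atilde_eq[OF g_sig_smooth[OF u] br_pos t] poly_mtd_eq[OF degree_ftilde] m sum_divide_distrib
      sum_distrib_left af_def bf_def
    by (intro sum.cong refl) simp
  then show ?thesis by (simp add: sum.cartesian_product case_prod_unfold)
qed

lemma gc_measurable: "v \<in> L2H Ksq \<Longrightarrow> (\<lambda>\<eta>. gc k \<eta> (v \<eta>)) \<in> borel_measurable borel"
  unfolding gc_def
  by (intro borel_measurable_times borel_measurable_sum pq_measurable tc_measurable) measurable

lemma af_measurable: "v \<in> L2H Ksq \<Longrightarrow> (\<lambda>\<eta>. af i \<eta> (v \<eta>)) \<in> borel_measurable borel"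
  unfolding af_def by (intro borel_measurable_times coeff_ftilde_measurable[OF bracket] gc_measurable)

text \<open>The order \<mu> of \<open>ftilde\<close> cancels the order -\<mu> of
  \<open>gc\<close>.\<close>

lemma af_bound: "\<exists>C\<ge>0. \<forall>\<eta> u. Ksq u < \<infinity> \<longrightarrow> cmod (af i \<eta> u) \<le> C * q0 u"
proof -
  let ?k = "snd (snd i)"
  obtain A where A: "\<And>\<eta>. cmod (coeff (ftilde br \<mu> a (fst i) \<eta>) (fst (snd i))) \<le> A * br \<eta> ^ \<mu>"
    using coeff_ftilde_bound[OF bracket] by meson
  have "\<forall>j. \<exists>C. C \<ge> 0 \<and> (\<forall>u. Ksq u < \<infinity> \<longrightarrow> cmod (pq j u) \<le> C * q0 u)" using pq_bound by metis
  then obtain P where P: "\<And>j. P j \<ge> 0" "\<And>j u. Ksq u < \<infinity> \<Longrightarrow> cmod (pq j u) \<le> P j * q0 u" by metis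
  have "\<forall>j. \<exists>C. C \<ge> 0 \<and> (\<forall>\<eta>. cmod (tc ?k j \<eta>) \<le> C)" using tc_bound[of ?k] by blast
  then obtain D where D: "\<And>j. D j \<ge> 0" "\<And>j \<eta>. cmod (tc ?k j \<eta>) \<le> D j" by metis
  let ?B = "\<Sum>j\<le>ns. P j * D j"
  have B: "?B \<ge> 0" using P(1) D(1) by (intro sum_nonneg) auto
  have "cmod (af i \<eta> u) \<le> (\<bar>A\<bar> * ?B) * q0 u" if u: "Ksq u < \<infinity>" for \<eta> u
  proof -
    have q: "q0 u \<ge> 0" by (simp add: q0_def)
    have "cmod (\<Sum>j\<le>ns. pq j u * tc ?k j \<eta>) \<le> (\<Sum>j\<le>ns. (P j * q0 u) * D j)"
      unfolding norm_mult[symmetric] using P D u q by (intro sum_norm_le) (auto simp: norm_mult intro!: mult_mono)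
    also have "\<dots> = ?B * q0 u" by (simp add: sum_distrib_left sum_distrib_right mult_ac)
    finally have S: "cmod (\<Sum>j\<le>ns. pq j u * tc ?k j \<eta>) \<le> ?B * q0 u" .
    have "cmod (af i \<eta> u) \<le> (\<bar>A\<bar> * br \<eta> ^ \<mu>) * (inverse (br \<eta> ^ \<mu>) * (?B * q0 u))"
      unfolding af_def gc_def norm_mult
    proof (intro mult_mono S)
      have "A * br \<eta> ^ \<mu> \<le> \<bar>A\<bar> * br \<eta> ^ \<mu>" using br_pos[of \<eta>] by (intro mult_right_mono) auto
      with A[of \<eta>] show "cmod (coeff (ftilde br \<mu> a (fst i) \<eta>) (fst (snd i))) \<le> \<bar>A\<bar> * br \<eta> ^ \<mu>" by linarith
      show "cmod (inverse (of_real (br \<eta> ^ \<mu>))) \<le> inverse (br \<eta> ^ \<mu>)"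
        using br_pos[of \<eta>] by (simp add: norm_inverse norm_power)
    qed (use B q br_pos[of \<eta>] in auto)
    also have "\<dots> = (\<bar>A\<bar> * ?B) * q0 u" using br_pos[of \<eta>] by simp
    finally show ?thesis .
  qed
  then show ?thesis using B by (intro exI[of _ "\<bar>A\<bar> * ?B"]) auto
qed

lemma bf_continuous: "continuous_on {0<..} (bf i)"
  unfolding bf_def[abs_def]
  by (intro continuous_intros smooth_continuous smooth_mtd_funpow E.e_smooth) auto

text \<open>Away from t = 0 there is no singularity, and the cutoff in \<open>e k\<close> bounds the
  support.\<close>

lemma bf_bound:
  assumes "\<epsilon> > 0"
  shows "\<exists>C R. C \<ge> 0 \<and> (\<forall>t\<ge>\<epsilon>. cmod (bf i t) \<le> C * indicator {0<..R} t)"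
proof -
  obtain R where R: "R > 0" "\<And>t. t > R \<Longrightarrow> \<omega> t = 0" using cutoff_support[OF cutoff] by metis
  have z: "bf i t = 0" if "t > R" for t
    unfolding bf_def using mtd_funpow_zero[of R "E.e (snd (snd i))" t] that R by (simp add: E.e_def)
  have "continuous_on {\<epsilon>..R} (bf i)" by (rule continuous_on_subset[OF bf_continuous]) (use assms in auto)
  then have "bounded (bf i ` {\<epsilon>..R})" by (intro compact_imp_bounded compact_continuous_image) auto
  then obtain B where "\<forall>z\<in>bf i ` {\<epsilon>..R}. norm z \<le> B" unfolding bounded_iff by blast
  then have "cmod (bf i t) \<le> \<bar>B\<bar>" if "t \<in> {\<epsilon>..R}" for t using that by (auto intro: order_trans[OF _ abs_ge_self])
  then have "cmod (bf i t) \<le> \<bar>B\<bar> * indicator {0<..R} t" if "t \<ge> \<epsilon>" for t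
    using that z[of t] assms by (cases "t \<le> R") auto
  then show ?thesis by (intro exI[of _ "\<bar>B\<bar>"] exI[of _ R]) auto
qed

lemma atilde_far:
  assumes \<epsilon>: "\<epsilon> > 0"
  obtains C R where "C \<ge> 0"
    "\<And>\<eta> u t. Ksq u < \<infinity> \<Longrightarrow> t \<ge> \<epsilon> \<Longrightarrow> cmod (atilde br \<mu> a \<eta> (gs \<eta> u) t) \<le> q0 u * (C * indicator {0<..R} t)"
proof -
  obtain A where A: "\<And>i. A i \<ge> 0" "\<And>i \<eta> u. Ksq u < \<infinity> \<Longrightarrow> cmod (af i \<eta> u) \<le> A i * q0 u"
    using af_bound by metis
  obtain B R where B: "\<And>i. B i \<ge> 0" "\<And>i t. t \<ge> \<epsilon> \<Longrightarrow> cmod (bf i t) \<le> B i * indicator {0<..R i} t"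
    using bf_bound[OF \<epsilon>] by metis
  define R' where "R' = Max (R ` AI)"
  have R': "R i \<le> R'" if "i \<in> AI" for i unfolding R'_def by (rule Max_ge) (use that in auto)
  show thesis
  proof (rule that[of "\<Sum>i\<in>AI. A i * B i" R'])
    show "0 \<le> (\<Sum>i\<in>AI. A i * B i)" using A(1) B(1) by (intro sum_nonneg) auto
    fix \<eta> u and t :: real assume u: "Ksq u < \<infinity>" and t: "t \<ge> \<epsilon>"
    have q: "q0 u \<ge> 0" by (simp add: q0_def)
    have "cmod (atilde br \<mu> a \<eta> (gs \<eta> u) t) \<le> (\<Sum>i\<in>AI. (A i * q0 u) * (B i * indicator {0<..R'} t))"
      unfolding atilde_sum[OF u less_le_trans[OF \<epsilon> t]]
    proof (rule sum_norm_le)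
      fix i assume i: "i \<in> AI"
      have "B i * indicator {0<..R i} t \<le> B i * indicator {0<..R'} t"
        using B(1) R'[OF i] by (intro mult_left_mono) (auto simp: indicator_def)
      with B(2)[OF t, of i] have "cmod (bf i t) \<le> B i * indicator {0<..R'} t" by (rule order_trans)
      then show "norm (af i \<eta> u * bf i t) \<le> (A i * q0 u) * (B i * indicator {0<..R'} t)"
        unfolding norm_mult by (intro mult_mono A(2) u mult_nonneg_nonneg A(1) q) auto
    qed
    also have "\<dots> = q0 u * ((\<Sum>i\<in>AI. A i * B i) * indicator {0<..R'} t)"
      unfolding sum_distrib_left sum_distrib_right by (intro sum.cong refl) (simp only: mult_ac)
    finally show "cmod (atilde br \<mu> a \<eta> (gs \<eta> u) t) \<le> q0 u * ((\<Sum>i\<in>AI. A i * B i) * indicator {0<..R'} t)" .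
  qed
qed

lemma g_sig_psi:
  assumes u: "Ksq u < \<infinity>" and t: "t > 0" and \<omega>: "\<omega> t = 1"
  shows "gs \<eta> u t = (\<Sum>l\<le>ms. psi md (\<sigma> - of_nat l) (gls l \<eta> * Hf \<eta> u) t)"
  unfolding g_sig_def psi_def powr_shift[OF t, symmetric]
  by (intro sum.cong refl) (simp add: g_part_eq[OF u _ t] \<omega>)

text \<open>The series at \<sigma> of f_m(z - l) g_l(z) h(z), with h the principal part: what f_m
  makes of the l-th summand of the symbol. Up to logarithms it contributes the power t^(m + l -
  \<mu> - \<sigma>).\<close>

definition G :: "nat \<Rightarrow> nat \<Rightarrow> real^'q \<Rightarrow> (real \<Rightarrow> complex) \<Rightarrow> complex fls" where
  "G m l \<eta> u = pl (ftilde br \<mu> a m \<eta>) (\<sigma> - of_nat l) * (gls l \<eta> * Hf \<eta> u)"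

text \<open>The recursion for \<open>gtilde\<close> makes all terms of total degree at most \<open>\<mu>\<^sub>\<sigma>\<close> cancel.\<close>

lemma G_cancel:
  assumes k: "k < 0"
  shows "(\<Sum>l\<le>M. G (M - l) l \<eta> u) $$ k = 0"
proof (cases "M = 0")
  case True
  let ?c = "of_real (br \<eta> ^ \<mu>) :: complex" and ?R = "inverse P0 * Mf u"
  have c: "fls_const ?c * fls_const (inverse ?c) = 1" using br_pos[of \<eta>] by (simp add: fls_const_mult_const)
  \<comment> \<open>Total degree 0 cancels without the recursion: f0 times the principal part of
    f0^(-1) \<open>Mf u\<close> differs from the power series \<open>Mf u\<close> by another power
    series, so it has no negative powers.\<close>
  have "G 0 0 \<eta> u = (fls_const ?c * fls_const (inverse ?c)) * (P0 * prp ?R)"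
    unfolding G_def by (simp add: ftilde_0 pl_smult Hf_def P0_def mult_ac)
  also have "\<dots> = P0 * ?R - P0 * fps_to_fls (fls_regpart ?R)"
    unfolding c by (simp add: prp_def right_diff_distrib)
  also have "P0 * ?R = Mf u" using P0_nonzero by (simp add: mult.assoc[symmetric])
  also have "(Mf u - P0 * fps_to_fls (fls_regpart ?R)) $$ k = 0"
  proof -
    have "(P0 * fps_to_fls (fls_regpart ?R)) $$ k = 0"
      by (rule fls_mult_nth_eq_0[where n = 0 and m = 0]) (use k in \<open>auto simp: P0_def pl_nonneg\<close>)
    then show ?thesis using k by (simp add: Mf_nth)
  qed
  finally show ?thesis using True by simp
next
  case False
  let ?c = "of_real (br \<eta> ^ \<mu>) :: complex" and ?P = "pl (conormal \<mu> a) (\<sigma> - of_nat M)"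
  let ?S = "\<Sum>l<M. pl (ftilde br \<mu> a (M - l) \<eta>) (\<sigma> - of_nat l) * gls l \<eta>"
  have c: "fls_const ?c * fls_const (inverse ?c) = 1" using br_pos[of \<eta>] by (simp add: fls_const_mult_const)
  have P: "?P * inverse ?P = 1" using pl_nonzero[OF conormal_nonzero] by simp
  have g: "gls M \<eta> = - (fls_const (inverse ?c) * inverse ?P) * ?S" using False by (subst gls.simps) simp
  have "pl (ftilde br \<mu> a 0 \<eta>) (\<sigma> - of_nat M) * gls M \<eta> = - ((fls_const ?c * fls_const (inverse ?c)) * (?P * inverse ?P) * ?S)"
    unfolding ftilde_0 pl_smult g by (simp only: mult_minus_left mult_minus_right mult_ac)
  then have z: "?S + pl (ftilde br \<mu> a 0 \<eta>) (\<sigma> - of_nat M) * gls M \<eta> = 0" unfolding c P by simp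
  have "{..M} = insert M {..<M}" by auto
  then have "(\<Sum>l\<le>M. G (M - l) l \<eta> u) = (?S + pl (ftilde br \<mu> a 0 \<eta>) (\<sigma> - of_nat M) * gls M \<eta>) * Hf \<eta> u"
    unfolding G_def by (simp add: distrib_right sum_distrib_right mult.assoc)
  then show ?thesis unfolding z by simp
qed

text \<open>A consequence of Re \<sigma> < 1/2. It guarantees that for M \<le> ms every f_(M - l) is
  among the terms m \<le> \<mu> of the truncated operator.\<close>

lemma ms_less: "ms < \<mu>"
proof -
  have "Re \<sigma> + real \<mu> - 1/2 < real \<mu>" using \<sigma>_bounds by simp
  then have "\<lfloor>Re \<sigma> + real \<mu> - 1/2\<rfloor> < int \<mu>" by (simp add: floor_less_iff)
  moreover have "0 < \<mu>" using \<sigma>_bounds by (cases \<mu>) auto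
  ultimately show ?thesis unfolding mu_sig_def by linarith
qed

abbreviation NI where "NI \<equiv> {p \<in> {..\<mu>} \<times> {..ms}. ms < fst p + snd p}"

text \<open>The pairs with m + l \<le> ms are regrouped by M = m + l and drop out by
  \<open>G_cancel\<close>, since \<open>Phi\<close> sees only negative exponents.\<close>

lemma sum_Phi_G:
  "(\<Sum>m\<le>\<mu>. \<Sum>l\<le>ms. x ^ (m + l) * Phi md (G m l \<eta> u) t) = (\<Sum>p\<in>NI. x ^ (fst p + snd p) * Phi md (G (fst p) (snd p) \<eta> u) t)"
proof -
  let ?f = "\<lambda>p. x ^ (fst p + snd p) * Phi md (G (fst p) (snd p) \<eta> u) t"
  let ?J = "{p \<in> {..\<mu>} \<times> {..ms}. fst p + snd p \<le> ms}"
  have "(\<Sum>p\<in>?J. ?f p) = (\<Sum>q\<in>(SIGMA M:{..ms}. {..M}). x ^ fst q * Phi md (G (fst q - snd q) (snd q) \<eta> u) t)"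
    by (rule sum.reindex_bij_witness[of _ "\<lambda>q. (fst q - snd q, snd q)" "\<lambda>p. (fst p + snd p, snd p)"])
       (use ms_less in auto)
  also have "\<dots> = (\<Sum>M\<le>ms. x ^ M * Phi md (\<Sum>l\<le>M. G (M - l) l \<eta> u) t)"
    by (subst sum.Sigma[symmetric, where g = "\<lambda>M l. x ^ M * Phi md (G (M - l) l \<eta> u) t", unfolded case_prod_unfold])
       (auto simp: Phi_sum sum_distrib_left)
  also have "\<dots> = 0"
  proof (intro sum.neutral ballI)
    fix M
    have "Phi md (\<Sum>l\<le>M. G (M - l) l \<eta> u) t = 0"
      unfolding Phi_def by (intro sum.neutral ballI) (simp add: G_cancel)
    then show "x ^ M * Phi md (\<Sum>l\<le>M. G (M - l) l \<eta> u) t = 0" by simp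
  qed
  finally have J: "(\<Sum>p\<in>?J. ?f p) = 0" .
  have "(\<Sum>m\<le>\<mu>. \<Sum>l\<le>ms. x ^ (m + l) * Phi md (G m l \<eta> u) t) = (\<Sum>p\<in>{..\<mu>} \<times> {..ms}. ?f p)"
    by (simp add: sum.cartesian_product case_prod_unfold)
  also have "{..\<mu>} \<times> {..ms} = ?J \<union> NI" by auto
  also have "(\<Sum>p\<in>?J \<union> NI. ?f p) = (\<Sum>p\<in>?J. ?f p) + (\<Sum>p\<in>NI. ?f p)"
    by (rule sum.union_disjoint) auto
  finally show ?thesis unfolding J by simp
qed

text \<open>Where \<omega> equals 1 the symbol is a sum of functions \<open>psi\<close>, on which
  polynomials in -t d/dt act by multiplication of series; the powers t^m of the operator and t^l of
  the summands combine.\<close>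

lemma atilde_near_eq:
  assumes u: "Ksq u < \<infinity>" and \<epsilon>: "\<And>t. 0 \<le> t \<Longrightarrow> t < \<epsilon> \<Longrightarrow> \<omega> t = 1" and t: "0 < t" "t < \<epsilon>"
  shows "atilde br \<mu> a \<eta> (gs \<eta> u) t = of_real t powr (- \<sigma>) / of_real t ^ \<mu> *
    (\<Sum>p\<in>NI. of_real t ^ (fst p + snd p) * Phi md (G (fst p) (snd p) \<eta> u) t)"
proof -
  have p: "poly_mtd (ftilde br \<mu> a m \<eta>) (gs \<eta> u) t = (\<Sum>l\<le>ms. psi md (\<sigma> - of_nat l) (G m l \<eta> u) t)" for m
    unfolding G_def
  proof (rule poly_mtd_psi[where \<epsilon> = \<epsilon>])
    show "gs \<eta> u s = (\<Sum>l\<le>ms. psi md (\<sigma> - of_nat l) (gls l \<eta> * Hf \<eta> u) s)" if "0 < s" "s < \<epsilon>" for s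
      by (rule g_sig_psi[OF u that(1)]) (use \<epsilon>[of s] that in auto)
    show "(gls l \<eta> * Hf \<eta> u) $$ k = 0" if "l \<in> {..ms}" "k < - 1 - int md" for l k
      using gls_Hf_below[of l k] that by simp
  qed (use t in auto)
  have "atilde br \<mu> a \<eta> (gs \<eta> u) t = of_real t powr (- \<sigma>) / of_real t ^ \<mu> *
      (\<Sum>m\<le>\<mu>. \<Sum>l\<le>ms. of_real t ^ (m + l) * Phi md (G m l \<eta> u) t)"
    unfolding atilde_eq[OF g_sig_smooth[OF u] br_pos t(1)] p psi_def powr_shift[OF t(1), symmetric]
      sum_divide_distrib sum_distrib_left power_add
    by (intro sum.cong refl) simp
  then show ?thesis unfolding sum_Phi_G .
qed

lemma lfam_Hf:
  assumes v: "v \<in> L2H Ksq"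
  shows "lfam (\<lambda>\<eta>. inverse (br \<eta> ^ \<mu>) * q0 (v \<eta>)) (\<lambda>\<eta>. Hf \<eta> (v \<eta>))"
proof -
  have fin: "Ksq (v \<eta>) < \<infinity>" for \<eta> using v by (simp add: L2H_def)
  have q: "0 \<le> inverse (br \<eta> ^ \<mu>) * q0 (v \<eta>)" for \<eta> using br_pos[of \<eta>] by (simp add: q0_def)
  have "lfam (\<lambda>\<eta>. (inverse (br \<eta> ^ \<mu>) * q0 (v \<eta>)) * 1)
      (\<lambda>\<eta>. fls_const (inverse (of_real (br \<eta> ^ \<mu>)) * pq j (v \<eta>)) * fls_X_inv ^ Suc j)" for j
  proof -
    obtain C where C: "C \<ge> 0" "\<And>u. Ksq u < \<infinity> \<Longrightarrow> cmod (pq j u) \<le> C * q0 u" by (rule pq_bound[of j]) (rule that)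
    have m: "(\<lambda>\<eta>. inverse (of_real (br \<eta> ^ \<mu>)) * pq j (v \<eta>)) \<in> borel_measurable borel"
      by (intro borel_measurable_times pq_measurable[OF v]) measurable
    have b: "cmod (inverse (of_real (br \<eta> ^ \<mu>)) * pq j (v \<eta>)) \<le> C * (inverse (br \<eta> ^ \<mu>) * q0 (v \<eta>))" for \<eta>
    proof -
      have "cmod (inverse (of_real (br \<eta> ^ \<mu>)) * pq j (v \<eta>)) = inverse (br \<eta> ^ \<mu>) * cmod (pq j (v \<eta>))"
        using br_pos[of \<eta>] by (simp add: norm_mult norm_inverse norm_power)
      also have "\<dots> \<le> inverse (br \<eta> ^ \<mu>) * (C * q0 (v \<eta>))"
        using br_pos[of \<eta>] by (intro mult_left_mono C fin) auto
      finally show ?thesis by (simp add: mult_ac)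
    qed
    show ?thesis by (rule lfam_mult[OF lfam_scalar[OF m b q] lfam_const]) (use q in auto)
  qed
  then have "lfam (\<lambda>\<eta>. inverse (br \<eta> ^ \<mu>) * q0 (v \<eta>))
      (\<lambda>\<eta>. \<Sum>j\<le>ns. fls_const (inverse (of_real (br \<eta> ^ \<mu>)) * pq j (v \<eta>)) * fls_X_inv ^ Suc j)"
    by (intro lfam_sum) (simp_all del: power_Suc)
  then show ?thesis unfolding Hf_pf pf_def .
qed

text \<open>The orders \<mu>, 0 and -\<mu> of the three factors add up to 0, which leaves the norm
  of \<open>v \<eta>\<close>.\<close>

lemma lfam_G:
  assumes v: "v \<in> L2H Ksq"
  shows "lfam (\<lambda>\<eta>. q0 (v \<eta>)) (\<lambda>\<eta>. G m l \<eta> (v \<eta>))"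
proof -
  have q: "0 \<le> inverse (br \<eta> ^ \<mu>) * q0 (v \<eta>)" "0 \<le> br \<eta> ^ \<mu>" for \<eta> using br_pos[of \<eta>] by (simp_all add: q0_def)
  have "lfam (\<lambda>\<eta>. br \<eta> ^ \<mu> * (1 * (inverse (br \<eta> ^ \<mu>) * q0 (v \<eta>)))) (\<lambda>\<eta>. G m l \<eta> (v \<eta>))"
    unfolding G_def by (rule lfam_mult[OF lfam_ftilde lfam_mult[OF lfam_gls lfam_Hf[OF v]]]) (use q in auto)
  then show ?thesis
    by (rule lfam_cong) (use br_pos in \<open>simp_all add: less_imp_neq[symmetric]\<close>)
qed

lemma atilde_near:
  assumes v: "v \<in> L2H Ksq"
  obtains C \<delta> b \<epsilon> where "C \<ge> 0" "\<epsilon> > 0" "b > - 1/2" "0 \<le> \<delta>" "\<delta> < b + 1/2"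
    "\<And>\<eta> t. 0 < t \<Longrightarrow> t < \<epsilon> \<Longrightarrow> cmod (atilde br \<mu> a \<eta> (gs \<eta> (v \<eta>)) t) \<le> q0 (v \<eta>) * (C * (exp (\<delta> * \<bar>ln t\<bar>) * t powr b))"
proof -
  have fin: "Ksq (v \<eta>) < \<infinity>" for \<eta> using v by (simp add: L2H_def)
  \<comment> \<open>The least power that survives the cancellation, m + l = ms + 1, has size t^b. By
    definition of the integer part Re \<sigma> + \<mu> - 1/2 < ms + 1, that is b > -1/2, and
    \<delta> takes half of the surplus for the logarithms.\<close>
  define b where "b = real (Suc ms) - real \<mu> - Re \<sigma>"
  define \<delta> where "\<delta> = (b + 1/2) / 2"
  have "real ms + 1 > Re \<sigma> + real \<mu> - 1/2" unfolding mu_sig_def by linarith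
  then have b: "b > - 1/2" by (simp add: b_def)
  then have \<delta>: "0 < \<delta>" "\<delta> < b + 1/2" by (simp_all add: \<delta>_def)
  obtain \<epsilon>0 where \<epsilon>0: "\<epsilon>0 > 0" "\<And>t. 0 \<le> t \<Longrightarrow> t < \<epsilon>0 \<Longrightarrow> \<omega> t = 1" using cutoff_one[OF cutoff] by metis
  have "\<forall>p j. \<exists>C. C \<ge> 0 \<and> (\<forall>\<eta>. cmod (G (fst p) (snd p) \<eta> (v \<eta>) $$ (- 1 - int j)) \<le> C * q0 (v \<eta>))"
    using lfam_bound[OF lfam_G[OF v]] by metis
  then obtain C where C: "\<And>p j. C p j \<ge> 0"
    "\<And>p j \<eta>. cmod (G (fst p) (snd p) \<eta> (v \<eta>) $$ (- 1 - int j)) \<le> C p j * q0 (v \<eta>)" by metis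
  define D where "D p = (\<Sum>j\<le>md. C p j / \<delta> ^ j)" for p
  have D: "D p \<ge> 0" for p unfolding D_def using C(1) \<delta>(1) by (intro sum_nonneg) auto
  show thesis
  proof (rule that[of "\<Sum>p\<in>NI. D p" "min 1 \<epsilon>0" b \<delta>])
    show "0 \<le> (\<Sum>p\<in>NI. D p)" using D by (intro sum_nonneg) auto
    fix \<eta> and t :: real assume t: "0 < t" "t < min 1 \<epsilon>0"
    have q: "q0 (v \<eta>) \<ge> 0" by (simp add: q0_def)
    have pw: "t powr (- Re \<sigma>) / t ^ \<mu> * t ^ Suc ms = t powr b"
      using t by (simp add: b_def powr_diff powr_minus powr_realpow powr_add field_simps)
    have "cmod (\<Sum>p\<in>NI. of_real t ^ (fst p + snd p) * Phi md (G (fst p) (snd p) \<eta> (v \<eta>)) t)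
        \<le> (\<Sum>p\<in>NI. t ^ Suc ms * (D p * q0 (v \<eta>) * exp (\<delta> * \<bar>ln t\<bar>)))"
    proof (rule sum_norm_le)
      fix p assume p: "p \<in> NI"
      \<comment> \<open>This needs t < 1, hence the bound \<open>min 1 \<epsilon>0\<close> on the
        range of t.\<close>
      then have "t ^ (fst p + snd p) \<le> t ^ Suc ms" using t by (intro power_decreasing) auto
      moreover have "cmod (Phi md (G (fst p) (snd p) \<eta> (v \<eta>)) t) \<le> D p * q0 (v \<eta>) * exp (\<delta> * \<bar>ln t\<bar>)"
        unfolding D_def by (rule Phi_bound[OF \<delta>(1) C(2)])
      ultimately show "norm (of_real t ^ (fst p + snd p) * Phi md (G (fst p) (snd p) \<eta> (v \<eta>)) t)
          \<le> t ^ Suc ms * (D p * q0 (v \<eta>) * exp (\<delta> * \<bar>ln t\<bar>))"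
        unfolding norm_mult norm_power norm_of_real using t by (intro mult_mono) auto
    qed
    moreover have "t < \<epsilon>0" using t by simp
    ultimately have "cmod (atilde br \<mu> a \<eta> (gs \<eta> (v \<eta>)) t) \<le> cmod (of_real t powr (- \<sigma>) / of_real t ^ \<mu>) *
        (\<Sum>p\<in>NI. t ^ Suc ms * (D p * q0 (v \<eta>) * exp (\<delta> * \<bar>ln t\<bar>)))"
      by (subst atilde_near_eq[OF fin _ t(1), of \<epsilon>0]) (auto simp only: \<epsilon>0(2) norm_mult intro!: mult_left_mono norm_ge_zero)
    also have "cmod (of_real t powr (- \<sigma>) / of_real t ^ \<mu>) = t powr (- Re \<sigma>) / t ^ \<mu>"
      using t by (simp add: norm_divide norm_power norm_powr_real_powr)
    also have "t powr (- Re \<sigma>) / t ^ \<mu> * (\<Sum>p\<in>NI. t ^ Suc ms * (D p * q0 (v \<eta>) * exp (\<delta> * \<bar>ln t\<bar>))) = (t powr (- Re \<sigma>) / t ^ \<mu> * t ^ Suc ms) * (\<Sum>p\<in>NI. D p) * q0 (v \<eta>) * exp (\<delta> * \<bar>ln t\<bar>)"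
      unfolding sum_distrib_left sum_distrib_right by (intro sum.cong refl) (simp only: mult_ac)
    also have "\<dots> = q0 (v \<eta>) * ((\<Sum>p\<in>NI. D p) * (exp (\<delta> * \<bar>ln t\<bar>) * t powr b))"
      unfolding pw by (simp only: mult_ac)
    finally show "cmod (atilde br \<mu> a \<eta> (gs \<eta> (v \<eta>)) t) \<le> q0 (v \<eta>) * ((\<Sum>p\<in>NI. D p) * (exp (\<delta> * \<bar>ln t\<bar>) * t powr b))" .
  qed (use b \<delta> \<epsilon>0(1) in auto)
qed

text \<open>The estimates near 0 and away from 0 combine into a product majorant,
  \<open>q0 (v \<eta>)\<close> times \<Theta> t, which is square integrable in each
  variable.\<close>

lemma atilde_L2H:
  assumes v: "v \<in> L2H Ksq"
  shows "(\<lambda>\<eta>. atilde br \<mu> a \<eta> (gs \<eta> (v \<eta>))) \<in> L2H L2_sq"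
proof -
  interpret L: weighted_L2 halfline L2_sq by (rule weighted_L2_L2_sq)
  have fin: "Ksq (v \<eta>) < \<infinity>" for \<eta> using v by (simp add: L2H_def)
  let ?h = "\<lambda>\<eta>. atilde br \<mu> a \<eta> (gs \<eta> (v \<eta>))"
  have q: "q0 u \<ge> 0" for u by (simp add: q0_def)
  obtain C \<delta> b \<epsilon> where C: "C \<ge> 0" "\<epsilon> > 0" "b > - 1/2" "0 \<le> \<delta>" "\<delta> < b + 1/2"
    and near: "\<And>\<eta> t. 0 < t \<Longrightarrow> t < \<epsilon> \<Longrightarrow> cmod (?h \<eta> t) \<le> q0 (v \<eta>) * (C * (exp (\<delta> * \<bar>ln t\<bar>) * t powr b))"
    by (rule atilde_near[OF v]) (rule that)
  obtain D R where D: "D \<ge> 0"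
    and far: "\<And>\<eta> u t. Ksq u < \<infinity> \<Longrightarrow> t \<ge> \<epsilon> \<Longrightarrow> cmod (atilde br \<mu> a \<eta> (gs \<eta> u) t) \<le> q0 u * (D * indicator {0<..R} t)"
    by (rule atilde_far[OF C(2)]) (rule that)
  define \<Theta>1 where "\<Theta>1 t = exp (\<delta> * \<bar>ln t\<bar>) * t powr b * indicator {0<..\<epsilon>} t" for t :: real
  \<comment> \<open>The vanishing exponents bring the bounded part into the form covered by
    \<open>nsq_powr_exp_finite\<close>.\<close>
  define \<Theta>2 where "\<Theta>2 t = exp (0 * \<bar>ln t\<bar>) * t powr 0 * indicator {0<..R} t" for t :: real
  define \<Theta> where "\<Theta> t = C * \<Theta>1 t + D * \<Theta>2 t" for t
  have im: "(\<lambda>t. indicator {0<..r} t :: real) \<in> borel_measurable halfline" for r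
    unfolding halfline_def by (intro measurable_restrict_space1) simp
  have "(\<lambda>t. exp (d * \<bar>ln t\<bar>) * t powr c) \<in> borel_measurable halfline" for c d :: real
    by (rule measurable_halfline_continuous) (auto intro!: continuous_intros)
  from borel_measurable_times[OF this[of \<delta> b] im[of \<epsilon>]] borel_measurable_times[OF this[of 0 0] im[of R]]
  have "\<Theta>1 \<in> borel_measurable halfline" "\<Theta>2 \<in> borel_measurable halfline"
    unfolding \<Theta>1_def[abs_def] \<Theta>2_def[abs_def] by this+
  then have \<Theta>m: "(\<lambda>t. complex_of_real (\<Theta>1 t)) \<in> borel_measurable halfline" "(\<lambda>t. complex_of_real (\<Theta>2 t)) \<in> borel_measurable halfline"
    by (simp_all add: borel_measurable_of_real)
  have "nsq halfline (\<lambda>t. of_real (\<Theta>1 t)) < \<infinity>" "nsq halfline (\<lambda>t. of_real (\<Theta>2 t)) < \<infinity>"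
    unfolding \<Theta>1_def \<Theta>2_def by (intro nsq_powr_exp_finite C; simp)+
  then have "nsq halfline (\<lambda>t. of_real C * of_real (\<Theta>1 t) + of_real D * of_real (\<Theta>2 t)) < \<infinity>"
    using \<Theta>m by (intro nsq_add_finite(1)) (auto simp: nsq_cmult ennreal_mult_less_top)
  then have \<Theta>fin: "nsq halfline (\<lambda>t. of_real (\<Theta> t)) < \<infinity>" by (simp add: \<Theta>_def)
  have \<Theta>M: "(\<lambda>t. complex_of_real (\<Theta> t)) \<in> borel_measurable halfline"
    unfolding \<Theta>_def of_real_add of_real_mult using \<Theta>m by measurable
  have bound: "cmod (?h \<eta> t) \<le> cmod (of_real (q0 (v \<eta>)) * of_real (\<Theta> t))" if t: "t > 0" for \<eta> t
  proof -
    have n: "0 \<le> \<Theta>1 t" "0 \<le> \<Theta>2 t" by (simp_all add: \<Theta>1_def \<Theta>2_def)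
    have "cmod (?h \<eta> t) \<le> q0 (v \<eta>) * \<Theta> t"
    proof (cases "t < \<epsilon>")
      case True
      have "cmod (?h \<eta> t) \<le> q0 (v \<eta>) * (C * \<Theta>1 t)" using near[OF t True] t True by (simp add: \<Theta>1_def)
      also have "\<dots> \<le> q0 (v \<eta>) * \<Theta> t" using n D by (intro mult_left_mono q) (simp add: \<Theta>_def)
      finally show ?thesis .
    next
      case False
      have "cmod (?h \<eta> t) \<le> q0 (v \<eta>) * (D * \<Theta>2 t)" using far[OF fin, of t \<eta>] False t by (simp add: \<Theta>2_def)
      also have "\<dots> \<le> q0 (v \<eta>) * \<Theta> t" using n C by (intro mult_left_mono q) (simp add: \<Theta>_def)
      finally show ?thesis .
    qed
    also have "\<dots> \<le> \<bar>q0 (v \<eta>) * \<Theta> t\<bar>" by simp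
    finally show ?thesis by (simp add: norm_mult abs_mult)
  qed
  have qm: "(\<lambda>\<eta>. complex_of_real (q0 (v \<eta>))) \<in> borel_measurable borel"
    using q0_measurable(1)[OF v] by measurable
  show ?thesis
    unfolding L.L2H_iff
  proof (intro conjI allI)
    have bm: "bf i \<in> borel_measurable halfline" for i by (rule measurable_halfline_continuous[OF bf_continuous])
    have "(\<lambda>p. \<Sum>i\<in>AI. af i (fst p) (v (fst p)) * bf i (snd p)) \<in> borel_measurable (lborel \<Otimes>\<^sub>M halfline)"
      by (intro borel_measurable_sum borel_measurable_times measurable_compose[OF measurable_fst] measurable_compose[OF measurable_snd bm])
         (simp add: af_measurable[OF v])
    then show "(\<lambda>(y,t). ?h y t) \<in> borel_measurable Omega"
      unfolding Omega_def
      by (rule measurable_cong[THEN iffD1, rotated])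
         (auto simp: space_pair_measure space_halfline atilde_sum[OF fin])
    have "nsq halfline (?h \<eta>) \<le> nsq halfline (\<lambda>t. of_real (q0 (v \<eta>)) * of_real (\<Theta> t))" for \<eta>
      by (rule nsq_mono) (use bound in \<open>simp add: space_halfline\<close>)
    also have "nsq halfline (\<lambda>t. of_real (q0 (v \<eta>)) * of_real (\<Theta> t)) < \<infinity>" for \<eta>
      using \<Theta>fin by (subst nsq_cmult[OF \<Theta>M]) (simp add: ennreal_mult_less_top)
    finally show "nsq halfline (?h \<eta>) < \<infinity>" for \<eta> .
    have "nsq (lborel \<Otimes>\<^sub>M halfline) (\<lambda>(y,t). ?h y t) \<le>
        nsq (lborel \<Otimes>\<^sub>M halfline) (\<lambda>p. of_real (q0 (v (fst p))) * of_real (\<Theta> (snd p)))"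
      by (rule nsq_mono) (use bound in \<open>auto simp: space_pair_measure space_halfline\<close>)
    also have "\<dots> = nsq lborel (\<lambda>\<eta>. of_real (q0 (v \<eta>))) * nsq halfline (\<lambda>t. of_real (\<Theta> t))"
      by (rule nsq_tensor[OF qm \<Theta>M sigma_finite_halfline])
    also have "\<dots> < \<infinity>" using q0_measurable(2)[OF v] \<Theta>fin by (simp add: ennreal_mult_less_top)
    finally show "nsq (lborel \<Otimes>\<^sub>M halfline) (\<lambda>(y,t). ?h y t) < \<infinity>" .
  qed
qed

text \<open>The operator is applied to the transform of w in the representative given by the Green
  symbol, which is smooth in t > 0; surjectivity of the transform on L2 then supplies h.\<close>

lemma atilde_defined:
  assumes "is_op Ksq NE gs u w"
  obtains h where "h \<in> L2H L2_sq" "is_op NE L2_sq (atilde br \<mu> a) w h"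
proof -
  interpret L: weighted_L2 halfline L2_sq by (rule weighted_L2_L2_sq)
  from assms obtain v where v: "is_ft Ksq u v" and w: "is_ft NE w (\<lambda>\<eta>. gs \<eta> (v \<eta>))" unfolding is_op_def by blast
  from v have "v \<in> L2H Ksq" by (simp add: is_ft_def)
  from atilde_L2H[OF this] obtain h where h: "is_ft L2_sq h (\<lambda>\<eta>. atilde br \<mu> a \<eta> (gs \<eta> (v \<eta>)))"
    by (rule L.is_ft_surjective)
  have "is_op NE L2_sq (atilde br \<mu> a) w h" using w h unfolding is_op_def by blast
  moreover have "h \<in> L2H L2_sq" using h by (simp add: is_ft_def)
  ultimately show thesis by (intro that)
qed

end

unbundle no fps_syntax

theorem theorem4p6:
  fixes \<mu> :: nat
    and \<omega> \<omega>0 :: "real \<Rightarrow> complex"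
    and br :: "real^'q \<Rightarrow> real"
    and b a :: "nat \<Rightarrow> ('q \<Rightarrow> nat) \<Rightarrow> real \<Rightarrow> complex"
    and N :: "complex \<Rightarrow> nat \<Rightarrow> nat"
  assumes "\<mu> \<ge> 1"
    and "cutoff \<omega>" and "cutoff \<omega>0" and "bracket br"
    and "edge_degenerate \<mu> b a"
    and "\<forall>u \<in> Wspace br \<omega> \<mu> 0.
           \<exists>h. is_A \<mu> b u h \<and> (\<lambda>y t. (1 - \<omega> t) * h y t) \<in> L2H L2_sq"
    and "\<exists>h. h meromorphic_on UNIV \<and> (\<forall>\<^sub>\<approx>z. poly (conormal \<mu> a) z * h z = 1)"
    and "\<forall>z. Re z = 1/2 - real \<mu> \<longrightarrow> \<not> is_pole (f0_inv \<mu> a) z"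
    and "admissible_N br \<mu> a N"
    and "\<sigma> \<in> Sigma_poles \<mu> a"
  shows "(\<forall>u \<in> L2H (K_sq \<omega> 0 (real \<mu>)). \<exists>w \<in> Hs (E_sq \<omega> (S_sig \<mu> a N \<sigma>)) \<mu>.
            is_op (K_sq \<omega> 0 (real \<mu>)) (E_sq \<omega> (S_sig \<mu> a N \<sigma>)) (g_sig br \<omega> \<omega>0 \<mu> a \<sigma>) u w)
       \<and> closed_subspace (Hs_sq (E_sq \<omega> (S_sig \<mu> a N \<sigma>)) \<mu>) (Hs (E_sq \<omega> (S_sig \<mu> a N \<sigma>)) \<mu>)
           (range_g br \<omega> \<omega>0 \<mu> a N \<sigma>)
       \<and> (\<forall>w \<in> range_g br \<omega> \<omega>0 \<mu> a N \<sigma>. \<exists>h \<in> L2H L2_sq.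
            is_op (E_sq \<omega> (S_sig \<mu> a N \<sigma>)) L2_sq (atilde br \<mu> a) w h)"
proof -
  interpret edge_op \<mu> \<omega> \<omega>0 br a N \<sigma> by unfold_locales (fact assms)+
  show ?thesis
  proof (intro conjI ballI)
    fix u :: "real^'q \<Rightarrow> real \<Rightarrow> complex" assume u: "u \<in> L2H (K_sq \<omega> 0 (real \<mu>))"
    show "\<exists>w \<in> Hs (E_sq \<omega> (S_sig \<mu> a N \<sigma>)) \<mu>. is_op (K_sq \<omega> 0 (real \<mu>)) (E_sq \<omega> (S_sig \<mu> a N \<sigma>)) (g_sig br \<omega> \<omega>0 \<mu> a \<sigma>) u w"
      unfolding E_S by (rule g_sig_defined[OF u]) blast
  next
    show "closed_subspace (Hs_sq (E_sq \<omega> (S_sig \<mu> a N \<sigma>)) \<mu>) (Hs (E_sq \<omega> (S_sig \<mu> a N \<sigma>)) \<mu>) (range_g br \<omega> \<omega>0 \<mu> a N \<sigma>)"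
      unfolding range_eq E_S by (rule range_closed)
  next
    fix w assume "w \<in> range_g br \<omega> \<omega>0 \<mu> a N \<sigma>"
    then obtain u where "is_op (K_sq \<omega> 0 (real \<mu>)) (E_sq \<omega> (S_sig \<mu> a N \<sigma>)) (g_sig br \<omega> \<omega>0 \<mu> a \<sigma>) u w"
      unfolding range_g_def by blast
    then show "\<exists>h \<in> L2H L2_sq. is_op (E_sq \<omega> (S_sig \<mu> a N \<sigma>)) L2_sq (atilde br \<mu> a) w h"
      unfolding E_S by (rule atilde_defined) blast
  qed
qed

end
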